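(* Assume Conditions C and D. Then $v_P>0$ if and only if there is a stationary distribution $Q$ for the Markov chain $x_n=(\theta^{\xi_n}\omega,Y_n)$, $n\ge0$, on $\Omega\times\mathcal D$ which is equivalent (mutually absolutely continuous) to $P\otimes\{\text{counting measure on }\mathcal D\}$. If such a distribution $Q$ exists, it is unique and is given by $$Q(B,i):=Q(B\times\{i\})=v_P\,\mathbb E^\pi\Big(\sum_{n=0}^{T_1-1}\mathbf I_B(\theta^{\xi_n}\omega)\,\mathbf I_{\{Y_n=i\}}\Big),\qquad B\in\mathcal F,\ i\in\mathcal D.$$
   Context: Setting. Fix $d\ge 1$, $\mathcal D=\{1,\dots,d\}$. Let $(\mathcal S,\mathcal B)$ be a measurable space, $\Omega=\mathcal S^{\mathbb Z}$ with product $\sigma$-algebra $\mathcal F$, and $P$ a probability measure on $(\Omega,\mathcal F)$ (law of the environment $\omega=(\omega_n)_{n\in\mathbb Z}$) with expectation $E_P$. $\theta:\Omega\to\Omega$ is the shift $(\theta\omega)_n=\omega_{n+1}$. Let $p,q,r$ be measurable functions from $\mathcal S$ to the nonnegative $d\times d$ matrices with $p+q+r$ stochastic; $p_n=p(\omega_n)$, $q_n=q(\omega_n)$, $r_n=r(\omega_n)$. Given $\omega$, the walk $X_t=(\xi_t,Y_t)$, $t\ge0$, is the Markov chain on $\mathbb Z\times\mathcal D$ which from $(n,i)$ jumps to $(n+1,j)$, $(n,j)$, $(n-1,j)$ with probability $p_n(i,j)$, $r_n(i,j)$, $q_n(i,j)$ respectively. $P^i_\omega$ is its law started at $(0,i)$.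 $\mathcal M_d$ is the set of collections $\mu=(\mu_\omega)_{\omega\in\Omega}$ of probability measures on $\mathcal D$ depending measurably on $\omega$ and only through $(\omega_n)_{n\le0}$. $P^\mu_\omega$ is the law of the walk with $\xi_0=0$, $Y_0\sim\mu_\omega$; the annealed law is $\mathbb P^\mu(F\times G)=\int_F P_\omega^\mu(G)\,P(d\omega)$, with expectation $\mathbb E^\mu$. $T_n=\inf\{t\ge0:\xi_t=n\}$ ($\inf\emptyset=\infty$). For vectors $\|x\|=\max_i|x^i|$, for matrices $\|\cdot\|$ is the induced operator norm; $\mathbf 1=(1,\dots,1)$; $I$ is the identity matrix. $\eta_n(i,j)=P^i_{\theta^n\omega}(T_1<\infty,\ Y_{T_1}=j)$. Condition C: (C1) $(\omega_n)$ is stationary and ergodic under $P$; (C2) $E_P\big(\log\frac1{1-\|r_0+p_0\|}\big)<\infty$ and $E_P\big(\log\frac1{1-\|r_0+q_0\|}\big)<\infty$; (C3) for all $j\in\mathcal D$, $\sum_i q_0(i,j)>0$ and $\sum_i p_0(i,j)>0$, $P$-a.s.; (C4) $P(\eta_0(i,j)>0)=1$ for all $i,j\in\mathcal D$. Under Condition C there is a unique stationary sequence $(\zeta_n)_{n\in\mathbb Z}$ of stochastic matrices (functions of $\omega$) with $\zeta_n=(I-q_n\zeta_{n-1}-r_n)^{-1}p_n$ $P$-a.s. Put $\gamma_n=(I-q_n\zeta_{n-1}-r_n)^{-1}$, $a_n=\gamma_nq_n$, and $\lambda=\lim_n\frac1n E_P(\log\|a_n\cdots a_1\|)$. Condition D: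 $\lambda<0$. (Under C, D is equivalent to $\xi_n\to+\infty$ a.s. for every starting height, and then $\zeta_n=\eta_n$ $P$-a.s.) $\pi_\omega:=\lim_{n\to\infty}e_i\,\eta_{-n}(\omega)\cdots\eta_{-1}(\omega)$ (row vector); under C and D the limit exists $P$-a.s., does not depend on $i$, and is a strictly positive probability vector on $\mathcal D$; $\pi=(\pi_\omega)\in\mathcal M_d$. Under C and D, for every $\mu\in\mathcal M_d$, $\mathbb P^\mu$-a.s. the limit $v_P=\lim\xi_n/n$ exists and equals the constant $1/E_P\big(\pi_\omega\cdot(b_0+a_0b_{-1}+a_0a_{-1}b_{-2}+\cdots)\big)$, $b_n=\gamma_n\mathbf 1$ ($1/\infty:=0$). The chain $x_n$ has transition kernel $K(\omega,i;B,j)=p_0(i,j)\mathbf I_B(\theta\omega)+r_0(i,j)\mathbf I_B(\omega)+q_0(i,j)\mathbf I_B(\theta^{-1}\omega)$; "stationary distribution" means a probability measure invariant under $K$. *)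

theory Defs
  imports "HOL-Probability.Probability"
begin

type_synonym 's env = "int \<Rightarrow> 's"
type_synonym 'd mat = "real ^ 'd ^ 'd"
type_synonym 'd state = "int \<times> 'd"
type_synonym 'd path = "nat \<Rightarrow> int \<times> 'd"

section \<open>Environment\<close>

abbreviation env_space :: "'s measure \<Rightarrow> 's env measure" where
  "env_space S \<equiv> PiM UNIV (\<lambda>_. S)"

definition shift :: "int \<Rightarrow> 's env \<Rightarrow> 's env" where
  "shift k \<omega> = (\<lambda>n. \<omega> (n + k))"

definition nonneg_matrix :: "('d::finite) mat \<Rightarrow> bool" where
  "nonneg_matrix A \<longleftrightarrow> (\<forall>i j. 0 \<le> A $ i $ j)"

definition stochastic :: "('d::finite) mat \<Rightarrow> bool" where
  "stochastic A \<longleftrightarrow> nonneg_matrix A \<and> (\<forall>i. (\<Sum>j\<in>UNIV. A $ i $ j) = 1)"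

definition rwre :: "'s measure \<Rightarrow> 's env measure \<Rightarrow>
    ('s \<Rightarrow> ('d::finite) mat) \<Rightarrow> ('s \<Rightarrow> 'd mat) \<Rightarrow> ('s \<Rightarrow> 'd mat) \<Rightarrow> bool" where
  "rwre S P p q r \<longleftrightarrow>
     prob_space P \<and> sets P = sets (env_space S) \<and>
     p \<in> borel_measurable S \<and> q \<in> borel_measurable S \<and> r \<in> borel_measurable S \<and>
     (\<forall>s\<in>space S. nonneg_matrix (p s) \<and> nonneg_matrix (q s) \<and> nonneg_matrix (r s) \<and>
        stochastic (p s + q s + r s))"

text \<open>The operator norm induced by the maximum norm; the library's \<open>onorm\<close> is the one
  induced by the Euclidean norm.\<close>

definition opnorm :: "('d::finite) mat \<Rightarrow> real" where
  "opnorm A = (SUP x\<in>{x. infnorm x = 1}. infnorm (A *v x))"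

section \<open>The walk in a fixed environment\<close>

definition jump_prob ::
    "('s \<Rightarrow> ('d::finite) mat) \<Rightarrow> ('s \<Rightarrow> 'd mat) \<Rightarrow> ('s \<Rightarrow> 'd mat) \<Rightarrow> 's env \<Rightarrow> 'd state \<Rightarrow> 'd state \<Rightarrow> real" where
  "jump_prob p q r \<omega> = (\<lambda>(n, i) (m, j).
     if m = n + 1 then p (\<omega> n) $ i $ j
     else if m = n then r (\<omega> n) $ i $ j
     else if m = n - 1 then q (\<omega> n) $ i $ j
     else 0)"

definition jump ::
    "('s \<Rightarrow> ('d::finite) mat) \<Rightarrow> ('s \<Rightarrow> 'd mat) \<Rightarrow> ('s \<Rightarrow> 'd mat) \<Rightarrow> 's env \<Rightarrow> 'd state \<Rightarrow> 'd state pmf" where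
  "jump p q r \<omega> x = embed_pmf (jump_prob p q r \<omega> x)"

abbreviation path_space :: "('d::finite) path measure" where
  "path_space \<equiv> PiM UNIV (\<lambda>_. count_space UNIV)"

definition step_kernel ::
    "('s \<Rightarrow> ('d::finite) mat) \<Rightarrow> ('s \<Rightarrow> 'd mat) \<Rightarrow> ('s \<Rightarrow> 'd mat) \<Rightarrow> 's env \<Rightarrow> 'd state pmf \<Rightarrow>
      nat \<Rightarrow> 'd path \<Rightarrow> 'd state measure" where
  "step_kernel p q r \<omega> \<nu> t h =
     measure_pmf (case t of 0 \<Rightarrow> \<nu> | Suc t' \<Rightarrow> jump p q r \<omega> (h t'))"

text \<open>The law on path space of the Markov chain with initial distribution \<open>\<nu>\<close>, obtained from the
  Ionescu-Tulcea theorem. The cylinder probabilities are computed in \<open>emeasure_walk_law\<close> below.\<close>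

definition walk_law ::
    "('s \<Rightarrow> ('d::finite) mat) \<Rightarrow> ('s \<Rightarrow> 'd mat) \<Rightarrow> ('s \<Rightarrow> 'd mat) \<Rightarrow> 's env \<Rightarrow> 'd state pmf \<Rightarrow> 'd path measure" where
  "walk_law p q r \<omega> \<nu> =
     projective_family.lim UNIV
       (Ionescu_Tulcea.CI (step_kernel p q r \<omega> \<nu>) (\<lambda>_. count_space UNIV))
       (\<lambda>_. count_space UNIV)"

definition quenched ::
    "('s \<Rightarrow> ('d::finite) mat) \<Rightarrow> ('s \<Rightarrow> 'd mat) \<Rightarrow> ('s \<Rightarrow> 'd mat) \<Rightarrow> 's env \<Rightarrow> 'd pmf \<Rightarrow> 'd path measure" where
  "quenched p q r \<omega> m = walk_law p q r \<omega> (map_pmf (Pair 0) m)"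

definition hit :: "int \<Rightarrow> 'd path \<Rightarrow> enat" where
  "hit n x = (INF t\<in>{t. fst (x t) = n}. enat t)"

definition eta ::
    "('s \<Rightarrow> ('d::finite) mat) \<Rightarrow> ('s \<Rightarrow> 'd mat) \<Rightarrow> ('s \<Rightarrow> 'd mat) \<Rightarrow> int \<Rightarrow> 's env \<Rightarrow> 'd mat" where
  "eta p q r n \<omega> = (\<chi> i j.
     measure (quenched p q r (shift n \<omega>) (return_pmf i))
       {x \<in> space path_space. hit 1 x < \<infinity> \<and> snd (x (the_enat (hit 1 x))) = j})"

section \<open>The annealed walk\<close>

definition past_laws :: "'s measure \<Rightarrow> ('s env \<Rightarrow> ('d::finite) pmf) set" where
  "past_laws S = {\<mu>. \<forall>j. (\<lambda>\<omega>. pmf (\<mu> \<omega>) j) \<in> borel_measurable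
     (vimage_algebra (space (env_space S)) (\<lambda>\<omega>. restrict \<omega> {..0}) (PiM {..0} (\<lambda>_. S)))}"

definition annealed :: "'s env measure \<Rightarrow>
    ('s \<Rightarrow> ('d::finite) mat) \<Rightarrow> ('s \<Rightarrow> 'd mat) \<Rightarrow> ('s \<Rightarrow> 'd mat) \<Rightarrow> ('s env \<Rightarrow> 'd pmf) \<Rightarrow>
    ('s env \<times> 'd path) measure" where
  "annealed P p q r \<mu> =
     P \<bind> (\<lambda>\<omega>. distr (quenched p q r \<omega> (\<mu> \<omega>)) (P \<Otimes>\<^sub>M path_space) (Pair \<omega>))"

definition is_speed :: "'s measure \<Rightarrow> 's env measure \<Rightarrow>
    ('s \<Rightarrow> ('d::finite) mat) \<Rightarrow> ('s \<Rightarrow> 'd mat) \<Rightarrow> ('s \<Rightarrow> 'd mat) \<Rightarrow> real \<Rightarrow> bool" where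
  "is_speed S P p q r v \<longleftrightarrow> (\<forall>\<mu>\<in>past_laws S. AE (\<omega>, x) in annealed P p q r \<mu>.
     (\<lambda>n. real_of_int (fst (x n)) / real n) \<longlonglongrightarrow> v)"

section \<open>Conditions\<close>

definition stationary_ergodic :: "'s env measure \<Rightarrow> bool" where
  "stationary_ergodic P \<longleftrightarrow>
     distr P P (shift 1) = P \<and>
     (\<forall>A\<in>sets P. shift 1 -` A \<inter> space P = A \<longrightarrow> measure P A = 0 \<or> measure P A = 1)"

text \<open>\<open>log (1 / (1 - x))\<close> for \<open>0 \<le> x \<le> 1\<close>, with value \<open>\<infinity>\<close> at \<open>x = 1\<close>.\<close>

definition log_inv_gap :: "real \<Rightarrow> ennreal" where
  "log_inv_gap x = (if x < 1 then ennreal (ln (1 / (1 - x))) else \<infinity>)"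

definition condition_C :: "'s env measure \<Rightarrow>
    ('s \<Rightarrow> ('d::finite) mat) \<Rightarrow> ('s \<Rightarrow> 'd mat) \<Rightarrow> ('s \<Rightarrow> 'd mat) \<Rightarrow> bool" where
  "condition_C P p q r \<longleftrightarrow>
     stationary_ergodic P \<and>
     (\<integral>\<^sup>+\<omega>. log_inv_gap (opnorm (r (\<omega> 0) + p (\<omega> 0))) \<partial>P) < \<infinity> \<and>
     (\<integral>\<^sup>+\<omega>. log_inv_gap (opnorm (r (\<omega> 0) + q (\<omega> 0))) \<partial>P) < \<infinity> \<and>
     (\<forall>j. AE \<omega> in P. 0 < (\<Sum>i\<in>UNIV. q (\<omega> 0) $ i $ j) \<and> 0 < (\<Sum>i\<in>UNIV. p (\<omega> 0) $ i $ j)) \<and>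
     (\<forall>i j. AE \<omega> in P. 0 < eta p q r 0 \<omega> $ i $ j)"

definition gamma ::
    "('s \<Rightarrow> ('d::finite) mat) \<Rightarrow> ('s \<Rightarrow> 'd mat) \<Rightarrow> (int \<Rightarrow> 's env \<Rightarrow> 'd mat) \<Rightarrow> int \<Rightarrow> 's env \<Rightarrow> 'd mat" where
  "gamma q r \<zeta> n \<omega> = matrix_inv (mat 1 - q (\<omega> n) ** \<zeta> (n - 1) \<omega> - r (\<omega> n))"

text \<open>Stationarity of a sequence of functions of the environment is expressed by its equivariance
  under the shift, that is, as stationarity jointly with the environment.\<close>

definition zeta_sequence :: "'s env measure \<Rightarrow>
    ('s \<Rightarrow> ('d::finite) mat) \<Rightarrow> ('s \<Rightarrow> 'd mat) \<Rightarrow> ('s \<Rightarrow> 'd mat) \<Rightarrow> (int \<Rightarrow> 's env \<Rightarrow> 'd mat) \<Rightarrow> bool" where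
  "zeta_sequence P p q r \<zeta> \<longleftrightarrow>
     (\<forall>n. \<zeta> n \<in> borel_measurable P \<and>
       (AE \<omega> in P. stochastic (\<zeta> n \<omega>)) \<and>
       (AE \<omega> in P. \<zeta> (n + 1) \<omega> = \<zeta> n (shift 1 \<omega>)) \<and>
       (AE \<omega> in P. \<zeta> n \<omega> = gamma q r \<zeta> n \<omega> ** p (\<omega> n)))"

text \<open>The product \<open>a_n ... a_1\<close> with \<open>a_n = gamma_n q_n\<close>.\<close>

primrec a_prod ::
    "('s \<Rightarrow> ('d::finite) mat) \<Rightarrow> ('s \<Rightarrow> 'd mat) \<Rightarrow> (int \<Rightarrow> 's env \<Rightarrow> 'd mat) \<Rightarrow> nat \<Rightarrow> 's env \<Rightarrow> 'd mat" where
  "a_prod q r \<zeta> 0 \<omega> = mat 1"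
| "a_prod q r \<zeta> (Suc n) \<omega> =
     (gamma q r \<zeta> (int (Suc n)) \<omega> ** q (\<omega> (int (Suc n)))) ** a_prod q r \<zeta> n \<omega>"

definition lyapunov :: "'s env measure \<Rightarrow>
    ('s \<Rightarrow> ('d::finite) mat) \<Rightarrow> ('s \<Rightarrow> 'd mat) \<Rightarrow> (int \<Rightarrow> 's env \<Rightarrow> 'd mat) \<Rightarrow> real" where
  "lyapunov P q r \<zeta> = lim (\<lambda>n. (1 / real n) * (\<integral>\<omega>. ln (opnorm (a_prod q r \<zeta> n \<omega>)) \<partial>P))"

definition condition_D :: "'s env measure \<Rightarrow>
    ('s \<Rightarrow> ('d::finite) mat) \<Rightarrow> ('s \<Rightarrow> 'd mat) \<Rightarrow> (int \<Rightarrow> 's env \<Rightarrow> 'd mat) \<Rightarrow> bool" where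
  "condition_D P q r \<zeta> \<longleftrightarrow> lyapunov P q r \<zeta> < 0"

section \<open>The law \<open>\<pi>\<close>\<close>

text \<open>The product \<open>eta_{-n} ... eta_{-1}\<close>.\<close>

primrec eta_prod ::
    "('s \<Rightarrow> ('d::finite) mat) \<Rightarrow> ('s \<Rightarrow> 'd mat) \<Rightarrow> ('s \<Rightarrow> 'd mat) \<Rightarrow> nat \<Rightarrow> 's env \<Rightarrow> 'd mat" where
  "eta_prod p q r 0 \<omega> = mat 1"
| "eta_prod p q r (Suc n) \<omega> = eta p q r (- int (Suc n)) \<omega> ** eta_prod p q r n \<omega>"

text \<open>The limit exists only almost surely, so \<open>\<pi>\<close> is any version of it in the class of
  collections of probability measures depending measurably on the past.\<close>

definition is_pi :: "'s measure \<Rightarrow> 's env measure \<Rightarrow>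
    ('s \<Rightarrow> ('d::finite) mat) \<Rightarrow> ('s \<Rightarrow> 'd mat) \<Rightarrow> ('s \<Rightarrow> 'd mat) \<Rightarrow> ('s env \<Rightarrow> 'd pmf) \<Rightarrow> bool" where
  "is_pi S P p q r \<pi> \<longleftrightarrow> \<pi> \<in> past_laws S \<and>
     (AE \<omega> in P. \<forall>i. (\<lambda>n. axis i 1 v* eta_prod p q r n \<omega>) \<longlonglongrightarrow> (\<chi> j. pmf (\<pi> \<omega>) j))"

section \<open>The environment viewed from the walk\<close>

definition env_kernel ::
    "('s \<Rightarrow> ('d::finite) mat) \<Rightarrow> ('s \<Rightarrow> 'd mat) \<Rightarrow> ('s \<Rightarrow> 'd mat) \<Rightarrow> 's env \<Rightarrow> 'd \<Rightarrow> 's env set \<Rightarrow> 'd \<Rightarrow> real" where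
  "env_kernel p q r \<omega> i B j =
     p (\<omega> 0) $ i $ j * indicator B (shift 1 \<omega>) +
     r (\<omega> 0) $ i $ j * indicator B \<omega> +
     q (\<omega> 0) $ i $ j * indicator B (shift (- 1) \<omega>)"

definition stationary_distribution :: "'s env measure \<Rightarrow>
    ('s \<Rightarrow> ('d::finite) mat) \<Rightarrow> ('s \<Rightarrow> 'd mat) \<Rightarrow> ('s \<Rightarrow> 'd mat) \<Rightarrow> ('s env \<times> 'd) measure \<Rightarrow> bool" where
  "stationary_distribution P p q r Q \<longleftrightarrow>
     prob_space Q \<and> sets Q = sets (P \<Otimes>\<^sub>M count_space UNIV) \<and>
     (\<forall>B\<in>sets P. \<forall>j. emeasure Q (B \<times> {j}) =
        (\<integral>\<^sup>+(\<omega>, i). ennreal (env_kernel p q r \<omega> i B j) \<partial>Q))"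

definition equivalent_measures :: "'a measure \<Rightarrow> 'a measure \<Rightarrow> bool" where
  "equivalent_measures M N \<longleftrightarrow>
     sets M = sets N \<and> absolutely_continuous M N \<and> absolutely_continuous N M"

definition equivalent_stationary :: "'s env measure \<Rightarrow>
    ('s \<Rightarrow> ('d::finite) mat) \<Rightarrow> ('s \<Rightarrow> 'd mat) \<Rightarrow> ('s \<Rightarrow> 'd mat) \<Rightarrow> ('s env \<times> 'd) measure \<Rightarrow> bool" where
  "equivalent_stationary P p q r Q \<longleftrightarrow>
     stationary_distribution P p q r Q \<and> equivalent_measures Q (P \<Otimes>\<^sub>M count_space UNIV)"

definition occupation :: "'s env set \<Rightarrow> 'd \<Rightarrow> 's env \<Rightarrow> 'd path \<Rightarrow> ennreal" where
  "occupation B i \<omega> x =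
     (\<Sum>n. if enat n < hit 1 x
           then indicator B (shift (fst (x n)) \<omega>) * indicator {i} (snd (x n)) else 0)"

section \<open>Cylinder probabilities of the walk\<close>

lemma pmf_jump:
  assumes "nonneg_matrix (p (\<omega> n))" "nonneg_matrix (q (\<omega> n))" "nonneg_matrix (r (\<omega> n))"
    and st: "stochastic (p (\<omega> n) + q (\<omega> n) + r (\<omega> n))"
  shows "pmf (jump p q r \<omega> (n, i)) y = jump_prob p q r \<omega> (n, i) y"
  unfolding jump_def
proof (rule pmf_embed_pmf)
  show nn: "0 \<le> jump_prob p q r \<omega> (n, i) y" for y
    using assms(1-3) by (auto simp: jump_prob_def nonneg_matrix_def split: prod.splits)
  let ?A = "{n + 1, n, n - 1} \<times> (UNIV :: 'a set)"
  have "(\<integral>\<^sup>+y. ennreal (jump_prob p q r \<omega> (n, i) y) \<partial>count_space UNIV) =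
      (\<integral>\<^sup>+y. ennreal (jump_prob p q r \<omega> (n, i) y) \<partial>count_space ?A)"
    by (intro nn_integral_count_space_eq) (auto simp: jump_prob_def split: if_splits)
  also have "\<dots> = (\<Sum>y\<in>?A. ennreal (jump_prob p q r \<omega> (n, i) y))"
    by (intro nn_integral_count_space_finite) auto
  also have "\<dots> = ennreal (\<Sum>y\<in>?A. jump_prob p q r \<omega> (n, i) y)"
    using nn by (intro sum_ennreal) auto
  also have "(\<Sum>y\<in>?A. jump_prob p q r \<omega> (n, i) y) =
      (\<Sum>m\<in>{n + 1, n, n - 1}. \<Sum>j\<in>UNIV. jump_prob p q r \<omega> (n, i) (m, j))"
    by (simp only: sum.cartesian_product) (simp add: split_def)
  also have "\<dots> = (\<Sum>j\<in>UNIV. (p (\<omega> n) + q (\<omega> n) + r (\<omega> n)) $ i $ j)"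
    by (simp add: jump_prob_def sum.distrib)
  also have "\<dots> = 1" using st by (simp add: stochastic_def)
  finally show "(\<integral>\<^sup>+y. ennreal (jump_prob p q r \<omega> (n, i) y) \<partial>count_space UNIV) = 1" by simp
qed

lemma Ionescu_Tulcea_step_kernel:
  fixes \<nu> :: "('d::finite) state pmf"
  shows "Ionescu_Tulcea (step_kernel p q r \<omega> \<nu>) (\<lambda>_. count_space UNIV)"
proof (rule Ionescu_Tulcea.intro)
  fix i
  show "step_kernel p q r \<omega> \<nu> i \<in>
      PiM {0..<i} (\<lambda>_. count_space UNIV) \<rightarrow>\<^sub>M subprob_algebra (count_space UNIV)"
  proof (cases i)
    case 0
    then show ?thesis
      unfolding step_kernel_def by (simp add: measure_pmf_in_subprob_algebra)
  next
    case (Suc k)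
    have "(\<lambda>h. measure_pmf (jump p q r \<omega> (h k))) \<in>
        PiM {0..<Suc k} (\<lambda>_. count_space UNIV) \<rightarrow>\<^sub>M subprob_algebra (count_space UNIV)"
    proof (rule measurable_compose[where g = "\<lambda>x. measure_pmf (jump p q r \<omega> x)"])
      show "(\<lambda>h. h k) \<in> PiM {0..<Suc k} (\<lambda>_. count_space UNIV) \<rightarrow>\<^sub>M count_space UNIV"
        by (rule measurable_component_singleton) simp
      show "(\<lambda>x. measure_pmf (jump p q r \<omega> x)) \<in> count_space UNIV \<rightarrow>\<^sub>M subprob_algebra (count_space UNIV)"
        by (simp add: measure_pmf_in_subprob_algebra)
    qed
    then show ?thesis unfolding Suc step_kernel_def by simp
  qed
next
  fix i and x :: "'d path"
  show "prob_space (step_kernel p q r \<omega> \<nu> i x)"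
    unfolding step_kernel_def by (rule prob_space_measure_pmf)
qed

lemma emeasure_walk_law:
  fixes y :: "('d::finite) path"
  shows "emeasure (walk_law p q r \<omega> \<nu>) {x. \<forall>t\<le>n. x t = y t} =
    ennreal (pmf \<nu> (y 0) * (\<Prod>t<n. pmf (jump p q r \<omega> (y t)) (y (Suc t))))"
proof -
  let ?K = "step_kernel p q r \<omega> \<nu>" and ?M = "\<lambda>_::nat. count_space (UNIV :: 'd state set)"
  interpret Ionescu_Tulcea ?K ?M by (rule Ionescu_Tulcea_step_kernel)
  let ?f = "pmf \<nu> (y 0)" and ?g = "\<lambda>t. pmf (jump p q r \<omega> (y t)) (y (Suc t))"
  let ?c = "\<lambda>m. {restrict y {0..<m}}"
  have sets_c[measurable, simp]: "?c m \<in> sets (PiM {0..<m} ?M)" for m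
  proof -
    have "?c m = PiE {0..<m} (\<lambda>t. {y t})"
      by (auto simp: PiE_def Pi_def extensional_def fun_eq_iff)
    then show ?thesis by (simp add: sets_PiM_I_finite)
  qed
  have step: "emeasure (C 0 (Suc m) (\<lambda>_. undefined)) (?c (Suc m)) =
      emeasure (?K m (restrict y {0..<m})) {y m} * emeasure (C 0 m (\<lambda>_. undefined)) (?c m)" for m
  proof -
    have sp: "(\<lambda>_. undefined) \<in> space (PiM {0..<0::nat} ?M)" by (simp add: space_PiM)
    have s: "sets (C 0 m (\<lambda>_. undefined)) = sets (PiM {0..<m} ?M)"
      using sets_C[OF sp, of m] by simp
    have sp': "space (C 0 m (\<lambda>_. undefined)) = space (PiM {0..<m} ?M)"
      using s by (rule sets_eq_imp_space_eq)
    have "emeasure (C 0 (Suc m) (\<lambda>_. undefined)) (?c (Suc m)) =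
       (\<integral>\<^sup>+h. emeasure (eP m h) (?c (Suc m)) \<partial>C 0 m (\<lambda>_. undefined))"
      by (simp, rule emeasure_bind[where N = "PiM {0..<Suc m} ?M"])
         (auto simp: sp' space_PiM PiE_eq_empty_iff measurable_cong_sets[OF s refl])
    also have "\<dots> = (\<integral>\<^sup>+h. emeasure (?K m (restrict y {0..<m})) {y m} * indicator (?c m) h
        \<partial>C 0 m (\<lambda>_. undefined))"
    proof (rule nn_integral_cong)
      fix h assume "h \<in> space (C 0 m (\<lambda>_. undefined))"
      then have h: "h \<in> space (PiM {0..<m} ?M)" by (simp add: sp')
      have "emeasure (eP m h) (?c (Suc m)) =
          emeasure (?K m h) {a \<in> space (?K m h). fun_upd h m a \<in> ?c (Suc m)}"
        using h by (subst emeasure_eP) (auto simp: vimage_def Int_def conj_commute step_kernel_def)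
      also have "{a \<in> space (?K m h). fun_upd h m a \<in> ?c (Suc m)} =
          (if h = restrict y {0..<m} then {y m} else {})"
        using h by (auto simp: step_kernel_def space_PiM PiE_def extensional_def fun_eq_iff)
      finally show "emeasure (eP m h) (?c (Suc m)) =
          emeasure (?K m (restrict y {0..<m})) {y m} * indicator (?c m) h"
        by (cases "h = restrict y {0..<m}") (simp_all del: restrict_apply)
    qed
    also have "\<dots> = emeasure (?K m (restrict y {0..<m})) {y m} * emeasure (C 0 m (\<lambda>_. undefined)) (?c m)"
      by (rule nn_integral_cmult_indicator) (simp add: s)
    finally show ?thesis .
  qed
  have C_eq: "emeasure (C 0 (Suc m) (\<lambda>_. undefined)) (?c (Suc m)) = ennreal (?f * (\<Prod>t<m. ?g t))" for m
  proof (induction m)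
    case 0
    have "emeasure (C 0 0 (\<lambda>_. undefined)) (?c 0) = 1"
      using sets_c[of 0] by (simp add: restrict_def)
    then show ?case by (subst step) (simp add: step_kernel_def emeasure_pmf_single)
  next
    case (Suc m)
    have "emeasure (?K (Suc m) (restrict y {0..<Suc m})) {y (Suc m)} = ennreal (?g m)"
      by (simp add: step_kernel_def emeasure_pmf_single)
    then show ?case
      by (simp only: step[of "Suc m"] Suc.IH)
         (simp add: ennreal_mult'[symmetric] mult_ac prod_nonneg)
  qed
  have up: "up_to {0..<Suc n} = Suc n"
    unfolding up_to_def by (rule Least_equality) (auto simp: not_less_eq_eq[symmetric])
  have "{x. \<forall>t\<le>n. x t = y t} = PF.emb UNIV {0..<Suc n} (?c (Suc n))"
    by (auto simp: prod_emb_def space_PiM fun_eq_iff restrict_def less_Suc_eq_le split: if_splits)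
  then have "emeasure (walk_law p q r \<omega> \<nu>) {x. \<forall>t\<le>n. x t = y t} =
      emeasure (CI {0..<Suc n}) (?c (Suc n))"
    unfolding walk_law_def by (simp only:) (rule lim, auto)
  also have "\<dots> = emeasure (C 0 (Suc n) (\<lambda>_. undefined)) (?c (Suc n))"
  proof -
    have sp: "(\<lambda>_. undefined) \<in> space (PiM {0..<0::nat} ?M)" by (simp add: space_PiM)
    have s: "sets (C 0 (Suc n) (\<lambda>_. undefined)) = sets (PiM {0..<Suc n} ?M)"
      using sets_C[OF sp, of "Suc n"] by simp
    have sp': "space (C 0 (Suc n) (\<lambda>_. undefined)) = space (PiM {0..<Suc n} ?M)"
      using s by (rule sets_eq_imp_space_eq)
    have "CI {0..<Suc n} = distr (C 0 (Suc n) (\<lambda>_. undefined)) (PiM {0..<Suc n} ?M) (\<lambda>x. x)"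
      unfolding CI_def up
    proof (rule distr_cong[OF refl refl])
      fix x assume "x \<in> space (C 0 (Suc n) (\<lambda>_. undefined))"
      then have "x \<in> PiE {0..<Suc n} (\<lambda>_. UNIV)"
        unfolding sp' by (simp add: space_PiM)
      then show "restrict x {0..<Suc n} = x" by (rule PiE_restrict)
    qed
    then show ?thesis using distr_id2[OF s[symmetric]] by (simp only:)
  qed
  also note C_eq
  finally show ?thesis .
qed

section \<open>The annealed law\<close>

lemma space_walk_law [simp]: "space (walk_law p q r \<omega> (\<nu> :: ('d::finite) state pmf)) = UNIV"
  and sets_walk_law [measurable_cong, simp]: "sets (walk_law p q r \<omega> \<nu>) = sets path_space"
  and prob_space_walk_law: "prob_space (walk_law p q r \<omega> \<nu>)"
proof -
  let ?K = "step_kernel p q r \<omega> \<nu>" and ?M = "\<lambda>_::nat. count_space (UNIV :: 'd state set)"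
  interpret Ionescu_Tulcea ?K ?M by (rule Ionescu_Tulcea_step_kernel)
  show "space (walk_law p q r \<omega> \<nu>) = UNIV" "sets (walk_law p q r \<omega> \<nu>) = sets path_space"
    unfolding walk_law_def by (simp_all add: space_PiM)
  show "prob_space (walk_law p q r \<omega> \<nu>)"
    unfolding walk_law_def
  proof (rule prob_space_distrD)
    show "(\<lambda>x. restrict x {}) \<in> PF.lim \<rightarrow>\<^sub>M PiM {} ?M"
      by (simp add: measurable_cong_sets[OF PF.sets_lim refl] measurable_restrict_subset)
    show "prob_space (distr PF.lim (PiM {} ?M) (\<lambda>x. restrict x {}))"
      by (subst distr_lim) (auto intro: PF.prob_space_P)
  qed
qed

lemma sets_path_space_cylinders:
  "sets (path_space :: ('d::finite) path measure) =
    sigma_sets UNIV (insert {} (range (\<lambda>(n::nat, y :: 'd path). {x. \<forall>t\<le>n. x t = y t})))"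
  (is "_ = sigma_sets UNIV ?G")
proof
  have G: "A \<in> sets (path_space :: 'd path measure)" if "A \<in> ?G" for A
  proof -
    have "{x. \<forall>t\<le>n. x t = y t} \<in> sets (path_space :: 'd path measure)" for n :: nat and y :: "'d path"
    proof -
      have "{x \<in> space path_space. \<forall>t\<le>n. x t = y t} \<in> sets (path_space :: 'd path measure)"
        by measurable
      then show ?thesis by (simp add: space_PiM)
    qed
    with that show ?thesis by auto
  qed
  show "sigma_sets UNIV ?G \<subseteq> sets path_space"
    using sets.sigma_sets_subset[of ?G "path_space :: 'd path measure"] G by (auto simp: space_PiM)
  let ?N = "sigma UNIV ?G"
  have "(\<lambda>x. x t) \<in> ?N \<rightarrow>\<^sub>M count_space UNIV" for t :: nat
  proof (rule measurable_count_space_eq2_countable[THEN iffD2], intro conjI ballI)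
    fix a :: "'d state"
    have "(\<lambda>x. x t) -` {a} \<inter> space ?N =
        (\<Union>ys\<in>{ys. ys ! t = a}. {x. \<forall>s\<le>t. x s = ys ! s})" (is "?L = ?R")
    proof
      show "?L \<subseteq> ?R"
      proof
        fix x assume "x \<in> ?L"
        then have "x t = a" by simp
        then show "x \<in> ?R"
          by (intro UN_I[of "map x [0..<Suc t]"]) (auto simp: nth_append less_Suc_eq_le simp del: upt_Suc)
      qed
    qed (auto simp: space_measure_of_conv)
    also have "\<dots> \<in> sets ?N"
      by (intro sets.countable_UN'') (auto intro!: in_measure_of)
    finally show "(\<lambda>x. x t) -` {a} \<inter> space ?N \<in> sets ?N" .
  qed auto
  then have "(\<lambda>x. x) \<in> ?N \<rightarrow>\<^sub>M (path_space :: 'd path measure)"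
    by (intro measurable_PiM_single') (auto simp: space_PiM)
  then show "sets path_space \<subseteq> sigma_sets UNIV ?G"
    by (auto dest!: measurable_sets simp: space_measure_of_conv)
qed

lemma measurable_quenched:
  fixes p q r :: "'s \<Rightarrow> ('d::finite) mat"
  assumes rw: "rwre S P p q r" and \<mu>: "\<mu> \<in> past_laws S"
  shows "(\<lambda>\<omega>. quenched p q r \<omega> (\<mu> \<omega>)) \<in> P \<rightarrow>\<^sub>M subprob_algebra path_space"
proof (rule measurable_subprob_algebra_generated)
  have sP: "sets P = sets (env_space S)" and [measurable]:
    "p \<in> borel_measurable S" "q \<in> borel_measurable S" "r \<in> borel_measurable S"
    using rw by (auto simp: rwre_def)
  have spP: "space P = space (env_space S)" using sP by (rule sets_eq_imp_space_eq)
  have co[measurable]: "(\<lambda>\<omega>. \<omega> n) \<in> P \<rightarrow>\<^sub>M S" for n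
    unfolding measurable_cong_sets[OF sP refl] by measurable
  have mu[measurable]: "(\<lambda>\<omega>. pmf (\<mu> \<omega>) j) \<in> borel_measurable P" for j
  proof -
    have "sets (vimage_algebra (space (env_space S)) (\<lambda>\<omega>. restrict \<omega> {..0}) (PiM {..0} (\<lambda>_. S)))
        \<subseteq> sets (env_space S)"
      by (rule sets_image_in_sets) (simp_all add: measurable_restrict_subset)
    then show ?thesis
      using \<mu> unfolding past_laws_def measurable_cong_sets[OF sP refl]
      by (auto simp: measurable_def)
  qed
  let ?G = "insert {} (range (\<lambda>(n::nat, y :: 'd path). {x. \<forall>t\<le>n. x t = y t}))"
  show "sets path_space = sigma_sets UNIV ?G" by (rule sets_path_space_cylinders)
  show "?G \<subseteq> Pow UNIV" by simp
  show "Int_stable ?G"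
  proof (rule Int_stableI)
    have *: "{x. \<forall>t\<le>n. x t = y t} \<inter> {x. \<forall>t\<le>m. x t = z t} \<in> ?G"
      if "n \<le> m" for n m and y z :: "'d path"
    proof (cases "\<forall>t\<le>n. y t = z t")
      case True
      then have "{x. \<forall>t\<le>n. x t = y t} \<inter> {x. \<forall>t\<le>m. x t = z t} = {x. \<forall>t\<le>m. x t = z t}"
        using that by auto
      then show ?thesis by auto
    next
      case False
      then obtain t where "t \<le> n" "y t \<noteq> z t" by auto
      then have "{x. \<forall>t\<le>n. x t = y t} \<inter> {x. \<forall>t\<le>m. x t = z t} = {}"
        using that by (force dest: le_trans)
      then show ?thesis by simp
    qed
    fix A B assume "A \<in> ?G" "B \<in> ?G"
    then consider "A = {} \<or> B = {}"
      | n y m z where "A = {x. \<forall>t\<le>n. x t = y t}" "B = {x. \<forall>t\<le>m. x t = z t}"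
      by auto
    then show "A \<inter> B \<in> ?G"
    proof cases
      case (2 n y m z)
      then show ?thesis using *[of n m y z] *[of m n z y] by (cases "n \<le> m") (auto simp: Int_commute)
    qed auto
  qed
  show "subprob_space (quenched p q r \<omega> (\<mu> \<omega>))" for \<omega>
    unfolding quenched_def by (intro prob_space_imp_subprob_space prob_space_walk_law)
  show "sets (quenched p q r \<omega> (\<mu> \<omega>)) = sets path_space" for \<omega>
    unfolding quenched_def by simp
  have one: "emeasure (quenched p q r \<omega> (\<mu> \<omega>)) UNIV = 1" for \<omega>
    using prob_space.emeasure_space_1[OF prob_space_walk_law] unfolding quenched_def by simp
  show "(\<lambda>\<omega>. emeasure (quenched p q r \<omega> (\<mu> \<omega>)) UNIV) \<in> borel_measurable P"
    by (simp add: one)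
  fix A assume "A \<in> ?G"
  then consider "A = {}" | n y where "A = {x. \<forall>t\<le>n. x t = y t}" by auto
  then show "(\<lambda>\<omega>. emeasure (quenched p q r \<omega> (\<mu> \<omega>)) A) \<in> borel_measurable P"
  proof cases
    case (2 n y)
    have pj: "pmf (jump p q r \<omega> x) z = jump_prob p q r \<omega> x z" if "\<omega> \<in> space P" for \<omega> x z
    proof -
      have "\<omega> (fst x) \<in> space S" using that by (auto simp: spP space_PiM)
      then show ?thesis
        using rw pmf_jump[of p \<omega> "fst x" q r "snd x" z] by (simp add: rwre_def)
    qed
    have [measurable]: "(\<lambda>\<omega>. pmf (jump p q r \<omega> x) z) \<in> borel_measurable P" for x z
    proof (subst measurable_cong[OF pj])
      have e: "(\<lambda>A::'d mat. A $ i $ j) \<in> borel_measurable borel" for i j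
        by (intro borel_measurable_continuous_onI continuous_intros)
      have [measurable]: "(\<lambda>\<omega>. f (\<omega> n) $ i $ j) \<in> borel_measurable P"
        if f: "f \<in> borel_measurable S" for f :: "'s \<Rightarrow> 'd mat" and n i j
        by (rule measurable_compose[OF measurable_compose[OF co f] e])
      obtain a i b j where x: "x = (a, i)" "z = (b, j)" by (cases x, cases z)
      show "(\<lambda>\<omega>. jump_prob p q r \<omega> x z) \<in> borel_measurable P"
        unfolding jump_prob_def x prod.case
        by measurable
    qed
    have pm: "pmf (map_pmf (Pair (0::int)) (\<mu> \<omega>)) w =
        (if fst w = 0 then pmf (\<mu> \<omega>) (snd w) else 0)" for \<omega> w
      by (cases w) (auto simp: pmf_map_inj' inj_def pmf_eq_0_set_pmf)
    show ?thesis
      unfolding 2 quenched_def emeasure_walk_law pm by measurable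
  qed simp
qed

lemma emeasure_annealed:
  fixes p q r :: "'s \<Rightarrow> ('d::finite) mat"
  assumes rw: "rwre S P p q r" and \<mu>: "\<mu> \<in> past_laws S"
    and F: "F \<in> sets P" and G: "G \<in> sets path_space"
  shows "emeasure (annealed P p q r \<mu>) (F \<times> G) =
    (\<integral>\<^sup>+\<omega>. emeasure (quenched p q r \<omega> (\<mu> \<omega>)) G * indicator F \<omega> \<partial>P)"
proof -
  interpret P: prob_space P using rw by (simp add: rwre_def)
  note [measurable] = measurable_quenched[OF rw \<mu>] F G
  have sq: "sets (quenched p q r \<omega> (\<mu> \<omega>)) = sets path_space" for \<omega>
    unfolding quenched_def by simp
  have m: "(\<lambda>\<omega>. distr (quenched p q r \<omega> (\<mu> \<omega>)) (P \<Otimes>\<^sub>M path_space) (Pair \<omega>))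
      \<in> P \<rightarrow>\<^sub>M subprob_algebra (P \<Otimes>\<^sub>M path_space)"
    by (rule measurable_distr2[where M = path_space]) simp_all
  have "emeasure (annealed P p q r \<mu>) (F \<times> G) =
      (\<integral>\<^sup>+\<omega>. emeasure (distr (quenched p q r \<omega> (\<mu> \<omega>)) (P \<Otimes>\<^sub>M path_space) (Pair \<omega>)) (F \<times> G) \<partial>P)"
    unfolding annealed_def
    by (rule emeasure_bind[OF P.not_empty m]) simp
  also have "\<dots> = (\<integral>\<^sup>+\<omega>. emeasure (quenched p q r \<omega> (\<mu> \<omega>)) G * indicator F \<omega> \<partial>P)"
  proof (rule nn_integral_cong)
    fix \<omega> assume "\<omega> \<in> space P"
    then have "Pair \<omega> \<in> quenched p q r \<omega> (\<mu> \<omega>) \<rightarrow>\<^sub>M P \<Otimes>\<^sub>M path_space"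
      unfolding measurable_cong_sets[OF sq refl] by measurable
    then have "emeasure (distr (quenched p q r \<omega> (\<mu> \<omega>)) (P \<Otimes>\<^sub>M path_space) (Pair \<omega>)) (F \<times> G) =
        emeasure (quenched p q r \<omega> (\<mu> \<omega>)) (Pair \<omega> -` (F \<times> G) \<inter> space (quenched p q r \<omega> (\<mu> \<omega>)))"
      by (rule emeasure_distr) simp
    also have "Pair \<omega> -` (F \<times> G) \<inter> space (quenched p q r \<omega> (\<mu> \<omega>)) = (if \<omega> \<in> F then G else {})"
      unfolding quenched_def by auto
    finally show "emeasure (distr (quenched p q r \<omega> (\<mu> \<omega>)) (P \<Otimes>\<^sub>M path_space) (Pair \<omega>)) (F \<times> G) =
        emeasure (quenched p q r \<omega> (\<mu> \<omega>)) G * indicator F \<omega>"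
      by (auto simp: indicator_def)
  qed
  finally show ?thesis .
qed

end

theory Submission
  imports Defs
begin

text \<open>Let \<open>\<rho>\<close> be the density of a stationary distribution, read as a row vector indexed by the phases, and
  write \<open>x\<^sub>n\<close> for the value of \<open>x\<close> at the environment shifted by \<open>n\<close>. Invariance means
  \<open>\<rho>\<^sub>n = \<rho>\<^sub>n\<^sub>-\<^sub>1 p\<^sub>n\<^sub>-\<^sub>1 + \<rho>\<^sub>n r\<^sub>n + \<rho>\<^sub>n\<^sub>+\<^sub>1 q\<^sub>n\<^sub>+\<^sub>1\<close>. The row vectors
  \<open>\<kappa>\<^sub>n = \<rho>\<^sub>n\<^sub>-\<^sub>1 p\<^sub>n\<^sub>-\<^sub>1 - \<rho>\<^sub>n q\<^sub>n \<zeta>\<^sub>n\<^sub>-\<^sub>1\<close> then satisfy \<open>\<kappa>\<^sub>n\<^sub>+\<^sub>1 = \<kappa>\<^sub>n \<zeta>\<^sub>n\<close>, their mass is the flux of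
  the chain, which by ergodicity is the constant \<open>v\<close>, and since the backward products of the
  \<open>\<zeta>\<^sub>n = \<eta>\<^sub>n\<close> converge to \<open>\<pi>\<close>, they are equal to \<open>v \<pi>\<^sub>n\<close>. Hence
  \<open>\<rho>\<^sub>n = (v \<pi>\<^sub>n + \<rho>\<^sub>n\<^sub>+\<^sub>1 q\<^sub>n\<^sub>+\<^sub>1) \<gamma>\<^sub>n\<close>. A nonnegative stationary solution of \<open>s\<^sub>n \<le> s\<^sub>n\<^sub>+\<^sub>1 a\<^sub>n\<close> vanishes
  when \<open>\<lambda> < 0\<close>. Applied to \<open>s\<^sub>n = \<rho>\<^sub>n q\<^sub>n\<close> this excludes \<open>v \<le> 0\<close>; for \<open>v > 0\<close> it shows that \<open>\<rho>\<close> is \<open>v\<close> times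
  the series \<open>\<pi>\<^sub>0 \<gamma>\<^sub>0 + \<pi>\<^sub>1 a\<^sub>1 \<gamma>\<^sub>0 + \<pi>\<^sub>2 a\<^sub>2 a\<^sub>1 \<gamma>\<^sub>0 + \<dots>\<close>, whose terms are the densities of the
  occupation of the successive levels by the walk stopped at \<open>T\<^sub>1\<close>. Conversely, this series always
  solves the equations of invariance if it is integrable. Its integral is the mean of \<open>T\<^sub>1\<close>, which is at
  most \<open>1 / v\<close>: the increments of the hitting times form a stationary sequence whose averages
  converge to \<open>1 / v\<close>.\<close>

section \<open>Nonnegative matrices\<close>

text \<open>The walk escapes to the right, so every step down from \<open>n\<close> is followed by a
  return whose phases are governed by \<open>\<zeta>\<^sub>n\<^sub>-\<^sub>1\<close>. Subtracting
  these returns from the upward flux leaves in \<kappa> the flux of first arrivals at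
  \<open>n\<close>, which is why \<kappa> has to be a multiple of \<pi>. Three points are not
  immediate. The constant mass of \<kappa> must be the speed: under the stationary law the mean
  displacement after n steps is exactly n times the mean of one step, while displacement over n is
  bounded by 1 and tends to v. The identity \<zeta> = \<eta> must be derived: \<eta> is the minimal
  nonnegative solution of the first-step equations, and its rows lose no mass because the products
  of the \<eta> converge to a probability vector. Finally, the logarithm of the mass of a
  subsolution need not be integrable, so the negative exponent enters through the mean of the log
  norm of one block of length N, compared by stationarity with a truncated coboundary, and not
  through pathwise growth rates.\<close>

lemma infnorm_le_iff:
  fixes x :: "real^'n"
  shows "infnorm x \<le> c \<longleftrightarrow> (\<forall>i. \<bar>x $ i\<bar> \<le> c)"
proof
  assume "infnorm x \<le> c"
  then show "\<forall>i. \<bar>x $ i\<bar> \<le> c"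
    using component_le_infnorm_cart order_trans by blast
next
  assume "\<forall>i. \<bar>x $ i\<bar> \<le> c"
  then show "infnorm x \<le> c"
    unfolding infnorm_cart by (intro cSup_least) auto
qed

text \<open>The row sum is attained at the sign vector of row \<open>i\<close>, which has maximum
  norm one. The crude constant \<open>?C\<close> only ensures that the supremum in
  \<open>opnorm\<close> is taken over a bounded set.\<close>

lemma abs_row_sum_le_opnorm:
  fixes A :: "('d::finite) mat"
  shows "(\<Sum>j\<in>UNIV. \<bar>A $ i $ j\<bar>) \<le> opnorm A"
proof -
  let ?C = "\<Sum>i\<in>UNIV. \<Sum>j\<in>UNIV. \<bar>A $ i $ j\<bar>"
  have bound: "infnorm (A *v x) \<le> ?C" if "infnorm x = 1" for x
    unfolding infnorm_le_iff
  proof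
    fix i
    have "\<bar>(A *v x) $ i\<bar> \<le> (\<Sum>j\<in>UNIV. \<bar>A $ i $ j * x $ j\<bar>)"
      unfolding matrix_vector_mult_def by (simp add: sum_abs)
    also have "\<dots> \<le> (\<Sum>j\<in>UNIV. \<bar>A $ i $ j\<bar>)"
    proof (rule sum_mono)
      fix j
      have "\<bar>x $ j\<bar> \<le> 1" using that infnorm_le_iff[of x 1] by simp
      then show "\<bar>A $ i $ j * x $ j\<bar> \<le> \<bar>A $ i $ j\<bar>"
        by (simp add: abs_mult mult_left_le)
    qed
    also have "\<dots> \<le> ?C"
      by (rule member_le_sum[where f = "\<lambda>i. \<Sum>j\<in>UNIV. \<bar>A $ i $ j\<bar>"]) (auto simp: sum_nonneg)
    finally show "\<bar>(A *v x) $ i\<bar> \<le> ?C" .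
  qed
  let ?e = "(\<chi> j. if A $ i $ j < 0 then -1 else 1) :: real^'d"
  have e: "infnorm ?e = 1"
  proof (rule antisym)
    show "infnorm ?e \<le> 1" by (simp add: infnorm_le_iff)
    have "\<bar>?e $ i\<bar> = 1" by simp
    then show "1 \<le> infnorm ?e" using component_le_infnorm_cart[of ?e i] by linarith
  qed
  have "(\<Sum>j\<in>UNIV. \<bar>A $ i $ j\<bar>) = (A *v ?e) $ i"
    by (auto simp: matrix_vector_mult_def intro!: sum.cong)
  also have "\<dots> \<le> infnorm (A *v ?e)"
    using component_le_infnorm_cart[of "A *v ?e" i] by linarith
  also have "\<dots> \<le> opnorm A"
    unfolding opnorm_def by (rule cSUP_upper) (use e bound in \<open>auto intro!: bdd_aboveI\<close>)
  finally show ?thesis .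
qed

text \<open>The converse of \<open>abs_row_sum_le_opnorm\<close>: together they identify
  \<open>opnorm\<close> with the largest absolute row sum, the form in which it is measured and
  estimated below.\<close>

lemma opnorm_le_abs:
  fixes A :: "('d::finite) mat"
  assumes c: "\<And>i. (\<Sum>j\<in>UNIV. \<bar>A $ i $ j\<bar>) \<le> c"
  shows "opnorm A \<le> c"
  unfolding opnorm_def
proof (rule cSUP_least)
  have "infnorm ((\<chi> i. 1) :: real^'d) = 1"
    using component_le_infnorm_cart[of "(\<chi> i. 1) :: real^'d"]
    by (intro antisym) (auto simp: infnorm_le_iff)
  then show "{x :: real^'d. infnorm x = 1} \<noteq> {}" by blast
  fix x :: "real^'d" assume "x \<in> {x. infnorm x = 1}"
  then have x: "\<bar>x $ j\<bar> \<le> 1" for j using infnorm_le_iff[of x 1] by simp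
  show "infnorm (A *v x) \<le> c"
    unfolding infnorm_le_iff
  proof
    fix i
    have "\<bar>(A *v x) $ i\<bar> \<le> (\<Sum>j\<in>UNIV. \<bar>A $ i $ j * x $ j\<bar>)"
      unfolding matrix_vector_mult_def by (simp add: sum_abs)
    also have "\<dots> \<le> (\<Sum>j\<in>UNIV. \<bar>A $ i $ j\<bar>)"
      using x by (intro sum_mono) (auto simp: abs_mult mult_left_le)
    finally show "\<bar>(A *v x) $ i\<bar> \<le> c" using c[of i] by simp
  qed
qed

lemma row_sum_le_opnorm: "(\<Sum>j\<in>UNIV. A $ i $ j) \<le> opnorm (A :: ('d::finite) mat)"
  by (rule order_trans[OF sum_mono abs_row_sum_le_opnorm]) (rule abs_ge_self)

lemma opnorm_le:
  fixes A :: "('d::finite) mat"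
  assumes "nonneg_matrix A" "\<And>i. (\<Sum>j\<in>UNIV. A $ i $ j) \<le> c"
  shows "opnorm A \<le> c"
  using assms by (intro opnorm_le_abs) (simp add: nonneg_matrix_def)

lemma opnorm_nonneg: "nonneg_matrix (A :: ('d::finite) mat) \<Longrightarrow> 0 \<le> opnorm A"
  using row_sum_le_opnorm[of A] by (meson nonneg_matrix_def order_trans sum_nonneg)

lemma nonneg_matrix_mult:
  "nonneg_matrix A \<Longrightarrow> nonneg_matrix B \<Longrightarrow> nonneg_matrix (A ** B)"
  by (auto simp: nonneg_matrix_def matrix_matrix_mult_def intro!: sum_nonneg)

lemma nonneg_matrix_add:
  "nonneg_matrix A \<Longrightarrow> nonneg_matrix B \<Longrightarrow> nonneg_matrix (A + B)"
  by (auto simp: nonneg_matrix_def)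

lemma nonneg_mat_1: "nonneg_matrix (mat 1)"
  by (auto simp: nonneg_matrix_def mat_def)

lemma row_sum_mult:
  "(\<Sum>j\<in>UNIV. (A ** B :: real^'d^'d) $ i $ j) = (\<Sum>k\<in>UNIV. A $ i $ k * (\<Sum>j\<in>UNIV. B $ k $ j))"
proof -
  have "(\<Sum>j\<in>UNIV. (A ** B) $ i $ j) = (\<Sum>j\<in>UNIV. \<Sum>k\<in>UNIV. A $ i $ k * B $ k $ j)"
    by (simp add: matrix_matrix_mult_def)
  also have "\<dots> = (\<Sum>k\<in>UNIV. \<Sum>j\<in>UNIV. A $ i $ k * B $ k $ j)" by (rule sum.swap)
  finally show ?thesis by (simp add: sum_distrib_left)
qed

lemma sum_vector_matrix_mult:
  "(\<Sum>j\<in>UNIV. (x v* A :: real^'d) $ j) = (\<Sum>k\<in>UNIV. x $ k * (\<Sum>j\<in>UNIV. A $ k $ j))"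
proof -
  have "(\<Sum>j\<in>UNIV. (x v* A) $ j) = (\<Sum>j\<in>UNIV. \<Sum>k\<in>UNIV. x $ k * A $ k $ j)"
    by (simp add: vector_matrix_mult_def mult.commute)
  also have "\<dots> = (\<Sum>k\<in>UNIV. \<Sum>j\<in>UNIV. x $ k * A $ k $ j)" by (rule sum.swap)
  finally show ?thesis by (simp add: sum_distrib_left)
qed

lemma opnorm_mult_le:
  fixes A B :: "('d::finite) mat"
  assumes A: "nonneg_matrix A" and B: "nonneg_matrix B"
  shows "opnorm (A ** B) \<le> opnorm A * opnorm B"
proof (rule opnorm_le[OF nonneg_matrix_mult[OF A B]])
  fix i
  have "(\<Sum>j\<in>UNIV. (A ** B) $ i $ j) \<le> (\<Sum>k\<in>UNIV. A $ i $ k * opnorm B)"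
    unfolding row_sum_mult using A row_sum_le_opnorm[of B]
    by (intro sum_mono mult_left_mono) (auto simp: nonneg_matrix_def)
  also have "\<dots> \<le> opnorm A * opnorm B"
    unfolding sum_distrib_right[symmetric]
    by (intro mult_right_mono row_sum_le_opnorm opnorm_nonneg B)
  finally show "(\<Sum>j\<in>UNIV. (A ** B) $ i $ j) \<le> opnorm A * opnorm B" .
qed

text \<open>By duality the norm induced by the maximum norm on columns controls the action on row
  vectors in the sum norm, the natural one for fluxes and densities.\<close>

lemma sum_vector_matrix_le_opnorm:
  fixes A :: "('d::finite) mat"
  assumes "\<And>k. 0 \<le> x $ k"
  shows "(\<Sum>j\<in>UNIV. (x v* A) $ j) \<le> (\<Sum>k\<in>UNIV. x $ k) * opnorm A"
  unfolding sum_vector_matrix_mult sum_distrib_right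
  using assms row_sum_le_opnorm by (intro sum_mono mult_left_mono) auto

lemma vector_matrix_mono:
  fixes A :: "('d::finite) mat"
  assumes "nonneg_matrix A" "\<And>k. x $ k \<le> y $ k"
  shows "(x v* A) $ j \<le> (y v* A) $ j"
  using assms by (auto simp: vector_matrix_mult_def nonneg_matrix_def intro!: sum_mono mult_mono mult_left_mono mult_right_mono)

lemma vector_matrix_nonneg:
  fixes A :: "('d::finite) mat"
  assumes "nonneg_matrix A" "\<And>k. 0 \<le> x $ k"
  shows "0 \<le> (x v* A) $ j"
  using assms by (auto simp: vector_matrix_mult_def nonneg_matrix_def intro!: sum_nonneg)

lemma vector_matrix_mul_add: "(x + y) v* A = x v* A + y v* (A :: real^'n^'m)"
  by (simp add: vec_eq_iff vector_matrix_mult_def sum.distrib algebra_simps)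

lemma vector_matrix_mul_diff: "(x - y) v* A = x v* A - y v* (A :: real^'n^'m)"
  by (simp add: vec_eq_iff vector_matrix_mult_def sum_subtractf algebra_simps)

lemma vector_matrix_mul_add_mat: "x v* (A + B) = x v* A + x v* (B :: real^'n^'m)"
  by (simp add: vec_eq_iff vector_matrix_mult_def sum.distrib algebra_simps)

lemma vector_matrix_mul_diff_mat: "x v* (A - B) = x v* A - x v* (B :: real^'n^'m)"
  by (simp add: vec_eq_iff vector_matrix_mult_def sum_subtractf algebra_simps)

lemma vector_matrix_mul_scaleR: "(c *\<^sub>R x) v* A = c *\<^sub>R (x v* (A :: real^'n^'m))"
  by (simp add: vec_eq_iff vector_matrix_mult_def sum_distrib_left algebra_simps)

lemma vector_matrix_mul_sum:
  "(\<Sum>m\<in>I. x m) v* B = (\<Sum>m\<in>I. x m v* (B :: real^'n^'m))"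
  by (induction I rule: infinite_finite_induct) (simp_all add: vector_matrix_mul_add)

lemma matrix_mult_add_left: "(A + B) ** C = A ** C + B ** (C :: real^'n^'m)"
  by (simp add: vec_eq_iff matrix_matrix_mult_def sum.distrib algebra_simps)

text \<open>A minimum principle takes the place of the Neumann series: if
  \<open>(mat 1 - M) *v y\<close> is nonnegative and \<open>y\<close> had a negative minimal
  coordinate, the row sums of \<open>M\<close> below one would make that coordinate of
  \<open>(mat 1 - M) *v y\<close> negative. Applied to a kernel vector and its negative it gives
  invertibility, applied to the columns of the inverse their sign, and applied to a constant vector
  minus the row sums of \<open>G\<close> the last bound.\<close>

lemma matrix_inv_one_minus:
  fixes M :: "('d::finite) mat"
  assumes M: "nonneg_matrix M" and c: "c < 1" and row: "\<And>i. (\<Sum>j\<in>UNIV. M $ i $ j) \<le> c"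
  defines "G \<equiv> matrix_inv (mat 1 - M)"
  shows "(mat 1 - M) ** G = mat 1" "G ** (mat 1 - M) = mat 1" "nonneg_matrix G"
    "nonneg_matrix (G - mat 1)" "(\<Sum>j\<in>UNIV. G $ i $ j) \<le> 1 / (1 - c)"
proof -
  have pos: "0 \<le> y $ i" if y: "\<And>i. 0 \<le> ((mat 1 - M) *v y) $ i" for y i
  proof (rule ccontr)
    assume neg: "\<not> 0 \<le> y $ i"
    have "finite (range (($) y))" by simp
    then have "Min (range (($) y)) \<in> range (($) y)" by (intro Min_in) auto
    then obtain k where "y $ k = Min (range (($) y))" by fastforce
    then have k: "y $ k \<le> y $ j" for j by simp
    have yk: "y $ k < 0" using k[of i] neg by linarith
    have "0 \<le> y $ k - (\<Sum>j\<in>UNIV. M $ k $ j * y $ j)"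
      using y[of k] by (simp add: matrix_vector_mult_diff_rdistrib) (simp add: matrix_vector_mult_def)
    also have "(\<Sum>j\<in>UNIV. M $ k $ j * y $ j) \<ge> (\<Sum>j\<in>UNIV. M $ k $ j * y $ k)"
      using M k by (intro sum_mono mult_left_mono) (auto simp: nonneg_matrix_def)
    then have "y $ k - (\<Sum>j\<in>UNIV. M $ k $ j * y $ j) \<le> y $ k - (\<Sum>j\<in>UNIV. M $ k $ j) * y $ k"
      by (simp add: sum_distrib_right)
    also have "\<dots> = (1 - (\<Sum>j\<in>UNIV. M $ k $ j)) * y $ k" by (simp add: algebra_simps)
    also have "\<dots> < 0" using row[of k] c yk by (intro mult_pos_neg) auto
    finally show False by simp
  qed
  have inj: "x = 0" if "(mat 1 - M) *v x = 0" for x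
  proof -
    have "0 \<le> x $ i" "0 \<le> (- x) $ i" for i
      using that pos[of x i] pos[of "- x" i] by (simp_all add: vec.neg)
    then show ?thesis by (auto simp: vec_eq_iff intro: antisym)
  qed
  have "invertible (mat 1 - M)"
    using inj unfolding invertible_left_inverse matrix_left_invertible_ker by blast
  then have "\<exists>A'. (mat 1 - M) ** A' = mat 1 \<and> A' ** (mat 1 - M) = mat 1"
    by (auto simp: invertible_def)
  from someI_ex[OF this] show GL: "(mat 1 - M) ** G = mat 1" and GR: "G ** (mat 1 - M) = mat 1"
    unfolding G_def matrix_inv_def by auto
  have col: "(mat 1 - M) *v column j G = axis j 1" for j
  proof -
    have "(mat 1 - M) *v column j G = column j ((mat 1 - M) ** G)"
      by (simp add: vec_eq_iff matrix_vector_mult_def matrix_matrix_mult_def column_def)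
    then show ?thesis unfolding GL by (simp add: vec_eq_iff column_def mat_def axis_def)
  qed
  show "nonneg_matrix G"
    unfolding nonneg_matrix_def
  proof (intro allI)
    fix i j
    have "0 \<le> column j G $ i" by (rule pos) (simp add: col axis_def)
    then show "0 \<le> G $ i $ j" by (simp add: column_def)
  qed
  then have "nonneg_matrix (M ** G)" by (intro nonneg_matrix_mult M)
  moreover have "G - mat 1 = M ** G"
  proof -
    have "G - mat 1 - M ** G = (mat 1 - M) ** G - mat 1"
      by (simp add: vec_eq_iff matrix_matrix_mult_def sum_subtractf left_diff_distrib mat_def sum.delta if_distrib [of "\<lambda>x. x * _"] cong: if_cong)
    then show ?thesis using GL by simp
  qed
  ultimately show "nonneg_matrix (G - mat 1)" by simp
  show "(\<Sum>j\<in>UNIV. G $ i $ j) \<le> 1 / (1 - c)"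
  proof -
    let ?e = "(\<chi> i. 1) :: real^'d"
    let ?y = "(1 / (1 - c)) *\<^sub>R ?e - G *v ?e"
    have "(mat 1 - M) *v ?y = (1 / (1 - c)) *\<^sub>R ((mat 1 - M) *v ?e) - ?e"
      by (simp add: matrix_vector_mult_diff_distrib matrix_vector_mul_assoc GL matrix_vector_mult_scaleR)
    then have "0 \<le> ((mat 1 - M) *v ?y) $ i" for i
      using c row[of i] by (simp add: matrix_vector_mult_diff_rdistrib) (simp add: matrix_vector_mult_def field_simps)
    from pos[OF this, of i] show ?thesis by (simp add: matrix_vector_mult_def)
  qed
qed

section \<open>Measurability of matrix operations\<close>

lemma borel_measurable_det:
  fixes f :: "'a \<Rightarrow> ('d::finite) mat"
  assumes [measurable]: "\<And>i j. (\<lambda>x. f x $ i $ j) \<in> borel_measurable M"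
  shows "(\<lambda>x. det (f x)) \<in> borel_measurable M"
  unfolding det_def by measurable

text \<open>Cramer's rule gives the entries as quotients of determinants. For a singular matrix the
  predicate under the choice operator is constantly false, so \<open>matrix_inv\<close> then has one
  fixed value, whose entry is \<open>?c\<close>, and measurability holds on singular matrices as
  well.\<close>

lemma borel_measurable_matrix_inv:
  fixes f :: "'a \<Rightarrow> ('d::finite) mat"
  assumes f[measurable]: "\<And>i j. (\<lambda>x. f x $ i $ j) \<in> borel_measurable M"
  shows "(\<lambda>x. matrix_inv (f x) $ i $ j) \<in> borel_measurable M"
proof -
  let ?C = "\<lambda>A :: 'd mat. det (\<chi> k l. if l = i then axis j 1 $ k else A $ k $ l) / det A"
  let ?c = "(SOME A' :: 'd mat. False) $ i $ j"
  have eq: "matrix_inv A $ i $ j = (if det A = 0 then ?c else ?C A)" for A :: "'d mat"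
  proof (cases "det A = 0")
    case True
    then have "\<not> invertible A" by (simp add: invertible_det_nz)
    then have "(\<lambda>A'. A ** A' = mat 1 \<and> A' ** A = mat 1) = (\<lambda>A'. False)"
      by (auto simp: invertible_def)
    then show ?thesis using True by (simp add: matrix_inv_def)
  next
    case False
    then have "\<exists>A'. A ** A' = mat 1 \<and> A' ** A = mat 1"
      by (simp flip: invertible_def add: invertible_det_nz)
    from someI_ex[OF this] have "A ** matrix_inv A = mat 1" by (simp add: matrix_inv_def)
    moreover have "A *v column j (matrix_inv A) = column j (A ** matrix_inv A)"
      by (simp add: vec_eq_iff matrix_vector_mult_def matrix_matrix_mult_def column_def)
    ultimately have "A *v column j (matrix_inv A) = axis j 1"
      by (simp add: vec_eq_iff column_def mat_def axis_def)
    then have "column j (matrix_inv A) $ i = ?C A"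
      unfolding cramer[OF False] by simp
    then show ?thesis using False by (simp add: column_def)
  qed
  have [measurable]: "(\<lambda>x. det (f x)) \<in> borel_measurable M"
    by (rule borel_measurable_det) fact
  have [measurable]: "(\<lambda>x. det (\<chi> k l. if l = i then axis j 1 $ k else f x $ k $ l)) \<in> borel_measurable M"
    by (rule borel_measurable_det) simp
  show ?thesis unfolding eq by measurable
qed

lemma borel_measurable_opnorm:
  fixes f :: "'a \<Rightarrow> ('d::finite) mat"
  assumes [measurable]: "\<And>i j. (\<lambda>x. f x $ i $ j) \<in> borel_measurable M"
  shows "(\<lambda>x. opnorm (f x)) \<in> borel_measurable M"
proof -
  have eq: "opnorm A = Max ((\<lambda>i. \<Sum>j\<in>UNIV. \<bar>A $ i $ j\<bar>) ` UNIV)" for A :: "'d mat"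
    by (rule antisym) (auto intro!: opnorm_le_abs abs_row_sum_le_opnorm)
  show ?thesis unfolding eq by (rule borel_measurable_Max) auto
qed

lemma borel_measurable_mat_mult:
  fixes f g :: "'a \<Rightarrow> ('d::finite) mat"
  assumes [measurable]: "\<And>i j. (\<lambda>x. f x $ i $ j) \<in> borel_measurable M" "\<And>i j. (\<lambda>x. g x $ i $ j) \<in> borel_measurable M"
  shows "(\<lambda>x. (f x ** g x) $ i $ j) \<in> borel_measurable M"
  unfolding matrix_matrix_mult_def by simp

lemma borel_measurable_vec_mat_mult:
  fixes f :: "'a \<Rightarrow> real^('d::finite)" and g :: "'a \<Rightarrow> 'd mat"
  assumes [measurable]: "\<And>i. (\<lambda>x. f x $ i) \<in> borel_measurable M" "\<And>i j. (\<lambda>x. g x $ i $ j) \<in> borel_measurable M"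
  shows "(\<lambda>x. (f x v* g x) $ j) \<in> borel_measurable M"
  unfolding vector_matrix_mult_def by simp

lemma borel_measurable_mat_entries:
  fixes f :: "'a \<Rightarrow> ('d::finite) mat"
  assumes "f \<in> borel_measurable M"
  shows "(\<lambda>x. f x $ i $ j) \<in> borel_measurable M"
proof (rule measurable_compose[OF assms])
  show "(\<lambda>A::'d mat. A $ i $ j) \<in> borel_measurable borel"
    by (intro borel_measurable_continuous_onI continuous_intros)
qed

section \<open>The Markov property\<close>

lemma space_path_space [simp]: "space path_space = UNIV"
  by (simp add: space_PiM)

lemma UNIV_in_path_space [simp]: "UNIV \<in> sets (path_space :: ('d::finite) path measure)"
  using sets.top[of "path_space :: 'd path measure"] by (simp only: space_path_space)

lemma measurable_path_coord [measurable]: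
  "(\<lambda>x. x t) \<in> path_space \<rightarrow>\<^sub>M (count_space UNIV :: ('d::finite) state measure)"
  by (rule measurable_component_singleton) simp

lemma sets_cylinder [measurable]: "{x. \<forall>t\<le>n. x t = y t} \<in> sets (path_space :: ('d::finite) path measure)"
proof -
  have "{x \<in> space path_space. \<forall>t\<le>n. x t = y t} \<in> sets (path_space :: 'd path measure)"
    by measurable
  then show ?thesis by simp
qed

lemma measurable_path_map:
  fixes f :: "('d::finite) state \<Rightarrow> 'd state"
  shows "(\<lambda>x t. f (x (g t))) \<in> path_space \<rightarrow>\<^sub>M path_space"
  by (rule measurable_PiM_single') (auto intro: measurable_compose[OF measurable_path_coord])

lemmas measurable_path_shift [measurable] =
  measurable_path_map[where f = "\<lambda>x. x" and g = "\<lambda>s. t + s" for t]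

text \<open>Two cylinders are disjoint or nested, so they form a generator stable under
  intersection. The cylinders \<open>?A\<close> of the first coordinate are countably many, because
  the state space is countable, and already cover the path space.\<close>

lemma path_measure_eqI:
  fixes M N :: "('d::finite) path measure"
  assumes sets: "sets M = sets path_space" "sets N = sets path_space"
    and fin: "finite_measure M"
    and eq: "\<And>n y. emeasure M {x. \<forall>t\<le>n. x t = y t} = emeasure N {x. \<forall>t\<le>n. x t = y t}"
  shows "M = N"
proof -
  let ?c = "\<lambda>(n::nat, y :: 'd path). {x. \<forall>t\<le>n. x t = y t}"
  let ?G = "insert {} (range ?c)"
  let ?A = "range (\<lambda>a. ?c (0, \<lambda>_. a))"
  interpret finite_measure M by fact
  show ?thesis
  proof (rule measure_eqI_generator_eq_countable[where E = ?G and A = ?A and \<Omega> = UNIV])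
    show "Int_stable ?G"
    proof (rule Int_stableI)
      have *: "?c (n, y) \<inter> ?c (m, z) \<in> ?G" if "n \<le> m" for n m y z
      proof (cases "\<forall>t\<le>n. y t = z t")
        case True
        then have "?c (n, y) \<inter> ?c (m, z) = ?c (m, z)" using that by auto
        then show ?thesis by blast
      next
        case False
        then have "?c (n, y) \<inter> ?c (m, z) = {}" using that by (force dest: le_trans)
        then show ?thesis by simp
      qed
      fix A B assume A: "A \<in> ?G" and B: "B \<in> ?G"
      show "A \<inter> B \<in> ?G"
      proof (cases "A = {} \<or> B = {}")
        case False
        then obtain n y m z where AB: "A = ?c (n, y)" "B = ?c (m, z)" using A B by auto
        show ?thesis
        proof (cases "n \<le> m")
          case True
          then show ?thesis using *[of n m y z] AB by simp
        next
          case False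
          then show ?thesis using *[of m n z y] AB by (simp add: Int_commute)
        qed
      qed auto
    qed
    show "emeasure M X = emeasure N X" if "X \<in> ?G" for X using that eq by auto
    show "countable ?A" by (rule countable_image) simp
    show "\<Union> ?A = UNIV" by auto
    show "?A \<subseteq> ?G" by blast
    show "emeasure M a \<noteq> \<infinity>" for a by simp
    show "sets M = sigma_sets UNIV ?G" "sets N = sigma_sets UNIV ?G"
      using sets by (simp_all only: sets_path_space_cylinders)
  qed simp
qed

lemma prod_lessThan_add:
  fixes f :: "nat \<Rightarrow> 'a::comm_monoid_mult"
  shows "(\<Prod>u<t + n. f u) = (\<Prod>u<t. f u) * (\<Prod>s<n. f (t + s))"
  by (induction n) (simp_all add: mult_ac)

lemma shift_0 [simp]: "shift 0 \<omega> = \<omega>"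
  by (simp add: shift_def)

lemma shift_shift [simp]: "shift k (shift l \<omega>) = shift (k + l) \<omega>"
  by (simp add: shift_def fun_eq_iff ac_simps)

lemma shift_apply: "shift k \<omega> n = \<omega> (n + k)"
  by (simp add: shift_def)

locale strip =
  fixes S :: "'s measure" and P :: "'s env measure"
    and p q r :: "'s \<Rightarrow> ('d::finite) mat"
  assumes rw: "rwre S P p q r"
begin

abbreviation law :: "'s env \<Rightarrow> 'd state pmf \<Rightarrow> 'd path measure" where
  "law \<equiv> walk_law p q r"

abbreviation law1 :: "'s env \<Rightarrow> 'd state \<Rightarrow> 'd path measure" where
  "law1 \<omega> x \<equiv> walk_law p q r \<omega> (return_pmf x)"

abbreviation jmp :: "'s env \<Rightarrow> 'd state \<Rightarrow> 'd state pmf" where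
  "jmp \<equiv> jump p q r"

lemma emeasure_law_space [simp]: "emeasure (law \<omega> \<nu>) UNIV = 1"
  using prob_space.emeasure_space_1[OF prob_space_walk_law, of p q r \<omega> \<nu>] by simp

text \<open>Both sides are finite measures in \<open>G\<close>, hence it suffices to compare them on
  cylinders, where the product formula applies. The path \<open>?y\<close> glues the two prescribed
  segments; this is consistent only if \<open>z 0 = y t\<close>, and otherwise both sides
  vanish.\<close>

lemma markov_cylinder:
  fixes y :: "'d path"
  assumes G [measurable]: "G \<in> sets path_space"
  shows "emeasure (law \<omega> \<nu>) ({x. \<forall>s\<le>t. x s = y s} \<inter> {x. (\<lambda>s. x (t + s)) \<in> G}) =
    emeasure (law \<omega> \<nu>) {x. \<forall>s\<le>t. x s = y s} * emeasure (law1 \<omega> (y t)) G"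
proof -
  let ?C = "{x. \<forall>s\<le>t. x s = y s}" and ?sh = "\<lambda>(x :: 'd path) s. x (t + s)"
  let ?M = "distr (density (law \<omega> \<nu>) (indicator ?C)) path_space ?sh"
  let ?c = "emeasure (law \<omega> \<nu>) ?C"
  have C [measurable]: "?C \<in> sets path_space" by (rule sets_cylinder)
  have M: "emeasure ?M A = emeasure (law \<omega> \<nu>) (?C \<inter> {x. ?sh x \<in> A})" if A: "A \<in> sets path_space" for A
  proof -
    have [measurable]: "{x. ?sh x \<in> A} \<in> sets path_space"
      using measurable_sets[OF measurable_path_shift[of t] A] by (simp add: vimage_def)
    have "emeasure ?M A = emeasure (density (law \<omega> \<nu>) (indicator ?C)) {x. ?sh x \<in> A}"
      using A by (subst emeasure_distr) (auto simp: vimage_def)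
    also have "\<dots> = (\<integral>\<^sup>+x. indicator ?C x * indicator {x. ?sh x \<in> A} x \<partial>law \<omega> \<nu>)"
      by (subst emeasure_density) auto
    also have "\<dots> = (\<integral>\<^sup>+x. indicator (?C \<inter> {x. ?sh x \<in> A}) x \<partial>law \<omega> \<nu>)"
      by (intro nn_integral_cong) (auto simp: indicator_def)
    finally show ?thesis by (subst (asm) nn_integral_indicator) auto
  qed
  have "?M = scale_measure ?c (law1 \<omega> (y t))"
  proof (rule path_measure_eqI)
    show "finite_measure ?M"
    proof
      have "emeasure ?M UNIV \<le> emeasure (law \<omega> \<nu>) UNIV"
        unfolding M[OF UNIV_in_path_space] by (rule emeasure_mono) simp_all
      then have "emeasure ?M UNIV \<noteq> top"
        unfolding emeasure_law_space by (rule neq_top_trans[rotated]) simp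
      then show "emeasure ?M (space ?M) \<noteq> \<infinity>" by (simp only: space_distr space_path_space infinity_ennreal_def) simp
    qed
    fix n and z :: "'d path"
    show "emeasure ?M {x. \<forall>s\<le>n. x s = z s} =
        emeasure (scale_measure ?c (law1 \<omega> (y t))) {x. \<forall>s\<le>n. x s = z s}"
    proof (cases "z 0 = y t")
      case True
      let ?y = "\<lambda>s. if s \<le> t then y s else z (s - t)"
      have ts: "?y (t + s) = z s" for s
      proof (cases s)
        case 0
        then show ?thesis using True by simp
      next
        case (Suc k)
        then show ?thesis by simp
      qed
      have "?C \<inter> {x. \<forall>s\<le>n. x (t + s) = z s} = {x. \<forall>s\<le>t + n. x s = ?y s}"
      proof (intro set_eqI iffI)
        fix x assume x: "x \<in> ?C \<inter> {x. \<forall>s\<le>n. x (t + s) = z s}"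
        have "x s = ?y s" if "s \<le> t + n" for s
        proof (cases "s \<le> t")
          case True
          then show ?thesis using x by simp
        next
          case False
          then have "s - t \<le> n" and s: "t + (s - t) = s" using that by auto
          then have "x (t + (s - t)) = z (s - t)" using x by blast
          then show ?thesis using False by (simp only: s if_False)
        qed
        then show "x \<in> {x. \<forall>s\<le>t + n. x s = ?y s}" by blast
      next
        fix x assume x: "x \<in> {x. \<forall>s\<le>t + n. x s = ?y s}"
        have "x s = y s" if "s \<le> t" for s
        proof -
          have "x s = ?y s" using x that by (simp only: mem_Collect_eq trans_le_add1)
          then show ?thesis using that by simp
        qed
        moreover have "x (t + s) = z s" if "s \<le> n" for s
        proof -
          have "x (t + s) = ?y (t + s)" using x that by (simp only: mem_Collect_eq nat_add_left_cancel_le)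
          then show ?thesis by (simp only: ts)
        qed
        ultimately show "x \<in> ?C \<inter> {x. \<forall>s\<le>n. x (t + s) = z s}" by blast
      qed
      then have "emeasure ?M {x. \<forall>s\<le>n. x s = z s} = emeasure (law \<omega> \<nu>) {x. \<forall>s\<le>t + n. x s = ?y s}"
        by (simp only: M[OF sets_cylinder] mem_Collect_eq)
      also have "\<dots> = ennreal (pmf \<nu> (?y 0) * (\<Prod>u<t + n. pmf (jmp \<omega> (?y u)) (?y (Suc u))))"
        by (rule emeasure_walk_law)
      also have "(\<Prod>u<t + n. pmf (jmp \<omega> (?y u)) (?y (Suc u))) =
          (\<Prod>u<t. pmf (jmp \<omega> (y u)) (y (Suc u))) * (\<Prod>s<n. pmf (jmp \<omega> (z s)) (z (Suc s)))"
      proof -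
        have "?y (Suc (t + s)) = z (Suc s)" for s using ts[of "Suc s"] by simp
        then show ?thesis unfolding prod_lessThan_add ts by simp
      qed
      finally show ?thesis
        using True
        by (simp add: emeasure_walk_law ennreal_mult'[symmetric] prod_nonneg mult_ac)
    next
      case False
      have "?C \<inter> {x. \<forall>s\<le>n. x (t + s) = z s} = {}"
      proof (intro equals0I)
        fix x assume "x \<in> ?C \<inter> {x. \<forall>s\<le>n. x (t + s) = z s}"
        then have "x t = y t" "x (t + 0) = z 0" by blast+
        then show False using False by simp
      qed
      then have "emeasure ?M {x. \<forall>s\<le>n. x s = z s} = 0"
        by (simp only: M[OF sets_cylinder] mem_Collect_eq emeasure_empty)
      moreover have "emeasure (law1 \<omega> (y t)) {x. \<forall>s\<le>n. x s = z s} = 0"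
        using False by (simp add: emeasure_walk_law)
      ultimately show ?thesis by simp
    qed
  qed simp_all
  then show ?thesis using M[OF G] by simp
qed

text \<open>An event determined by the times up to \<open>t\<close> is a disjoint union of countably
  many cylinders, indexed by the lists of \<open>Suc t\<close> states; all those contained in
  \<open>E\<close> end in the same state \<open>z\<close>.\<close>

lemma markov:
  assumes E: "\<And>x x'. (\<And>s. s \<le> t \<Longrightarrow> x s = x' s) \<Longrightarrow> x \<in> E \<Longrightarrow> x' \<in> E"
    and z: "\<And>x. x \<in> E \<Longrightarrow> x t = z"
    and G [measurable]: "G \<in> sets path_space"
  shows "emeasure (law \<omega> \<nu>) (E \<inter> {x. (\<lambda>s. x (t + s)) \<in> G}) =
    emeasure (law \<omega> \<nu>) E * emeasure (law1 \<omega> z) G"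
proof -
  let ?I = "{ys. length ys = Suc t \<and> (\<lambda>s. ys ! s) \<in> E}"
  let ?c = "\<lambda>ys. {x. \<forall>s\<le>t. x s = ys ! s}"
  have un: "E = (\<Union>ys\<in>?I. ?c ys)"
  proof (intro set_eqI iffI)
    fix x assume x: "x \<in> E"
    let ?ys = "map x [0..<Suc t]"
    have n: "?ys ! s = x s" if "s \<le> t" for s
      using that by (simp add: nth_append less_Suc_eq_le del: upt_Suc)
    have "(\<lambda>s. ?ys ! s) \<in> E" by (rule E[OF _ x]) (simp only: n)
    then show "x \<in> (\<Union>ys\<in>?I. ?c ys)" by (intro UN_I[of ?ys]) (auto simp: n simp del: upt_Suc)
  next
    fix x assume "x \<in> (\<Union>ys\<in>?I. ?c ys)"
    then obtain ys where "(\<lambda>s. ys ! s) \<in> E" "\<forall>s\<le>t. x s = ys ! s" by auto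
    then show "x \<in> E" using E[of "\<lambda>s. ys ! s" x] by simp
  qed
  have disj: "disjoint_family_on ?c ?I"
    unfolding disjoint_family_on_def
  proof (intro ballI impI)
    fix a b assume a: "a \<in> ?I" and b: "b \<in> ?I" and "a \<noteq> b"
    then obtain s where "s < Suc t" "a ! s \<noteq> b ! s" by (auto simp: list_eq_iff_nth_eq)
    then show "?c a \<inter> ?c b = {}" by (auto simp: less_Suc_eq_le)
  qed
  have [measurable]: "{x. (\<lambda>s. x (t + s)) \<in> G} \<in> sets path_space"
    using measurable_sets[OF measurable_path_shift[of t] G] by (simp add: vimage_def)
  have "emeasure (law \<omega> \<nu>) (E \<inter> {x. (\<lambda>s. x (t + s)) \<in> G}) =
      emeasure (law \<omega> \<nu>) (\<Union>ys\<in>?I. ?c ys \<inter> {x. (\<lambda>s. x (t + s)) \<in> G})"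
    by (subst un) simp
  also have "\<dots> = (\<integral>\<^sup>+ys. emeasure (law \<omega> \<nu>) (?c ys \<inter> {x. (\<lambda>s. x (t + s)) \<in> G}) \<partial>count_space ?I)"
    by (rule emeasure_UN_countable)
       (use disj in \<open>auto simp: disjoint_family_on_def intro!: sets.Int sets_cylinder\<close>)
  also have "\<dots> = (\<integral>\<^sup>+ys. emeasure (law \<omega> \<nu>) (?c ys) * emeasure (law1 \<omega> z) G \<partial>count_space ?I)"
  proof (rule nn_integral_cong)
    fix ys assume "ys \<in> space (count_space ?I)"
    then have "ys ! t = z" using z[of "\<lambda>s. ys ! s"] by simp
    then show "emeasure (law \<omega> \<nu>) (?c ys \<inter> {x. (\<lambda>s. x (t + s)) \<in> G}) =
        emeasure (law \<omega> \<nu>) (?c ys) * emeasure (law1 \<omega> z) G"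
      using markov_cylinder[OF G, of \<omega> \<nu> t "\<lambda>s. ys ! s"] by simp
  qed
  also have "\<dots> = (\<integral>\<^sup>+ys. emeasure (law \<omega> \<nu>) (?c ys) \<partial>count_space ?I) * emeasure (law1 \<omega> z) G"
    by (rule nn_integral_multc) simp
  also have "(\<integral>\<^sup>+ys. emeasure (law \<omega> \<nu>) (?c ys) \<partial>count_space ?I) = emeasure (law \<omega> \<nu>) E"
    by (subst un, rule emeasure_UN_countable[symmetric])
       (use disj in \<open>auto intro!: sets_cylinder\<close>)
  finally show ?thesis .
qed

lemma markov_at:
  assumes G: "G \<in> sets path_space"
  shows "emeasure (law \<omega> \<nu>) ({x. x t = z} \<inter> {x. (\<lambda>s. x (t + s)) \<in> G}) =
    emeasure (law \<omega> \<nu>) {x. x t = z} * emeasure (law1 \<omega> z) G"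
proof (rule markov[OF _ _ G])
  fix x x' :: "'d path" assume eq: "\<And>s. s \<le> t \<Longrightarrow> x s = x' s" and x: "x \<in> {x. x t = z}"
  show "x' \<in> {x. x t = z}" using eq[of t] x by simp
qed simp

lemma emeasure_law_partition:
  assumes [measurable]: "A \<in> sets path_space"
  shows "emeasure (law \<omega> \<nu>) A = (\<integral>\<^sup>+z. emeasure (law \<omega> \<nu>) ({x. x t = z} \<inter> A) \<partial>count_space UNIV)"
proof -
  have "A = (\<Union>z. {x. x t = z} \<inter> A)" by auto
  also have "emeasure (law \<omega> \<nu>) \<dots> = (\<integral>\<^sup>+z. emeasure (law \<omega> \<nu>) ({x. x t = z} \<inter> A) \<partial>count_space UNIV)"
  proof (rule emeasure_UN_countable)
    fix z :: "'d state"
    have "{x \<in> space path_space. x t = z} \<in> sets (path_space :: 'd path measure)" by measurable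
    then show "{x. x t = z} \<inter> A \<in> sets (law \<omega> \<nu>)" by auto
  qed (auto simp: disjoint_family_on_def)
  finally show ?thesis .
qed

lemma emeasure_law_0: "emeasure (law \<omega> \<nu>) {x. x 0 = z} = ennreal (pmf \<nu> z)"
  using emeasure_walk_law[of p q r \<omega> \<nu> 0 "\<lambda>_. z"] by simp

lemma emeasure_law_start:
  assumes G: "G \<in> sets path_space"
  shows "emeasure (law \<omega> \<nu>) G = (\<integral>\<^sup>+z. emeasure (law1 \<omega> z) G \<partial>\<nu>)"
proof -
  have "emeasure (law \<omega> \<nu>) G = (\<integral>\<^sup>+z. emeasure (law \<omega> \<nu>) ({x. x 0 = z} \<inter> G) \<partial>count_space UNIV)"
    by (rule emeasure_law_partition[OF G])
  also have "\<dots> = (\<integral>\<^sup>+z. ennreal (pmf \<nu> z) * emeasure (law1 \<omega> z) G \<partial>count_space UNIV)"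
  proof (rule nn_integral_cong)
    fix z
    show "emeasure (law \<omega> \<nu>) ({x. x 0 = z} \<inter> G) = ennreal (pmf \<nu> z) * emeasure (law1 \<omega> z) G"
      using markov_at[OF G, of \<omega> \<nu> 0 z] by (simp add: emeasure_law_0)
  qed
  also have "\<dots> = (\<integral>\<^sup>+z. emeasure (law1 \<omega> z) G \<partial>\<nu>)"
    by (simp add: nn_integral_measure_pmf)
  finally show ?thesis .
qed

lemma emeasure_quenched:
  assumes G: "G \<in> sets path_space"
  shows "emeasure (quenched p q r \<omega> m) G = (\<Sum>i\<in>UNIV. ennreal (pmf m i) * emeasure (law1 \<omega> (0, i)) G)"
proof -
  have "emeasure (quenched p q r \<omega> m) G = (\<integral>\<^sup>+i. emeasure (law1 \<omega> (0, i)) G \<partial>m)"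
    unfolding quenched_def by (subst emeasure_law_start[OF G], subst nn_integral_map_pmf) (rule refl)
  also have "\<dots> = (\<integral>\<^sup>+i. ennreal (pmf m i) * emeasure (law1 \<omega> (0, i)) G \<partial>count_space UNIV)"
    by (rule nn_integral_measure_pmf)
  also have "\<dots> = (\<Sum>i\<in>UNIV. ennreal (pmf m i) * emeasure (law1 \<omega> (0, i)) G)"
    by (rule nn_integral_count_space_finite) simp
  finally show ?thesis .
qed

lemma quenched_return: "quenched p q r \<omega> (return_pmf i) = law1 \<omega> (0, i)"
  by (simp add: quenched_def)

lemma emeasure_law_1: "emeasure (law \<omega> \<nu>) {x. x 1 = z} = (\<integral>\<^sup>+w. ennreal (pmf (jmp \<omega> w) z) \<partial>\<nu>)"
proof -
  have m: "{x. x 1 = z} \<in> sets (path_space :: 'd path measure)"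
  proof -
    have "{x \<in> space path_space. x 1 = z} \<in> sets (path_space :: 'd path measure)" by measurable
    then show ?thesis by simp
  qed
  have eq: "{x. x 0 = w} \<inter> {x. x 1 = z} = {x :: 'd path. \<forall>t\<le>1. x t = (if t = 0 then w else z)}" for w :: "'d state"
    by (auto simp: le_Suc_eq)
  have "emeasure (law \<omega> \<nu>) ({x. x 0 = w} \<inter> {x. x 1 = z}) = ennreal (pmf \<nu> w) * ennreal (pmf (jmp \<omega> w) z)" for w
    unfolding eq emeasure_walk_law by (simp add: ennreal_mult')
  then have "emeasure (law \<omega> \<nu>) {x. x 1 = z} =
      (\<integral>\<^sup>+w. ennreal (pmf \<nu> w) * ennreal (pmf (jmp \<omega> w) z) \<partial>count_space UNIV)"
    by (simp only: emeasure_law_partition[OF m, where t = 0])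
  also have "\<dots> = (\<integral>\<^sup>+w. ennreal (pmf (jmp \<omega> w) z) \<partial>\<nu>)"
    by (rule nn_integral_measure_pmf[symmetric])
  finally show ?thesis .
qed

lemma distr_law1_step: "distr (law1 \<omega> x) path_space (\<lambda>x t. x (Suc t)) = law \<omega> (jmp \<omega> x)"
proof (rule path_measure_eqI)
  have sh: "(\<lambda>x t. x (Suc t)) \<in> law1 \<omega> x \<rightarrow>\<^sub>M path_space"
    unfolding measurable_cong_sets[OF sets_walk_law refl] using measurable_path_shift[of 1] by simp
  show "finite_measure (distr (law1 \<omega> x) path_space (\<lambda>x t. x (Suc t)))"
    by (intro prob_space.finite_measure prob_space.prob_space_distr prob_space_walk_law sh)
  fix n and y :: "'d path"
  let ?G = "{x. \<forall>t\<le>n. x t = y t}"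
  have G: "?G \<in> sets path_space" by (rule sets_cylinder)
  have m: "{x. (\<lambda>s. x (Suc s)) \<in> ?G} \<in> sets path_space"
    using measurable_sets[OF measurable_path_shift[of 1] G] by (simp add: vimage_def)
  have "emeasure (distr (law1 \<omega> x) path_space (\<lambda>x t. x (Suc t))) ?G =
      emeasure (law1 \<omega> x) {x. (\<lambda>s. x (Suc s)) \<in> ?G}"
    by (subst emeasure_distr[OF sh G]) (simp add: vimage_def)
  also have "\<dots> = (\<integral>\<^sup>+z. emeasure (law1 \<omega> x) ({x. x 1 = z} \<inter> {x. (\<lambda>s. x (Suc s)) \<in> ?G}) \<partial>count_space UNIV)"
    by (rule emeasure_law_partition[OF m])
  also have "\<dots> = (\<integral>\<^sup>+z. ennreal (pmf (jmp \<omega> x) z) * emeasure (law1 \<omega> z) ?G \<partial>count_space UNIV)"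
  proof (rule nn_integral_cong)
    fix z
    show "emeasure (law1 \<omega> x) ({x. x 1 = z} \<inter> {x. (\<lambda>s. x (Suc s)) \<in> ?G}) =
       ennreal (pmf (jmp \<omega> x) z) * emeasure (law1 \<omega> z) ?G"
      using markov_at[OF G, of \<omega> "return_pmf x" 1 z] emeasure_law_1[of \<omega> "return_pmf x" z]
      by simp
  qed
  also have "\<dots> = emeasure (law \<omega> (jmp \<omega> x)) ?G"
    by (subst emeasure_law_start[OF G], subst nn_integral_measure_pmf) (rule refl)
  finally show "emeasure (distr (law1 \<omega> x) path_space (\<lambda>x t. x (Suc t))) ?G = emeasure (law \<omega> (jmp \<omega> x)) ?G" .
qed simp_all

lemma emeasure_law1_step:
  assumes G: "G \<in> sets path_space"
  shows "emeasure (law1 \<omega> x) {x. (\<lambda>t. x (Suc t)) \<in> G} = (\<integral>\<^sup>+z. emeasure (law1 \<omega> z) G \<partial>jmp \<omega> x)"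
proof -
  have sh: "(\<lambda>x t. x (Suc t)) \<in> law1 \<omega> x \<rightarrow>\<^sub>M path_space"
    unfolding measurable_cong_sets[OF sets_walk_law refl] using measurable_path_shift[of 1] by simp
  show ?thesis
    unfolding emeasure_law_start[OF G, symmetric] distr_law1_step[symmetric]
    by (subst emeasure_distr[OF sh G]) (simp add: vimage_def)
qed

lemma space_P: "space P = space (env_space S)"
  using rw sets_eq_imp_space_eq unfolding rwre_def by blast

lemma env_in_S: "\<omega> \<in> space P \<Longrightarrow> \<omega> n \<in> space S"
  by (auto simp: space_P space_PiM)

lemma pmf_jmp: "\<omega> \<in> space P \<Longrightarrow> pmf (jmp \<omega> x) z = jump_prob p q r \<omega> x z"
  using rw pmf_jump[of p \<omega> "fst x" q r "snd x" z] env_in_S[of \<omega> "fst x"] by (simp add: rwre_def)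

lemma shift_in_space: "\<omega> \<in> space P \<Longrightarrow> shift k \<omega> \<in> space P"
  by (auto simp: space_P space_PiM shift_def)

abbreviation recentre :: "int \<Rightarrow> 'd path \<Rightarrow> 'd path" where
  "recentre n x \<equiv> (\<lambda>t. (fst (x t) - n, snd (x t)))"

lemma measurable_recentre: "recentre n \<in> path_space \<rightarrow>\<^sub>M path_space"
  using measurable_path_map[where f = "\<lambda>z. (fst z - n, snd z)" and g = "\<lambda>t. t"] .

text \<open>Translation covariance: a jump from level k in \<omega> has the law of a jump from level
  k - n in the environment shifted by n.\<close>

lemma distr_law1_recentre:
  assumes \<omega>: "\<omega> \<in> space P"
  shows "distr (law1 \<omega> (n, i)) path_space (recentre n) = law1 (shift n \<omega>) (0, i)"
proof (rule path_measure_eqI)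
  have m: "recentre n \<in> law1 \<omega> (n, i) \<rightarrow>\<^sub>M path_space"
    unfolding measurable_cong_sets[OF sets_walk_law refl] by (rule measurable_recentre)
  show "finite_measure (distr (law1 \<omega> (n, i)) path_space (recentre n))"
    by (intro prob_space.finite_measure prob_space.prob_space_distr prob_space_walk_law m)
  fix t and y :: "'d path"
  let ?y = "\<lambda>t. (fst (y t) + n, snd (y t))"
  have "emeasure (distr (law1 \<omega> (n, i)) path_space (recentre n)) {x. \<forall>s\<le>t. x s = y s} =
      emeasure (law1 \<omega> (n, i)) {x. \<forall>s\<le>t. x s = ?y s}"
    by (subst emeasure_distr[OF m sets_cylinder])
       (auto intro!: arg_cong[where f = "emeasure _"] simp: prod_eq_iff algebra_simps)
  also have "\<dots> = emeasure (law1 (shift n \<omega>) (0, i)) {x. \<forall>s\<le>t. x s = y s}"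
  proof -
    have "pmf (jmp \<omega> (?y s)) (?y (Suc s)) = pmf (jmp (shift n \<omega>) (y s)) (y (Suc s))" for s
      unfolding pmf_jmp[OF \<omega>] pmf_jmp[OF shift_in_space[OF \<omega>]] unfolding jump_prob_def shift_def
      by (simp split: prod.splits)
    moreover have "pmf (return_pmf (n, i)) (?y 0) = pmf (return_pmf (0, i)) (y 0)"
      by (cases "y 0") (auto simp: indicator_def)
    ultimately show ?thesis by (simp only: emeasure_walk_law)
  qed
  finally show "emeasure (distr (law1 \<omega> (n, i)) path_space (recentre n)) {x. \<forall>s\<le>t. x s = y s} =
    emeasure (law1 (shift n \<omega>) (0, i)) {x. \<forall>s\<le>t. x s = y s}" .
qed simp_all

lemma emeasure_law1_recentre:
  assumes "\<omega> \<in> space P" and G: "G \<in> sets path_space"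
  shows "emeasure (law1 \<omega> (n, i)) {x. recentre n x \<in> G} = emeasure (law1 (shift n \<omega>) (0, i)) G"
proof -
  have m: "recentre n \<in> law1 \<omega> (n, i) \<rightarrow>\<^sub>M path_space"
    unfolding measurable_cong_sets[OF sets_walk_law refl] by (rule measurable_recentre)
  show ?thesis
    unfolding distr_law1_recentre[OF assms(1), symmetric]
    by (subst emeasure_distr[OF m G]) (simp add: vimage_def)
qed

section \<open>Hitting level one\<close>

definition hits :: "'d path \<Rightarrow> bool" where
  "hits x \<longleftrightarrow> (\<exists>t. fst (x t) = 1)"

text \<open>A natural number version of \<open>hit 1\<close>, left unspecified on paths that never
  reach level 1. It is therefore used together with \<open>hits\<close>; \<open>hit_eq\<close>
  states the relation to \<open>hit\<close>.\<close>

definition htime :: "'d path \<Rightarrow> nat" where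
  "htime x = (LEAST t. fst (x t) = 1)"

text \<open>The path from the first visit to level 1 on, recentred so as to start at level 0 again;
  it is a walk in the environment shifted by one.\<close>

definition after :: "'d path \<Rightarrow> 'd path" where
  "after x = recentre 1 (\<lambda>s. x (htime x + s))"

definition hitset :: "'d \<Rightarrow> 'd path set" where
  "hitset j = {x. hits x \<and> snd (x (htime x)) = j}"

lemma htime_level: "hits x \<Longrightarrow> fst (x (htime x)) = 1"
  unfolding hits_def htime_def by (rule LeastI_ex)

lemma htime_eqI: "fst (x t) = 1 \<Longrightarrow> (\<And>s. s < t \<Longrightarrow> fst (x s) \<noteq> 1) \<Longrightarrow> htime x = t"
  unfolding htime_def by (rule Least_equality) (auto simp: not_less[symmetric])

lemma not_hit_before_htime: "s < htime x \<Longrightarrow> fst (x s) \<noteq> 1"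
  unfolding htime_def by (rule not_less_Least)

lemma hit_eq: "hit 1 (x :: 'd path) = (if hits x then enat (htime x) else \<infinity>)"
proof (cases "hits x")
  case True
  have "hit 1 x = enat (htime x)"
    unfolding hit_def
  proof (rule antisym)
    show "(INF t\<in>{t. fst (x t) = 1}. enat t) \<le> enat (htime x)"
      by (rule INF_lower) (simp add: htime_level True)
    show "enat (htime x) \<le> (INF t\<in>{t. fst (x t) = 1}. enat t)"
      by (rule INF_greatest) (auto simp: htime_def intro: Least_le)
  qed
  then show ?thesis using True by simp
next
  case False
  then have "{t. fst (x t) = 1} = {}" by (auto simp: hits_def)
  then show ?thesis using False by (simp add: hit_def top_enat_def)
qed

lemma less_hit_iff: "enat n < hit 1 (x :: 'd path) \<longleftrightarrow> (\<forall>s\<le>n. fst (x s) \<noteq> 1)"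
proof
  assume n: "enat n < hit 1 x"
  show "\<forall>s\<le>n. fst (x s) \<noteq> 1"
  proof (intro allI impI)
    fix s assume "s \<le> n"
    then show "fst (x s) \<noteq> 1"
      using n not_hit_before_htime[of s x] by (auto simp: hit_eq hits_def split: if_splits)
  qed
next
  assume "\<forall>s\<le>n. fst (x s) \<noteq> 1"
  then show "enat n < hit 1 x"
    using htime_level[of x] by (auto simp: hit_eq not_le[symmetric])
qed

lemma hitset_eq: "hitset j = {x. hit 1 x < \<infinity> \<and> snd (x (the_enat (hit 1 x))) = j}"
  by (auto simp: hitset_def hit_eq)

lemma measurable_path_fst [measurable]:
  "(\<lambda>x :: 'd path. fst (x t)) \<in> path_space \<rightarrow>\<^sub>M count_space UNIV"
  by (rule measurable_compose[OF measurable_path_coord]) simp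

lemma measurable_path_snd [measurable]:
  "(\<lambda>x :: 'd path. snd (x t)) \<in> path_space \<rightarrow>\<^sub>M count_space UNIV"
  by (rule measurable_compose[OF measurable_path_coord]) simp

lemma measurable_hits [measurable]: "Measurable.pred path_space hits"
  unfolding hits_def by measurable

lemma measurable_htime [measurable]: "htime \<in> path_space \<rightarrow>\<^sub>M count_space UNIV"
  unfolding htime_def by measurable

lemma measurable_after [measurable]: "after \<in> path_space \<rightarrow>\<^sub>M path_space"
proof -
  have "(\<lambda>x. recentre 1 (\<lambda>s. x (t + s))) \<in> path_space \<rightarrow>\<^sub>M path_space" for t
    by (rule measurable_path_map[where f = "\<lambda>z. (fst z - 1, snd z)" and g = "\<lambda>s. t + s"])
  then have "(\<lambda>x. recentre 1 (\<lambda>s. x (htime x + s))) \<in> path_space \<rightarrow>\<^sub>M path_space"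
    by (rule measurable_compose_countable[where f = "\<lambda>t x. recentre 1 (\<lambda>s. x (t + s))"])
       (rule measurable_htime)
  then show ?thesis unfolding after_def .
qed

lemma sets_Collect_path:
  "Measurable.pred path_space Q \<Longrightarrow> {x. Q x} \<in> sets (path_space :: 'd path measure)"
  using measurable_sets[of Q path_space "count_space UNIV" "{True}"] by (simp add: vimage_def)

lemma sets_hits [measurable]: "{x. hits x} \<in> sets path_space"
  by (rule sets_Collect_path) measurable

lemma sets_hitset [measurable]: "hitset j \<in> sets path_space"
proof -
  have [measurable]: "(\<lambda>x. snd (x (htime x))) \<in> path_space \<rightarrow>\<^sub>M (count_space UNIV :: 'd measure)"
    by (rule measurable_compose_countable[where f = "\<lambda>t x. snd (x t)"])
       (rule measurable_path_snd measurable_htime)+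
  then have "Measurable.pred path_space (\<lambda>x. hits x \<and> snd (x (htime x)) = j)" by measurable
  then show ?thesis unfolding hitset_def by (rule sets_Collect_path)
qed

lemma hits_eq_UN_hitset: "{x. hits x} = (\<Union>j. hitset j)"
  by (auto simp: hitset_def)

text \<open>The event is split according to the value \<open>t\<close> of the hitting time. Each
  piece \<open>?E t\<close> is determined by the coordinates up to \<open>t\<close> and prescribes
  the state at \<open>t\<close>, so the Markov property at a fixed time applies; recentring then
  moves the environment.\<close>

lemma strong_markov:
  assumes \<omega>: "\<omega> \<in> space P" and G: "G \<in> sets path_space"
  shows "emeasure (law \<omega> \<nu>) {x \<in> hitset j. after x \<in> G} =
    emeasure (law \<omega> \<nu>) (hitset j) * emeasure (law1 (shift 1 \<omega>) (0, j)) G"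
proof -
  let ?E = "\<lambda>t. {x :: 'd path. x t = (1, j) \<and> (\<forall>s<t. fst (x s) \<noteq> 1)}"
  let ?G = "{x. recentre 1 x \<in> G}"
  have G': "?G \<in> sets path_space"
    using measurable_sets[OF measurable_recentre G, of 1] by (simp add: vimage_def)
  have E_set [measurable]: "?E t \<in> sets path_space" for t
    by (rule sets_Collect_path) measurable
  have sh [measurable]: "{x. (\<lambda>s. x (t + s)) \<in> ?G} \<in> sets path_space" for t
    using measurable_sets[OF measurable_path_shift[of t] G'] by (simp add: vimage_def)
  have t: "htime x = t" if "x \<in> ?E t" for x t
    using that by (intro htime_eqI) auto
  have mem: "x \<in> hitset j \<longleftrightarrow> (\<exists>t. x \<in> ?E t)" for x
  proof
    assume "x \<in> hitset j"
    then have "x \<in> ?E (htime x)"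
      using htime_level[of x] not_hit_before_htime[of _ x] by (auto simp: hitset_def prod_eq_iff)
    then show "\<exists>t. x \<in> ?E t" ..
  next
    assume "\<exists>t. x \<in> ?E t"
    then obtain t where tt: "x \<in> ?E t" ..
    then show "x \<in> hitset j" using t[OF tt] by (auto simp: hitset_def hits_def intro!: exI[of _ t])
  qed
  have un: "hitset j = (\<Union>t. ?E t)"
    using mem by blast
  have un': "{x \<in> hitset j. after x \<in> G} = (\<Union>t. ?E t \<inter> {x. (\<lambda>s. x (t + s)) \<in> ?G})"
  proof (intro set_eqI iffI)
    fix x assume x: "x \<in> {x \<in> hitset j. after x \<in> G}"
    then obtain t where tt: "x \<in> ?E t" using mem by blast
    then have "x \<in> ?E t \<inter> {x. (\<lambda>s. x (t + s)) \<in> ?G}"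
      using x t[OF tt] by (simp add: after_def)
    then show "x \<in> (\<Union>t. ?E t \<inter> {x. (\<lambda>s. x (t + s)) \<in> ?G})" by blast
  next
    fix x assume "x \<in> (\<Union>t. ?E t \<inter> {x. (\<lambda>s. x (t + s)) \<in> ?G})"
    then obtain t where tt: "x \<in> ?E t" and g: "(\<lambda>s. x (t + s)) \<in> ?G" by blast
    have "x \<in> hitset j" using tt mem by blast
    then show "x \<in> {x \<in> hitset j. after x \<in> G}"
      using g t[OF tt] by (simp add: after_def)
  qed
  have disj: "disjoint_family ?E"
    unfolding disjoint_family_on_def using t by blast
  have "emeasure (law \<omega> \<nu>) {x \<in> hitset j. after x \<in> G} =
      (\<Sum>t. emeasure (law \<omega> \<nu>) (?E t \<inter> {x. (\<lambda>s. x (t + s)) \<in> ?G}))"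
    unfolding un'
  proof (rule suminf_emeasure[symmetric])
    show "range (\<lambda>t. ?E t \<inter> {x. (\<lambda>s. x (t + s)) \<in> ?G}) \<subseteq> sets (law \<omega> \<nu>)"
      unfolding sets_walk_law using sets.Int[OF E_set sh] by blast
    show "disjoint_family (\<lambda>t. ?E t \<inter> {x. (\<lambda>s. x (t + s)) \<in> ?G})"
      using disj by (rule disjoint_family_subset) blast
  qed
  also have "\<dots> = (\<Sum>t. emeasure (law \<omega> \<nu>) (?E t) * emeasure (law1 (shift 1 \<omega>) (0, j)) G)"
  proof (rule suminf_cong)
    fix t
    have "emeasure (law \<omega> \<nu>) (?E t \<inter> {x. (\<lambda>s. x (t + s)) \<in> ?G}) =
        emeasure (law \<omega> \<nu>) (?E t) * emeasure (law1 \<omega> (1, j)) ?G"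
    proof (rule markov[OF _ _ G'])
      fix x x' :: "'d path" assume eq: "\<And>s. s \<le> t \<Longrightarrow> x s = x' s" and x: "x \<in> ?E t"
      have "x' t = (1, j)" using eq[of t] x by simp
      moreover have "fst (x' s) \<noteq> 1" if "s < t" for s
      proof -
        have "x' s = x s" using eq[of s] that by simp
        then show ?thesis using x that by simp
      qed
      ultimately show "x' \<in> ?E t" by simp
    qed simp
    then show "emeasure (law \<omega> \<nu>) (?E t \<inter> {x. (\<lambda>s. x (t + s)) \<in> ?G}) =
        emeasure (law \<omega> \<nu>) (?E t) * emeasure (law1 (shift 1 \<omega>) (0, j)) G"
      by (simp add: emeasure_law1_recentre[OF \<omega> G])
  qed
  also have "\<dots> = (\<Sum>t. emeasure (law \<omega> \<nu>) (?E t)) * emeasure (law1 (shift 1 \<omega>) (0, j)) G"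
    by (rule ennreal_suminf_multc)
  also have "(\<Sum>t. emeasure (law \<omega> \<nu>) (?E t)) = emeasure (law \<omega> \<nu>) (hitset j)"
    unfolding un
  proof (rule suminf_emeasure)
    show "range ?E \<subseteq> sets (law \<omega> \<nu>)"
      unfolding sets_walk_law using E_set by blast
  qed (rule disj)
  finally show ?thesis .
qed

lemma emeasure_after:
  assumes \<omega>: "\<omega> \<in> space P" and G: "G \<in> sets path_space"
  shows "emeasure (law \<omega> \<nu>) {x. hits x \<and> after x \<in> G} =
    (\<Sum>j\<in>UNIV. emeasure (law \<omega> \<nu>) (hitset j) * emeasure (law1 (shift 1 \<omega>) (0, j)) G)"
proof -
  have m: "{x \<in> hitset j. after x \<in> G} \<in> sets path_space" for j
  proof -
    have "{x. after x \<in> G} \<in> sets path_space"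
      using measurable_sets[OF measurable_after G] by (simp add: vimage_def)
    then have "hitset j \<inter> {x. after x \<in> G} \<in> sets path_space" by (intro sets.Int sets_hitset)
    then show ?thesis by (simp add: Int_def)
  qed
  have "{x. hits x \<and> after x \<in> G} = (\<Union>j. {x \<in> hitset j. after x \<in> G})"
    by (auto simp: hitset_def)
  then have "emeasure (law \<omega> \<nu>) {x. hits x \<and> after x \<in> G} =
      (\<Sum>j\<in>UNIV. emeasure (law \<omega> \<nu>) {x \<in> hitset j. after x \<in> G})"
    using m by (simp only:) (rule sum_emeasure[symmetric], auto simp: disjoint_family_on_def hitset_def)
  then show ?thesis by (simp only: strong_markov[OF \<omega> G])
qed

section \<open>The matrix of hitting probabilities\<close>

abbreviation et :: "'s env \<Rightarrow> 'd mat" where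
  "et \<omega> \<equiv> eta p q r 0 \<omega>"

lemma eta_eq: "eta p q r n \<omega> = et (shift n \<omega>)"
  by (simp add: eta_def)

lemma emeasure_hitset: "emeasure (law1 \<omega> (0, i)) (hitset j) = ennreal (et \<omega> $ i $ j)"
proof -
  interpret prob_space "law1 \<omega> (0, i)" by (rule prob_space_walk_law)
  show ?thesis
    by (simp add: eta_def quenched_return emeasure_eq_measure hitset_eq)
qed

lemma nonneg_et: "nonneg_matrix (et \<omega>)"
  by (simp add: nonneg_matrix_def eta_def)

lemma emeasure_hits: "emeasure (law1 \<omega> (0, i)) {x. hits x} = ennreal (\<Sum>j\<in>UNIV. et \<omega> $ i $ j)"
proof -
  have "emeasure (law1 \<omega> (0, i)) {x. hits x} = (\<Sum>j\<in>UNIV. emeasure (law1 \<omega> (0, i)) (hitset j))"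
    unfolding hits_eq_UN_hitset
    by (rule sum_emeasure[symmetric]) (auto simp: disjoint_family_on_def hitset_def intro: sets_hitset[unfolded hitset_def])
  also have "\<dots> = (\<Sum>j\<in>UNIV. ennreal (et \<omega> $ i $ j))" by (simp only: emeasure_hitset)
  also have "\<dots> = ennreal (\<Sum>j\<in>UNIV. et \<omega> $ i $ j)"
    using nonneg_et by (intro sum_ennreal) (auto simp: nonneg_matrix_def)
  finally show ?thesis .
qed

lemma et_row_sum_le_1: "(\<Sum>j\<in>UNIV. et \<omega> $ i $ j) \<le> 1"
proof -
  interpret prob_space "law1 \<omega> (0, i)" by (rule prob_space_walk_law)
  have "ennreal (\<Sum>j\<in>UNIV. et \<omega> $ i $ j) \<le> 1"
    using emeasure_le_1[of "{x. hits x}"] by (simp only: emeasure_hits)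
  then show ?thesis by simp
qed

lemma emeasure_quenched_hitset:
  "emeasure (quenched p q r \<omega> m) (hitset j) = ennreal (((\<chi> i. pmf m i) v* et \<omega>) $ j)"
proof -
  have "emeasure (quenched p q r \<omega> m) (hitset j) = (\<Sum>i\<in>UNIV. ennreal (pmf m i * et \<omega> $ i $ j))"
    by (subst emeasure_quenched[OF sets_hitset]) (simp only: emeasure_hitset ennreal_mult'[OF pmf_nonneg])
  also have "\<dots> = ennreal (\<Sum>i\<in>UNIV. pmf m i * et \<omega> $ i $ j)"
    using nonneg_et by (intro sum_ennreal) (auto simp: nonneg_matrix_def)
  finally show ?thesis by (simp add: vector_matrix_mult_def mult.commute)
qed

lemma const_past_laws: "(\<lambda>_. m) \<in> past_laws S"
  by (simp add: past_laws_def)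

lemma measurable_et: "(\<lambda>\<omega>. et \<omega> $ i $ j) \<in> borel_measurable P"
proof -
  note m = measurable_quenched[OF rw const_past_laws[of "return_pmf i"]]
  have [measurable]: "(\<lambda>\<omega>. emeasure (quenched p q r \<omega> (return_pmf i)) (hitset j)) \<in> borel_measurable P"
    by (rule measurable_compose[OF m measurable_emeasure_subprob_algebra[OF sets_hitset]])
  have "(\<lambda>\<omega>. enn2real (emeasure (quenched p q r \<omega> (return_pmf i)) (hitset j))) \<in> borel_measurable P"
    by measurable
  then have "(\<lambda>\<omega>. enn2real (ennreal (et \<omega> $ i $ j))) \<in> borel_measurable P"
    unfolding quenched_return emeasure_hitset .
  then show ?thesis
    using nonneg_et by (simp add: nonneg_matrix_def)
qed

section \<open>One step of the walk\<close>

lemma nonneg_pqr: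
  assumes "\<omega> \<in> space P"
  shows "0 \<le> p (\<omega> n) $ i $ j" "0 \<le> q (\<omega> n) $ i $ j" "0 \<le> r (\<omega> n) $ i $ j"
    "nonneg_matrix (p (\<omega> n))" "nonneg_matrix (q (\<omega> n))" "nonneg_matrix (r (\<omega> n))"
  using rw env_in_S[OF assms, of n] by (auto simp: rwre_def nonneg_matrix_def)

lemma row_sum_pqr:
  assumes "\<omega> \<in> space P"
  shows "(\<Sum>j\<in>UNIV. p (\<omega> n) $ i $ j) + (\<Sum>j\<in>UNIV. q (\<omega> n) $ i $ j) + (\<Sum>j\<in>UNIV. r (\<omega> n) $ i $ j) = 1"
  using rw env_in_S[OF assms, of n] by (simp add: rwre_def stochastic_def sum.distrib)

lemma nn_integral_jmp:
  fixes f :: "'d state \<Rightarrow> ennreal"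
  assumes \<omega>: "\<omega> \<in> space P"
  shows "(\<integral>\<^sup>+z. f z \<partial>jmp \<omega> (n, i)) =
    (\<Sum>j\<in>UNIV. ennreal (p (\<omega> n) $ i $ j) * f (n + 1, j) + ennreal (r (\<omega> n) $ i $ j) * f (n, j)
       + ennreal (q (\<omega> n) $ i $ j) * f (n - 1, j))"
proof -
  let ?A = "{n + 1, n, n - 1} \<times> (UNIV :: 'd set)"
  have "(\<integral>\<^sup>+z. f z \<partial>jmp \<omega> (n, i)) = (\<integral>\<^sup>+z. ennreal (jump_prob p q r \<omega> (n, i) z) * f z \<partial>count_space UNIV)"
    by (subst nn_integral_measure_pmf) (simp only: pmf_jmp[OF \<omega>])
  also have "\<dots> = (\<integral>\<^sup>+z. ennreal (jump_prob p q r \<omega> (n, i) z) * f z \<partial>count_space ?A)"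
    by (intro nn_integral_count_space_eq) (auto simp: jump_prob_def split: if_splits)
  also have "\<dots> = (\<Sum>z\<in>?A. ennreal (jump_prob p q r \<omega> (n, i) z) * f z)"
    by (intro nn_integral_count_space_finite) auto
  also have "\<dots> = (\<Sum>m\<in>{n + 1, n, n - 1}. \<Sum>j\<in>UNIV. ennreal (jump_prob p q r \<omega> (n, i) (m, j)) * f (m, j))"
    by (simp only: sum.cartesian_product) (simp add: split_def)
  also have "\<dots> = (\<Sum>j\<in>UNIV. ennreal (p (\<omega> n) $ i $ j) * f (n + 1, j)) +
      ((\<Sum>j\<in>UNIV. ennreal (r (\<omega> n) $ i $ j) * f (n, j)) + (\<Sum>j\<in>UNIV. ennreal (q (\<omega> n) $ i $ j) * f (n - 1, j)))"
    by (simp add: jump_prob_def)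
  finally show ?thesis by (simp add: sum.distrib add.assoc)
qed

text \<open>Hitting probabilities are the minimal nonnegative solution of the first-step equations.
  The matrix \<open>U m\<close> is a candidate for the hitting probabilities from level
  \<open>- m\<close>, and induction on \<open>t\<close> shows that it dominates the probability of
  hitting level 1 within \<open>t\<close> steps in phase \<open>j\<close>.\<close>

lemma et_le_harmonic:
  fixes Z :: "nat \<Rightarrow> 'd mat" and U :: "nat \<Rightarrow> 'd mat"
  assumes \<omega>: "\<omega> \<in> space P"
    and nn: "\<And>m. nonneg_matrix (U m)"
    and h0: "U 0 = p (\<omega> 0) + r (\<omega> 0) ** U 0 + q (\<omega> 0) ** U 1"
    and hS: "\<And>m. U (Suc m) = p (\<omega> (- int (Suc m))) ** U m + r (\<omega> (- int (Suc m))) ** U (Suc m)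
      + q (\<omega> (- int (Suc m))) ** U (Suc (Suc m))"
  shows "et \<omega> $ i $ j \<le> U 0 $ i $ j"
proof -
  let ?A = "\<lambda>t. {x :: 'd path. \<exists>s\<le>t. x s = (1, j) \<and> (\<forall>u<s. fst (x u) \<noteq> 1)}"
  have A_set [measurable]: "?A t \<in> sets path_space" for t
    by (rule sets_Collect_path) measurable
  \<comment> \<open>The boundary values: a walk started at level 1 hits it at once in its initial
    phase, so the identity matrix dominates.\<close>
  have level1: "emeasure (law1 \<omega> (1, i)) (?A t) \<le> (if i = j then 1 else 0)" for i t
  proof -
    interpret prob_space "law1 \<omega> (1, i)" by (rule prob_space_walk_law)
    show ?thesis
    proof (cases "i = j")
      case True
      then show ?thesis using emeasure_le_1 by auto
    next
      case False
      have "?A t \<subseteq> {x. x 0 = (1, j)} \<union> - {x. x 0 = (1, i)}"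
      proof
        fix x assume "x \<in> ?A t"
        then obtain s where s: "x s = (1, j)" "\<forall>u<s. fst (x u) \<noteq> 1" by auto
        show "x \<in> {x. x 0 = (1, j)} \<union> - {x. x 0 = (1, i)}"
        proof (cases "s = 0")
          case True
          then show ?thesis using s by simp
        next
          case False
          then have "fst (x 0) \<noteq> 1" using s by blast
          then show ?thesis by auto
        qed
      qed
      also have "\<dots> = - {x. x 0 = (1, i)}" using False by auto
      finally have "emeasure (law1 \<omega> (1, i)) (?A t) \<le> emeasure (law1 \<omega> (1, i)) (space (law1 \<omega> (1, i)) - {x. x 0 = (1, i)})"
        by (intro emeasure_mono) (auto intro!: sets.compl_sets sets.Diff sets_Collect_path simp: Compl_eq_Diff_UNIV)
      also have "\<dots> = 0"
      proof (subst emeasure_compl)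
        show "{x. x 0 = (1, i)} \<in> sets (law1 \<omega> (1, i))"
          unfolding sets_walk_law by (rule sets_Collect_path) measurable
      qed (simp_all add: emeasure_law_0 emeasure_space_1 del: space_walk_law)
      finally show ?thesis by simp
    qed
  qed
  \<comment> \<open>An upper bound is all that minimality uses; the null set \<open>?N\<close>
    absorbs the paths that do not start in \<open>(n, i)\<close>.\<close>
  have step: "emeasure (law1 \<omega> (n, i)) (?A (Suc t)) \<le> (\<integral>\<^sup>+z. emeasure (law1 \<omega> z) (?A t) \<partial>jmp \<omega> (n, i))"
    if "n \<noteq> 1" for n i t
  proof -
    let ?N = "- {x :: 'd path. x 0 = (n, i)}" and ?B = "{x. (\<lambda>s. x (Suc s)) \<in> ?A t}"
    interpret prob_space "law1 \<omega> (n, i)" by (rule prob_space_walk_law)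
    have B: "?B \<in> sets path_space"
      using measurable_sets[OF measurable_path_shift[of 1] A_set[of t]] by (simp add: vimage_def)
    have C: "{x :: 'd path. x 0 = (n, i)} \<in> sets path_space"
      by (rule sets_Collect_path) measurable
    then have N: "?N \<in> sets path_space"
      using sets.compl_sets[OF C] by (simp add: Compl_eq_Diff_UNIV)
    have N0: "emeasure (law1 \<omega> (n, i)) ?N = 0"
      using emeasure_compl[of "{x. x 0 = (n, i)}" "law1 \<omega> (n, i)"] C
      by (simp add: emeasure_law_0 Compl_eq_Diff_UNIV)
    have "?A (Suc t) \<subseteq> ?B \<union> ?N"
    proof
      fix x assume "x \<in> ?A (Suc t)"
      then obtain s where s: "s \<le> Suc t" "x s = (1, j)" "\<forall>u<s. fst (x u) \<noteq> 1" by auto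
      show "x \<in> ?B \<union> ?N"
      proof (cases s)
        case 0
        then show ?thesis using s \<open>n \<noteq> 1\<close> by auto
      next
        case (Suc s')
        then have "x \<in> ?B" using s by auto
        then show ?thesis by simp
      qed
    qed
    then have "emeasure (law1 \<omega> (n, i)) (?A (Suc t)) \<le> emeasure (law1 \<omega> (n, i)) (?B \<union> ?N)"
      using B N by (intro emeasure_mono) auto
    also have "\<dots> \<le> emeasure (law1 \<omega> (n, i)) ?B + emeasure (law1 \<omega> (n, i)) ?N"
      using B N by (intro emeasure_subadditive) auto
    finally show ?thesis by (simp only: N0 add_0_right emeasure_law1_step[OF A_set])
  qed
  have sum_eq: "(\<Sum>k\<in>UNIV. ennreal (A $ i $ k) * ennreal (B $ k $ j)) = ennreal ((A ** B) $ i $ j)"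
    if "nonneg_matrix A" "nonneg_matrix B" for A B :: "'d mat" and i
  proof -
    have "(\<Sum>k\<in>UNIV. ennreal (A $ i $ k) * ennreal (B $ k $ j)) = (\<Sum>k\<in>UNIV. ennreal (A $ i $ k * B $ k $ j))"
      using that by (intro sum.cong refl) (simp add: ennreal_mult nonneg_matrix_def)
    also have "\<dots> = ennreal (\<Sum>k\<in>UNIV. A $ i $ k * B $ k $ j)"
      using that by (intro sum_ennreal) (simp add: nonneg_matrix_def)
    finally show ?thesis by (simp add: matrix_matrix_mult_def)
  qed
  have bound: "emeasure (law1 \<omega> (- int m, i)) (?A t) \<le> ennreal (U m $ i $ j)" for m i t
  proof (induction t arbitrary: m i)
    case 0
    have "emeasure (law1 \<omega> (- int m, i)) (?A 0) = 0"
      by (simp add: emeasure_law_0)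
    then show ?case by simp
  next
    case (Suc t)
    let ?n = "- int m"
    have "emeasure (law1 \<omega> (?n, i)) (?A (Suc t)) \<le> (\<integral>\<^sup>+z. emeasure (law1 \<omega> z) (?A t) \<partial>jmp \<omega> (?n, i))"
      by (rule step) simp
    also have "\<dots> = (\<Sum>k\<in>UNIV. ennreal (p (\<omega> ?n) $ i $ k) * emeasure (law1 \<omega> (?n + 1, k)) (?A t)
        + ennreal (r (\<omega> ?n) $ i $ k) * emeasure (law1 \<omega> (?n, k)) (?A t)
        + ennreal (q (\<omega> ?n) $ i $ k) * emeasure (law1 \<omega> (?n - 1, k)) (?A t))"
      by (rule nn_integral_jmp[OF \<omega>])
    \<comment> \<open>The upper neighbour of level 0 is the boundary level 1, so for
      \<open>m = 0\<close> the matrix \<open>mat 1\<close> stands in the place of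
      \<open>U (m - 1)\<close>.\<close>
    also have "\<dots> \<le> (\<Sum>k\<in>UNIV. ennreal (p (\<omega> ?n) $ i $ k) * ennreal ((if m = 0 then mat 1 else U (m - 1)) $ k $ j)
        + ennreal (r (\<omega> ?n) $ i $ k) * ennreal (U m $ k $ j)
        + ennreal (q (\<omega> ?n) $ i $ k) * ennreal (U (Suc m) $ k $ j))"
    proof (intro sum_mono add_mono mult_left_mono)
      fix k
      show "emeasure (law1 \<omega> (?n + 1, k)) (?A t) \<le> ennreal ((if m = 0 then mat 1 else U (m - 1)) $ k $ j)"
      proof (cases m)
        case 0
        then show ?thesis using level1[of k t] by (auto simp: mat_def)
      next
        case (Suc m')
        then show ?thesis using Suc.IH[of m' k] by simp
      qed
      show "emeasure (law1 \<omega> (?n, k)) (?A t) \<le> ennreal (U m $ k $ j)" by (rule Suc.IH)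
      show "emeasure (law1 \<omega> (?n - 1, k)) (?A t) \<le> ennreal (U (Suc m) $ k $ j)"
      proof -
        have "?n - 1 = - int (Suc m)" by simp
        then show ?thesis using Suc.IH[of "Suc m" k] by (simp only:)
      qed
    qed simp_all
    also have "\<dots> = ennreal ((p (\<omega> ?n) ** (if m = 0 then mat 1 else U (m - 1))) $ i $ j
        + (r (\<omega> ?n) ** U m) $ i $ j + (q (\<omega> ?n) ** U (Suc m)) $ i $ j)"
    proof -
      let ?V = "if m = 0 then mat 1 else U (m - 1)"
      have V: "nonneg_matrix ?V" by (simp add: nn nonneg_mat_1)
      have pos: "0 \<le> (A ** B) $ i $ j" if "nonneg_matrix A" "nonneg_matrix B" for A B :: "'d mat"
        using nonneg_matrix_mult[OF that] by (simp add: nonneg_matrix_def)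
      note nn' = nonneg_pqr(4-6)[OF \<omega>]
      show ?thesis
        by (simp only: sum.distrib sum_eq nn' V nn ennreal_plus[symmetric] pos add_nonneg_nonneg)
    qed
    also have "\<dots> = ennreal (U m $ i $ j)"
    proof -
      have "U m = p (\<omega> ?n) ** (if m = 0 then mat 1 else U (m - 1)) + r (\<omega> ?n) ** U m + q (\<omega> ?n) ** U (Suc m)"
      proof (cases m)
        case 0
        show ?thesis
          unfolding 0 of_nat_0 minus_zero if_P[OF refl] matrix_mul_rid One_nat_def[symmetric] by (rule h0)
      next
        case (Suc m')
        show ?thesis
          unfolding Suc if_not_P[OF nat.distinct(2)] diff_Suc_1 by (rule hS)
      qed
      from arg_cong[OF this, of "\<lambda>A. A $ i $ j"] show ?thesis
        by (simp only: vector_add_component)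
    qed
    finally show ?case .
  qed
  have "hitset j = (\<Union>t. ?A t)"
  proof (intro set_eqI iffI)
    fix x assume "x \<in> hitset j"
    then have "x \<in> ?A (htime x)"
      using htime_level[of x] not_hit_before_htime[of _ x]
      by (auto simp: hitset_def prod_eq_iff intro!: exI[of _ "htime x"])
    then show "x \<in> (\<Union>t. ?A t)" by blast
  next
    fix x assume "x \<in> (\<Union>t. ?A t)"
    then obtain s where s: "x s = (1, j)" "\<forall>u<s. fst (x u) \<noteq> 1" by auto
    then have "htime x = s" by (intro htime_eqI) auto
    then show "x \<in> hitset j" using s by (auto simp: hitset_def hits_def intro!: exI[of _ s])
  qed
  then have "ennreal (et \<omega> $ i $ j) = emeasure (law1 \<omega> (0, i)) (\<Union>t. ?A t)"
    by (simp only: emeasure_hitset[symmetric])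
  also have "\<dots> = (SUP t. emeasure (law1 \<omega> (0, i)) (?A t))"
    by (rule SUP_emeasure_incseq[symmetric]) (auto simp: incseq_def intro: le_trans A_set)
  also have "\<dots> \<le> ennreal (U 0 $ i $ j)"
    using bound[of 0 i] by (intro SUP_least) simp
  finally show ?thesis
    using nn[of 0] by (simp add: nonneg_matrix_def)
qed

end

section \<open>Stationarity and ergodicity\<close>

text \<open>If every \<open>E N\<close> with positive \<open>N\<close> were nonnegative, the
  averages would converge to their infimum \<open>L\<close>, which is nonnegative (Fekete).
  Convergence has to be established for the contradiction, because \<open>lim\<close> says nothing
  about a sequence without a limit. The constant \<open>C\<close> bounds the contribution of the
  remainder modulo \<open>N\<close>.\<close>

lemma subadditive_exists_negative:
  fixes E :: "nat \<Rightarrow> real"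
  assumes sub: "\<And>m n. E (m + n) \<le> E m + E n"
    and lim: "lim (\<lambda>n. 1 / real n * E n) < 0"
  shows "\<exists>N>0. E N < 0"
proof (rule ccontr)
  assume neg: "\<not> ?thesis"
  have nn: "0 \<le> E n" if "n > 0" for n using neg that not_less by blast
  have E0: "0 \<le> E 0" using sub[of 0 0] by simp
  then have nn: "0 \<le> E n" for n using nn by (cases n) auto
  have mult: "E (k * N + s) \<le> real k * E N + E s" for k N s
  proof (induction k)
    case (Suc k)
    have "E (Suc k * N + s) \<le> E N + E (k * N + s)" using sub[of N "k * N + s"] by (simp add: add.assoc)
    then show ?case using Suc by (simp add: algebra_simps)
  qed simp
  define L where "L = (INF n\<in>{1..}. E n / real n)"
  have bdd: "bdd_below ((\<lambda>n. E n / real n) ` {1..})"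
    using nn by (intro bdd_belowI[of _ 0]) auto
  have L_le: "L \<le> E n / real n" if "n > 0" for n
    unfolding L_def by (rule cINF_lower[OF bdd]) (use that in auto)
  have L0: "0 \<le> L"
    unfolding L_def using nn by (intro cINF_greatest) auto
  have "(\<lambda>n. E n / real n) \<longlonglongrightarrow> L"
  proof (rule LIMSEQ_I)
    fix e :: real assume e: "e > 0"
    have "\<exists>N\<in>{1..}. E N / real N < L + e / 2"
      using e cINF_less_iff[OF _ bdd, of "L + e / 2"] unfolding L_def by auto
    then obtain N where "N \<in> {1..}" and N2: "E N / real N < L + e / 2" by blast
    then have N: "N > 0" "E N / real N < L + e / 2" by auto
    define C where "C = (\<Sum>s<N. E s)"
    have C: "E s \<le> C" if "s < N" for s
      unfolding C_def using that nn by (intro member_le_sum) auto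
    have bound: "E n / real n \<le> E N / real N + C / real n" if n: "n > 0" for n
    proof -
      have "E n \<le> real (n div N) * E N + E (n mod N)"
        using mult[of "n div N" N "n mod N"] by simp
      also have "\<dots> \<le> real (n div N) * E N + C" using C[of "n mod N"] N by simp
      finally have "E n / real n \<le> (real (n div N) * E N + C) / real n"
        by (rule divide_right_mono) simp
      also have "\<dots> = real (n div N) / real n * E N + C / real n" by (simp add: add_divide_distrib)
      also have "real (n div N) / real n * E N \<le> 1 / real N * E N"
      proof (rule mult_right_mono[OF _ nn])
        have "real (n div N) * real N \<le> real n"
          by (metis div_times_less_eq_dividend of_nat_le_iff of_nat_mult)
        then show "real (n div N) / real n \<le> 1 / real N"
          using n N by (simp add: field_simps)
      qed
      finally show ?thesis by simp
    qed
    obtain n0 :: nat where n0: "real n0 > 2 * \<bar>C\<bar> / e" using reals_Archimedean2 by blast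
    show "\<exists>no. \<forall>n\<ge>no. norm (E n / real n - L) < e"
    proof (intro exI allI impI)
      fix n assume n: "Suc n0 \<le> n"
      then have "n > 0" by simp
      have "2 * \<bar>C\<bar> / e < real n" using n0 n by linarith
      then have "2 * \<bar>C\<bar> < e * real n" using e by (simp add: field_simps)
      then have "C / real n < e / 2" using \<open>n > 0\<close> by (simp add: field_simps)
      then have "E n / real n < L + e" using bound[OF \<open>n > 0\<close>] N by linarith
      then show "norm (E n / real n - L) < e" using L_le[OF \<open>n > 0\<close>] by simp
    qed
  qed
  then have "lim (\<lambda>n. 1 / real n * E n) = L" by (intro limI) simp
  with lim L0 show False by simp
qed

text \<open>No integrability of \<tau> is assumed, so \<tau> is truncated at \<open>K\<close>. By
  invariance the truncated mean is the mean of an average of truncations, which is at most the mean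
  of the truncated average \<open>?A n\<close>; bounded convergence sends this to
  \<open>min K L\<close>. Monotone convergence then removes the truncation.\<close>

lemma expectation_le_limit_of_averages:
  fixes \<tau> :: "'a \<Rightarrow> real"
  assumes M: "prob_space M" and T [measurable]: "T \<in> M \<rightarrow>\<^sub>M M" and inv: "distr M M T = M"
    and \<tau> [measurable]: "\<tau> \<in> borel_measurable M" and nn: "\<And>x. 0 \<le> \<tau> x"
    and lim: "AE x in M. (\<lambda>n. (\<Sum>k<n. \<tau> ((T ^^ k) x)) / real n) \<longlonglongrightarrow> L"
  shows "(\<integral>\<^sup>+x. ennreal (\<tau> x) \<partial>M) \<le> ennreal L"
proof -
  interpret prob_space M by fact
  have Tk [measurable]: "T ^^ k \<in> M \<rightarrow>\<^sub>M M" for k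
    by (induction k) (auto simp: id_def comp_def intro: measurable_compose)
  have inv_k: "distr M M (T ^^ k) = M" for k
  proof (induction k)
    case 0
    then show ?case by (simp add: id_def)
  next
    case (Suc k)
    have "distr M M (T ^^ Suc k) = distr (distr M M (T ^^ k)) M T"
      by (subst distr_distr) (auto simp: comp_def)
    then show ?case by (simp only: Suc inv)
  qed
  have trunc: "(\<integral>x. min (\<tau> x) (real K) \<partial>M) \<le> L" for K
  proof -
    let ?t = "\<lambda>x. min (\<tau> x) (real K)"
    let ?A = "\<lambda>n x. min (real K) ((\<Sum>k<n. \<tau> ((T ^^ k) x)) / real n)"
    have int: "integrable M (\<lambda>x. ?t ((T ^^ k) x))" for k
      using nn by (intro integrable_const_bound[where B = "real K"]) (auto simp: abs_of_nonneg)
    have eq: "(\<integral>x. ?t ((T ^^ k) x) \<partial>M) = (\<integral>x. ?t x \<partial>M)" for k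
    proof -
      have "(\<integral>x. ?t x \<partial>M) = (\<integral>x. ?t x \<partial>distr M M (T ^^ k))" by (simp only: inv_k)
      also have "\<dots> = (\<integral>x. ?t ((T ^^ k) x) \<partial>M)" by (rule integral_distr) measurable
      finally show ?thesis by simp
    qed
    have le: "(\<integral>x. ?t x \<partial>M) \<le> (\<integral>x. ?A n x \<partial>M)" if n: "n > 0" for n
    proof -
      have "(\<integral>x. ?t x \<partial>M) = (\<integral>x. (\<Sum>k<n. ?t ((T ^^ k) x)) / real n \<partial>M)"
        using n by (simp add: int eq)
      also have "\<dots> \<le> (\<integral>x. ?A n x \<partial>M)"
      proof (rule integral_mono)
        show "integrable M (\<lambda>x. (\<Sum>k<n. ?t ((T ^^ k) x)) / real n)"
          using int by simp
        show "integrable M (?A n)"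
          using nn by (intro integrable_const_bound[where B = "real K"]) (auto simp: abs_of_nonneg sum_nonneg divide_nonneg_nonneg)
        fix x
        have "(\<Sum>k<n. ?t ((T ^^ k) x)) \<le> (\<Sum>k<n. real K)" by (intro sum_mono) simp
        moreover have "(\<Sum>k<n. ?t ((T ^^ k) x)) \<le> (\<Sum>k<n. \<tau> ((T ^^ k) x))" by (intro sum_mono) simp
        ultimately show "(\<Sum>k<n. ?t ((T ^^ k) x)) / real n \<le> ?A n x"
          using n by (simp add: field_simps divide_right_mono)
      qed
      finally show ?thesis .
    qed
    have "(\<lambda>n. \<integral>x. ?A n x \<partial>M) \<longlonglongrightarrow> (\<integral>x. min (real K) L \<partial>M)"
    proof (rule integral_dominated_convergence[where w = "\<lambda>_. real K"])
      show "AE x in M. (\<lambda>n. ?A n x) \<longlonglongrightarrow> min (real K) L"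
        using lim by eventually_elim (intro tendsto_min tendsto_const)
      show "AE x in M. norm (?A n x) \<le> real K" for n
        using nn by (auto simp: abs_of_nonneg sum_nonneg divide_nonneg_nonneg)
    qed auto
    then have "(\<integral>x. ?t x \<partial>M) \<le> (\<integral>x. min (real K) L \<partial>M)"
      by (rule LIMSEQ_le_const) (use le in \<open>auto intro!: exI[of _ 1]\<close>)
    then show ?thesis by (simp add: prob_space)
  qed
  have "(\<integral>\<^sup>+x. ennreal (\<tau> x) \<partial>M) = (\<integral>\<^sup>+x. (SUP K. ennreal (min (\<tau> x) (real K))) \<partial>M)"
  proof (rule nn_integral_cong)
    fix x
    obtain K0 :: nat where K0: "\<tau> x \<le> real K0" using real_arch_simple by blast
    show "ennreal (\<tau> x) = (SUP K. ennreal (min (\<tau> x) (real K)))"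
    proof (rule antisym)
      show "ennreal (\<tau> x) \<le> (SUP K. ennreal (min (\<tau> x) (real K)))"
        by (rule SUP_upper2[of K0]) (use K0 in \<open>auto simp: min_def\<close>)
    qed (auto intro!: SUP_least ennreal_leI)
  qed
  also have "\<dots> = (SUP K. \<integral>\<^sup>+x. ennreal (min (\<tau> x) (real K)) \<partial>M)"
    by (rule nn_integral_monotone_convergence_SUP) (auto simp: incseq_def le_fun_def intro!: ennreal_leI min.mono)
  also have "\<dots> \<le> ennreal L"
  proof (rule SUP_least)
    fix K
    have "(\<integral>\<^sup>+x. ennreal (min (\<tau> x) (real K)) \<partial>M) = ennreal (\<integral>x. min (\<tau> x) (real K) \<partial>M)"
      using nn by (intro nn_integral_eq_integral integrable_const_bound[where B = "real K"]) (auto simp: abs_of_nonneg)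
    then show "(\<integral>\<^sup>+x. ennreal (min (\<tau> x) (real K)) \<partial>M) \<le> ennreal L"
      using trunc[of K] by (simp add: ennreal_leI)
  qed
  finally show ?thesis .
qed

locale ergodic_strip = strip S P p q r
  for S :: "'s measure" and P :: "'s env measure" and p q r :: "'s \<Rightarrow> ('d::finite) mat" +
  assumes erg: "stationary_ergodic P"
begin

sublocale P: prob_space P
  using rw by (simp add: rwre_def)

lemma sets_P: "sets P = sets (env_space S)"
  using rw by (simp add: rwre_def)

lemma measurable_env_coord [measurable]: "(\<lambda>\<omega>. \<omega> n) \<in> P \<rightarrow>\<^sub>M S"
  unfolding measurable_cong_sets[OF sets_P refl] by measurable

lemma measurable_shift [measurable]: "shift k \<in> P \<rightarrow>\<^sub>M P"
  unfolding measurable_cong_sets[OF sets_P sets_P] shift_def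
  by (rule measurable_PiM_single') (auto simp: space_PiM)

lemma distr_shift_add:
  "distr P P (shift (k + l)) = distr (distr P P (shift l)) P (shift k)"
  by (subst distr_distr) (auto simp: comp_def shift_shift)

text \<open>Stationarity is assumed for the unit shift; positive powers follow by iteration and
  negative ones by invertibility of the shift.\<close>

lemma distr_shift: "distr P P (shift k) = P"
proof -
  have d1: "distr P P (shift 1) = P" using erg by (simp add: stationary_ergodic_def)
  have "shift 0 = (\<lambda>\<omega> :: 's env. \<omega>)" by (simp add: shift_def fun_eq_iff)
  then have d0: "distr P P (shift 0) = P" by (simp add: distr_id)
  have pos: "distr P P (shift (int n)) = P" for n
  proof (induction n)
    case (Suc n)
    then show ?case using distr_shift_add[of 1 "int n"] d1 by simp
  qed (simp add: d0)
  have neg: "distr P P (shift (- int n)) = P" for n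
    using distr_shift_add[of "- int n" "int n"] d0 pos[of n] by simp
  show ?thesis using pos[of "nat k"] neg[of "nat (- k)"] by (cases "k \<ge> 0") auto
qed

lemma AE_shift:
  assumes "AE \<omega> in P. Q \<omega>"
  shows "AE \<omega> in P. Q (shift k \<omega>)"
proof -
  have "AE \<omega> in distr P P (shift k). Q \<omega>" unfolding distr_shift by (rule assms)
  then show ?thesis by (rule AE_distrD[OF measurable_shift])
qed

lemma AE_shift_all: "AE \<omega> in P. Q \<omega> \<Longrightarrow> AE \<omega> in P. \<forall>k. Q (shift k \<omega>)"
  by (simp add: AE_all_countable AE_shift)

lemma nn_integral_shift:
  "f \<in> borel_measurable P \<Longrightarrow> (\<integral>\<^sup>+\<omega>. f (shift k \<omega>) \<partial>P) = (\<integral>\<^sup>+\<omega>. f \<omega> \<partial>P)"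
  using nn_integral_distr[OF measurable_shift[of k], of f] by (simp add: distr_shift)

lemma integral_shift:
  fixes f :: "'s env \<Rightarrow> real"
  shows "f \<in> borel_measurable P \<Longrightarrow> (\<integral>\<omega>. f (shift k \<omega>) \<partial>P) = (\<integral>\<omega>. f \<omega> \<partial>P)"
  using integral_distr[OF measurable_shift[of k], of f] by (simp add: distr_shift)

lemma integrable_shift:
  fixes f :: "'s env \<Rightarrow> real"
  assumes "integrable P f"
  shows "integrable P (\<lambda>\<omega>. f (shift k \<omega>))"
proof -
  have "integrable (distr P P (shift k)) f" using assms by (simp add: distr_shift)
  then show ?thesis by (subst (asm) integrable_distr_eq) (use assms in auto)
qed

text \<open>Ergodicity is stated for strictly invariant events. The event \<open>?A\<close> that all
  sufficiently late shifts lie in \<open>A\<close> is strictly invariant, and it agrees with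
  \<open>A\<close> almost surely.\<close>

lemma invariant_event:
  assumes A [measurable]: "A \<in> sets P" and inv: "AE \<omega> in P. shift 1 \<omega> \<in> A \<longleftrightarrow> \<omega> \<in> A"
  shows "measure P A = 0 \<or> measure P A = 1"
proof -
  let ?A = "{\<omega> \<in> space P. \<exists>N. \<forall>n\<ge>N. shift (int n) \<omega> \<in> A}"
  have pr [measurable]: "Measurable.pred P (\<lambda>\<omega>. shift k \<omega> \<in> A)" for k
    by measurable
  have meas: "?A \<in> sets P" by measurable
  have "shift 1 -` ?A \<inter> space P = ?A"
  proof (intro set_eqI iffI)
    fix \<omega> assume "\<omega> \<in> shift 1 -` ?A \<inter> space P"
    then obtain N where sp: "\<omega> \<in> space P" and N: "\<And>n. n \<ge> N \<Longrightarrow> shift (int n + 1) \<omega> \<in> A"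
      by (auto simp: shift_shift)
    have "shift (int n) \<omega> \<in> A" if "n \<ge> Suc N" for n
      using N[of "n - 1"] that by (simp add: of_nat_diff)
    with sp show "\<omega> \<in> ?A" by auto
  next
    fix \<omega> assume "\<omega> \<in> ?A"
    then obtain N where sp: "\<omega> \<in> space P" and N: "\<And>n. n \<ge> N \<Longrightarrow> shift (int n) \<omega> \<in> A"
      by auto
    have "shift (int n + 1) \<omega> \<in> A" if "n \<ge> N" for n
      using N[of "Suc n"] that by (simp add: add.commute)
    with sp show "\<omega> \<in> shift 1 -` ?A \<inter> space P"
      by (auto simp: shift_shift shift_in_space)
  qed
  then have "measure P ?A = 0 \<or> measure P ?A = 1"
    using erg meas by (auto simp: stationary_ergodic_def)
  moreover have "measure P ?A = measure P A"
  proof (rule P.finite_measure_eq_AE)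
    show "AE \<omega> in P. (\<omega> \<in> ?A) = (\<omega> \<in> A)"
      using AE_shift_all[OF inv] AE_space
    proof eventually_elim
      case (elim \<omega>)
      have "shift (int n) \<omega> \<in> A \<longleftrightarrow> \<omega> \<in> A" for n
      proof (induction n)
        case (Suc n)
        then show ?case using elim(1)[rule_format, of "int n"] by (simp add: shift_shift)
      qed (simp add: shift_def)
      then show ?case using elim(2) by auto
    qed
  qed (use meas in auto)
  ultimately show ?thesis by simp
qed

text \<open>The preimage of \<open>A\<close> is almost surely contained in \<open>A\<close> and has
  the same probability by stationarity, so the two differ by a null set.\<close>

lemma backward_invariant_event:
  assumes A [measurable]: "A \<in> sets P" and inv: "AE \<omega> in P. shift 1 \<omega> \<in> A \<longrightarrow> \<omega> \<in> A"
  shows "measure P A = 0 \<or> measure P A = 1"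
proof (rule invariant_event[OF A])
  let ?B = "shift 1 -` A \<inter> space P"
  have B [measurable]: "?B \<in> sets P" by measurable
  have "emeasure P ?B = emeasure (distr P P (shift 1)) A"
    by (rule emeasure_distr[symmetric]) measurable
  then have eq: "measure P ?B = measure P A" by (simp add: distr_shift measure_def)
  have sub: "measure P (A \<inter> ?B) = measure P ?B"
    by (rule P.finite_measure_eq_AE) (use inv in auto)
  have "measure P (A - ?B) = 0"
    using P.finite_measure_Diff'[of A ?B] by (simp add: sub eq)
  then have "A - ?B \<in> null_sets P" by (simp add: P.emeasure_eq_measure null_sets_def)
  then have "AE \<omega> in P. \<omega> \<notin> A - ?B" by (rule AE_not_in)
  with inv AE_space show "AE \<omega> in P. shift 1 \<omega> \<in> A \<longleftrightarrow> \<omega> \<in> A"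
    by eventually_elim auto
qed

text \<open>The event that an invariant function exceeds its mean has probability 0 or 1, and
  probability 1 would make the mean exceed itself. The same argument for the negative gives the
  other inequality.\<close>

lemma invariant_function:
  fixes c :: "'s env \<Rightarrow> real"
  assumes int: "integrable P c" and inv: "AE \<omega> in P. c (shift 1 \<omega>) = c \<omega>"
  shows "AE \<omega> in P. c \<omega> = (\<integral>\<omega>. c \<omega> \<partial>P)"
proof -
  have le: "AE \<omega> in P. f \<omega> \<le> (\<integral>\<omega>. f \<omega> \<partial>P)"
    if f: "integrable P f" "AE \<omega> in P. f (shift 1 \<omega>) = f \<omega>" for f :: "'s env \<Rightarrow> real"
  proof -
    note [measurable] = borel_measurable_integrable[OF f(1)]
    let ?k = "\<integral>\<omega>. f \<omega> \<partial>P"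
    let ?A = "{\<omega> \<in> space P. ?k < f \<omega>}"
    have A: "?A \<in> sets P" by measurable
    have "AE \<omega> in P. shift 1 \<omega> \<in> ?A \<longleftrightarrow> \<omega> \<in> ?A"
      using f(2) AE_space by eventually_elim (auto simp: shift_in_space)
    then have "measure P ?A = 0 \<or> measure P ?A = 1" by (rule invariant_event[OF A])
    moreover have "measure P ?A \<noteq> 1"
    proof
      assume "measure P ?A = 1"
      then have "AE \<omega> in P. \<omega> \<in> ?A" by (rule P.AE_prob_1)
      then have ae: "AE \<omega> in P. ?k < f \<omega>" by eventually_elim simp
      have "?k = (\<integral>\<omega>. ?k \<partial>P)" by (simp add: P.prob_space)
      also have "\<dots> < (\<integral>\<omega>. f \<omega> \<partial>P)"
      proof (rule P.integral_less_AE_space)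
        show "emeasure P (space P) \<noteq> 0" by (simp add: P.emeasure_space_1)
      qed (use f ae in auto)
      finally show False by simp
    qed
    ultimately have "measure P ?A = 0" by simp
    then have "?A \<in> null_sets P" using A by (simp add: P.emeasure_eq_measure null_sets_def)
    from AE_not_in[OF this] AE_space show ?thesis by eventually_elim auto
  qed
  from le[OF int inv] le[of "\<lambda>\<omega>. - c \<omega>"] int inv
  have "AE \<omega> in P. c \<omega> \<le> (\<integral>\<omega>. c \<omega> \<partial>P)" "AE \<omega> in P. - c \<omega> \<le> - (\<integral>\<omega>. c \<omega> \<partial>P)" by auto
  then show ?thesis by eventually_elim auto
qed

text \<open>The function \<open>f\<close> is merely measurable, so the difference of
  \<open>f\<close> and its shift cannot be integrated directly. Truncation at level \<open>M\<close>
  is monotone and 1-Lipschitz and makes the means of the two terms cancel; Fatou's lemma recovers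
  the untruncated inequality.\<close>

lemma coboundary_bound:
  fixes f g :: "'s env \<Rightarrow> real"
  assumes f [measurable]: "f \<in> borel_measurable P" and g: "integrable P g"
    and le: "AE \<omega> in P. f \<omega> \<le> f (shift k \<omega>) + g \<omega>"
  shows "0 \<le> (\<integral>\<omega>. g \<omega> \<partial>P)"
proof -
  note [measurable] = borel_measurable_integrable[OF g]
  define c where "c M x = max (- real M) (min (real M) x)" for M x
  have [measurable]: "(\<lambda>\<omega>. c M (f \<omega>)) \<in> borel_measurable P" for M
    unfolding c_def by measurable
  have fs [measurable]: "(\<lambda>\<omega>. f (shift k \<omega>)) \<in> borel_measurable P"
    by (rule measurable_compose[OF measurable_shift f])
  have [measurable]: "(\<lambda>\<omega>. c M (f (shift k \<omega>))) \<in> borel_measurable P" for M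
    unfolding c_def by measurable
  have ci: "integrable P (\<lambda>\<omega>. c M (f \<omega>))" for M
    by (rule P.integrable_const_bound[where B = "real M"]) (auto simp: c_def)
  have cs: "integrable P (\<lambda>\<omega>. c M (f (shift k \<omega>)))" for M
    by (rule integrable_shift[OF ci])
  \<comment> \<open>Adding the absolute value of \<open>g\<close> makes the truncated increments
    nonnegative, as Fatou's lemma requires, and keeps their integrals independent of
    \<open>M\<close>.\<close>
  let ?h = "\<lambda>M \<omega>. c M (f (shift k \<omega>)) - c M (f \<omega>) + \<bar>g \<omega>\<bar>"
  have h_nn: "AE \<omega> in P. \<forall>M. 0 \<le> ?h M \<omega>"
    using le by eventually_elim (auto simp: c_def max_def min_def abs_if)
  have h_int: "(\<integral>\<^sup>+\<omega>. ennreal (?h M \<omega>) \<partial>P) = ennreal (\<integral>\<omega>. \<bar>g \<omega>\<bar> \<partial>P)" for M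
  proof -
    have "(\<integral>\<^sup>+\<omega>. ennreal (?h M \<omega>) \<partial>P) = ennreal (\<integral>\<omega>. ?h M \<omega> \<partial>P)"
      using h_nn ci cs g by (intro nn_integral_eq_integral) auto
    also have "(\<integral>\<omega>. ?h M \<omega> \<partial>P) = (\<integral>\<omega>. \<bar>g \<omega>\<bar> \<partial>P)"
      using ci cs g integral_shift[of "\<lambda>\<omega>. c M (f \<omega>)" k] by simp
    finally show ?thesis .
  qed
  have "(\<integral>\<^sup>+\<omega>. ennreal (\<bar>g \<omega>\<bar> - g \<omega>) \<partial>P) \<le> (\<integral>\<^sup>+\<omega>. liminf (\<lambda>M. ennreal (?h M \<omega>)) \<partial>P)"
  proof (rule nn_integral_mono_AE)
    show "AE \<omega> in P. ennreal (\<bar>g \<omega>\<bar> - g \<omega>) \<le> liminf (\<lambda>M. ennreal (?h M \<omega>))"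
      using le
    proof eventually_elim
      case (elim \<omega>)
      obtain M0 :: nat where M0: "\<bar>f \<omega>\<bar> + \<bar>f (shift k \<omega>)\<bar> \<le> real M0" using real_arch_simple by blast
      have "eventually (\<lambda>M. ennreal (\<bar>g \<omega>\<bar> - g \<omega>) \<le> ennreal (?h M \<omega>)) sequentially"
        using eventually_ge_at_top[of M0]
      proof eventually_elim
        case (elim M)
        then have "real M0 \<le> real M" by simp
        then have "\<bar>f \<omega>\<bar> \<le> real M" "\<bar>f (shift k \<omega>)\<bar> \<le> real M"
          using M0 by linarith+
        then have "c M (f \<omega>) = f \<omega>" "c M (f (shift k \<omega>)) = f (shift k \<omega>)"
          by (auto simp: c_def max_def min_def)
        then show ?case using \<open>f \<omega> \<le> f (shift k \<omega>) + g \<omega>\<close> by (intro ennreal_leI) simp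
      qed
      then show ?case by (rule Liminf_bounded)
    qed
  qed
  also have "\<dots> \<le> liminf (\<lambda>M. \<integral>\<^sup>+\<omega>. ennreal (?h M \<omega>) \<partial>P)"
    by (rule nn_integral_liminf) measurable
  also have "\<dots> = ennreal (\<integral>\<omega>. \<bar>g \<omega>\<bar> \<partial>P)"
    unfolding h_int by (simp add: Liminf_const)
  also have "(\<integral>\<^sup>+\<omega>. ennreal (\<bar>g \<omega>\<bar> - g \<omega>) \<partial>P) = ennreal (\<integral>\<omega>. \<bar>g \<omega>\<bar> - g \<omega> \<partial>P)"
    using g by (intro nn_integral_eq_integral) auto
  finally have "(\<integral>\<omega>. \<bar>g \<omega>\<bar> - g \<omega> \<partial>P) \<le> (\<integral>\<omega>. \<bar>g \<omega>\<bar> \<partial>P)"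
    by (simp add: ennreal_le_iff)
  then show ?thesis using g by simp
qed

text \<open>The factors \<open>f (shift (k l) \<omega>)\<close> need not converge, but they all have
  the law of \<open>f\<close> and are thus uniformly integrable. Splitting \<open>f\<close> into a
  part of size at most \<open>M\<close> and the excess \<open>?e M\<close> allows l to tend to
  infinity for fixed \<open>M\<close>, and then \<open>M\<close> to tend to infinity.\<close>

lemma vanishing_by_stationarity:
  fixes X f :: "'s env \<Rightarrow> real" and d :: "nat \<Rightarrow> 's env \<Rightarrow> real"
  assumes X [measurable]: "X \<in> borel_measurable P" and X0: "\<And>\<omega>. 0 \<le> X \<omega>"
    and f: "integrable P f" and f0: "\<And>\<omega>. 0 \<le> f \<omega>"
    and d [measurable]: "\<And>l. d l \<in> borel_measurable P" and d0: "\<And>l \<omega>. 0 \<le> d l \<omega>"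
    and dB: "\<And>l. AE \<omega> in P. d l \<omega> \<le> B"
    and lim: "AE \<omega> in P. (\<lambda>l. d l \<omega>) \<longlonglongrightarrow> 0"
    and le: "\<And>l. AE \<omega> in P. X \<omega> \<le> f (shift (k l) \<omega>) * d l \<omega>"
  shows "AE \<omega> in P. X \<omega> = 0"
proof -
  note [measurable] = borel_measurable_integrable[OF f]
  have fs [measurable]: "(\<lambda>\<omega>. f (shift m \<omega>)) \<in> borel_measurable P" for m
    by (rule measurable_compose[OF measurable_shift]) measurable
  have di: "integrable P (d l)" for l
    using dB[of l] d0 by (intro P.integrable_const_bound[where B = B]) auto
  have B0: "0 \<le> B"
  proof -
    have "AE \<omega> in P. 0 \<le> B" using dB[of 0] by eventually_elim (use d0 order_trans in blast)
    then show ?thesis by simp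
  qed
  have Xint: "integrable P X"
  proof (rule Bochner_Integration.integrable_bound)
    show "integrable P (\<lambda>\<omega>. f (shift (k 0) \<omega>) * B)" using integrable_shift[OF f] by simp
    show "AE \<omega> in P. norm (X \<omega>) \<le> norm (f (shift (k 0) \<omega>) * B)"
      using le[of 0] dB[of 0]
    proof eventually_elim
      case (elim \<omega>)
      have "f (shift (k 0) \<omega>) * d 0 \<omega> \<le> f (shift (k 0) \<omega>) * B"
        using elim f0 by (intro mult_left_mono) auto
      then show ?case using elim X0[of \<omega>] by simp
    qed
  qed measurable
  let ?e = "\<lambda>M \<omega>. max (f \<omega> - real M) 0"
  have e_int: "integrable P (?e M)" for M using f by auto
  have bound: "(\<integral>\<omega>. X \<omega> \<partial>P) \<le> real M * (\<integral>\<omega>. d l \<omega> \<partial>P) + B * (\<integral>\<omega>. ?e M \<omega> \<partial>P)" for M l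
  proof -
    have "(\<integral>\<omega>. X \<omega> \<partial>P) \<le> (\<integral>\<omega>. real M * d l \<omega> + B * ?e M (shift (k l) \<omega>) \<partial>P)"
    proof (rule integral_mono_AE[OF Xint])
      show "integrable P (\<lambda>\<omega>. real M * d l \<omega> + B * ?e M (shift (k l) \<omega>))"
        using di integrable_shift[OF e_int] by auto
      show "AE \<omega> in P. X \<omega> \<le> real M * d l \<omega> + B * ?e M (shift (k l) \<omega>)"
        using le[of l] dB[of l]
      proof eventually_elim
        case (elim \<omega>)
        let ?f = "f (shift (k l) \<omega>)"
        have "?f * d l \<omega> \<le> (real M + ?e M (shift (k l) \<omega>)) * d l \<omega>"
          using d0 by (intro mult_right_mono) auto
        also have "\<dots> = real M * d l \<omega> + ?e M (shift (k l) \<omega>) * d l \<omega>" by (simp add: algebra_simps)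
        also have "?e M (shift (k l) \<omega>) * d l \<omega> \<le> ?e M (shift (k l) \<omega>) * B"
          using elim by (intro mult_left_mono) auto
        finally show ?case using elim by (simp add: mult.commute)
      qed
    qed
    also have "\<dots> = real M * (\<integral>\<omega>. d l \<omega> \<partial>P) + B * (\<integral>\<omega>. ?e M (shift (k l) \<omega>) \<partial>P)"
      using di integrable_shift[OF e_int] by auto
    also have "(\<integral>\<omega>. ?e M (shift (k l) \<omega>) \<partial>P) = (\<integral>\<omega>. ?e M \<omega> \<partial>P)"
      by (rule integral_shift) measurable
    finally show ?thesis .
  qed
  have dl: "(\<lambda>l. \<integral>\<omega>. d l \<omega> \<partial>P) \<longlonglongrightarrow> (\<integral>\<omega>. 0 \<partial>P)"
  proof (rule integral_dominated_convergence[where w = "\<lambda>_. B"])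
    show "AE \<omega> in P. norm (d l \<omega>) \<le> B" for l using dB[of l] by eventually_elim (simp add: d0)
  qed (use lim in auto)
  have bound2: "(\<integral>\<omega>. X \<omega> \<partial>P) \<le> B * (\<integral>\<omega>. ?e M \<omega> \<partial>P)" for M
  proof -
    have "(\<lambda>l. real M * (\<integral>\<omega>. d l \<omega> \<partial>P) + B * (\<integral>\<omega>. ?e M \<omega> \<partial>P)) \<longlonglongrightarrow>
        real M * 0 + B * (\<integral>\<omega>. ?e M \<omega> \<partial>P)"
      using dl by (intro tendsto_intros) simp
    then show ?thesis using bound[of M] by (intro LIMSEQ_le_const[where X = "\<lambda>l. _ l"]) auto
  qed
  have el: "(\<lambda>M. \<integral>\<omega>. ?e M \<omega> \<partial>P) \<longlonglongrightarrow> (\<integral>\<omega>. 0 \<partial>P)"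
  proof (rule integral_dominated_convergence[where w = f])
    show "AE \<omega> in P. (\<lambda>M. ?e M \<omega>) \<longlonglongrightarrow> 0"
    proof (rule AE_I2)
      fix \<omega>
      obtain M0 :: nat where "f \<omega> \<le> real M0" using real_arch_simple by blast
      then have "eventually (\<lambda>M. ?e M \<omega> = 0) sequentially"
        by (auto simp: eventually_sequentially max_def intro!: exI[of _ M0])
      then show "(\<lambda>M. ?e M \<omega>) \<longlonglongrightarrow> 0" by (rule tendsto_eventually)
    qed
    show "AE \<omega> in P. norm (?e M \<omega>) \<le> f \<omega>" for M using f0 by (auto simp: max_def)
  qed (use f in auto)
  have "(\<lambda>M. B * (\<integral>\<omega>. ?e M \<omega> \<partial>P)) \<longlonglongrightarrow> B * 0"
    using el by (intro tendsto_intros) simp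
  then have "(\<integral>\<omega>. X \<omega> \<partial>P) \<le> B * 0"
    using bound2 by (intro LIMSEQ_le_const) auto
  moreover have "0 \<le> (\<integral>\<omega>. X \<omega> \<partial>P)" using X0 by simp
  ultimately have "(\<integral>\<omega>. X \<omega> \<partial>P) = 0" by simp
  then show ?thesis
    using integral_nonneg_eq_0_iff_AE[OF Xint] X0 by simp
qed

end

section \<open>The walk killed at level one\<close>

text \<open>Here \<open>k n l i\<close> is the mass of a killed chain at time n, depth l and phase
  i; \<open>a\<close>, \<open>b\<close> and \<open>c\<close> are the weights of moving one level up,
  staying and moving one level down, \<nu> is the initial law and \<open>w\<close> the exit weight.
  The Green function \<open>g\<close> is the minimal nonnegative solution of the equation satisfied
  by \<open>h\<close>, so it lies below \<open>h\<close>. Equal total exit mass forces equality at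
  depth 0, and then the equation at each depth determines the next one.\<close>

lemma green_function_unique:
  fixes k :: "nat \<Rightarrow> nat \<Rightarrow> ('d::finite) \<Rightarrow> real" and h :: "nat \<Rightarrow> 'd \<Rightarrow> real"
    and a b c :: "nat \<Rightarrow> 'd \<Rightarrow> 'd \<Rightarrow> real"
  assumes k0: "\<And>l j. k 0 l j = (if l = 0 then \<nu> j else 0)"
    and kS: "\<And>n l j. k (Suc n) l j = (\<Sum>i\<in>UNIV. k n (Suc l) i * a l i j + k n l i * b l i j +
        (if l = 0 then 0 else k n (l - 1) i * c (l - 1) i j))"
    and h: "\<And>l j. h l j = (if l = 0 then \<nu> j else 0) + (\<Sum>i\<in>UNIV. h (Suc l) i * a l i j + h l i * b l i j +
        (if l = 0 then 0 else h (l - 1) i * c (l - 1) i j))"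
    and nn: "\<And>l i. 0 \<le> h l i" "\<And>j. 0 \<le> \<nu> j" "\<And>l i j. 0 \<le> a l i j" "\<And>l i j. 0 \<le> b l i j" "\<And>l i j. 0 \<le> c l i j"
    and w: "\<And>i. 0 < w i" and out: "(\<lambda>n. \<Sum>i\<in>UNIV. k n 0 i * w i) sums (\<Sum>i\<in>UNIV. h 0 i * w i)"
    and a_pos: "\<And>l i. 0 < (\<Sum>j\<in>UNIV. a l i j)"
  shows "(\<lambda>n. k n l i) sums h l i"
proof -
  have k_nn: "0 \<le> k n l i" for n l i
    by (induction n arbitrary: l i) (auto simp: k0 kS nn intro!: sum_nonneg add_nonneg_nonneg mult_nonneg_nonneg)
  \<comment> \<open>Induction on the number of times: the recursion expresses the sum up to
    \<open>Suc N\<close> through sums up to \<open>N\<close>, to which the equation for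
    \<open>h\<close> applies.\<close>
  have partial: "(\<Sum>n<N. k n l j) \<le> h l j" for N l j
  proof (induction N arbitrary: l j)
    case 0
    then show ?case by (simp add: nn)
  next
    case (Suc N)
    have "(\<Sum>n<N. k (Suc n) l j) = (\<Sum>i\<in>UNIV. \<Sum>n<N. k n (Suc l) i * a l i j + k n l i * b l i j +
        (if l = 0 then 0 else k n (l - 1) i * c (l - 1) i j))"
      unfolding kS by (rule sum.swap)
    also have "\<dots> = (\<Sum>i\<in>UNIV. (\<Sum>n<N. k n (Suc l) i) * a l i j + (\<Sum>n<N. k n l i) * b l i j +
        (if l = 0 then 0 else (\<Sum>n<N. k n (l - 1) i) * c (l - 1) i j))"
      by (intro sum.cong refl) (simp add: sum.distrib sum_distrib_right)
    also have "\<dots> \<le> (\<Sum>i\<in>UNIV. h (Suc l) i * a l i j + h l i * b l i j +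
        (if l = 0 then 0 else h (l - 1) i * c (l - 1) i j))"
    proof (rule sum_mono)
      fix i
      show "(\<Sum>n<N. k n (Suc l) i) * a l i j + (\<Sum>n<N. k n l i) * b l i j +
          (if l = 0 then 0 else (\<Sum>n<N. k n (l - 1) i) * c (l - 1) i j) \<le>
        h (Suc l) i * a l i j + h l i * b l i j + (if l = 0 then 0 else h (l - 1) i * c (l - 1) i j)"
        by (intro add_mono mult_right_mono[OF Suc.IH nn(3)] mult_right_mono[OF Suc.IH nn(4)])
           (simp add: mult_right_mono[OF Suc.IH nn(5)])
    qed
    finally have "k 0 l j + (\<Sum>n<N. k (Suc n) l j) \<le> h l j"
      unfolding k0 by (subst h) (rule add_left_mono)
    then show ?case by (simp only: sum.lessThan_Suc_shift)
  qed
  define g where "g l i = (\<Sum>n. k n l i)" for l i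
  have summ: "summable (\<lambda>n. k n l i)" for l i
    by (rule summableI_nonneg_bounded[OF k_nn partial])
  then have g: "(\<lambda>n. k n l i) sums g l i" for l i
    unfolding g_def by (rule summable_sums)
  have g_le: "g l i \<le> h l i" for l i
    unfolding g_def by (rule suminf_le_const[OF summ partial])
  have g_eq: "g l j = (if l = 0 then \<nu> j else 0) + (\<Sum>i\<in>UNIV. g (Suc l) i * a l i j + g l i * b l i j +
        (if l = 0 then 0 else g (l - 1) i * c (l - 1) i j))" for l j
  proof -
    have "(\<lambda>n. k (Suc n) l j) sums (\<Sum>i\<in>UNIV. g (Suc l) i * a l i j + g l i * b l i j +
        (if l = 0 then 0 else g (l - 1) i * c (l - 1) i j))"
      unfolding kS
    proof (rule sums_sum)
      fix i
      have "(\<lambda>n. if l = 0 then 0 else k n (l - 1) i * c (l - 1) i j) sums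
          (if l = 0 then 0 else g (l - 1) i * c (l - 1) i j)"
        using sums_mult2[OF g[of "l - 1" i], of "c (l - 1) i j"] by simp
      then show "(\<lambda>n. k n (Suc l) i * a l i j + k n l i * b l i j + (if l = 0 then 0 else k n (l - 1) i * c (l - 1) i j)) sums
          (g (Suc l) i * a l i j + g l i * b l i j + (if l = 0 then 0 else g (l - 1) i * c (l - 1) i j))"
        by (intro sums_add[OF sums_add[OF sums_mult2[OF g] sums_mult2[OF g]]])
    qed
    from sums_Suc[OF this] g[of l j] show ?thesis
      unfolding k0 by (simp only: sums_unique2 add.commute)
  qed
  \<comment> \<open>Two ordered vectors with the same sum under strictly positive weights
    coincide.\<close>
  have eqI: "u i = v i" if le: "\<And>i. u i \<le> v i" and eq: "(\<Sum>i\<in>UNIV. u i * y i) = (\<Sum>i\<in>UNIV. v i * y i)"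
    and y: "\<And>i. 0 < y i" for u v y :: "'d \<Rightarrow> real" and i
  proof -
    have "(\<Sum>i\<in>UNIV. (v i - u i) * y i) = 0" using eq by (simp add: left_diff_distrib sum_subtractf)
    moreover have "0 \<le> (v i - u i) * y i" for i using le[of i] y[of i] by simp
    ultimately have "(v i - u i) * y i = 0" by (simp add: sum_nonneg_eq_0_iff)
    then show ?thesis using y[of i] by simp
  qed
  have "g l i = h l i" for i
  proof (induction l arbitrary: i rule: less_induct)
    case (less l)
    show ?case
    proof (cases l)
      case 0
      have "(\<lambda>n. \<Sum>i\<in>UNIV. k n 0 i * w i) sums (\<Sum>i\<in>UNIV. g 0 i * w i)"
        by (intro sums_sum sums_mult2 g)
      with out have eq: "(\<Sum>i\<in>UNIV. g 0 i * w i) = (\<Sum>i\<in>UNIV. h 0 i * w i)" by (rule sums_unique2[symmetric])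
      show ?thesis unfolding 0 by (rule eqI[OF g_le eq w])
    next
      case (Suc l')
      have 1: "g l' i = h l' i" for i using less Suc by simp
      have 2: "l' \<noteq> 0 \<Longrightarrow> g (l' - 1) i = h (l' - 1) i" for i using less Suc by simp
      \<comment> \<open>All terms of the equation at depth \<open>l'\<close> are already known to
        agree except the inflow from depth \<open>Suc l'\<close>. Summing this inflow over the
        phases gives the weighted total with the positive weights of \<open>a_pos\<close>.\<close>
      have col: "(\<Sum>i\<in>UNIV. g (Suc l') i * a l' i j) = (\<Sum>i\<in>UNIV. h (Suc l') i * a l' i j)" for j
        using g_eq[of l' j] h[of l' j] 1 2 by (cases "l' = 0") (simp_all add: sum.distrib)
      have tot: "(\<Sum>j\<in>UNIV. \<Sum>i\<in>UNIV. u i * a l' i j) = (\<Sum>i\<in>UNIV. u i * (\<Sum>j\<in>UNIV. a l' i j))" for u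
        by (subst sum.swap) (simp add: sum_distrib_left)
      have eq: "(\<Sum>i\<in>UNIV. g (Suc l') i * (\<Sum>j\<in>UNIV. a l' i j)) = (\<Sum>i\<in>UNIV. h (Suc l') i * (\<Sum>j\<in>UNIV. a l' i j))"
        unfolding tot[symmetric] col ..
      show ?thesis unfolding Suc by (rule eqI[OF g_le eq a_pos])
    qed
  qed
  then show ?thesis using g[of l i] by simp
qed

context strip
begin

definition alive :: "nat \<Rightarrow> 'd path set" where
  "alive n = {x. \<forall>s\<le>n. fst (x s) \<noteq> 1}"

definition kill :: "'s env \<Rightarrow> 'd pmf \<Rightarrow> nat \<Rightarrow> 'd state \<Rightarrow> real" where
  "kill \<omega> m n z = measure (quenched p q r \<omega> m) ({x. x n = z} \<inter> alive n)"

lemma sets_alive [measurable]: "alive n \<in> sets path_space"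
  unfolding alive_def by (rule sets_Collect_path) measurable

lemma sets_at [measurable]: "{x :: 'd path. x n = z} \<in> sets path_space"
  by (rule sets_Collect_path) measurable

lemma prob_space_quenched: "prob_space (quenched p q r \<omega> m)"
  unfolding quenched_def by (rule prob_space_walk_law)

lemma sets_quenched [simp]: "sets (quenched p q r \<omega> m) = sets path_space"
  unfolding quenched_def by simp

lemma space_quenched [simp]: "space (quenched p q r \<omega> m) = UNIV"
  unfolding quenched_def by simp

lemma emeasure_kill: "emeasure (quenched p q r \<omega> m) ({x. x n = z} \<inter> alive n) = ennreal (kill \<omega> m n z)"
proof -
  interpret prob_space "quenched p q r \<omega> m" by (rule prob_space_quenched)
  show ?thesis by (simp add: kill_def emeasure_eq_measure)
qed

lemma kill_nonneg: "0 \<le> kill \<omega> m n z"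
  by (simp add: kill_def)

lemma pmf_map_Pair_0: "pmf (map_pmf (Pair (0::int)) m) (k, j) = (if k = 0 then pmf m j else 0)"
  by (auto simp: pmf_map_inj' inj_def pmf_eq_0_set_pmf)

lemma emeasure_quenched_0:
  "emeasure (quenched p q r \<omega> m) {x. x 0 = (k, j)} = ennreal (if k = 0 then pmf m j else 0)"
  unfolding quenched_def emeasure_law_0 pmf_map_Pair_0 ..

lemma kill_0: "kill \<omega> m 0 (k, j) = (if k = 0 then pmf m j else 0)"
proof (cases "k = 1")
  case True
  then have "{x. x 0 = (k, j)} \<inter> alive 0 = {}" by (auto simp: alive_def)
  then show ?thesis using True by (simp add: kill_def)
next
  case False
  then have eq: "{x. x 0 = (k, j)} \<inter> alive 0 = {x. x 0 = (k, j)}" by (auto simp: alive_def)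
  have "kill \<omega> m 0 (k, j) = (if k = 0 then pmf m j else 0)"
    unfolding kill_def eq measure_def emeasure_quenched_0 by simp
  then show ?thesis .
qed

text \<open>Survival is required up to time \<open>n\<close> only, so the formula covers both a
  further step of the killed walk and the exit onto level 1.\<close>

lemma step_prob:
  assumes \<omega>: "\<omega> \<in> space P"
  shows "measure (quenched p q r \<omega> m) ({x. x (Suc n) = (k, j)} \<inter> alive n) =
    (\<Sum>i\<in>UNIV. kill \<omega> m n (k - 1, i) * p (\<omega> (k - 1)) $ i $ j + kill \<omega> m n (k, i) * r (\<omega> k) $ i $ j
      + kill \<omega> m n (k + 1, i) * q (\<omega> (k + 1)) $ i $ j)" (is "_ = ?R")
proof -
  let ?\<nu> = "map_pmf (Pair 0) m" and ?w = "(k, j)"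
  interpret prob_space "quenched p q r \<omega> m" by (rule prob_space_quenched)
  have each: "emeasure (law \<omega> ?\<nu>) ({x. x n = z} \<inter> ({x. x (Suc n) = ?w} \<inter> alive n)) =
      ennreal (kill \<omega> m n z * jump_prob p q r \<omega> z ?w)" for z
  proof -
    have "{x. x n = z} \<inter> ({x. x (Suc n) = ?w} \<inter> alive n) =
        ({x. x n = z} \<inter> alive n) \<inter> {x. (\<lambda>s. x (n + s)) \<in> {x. x 1 = ?w}}"
      by (simp only: mem_Collect_eq Int_ac add_Suc_right add_0_right One_nat_def)
    also have "emeasure (law \<omega> ?\<nu>) \<dots> =
        emeasure (law \<omega> ?\<nu>) ({x. x n = z} \<inter> alive n) * emeasure (law1 \<omega> z) {x. x 1 = ?w}"
    proof (rule markov[OF _ _ sets_at])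
      fix x x' :: "'d path"
      assume eq: "\<And>s. s \<le> n \<Longrightarrow> x s = x' s" and x: "x \<in> {x. x n = z} \<inter> alive n"
      have "x' n = z" using eq[of n] x by simp
      moreover have "x' \<in> alive n"
        unfolding alive_def mem_Collect_eq
      proof (intro allI impI)
        fix s assume "s \<le> n"
        then show "fst (x' s) \<noteq> 1" using eq[of s, symmetric] x by (simp add: alive_def)
      qed
      ultimately show "x' \<in> {x. x n = z} \<inter> alive n" by simp
    qed simp
    also have "emeasure (law \<omega> ?\<nu>) ({x. x n = z} \<inter> alive n) = ennreal (kill \<omega> m n z)"
      using emeasure_kill[of \<omega> m n z] by (simp add: quenched_def)
    also have "emeasure (law1 \<omega> z) {x. x 1 = ?w} = ennreal (jump_prob p q r \<omega> z ?w)"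
      unfolding emeasure_law_1 by (simp add: pmf_jmp[OF \<omega>])
    finally show ?thesis by (simp add: ennreal_mult' kill_nonneg)
  qed
  let ?A = "{k - 1, k, k + 1} \<times> (UNIV :: 'd set)"
  have "emeasure (law \<omega> ?\<nu>) ({x. x (Suc n) = ?w} \<inter> alive n) =
      (\<integral>\<^sup>+z. ennreal (kill \<omega> m n z * jump_prob p q r \<omega> z ?w) \<partial>count_space UNIV)"
    unfolding each[symmetric] by (rule emeasure_law_partition) (intro sets.Int sets_at sets_alive)
  also have "\<dots> = (\<integral>\<^sup>+z. ennreal (kill \<omega> m n z * jump_prob p q r \<omega> z ?w) \<partial>count_space ?A)"
    by (intro nn_integral_count_space_eq) (auto simp: jump_prob_def split: if_splits)
  also have "\<dots> = (\<Sum>z\<in>?A. ennreal (kill \<omega> m n z * jump_prob p q r \<omega> z ?w))"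
    by (intro nn_integral_count_space_finite) auto
  also have "\<dots> = ennreal (\<Sum>z\<in>?A. kill \<omega> m n z * jump_prob p q r \<omega> z ?w)"
    by (intro sum_ennreal mult_nonneg_nonneg kill_nonneg) (simp add: pmf_jmp[OF \<omega>, symmetric])
  also have "(\<Sum>z\<in>?A. kill \<omega> m n z * jump_prob p q r \<omega> z ?w) =
      (\<Sum>l\<in>{k - 1, k, k + 1}. \<Sum>i\<in>UNIV. kill \<omega> m n (l, i) * jump_prob p q r \<omega> (l, i) ?w)"
    by (simp only: sum.cartesian_product) (simp add: split_def)
  also have "\<dots> = ?R"
    by (simp add: jump_prob_def sum.distrib)
  finally have "emeasure (quenched p q r \<omega> m) ({x. x (Suc n) = ?w} \<inter> alive n) = ennreal ?R"
    by (simp only: quenched_def)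
  then have "ennreal (measure (quenched p q r \<omega> m) ({x. x (Suc n) = ?w} \<inter> alive n)) = ennreal ?R"
    by (simp only: emeasure_eq_measure)
  moreover have "0 \<le> ?R"
    using nonneg_pqr[OF \<omega>] kill_nonneg by (intro sum_nonneg add_nonneg_nonneg mult_nonneg_nonneg) auto
  ultimately show ?thesis by simp
qed

lemma kill_Suc:
  assumes \<omega>: "\<omega> \<in> space P" and k: "k \<noteq> 1"
  shows "kill \<omega> m (Suc n) (k, j) =
    (\<Sum>i\<in>UNIV. kill \<omega> m n (k - 1, i) * p (\<omega> (k - 1)) $ i $ j + kill \<omega> m n (k, i) * r (\<omega> k) $ i $ j
      + kill \<omega> m n (k + 1, i) * q (\<omega> (k + 1)) $ i $ j)"
proof -
  have "{x. x (Suc n) = (k, j)} \<inter> alive (Suc n) = {x. x (Suc n) = (k, j)} \<inter> alive n"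
    using k by (auto simp: alive_def le_Suc_eq)
  then show ?thesis unfolding kill_def[of _ _ "Suc n"] using step_prob[OF \<omega>] by simp
qed

lemma kill_1: "kill \<omega> m n (1, j) = 0"
proof -
  have "{x. x n = (1, j)} \<inter> alive n = {}" by (auto simp: alive_def)
  then show ?thesis by (simp add: kill_def)
qed

text \<open>A walk with unit steps started at level 0 cannot pass above level 1 without visiting
  it.\<close>

lemma kill_above:
  assumes \<omega>: "\<omega> \<in> space P"
  shows "1 \<le> k \<Longrightarrow> kill \<omega> m n (k, j) = 0"
proof (induction n arbitrary: k j)
  case 0
  then show ?case by (simp add: kill_0)
next
  case (Suc n)
  show ?case
  proof (cases "k = 1")
    case True
    then show ?thesis by (simp add: kill_1)
  next
    case False
    then show ?thesis using Suc by (subst kill_Suc[OF \<omega> False]) simp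
  qed
qed

text \<open>Decomposition by the time of the first visit to level 1: it occurs at
  \<open>Suc n\<close> exactly when the walk is alive at time \<open>n\<close> and then steps to 1,
  and this step can only start at level 0. Time 0 is excluded by the initial level.\<close>

lemma exit_sums:
  assumes \<omega>: "\<omega> \<in> space P"
  shows "(\<lambda>n. \<Sum>i\<in>UNIV. kill \<omega> m n (0, i) * (\<Sum>j\<in>UNIV. p (\<omega> 0) $ i $ j)) sums
    measure (quenched p q r \<omega> m) {x. hits x}"
proof -
  interpret prob_space "quenched p q r \<omega> m" by (rule prob_space_quenched)
  let ?B = "\<lambda>n. {x. fst (x (Suc n)) = 1} \<inter> alive n"
  have B_set: "?B n \<in> sets path_space" for n
    by (intro sets.Int sets_alive sets_Collect_path) measurable
  have B: "measure (quenched p q r \<omega> m) (?B n) = (\<Sum>i\<in>UNIV. kill \<omega> m n (0, i) * (\<Sum>j\<in>UNIV. p (\<omega> 0) $ i $ j))" for n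
  proof -
    have "?B n = (\<Union>j. {x. x (Suc n) = (1, j)} \<inter> alive n)" by (auto simp: prod_eq_iff)
    then have "measure (quenched p q r \<omega> m) (?B n) =
        measure (quenched p q r \<omega> m) (\<Union>j. {x. x (Suc n) = (1, j)} \<inter> alive n)" by simp
    also have "\<dots> = (\<Sum>j\<in>UNIV. measure (quenched p q r \<omega> m) ({x. x (Suc n) = (1, j)} \<inter> alive n))"
      by (rule finite_measure_finite_Union) (auto simp: disjoint_family_on_def intro!: sets.Int sets_at sets_alive)
    also have "\<dots> = (\<Sum>j\<in>UNIV. \<Sum>i\<in>UNIV. kill \<omega> m n (0, i) * p (\<omega> 0) $ i $ j)"
      unfolding step_prob[OF \<omega>] using kill_above[OF \<omega>] by simp
    also have "\<dots> = (\<Sum>i\<in>UNIV. \<Sum>j\<in>UNIV. kill \<omega> m n (0, i) * p (\<omega> 0) $ i $ j)" by (rule sum.swap)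
    finally show ?thesis by (simp add: sum_distrib_left)
  qed
  have disj: "disjoint_family ?B"
    unfolding disjoint_family_on_def
  proof (intro ballI impI)
    have "?B n \<inter> ?B n' = {}" if "n < n'" for n n' using that by (auto simp: alive_def Suc_le_eq)
    then show "?B n \<inter> ?B n' = {}" if "n \<noteq> n'" for n n' using that
      by (metis Int_commute linorder_neqE_nat)
  qed
  have "(\<lambda>n. measure (quenched p q r \<omega> m) (?B n)) sums measure (quenched p q r \<omega> m) (\<Union>n. ?B n)"
    using B_set disj by (intro finite_measure_UNION) auto
  also have "measure (quenched p q r \<omega> m) (\<Union>n. ?B n) = measure (quenched p q r \<omega> m) {x. hits x}"
  proof (rule finite_measure_eq_AE)
    have "AE x in quenched p q r \<omega> m. \<forall>j. x 0 \<noteq> (1, j)"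
    proof (unfold AE_all_countable, intro allI)
      fix j
      have "{x. x 0 = (1, j)} \<in> null_sets (quenched p q r \<omega> m)"
        by (intro null_setsI) (simp_all only: emeasure_quenched_0 sets_quenched sets_at, simp)
      from AE_not_in[OF this] show "AE x in quenched p q r \<omega> m. x 0 \<noteq> (1, j)" by simp
    qed
    then show "AE x in quenched p q r \<omega> m. (x \<in> (\<Union>n. ?B n)) = (x \<in> {x. hits x})"
    proof eventually_elim
      case (elim x)
      show ?case
      proof
        assume "x \<in> (\<Union>n. ?B n)"
        then show "x \<in> {x. hits x}" by (auto simp: hits_def)
      next
        assume "x \<in> {x. hits x}"
        then have l: "fst (x (htime x)) = 1" using htime_level by simp
        have "htime x \<noteq> 0"
        proof
          assume "htime x = 0"
          then have "x 0 = (1, snd (x 0))" using l by (simp add: prod_eq_iff)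
          then show False using elim by blast
        qed
        then obtain n where n: "htime x = Suc n" by (cases "htime x") auto
        have "x \<in> ?B n" using l not_hit_before_htime[of _ x] by (auto simp: alive_def n)
        then show "x \<in> (\<Union>n. ?B n)" by blast
      qed
    qed
    show "(\<Union>n. ?B n) \<in> events" using B_set by auto
    show "{x. hits x} \<in> events" using sets_hits by simp
  qed
  finally show ?thesis by (simp only: B)
qed

text \<open>Expanding the occupation over times and states and exchanging sums turns its mean into
  the Green function of the killed walk. Only the levels \<open>- int l\<close> carry mass, by
  \<open>kill_above\<close>, and a visit there is recorded in the environment shifted by
  \<open>- int l\<close>.\<close>

lemma nn_integral_occupation:
  assumes \<omega>: "\<omega> \<in> space P"
    and G: "\<And>l. (\<lambda>n. kill \<omega> m n (- int l, i)) sums h l"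
  shows "(\<integral>\<^sup>+x. occupation B i \<omega> x \<partial>quenched p q r \<omega> m) =
    (\<Sum>l. ennreal (h l) * indicator B (shift (- int l) \<omega>))"
proof -
  let ?Q = "quenched p q r \<omega> m"
  let ?g = "\<lambda>z. indicator B (shift (fst z) \<omega>) * indicator {i} (snd z) :: ennreal"
  let ?E = "\<lambda>n z. {x. x n = z} \<inter> alive n"
  have E_set: "?E n z \<in> sets ?Q" for n z
    unfolding sets_quenched by (intro sets.Int sets_at sets_alive)
  have occ: "occupation B i \<omega> x = (\<Sum>n. indicator (alive n) x * ?g (x n))" for x
    unfolding occupation_def less_hit_iff by (intro suminf_cong) (auto simp: alive_def)
  have meas: "(\<lambda>x. indicator (alive n) x * ?g (x n)) \<in> borel_measurable ?Q" for n
  proof -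
    have "(\<lambda>x. ?g (x n)) \<in> borel_measurable path_space"
      by (rule measurable_compose[OF measurable_path_coord]) simp
    then show ?thesis
      by (intro borel_measurable_times_ennreal borel_measurable_indicator)
         (simp_all add: measurable_cong_sets[OF sets_quenched refl] sets_alive)
  qed
  have each: "(\<integral>\<^sup>+x. indicator (alive n) x * ?g (x n) \<partial>?Q) =
      (\<integral>\<^sup>+z. ?g z * ennreal (kill \<omega> m n z) \<partial>count_space UNIV)" for n
  proof -
    have "indicator (alive n) x * ?g (x n) = (\<integral>\<^sup>+z. ?g z * indicator (?E n z) x \<partial>count_space UNIV)" for x
    proof -
      have "(\<integral>\<^sup>+z. ?g z * indicator (?E n z) x \<partial>count_space UNIV) =
          (\<integral>\<^sup>+z. ?g z * indicator (?E n z) x \<partial>count_space {x n})"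
        by (intro nn_integral_count_space_eq) (auto simp: indicator_def)
      also have "\<dots> = (\<Sum>z\<in>{x n}. ?g z * indicator (?E n z) x)"
        by (rule nn_integral_count_space_finite) simp
      also have "\<dots> = ?g (x n) * indicator (?E n (x n)) x"
        by (simp only: sum.insert finite.emptyI empty_iff not_False_eq_True sum.empty add_0_right)
      finally show ?thesis by (auto simp: indicator_def)
    qed
    then have "(\<integral>\<^sup>+x. indicator (alive n) x * ?g (x n) \<partial>?Q) =
        (\<integral>\<^sup>+x. (\<integral>\<^sup>+z. ?g z * indicator (?E n z) x \<partial>count_space UNIV) \<partial>?Q)"
      by (simp only:)
    also have "\<dots> = (\<integral>\<^sup>+z. (\<integral>\<^sup>+x. ?g z * indicator (?E n z) x \<partial>?Q) \<partial>count_space UNIV)"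
    proof (rule nn_integral_count_space_nn_integral)
      show "(\<lambda>x. ?g z * indicator (?E n z) x) \<in> borel_measurable ?Q" for z
        by (intro borel_measurable_times_ennreal borel_measurable_const borel_measurable_indicator E_set)
    qed simp
    also have "\<dots> = (\<integral>\<^sup>+z. ?g z * ennreal (kill \<omega> m n z) \<partial>count_space UNIV)"
      by (subst nn_integral_cmult_indicator[OF E_set]) (simp only: emeasure_kill)
    finally show ?thesis .
  qed
  have "(\<integral>\<^sup>+x. occupation B i \<omega> x \<partial>?Q) = (\<Sum>n. \<integral>\<^sup>+z. ?g z * ennreal (kill \<omega> m n z) \<partial>count_space UNIV)"
    unfolding occ by (subst nn_integral_suminf[OF meas]) (simp only: each)
  also have "\<dots> = (\<integral>\<^sup>+z. (\<Sum>n. ?g z * ennreal (kill \<omega> m n z)) \<partial>count_space UNIV)"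
    by (rule nn_integral_suminf[symmetric]) simp
  also have "\<dots> = (\<integral>\<^sup>+z. ?g z * (\<Sum>n. ennreal (kill \<omega> m n z)) \<partial>count_space UNIV)"
    by (simp only: ennreal_suminf_cmult)
  also have "\<dots> = (\<integral>\<^sup>+z. ?g z * (\<Sum>n. ennreal (kill \<omega> m n z)) \<partial>count_space (range (\<lambda>l. (- int l, i))))"
  proof (intro nn_integral_count_space_eq)
    fix z assume "z \<in> UNIV - range (\<lambda>l. (- int l, i))"
    then have z: "z \<noteq> (- int l, i)" for l by auto
    show "?g z * (\<Sum>n. ennreal (kill \<omega> m n z)) = 0"
    proof (cases "snd z = i \<and> fst z \<le> 0")
      case True
      then have "z = (- int (nat (- fst z)), i)" by (simp add: prod_eq_iff)
      with z show ?thesis by blast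
    next
      case False
      then consider "snd z \<noteq> i" | "1 \<le> fst z" by linarith
      then show ?thesis
      proof cases
        case 2
        then have "kill \<omega> m n z = 0" for n using kill_above[OF \<omega> 2, of m n "snd z"] by simp
        then show ?thesis by simp
      qed simp
    qed
  qed auto
  also have "\<dots> = (\<integral>\<^sup>+l. ?g (- int l, i) * (\<Sum>n. ennreal (kill \<omega> m n (- int l, i))) \<partial>count_space UNIV)"
    by (rule nn_integral_bij_count_space[symmetric]) (auto simp: bij_betw_def inj_on_def)
  also have "\<dots> = (\<Sum>l. ?g (- int l, i) * (\<Sum>n. ennreal (kill \<omega> m n (- int l, i))))"
    by (rule nn_integral_count_space_nat)
  also have "\<dots> = (\<Sum>l. ennreal (h l) * indicator B (shift (- int l) \<omega>))"
  proof (rule suminf_cong)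
    fix l
    have "(\<Sum>n. ennreal (kill \<omega> m n (- int l, i))) = ennreal (h l)"
      by (rule suminf_ennreal_eq[OF kill_nonneg G])
    then show "?g (- int l, i) * (\<Sum>n. ennreal (kill \<omega> m n (- int l, i))) =
        ennreal (h l) * indicator B (shift (- int l) \<omega>)"
      by (simp add: mult.commute)
  qed
  finally show ?thesis .
qed

end

section \<open>Renewal at the hitting time\<close>

context ergodic_strip
begin

text \<open>The passage to the first arrival at level 1, with environment and path both recentred
  there: a skew product over the shift.\<close>

definition renew :: "'s env \<times> 'd path \<Rightarrow> 's env \<times> 'd path" where
  "renew = (\<lambda>(\<omega>, x). (shift 1 \<omega>, after x))"

lemma measurable_renew: "renew \<in> P \<Otimes>\<^sub>M path_space \<rightarrow>\<^sub>M P \<Otimes>\<^sub>M path_space"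
proof -
  have "(\<lambda>z. (shift 1 (fst z), after (snd z))) \<in> P \<Otimes>\<^sub>M path_space \<rightarrow>\<^sub>M P \<Otimes>\<^sub>M path_space"
    by (intro measurable_Pair measurable_compose[OF measurable_fst measurable_shift]
      measurable_compose[OF measurable_snd measurable_after])
  then show ?thesis by (simp add: renew_def split_def)
qed

lemma measurable_annealed_kernel:
  assumes "\<mu> \<in> past_laws S"
  shows "(\<lambda>\<omega>. distr (quenched p q r \<omega> (\<mu> \<omega>)) (P \<Otimes>\<^sub>M path_space) (Pair \<omega>))
    \<in> P \<rightarrow>\<^sub>M subprob_algebra (P \<Otimes>\<^sub>M path_space)"
  by (rule measurable_distr2[where M = path_space])
     (simp_all add: measurable_quenched[OF rw assms])

lemma sets_annealed:
  assumes "\<mu> \<in> past_laws S"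
  shows "sets (annealed P p q r \<mu>) = sets (P \<Otimes>\<^sub>M path_space)"
  unfolding annealed_def
  by (rule sets_bind_measurable[OF measurable_annealed_kernel[OF assms] P.not_empty])

lemma space_annealed:
  assumes "\<mu> \<in> past_laws S"
  shows "space (annealed P p q r \<mu>) = space P \<times> UNIV"
  using sets_eq_imp_space_eq[OF sets_annealed[OF assms]] by (simp add: space_pair_measure)

lemma prob_space_annealed:
  assumes "\<mu> \<in> past_laws S"
  shows "prob_space (annealed P p q r \<mu>)"
proof
  have "emeasure (annealed P p q r \<mu>) (space P \<times> UNIV) =
      (\<integral>\<^sup>+\<omega>. emeasure (quenched p q r \<omega> (\<mu> \<omega>)) UNIV * indicator (space P) \<omega> \<partial>P)"
    by (rule emeasure_annealed[OF rw assms]) simp_all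
  also have "\<dots> = (\<integral>\<^sup>+\<omega>. 1 \<partial>P)"
    by (intro nn_integral_cong) (simp add: quenched_def)
  finally show "emeasure (annealed P p q r \<mu>) (space (annealed P p q r \<mu>)) = 1"
    by (simp add: space_annealed[OF assms] P.emeasure_space_1)
qed

lemma AE_annealed:
  assumes \<mu>: "\<mu> \<in> past_laws S" and Q: "Measurable.pred (P \<Otimes>\<^sub>M path_space) (\<lambda>z. Q (fst z) (snd z))"
  shows "(AE z in annealed P p q r \<mu>. Q (fst z) (snd z)) \<longleftrightarrow>
    (AE \<omega> in P. AE x in quenched p q r \<omega> (\<mu> \<omega>). Q \<omega> x)"
proof -
  have "(AE z in annealed P p q r \<mu>. Q (fst z) (snd z)) \<longleftrightarrow>
      (AE \<omega> in P. AE z in distr (quenched p q r \<omega> (\<mu> \<omega>)) (P \<Otimes>\<^sub>M path_space) (Pair \<omega>). Q (fst z) (snd z))"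
    unfolding annealed_def by (rule AE_bind[OF measurable_annealed_kernel[OF \<mu>] Q])
  also have "\<dots> \<longleftrightarrow> (AE \<omega> in P. AE x in quenched p q r \<omega> (\<mu> \<omega>). Q \<omega> x)"
  proof (rule AE_cong)
    fix \<omega> assume "\<omega> \<in> space P"
    then have "Pair \<omega> \<in> quenched p q r \<omega> (\<mu> \<omega>) \<rightarrow>\<^sub>M P \<Otimes>\<^sub>M path_space"
      unfolding measurable_cong_sets[OF sets_quenched refl] by measurable
    then show "(AE z in distr (quenched p q r \<omega> (\<mu> \<omega>)) (P \<Otimes>\<^sub>M path_space) (Pair \<omega>). Q (fst z) (snd z)) \<longleftrightarrow>
        (AE x in quenched p q r \<omega> (\<mu> \<omega>). Q \<omega> x)"
      by (subst AE_distr_iff) (use Q in \<open>auto simp: pred_def\<close>)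
  qed
  finally show ?thesis .
qed

lemma nn_integral_annealed:
  assumes \<mu>: "\<mu> \<in> past_laws S" and f: "(\<lambda>z. f (fst z) (snd z)) \<in> borel_measurable (P \<Otimes>\<^sub>M path_space)"
  shows "(\<integral>\<^sup>+z. f (fst z) (snd z) \<partial>annealed P p q r \<mu>) =
    (\<integral>\<^sup>+\<omega>. \<integral>\<^sup>+x. f \<omega> x \<partial>quenched p q r \<omega> (\<mu> \<omega>) \<partial>P)"
proof -
  have "(\<integral>\<^sup>+z. f (fst z) (snd z) \<partial>annealed P p q r \<mu>) =
      (\<integral>\<^sup>+\<omega>. \<integral>\<^sup>+z. f (fst z) (snd z) \<partial>distr (quenched p q r \<omega> (\<mu> \<omega>)) (P \<Otimes>\<^sub>M path_space) (Pair \<omega>) \<partial>P)"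
    unfolding annealed_def by (rule nn_integral_bind[OF f measurable_annealed_kernel[OF \<mu>]])
  also have "\<dots> = (\<integral>\<^sup>+\<omega>. \<integral>\<^sup>+x. f \<omega> x \<partial>quenched p q r \<omega> (\<mu> \<omega>) \<partial>P)"
  proof (rule nn_integral_cong)
    fix \<omega> assume "\<omega> \<in> space P"
    then have "Pair \<omega> \<in> quenched p q r \<omega> (\<mu> \<omega>) \<rightarrow>\<^sub>M P \<Otimes>\<^sub>M path_space"
      unfolding measurable_cong_sets[OF sets_quenched refl] by measurable
    then show "(\<integral>\<^sup>+z. f (fst z) (snd z) \<partial>distr (quenched p q r \<omega> (\<mu> \<omega>)) (P \<Otimes>\<^sub>M path_space) (Pair \<omega>)) =
        (\<integral>\<^sup>+x. f \<omega> x \<partial>quenched p q r \<omega> (\<mu> \<omega>))"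
      by (subst nn_integral_distr) (use f in auto)
  qed
  finally show ?thesis .
qed

text \<open>The mass of \<open>m\<close> transported by the hitting probabilities is that of the
  probability vector \<open>m'\<close>, so none of it fails to arrive.\<close>

lemma quenched_hits:
  assumes "\<And>j. pmf m' j = ((\<chi> i. pmf m i) v* et \<omega>) $ j"
  shows "emeasure (quenched p q r \<omega> m) {x. hits x} = 1"
proof -
  have "emeasure (quenched p q r \<omega> m) {x. hits x} = (\<Sum>j\<in>UNIV. emeasure (quenched p q r \<omega> m) (hitset j))"
    unfolding hits_eq_UN_hitset using sets_hitset
    by (intro sum_emeasure[symmetric]) (auto simp: disjoint_family_on_def hitset_def)
  also have "\<dots> = (\<Sum>j\<in>UNIV. ennreal (pmf m' j))"
    by (simp only: emeasure_quenched_hitset assms)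
  also have "\<dots> = 1"
    by (subst sum_ennreal) (simp_all add: sum_pmf_eq_1)
  finally show ?thesis .
qed

text \<open>By the strong Markov property the recentred future is a walk in the shifted environment
  whose initial phase has law \<mu> times \<eta>. The hypothesis says that this is \<mu> of the
  shifted environment, so stationarity of the environment gives invariance. Both sides are compared
  on rectangles.\<close>

lemma distr_renew:
  assumes \<mu>: "\<mu> \<in> past_laws S"
    and inv: "AE \<omega> in P. \<forall>j. pmf (\<mu> (shift 1 \<omega>)) j = ((\<chi> i. pmf (\<mu> \<omega>) i) v* et \<omega>) $ j"
  shows "distr (annealed P p q r \<mu>) (annealed P p q r \<mu>) renew = annealed P p q r \<mu>"
proof -
  let ?A = "annealed P p q r \<mu>"
  interpret A: prob_space ?A by (rule prob_space_annealed[OF \<mu>])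
  note sA = sets_annealed[OF \<mu>]
  have T: "renew \<in> ?A \<rightarrow>\<^sub>M ?A"
    unfolding measurable_cong_sets[OF sA sA] by (rule measurable_renew)
  let ?E = "{F \<times> G | F G. F \<in> sets P \<and> G \<in> sets (path_space :: 'd path measure)}"
  show ?thesis
  proof (rule measure_eqI_generator_eq[where E = ?E and \<Omega> = "space P \<times> UNIV" and A = "\<lambda>_. space P \<times> UNIV"])
    show "Int_stable ?E" by (rule Int_stable_pair_measure_generator)
    show "?E \<subseteq> Pow (space P \<times> UNIV)" using sets.sets_into_space by blast
    show "sets (distr ?A ?A renew) = sigma_sets (space P \<times> UNIV) ?E" "sets ?A = sigma_sets (space P \<times> UNIV) ?E"
      using sets_pair_measure[of P "path_space :: 'd path measure"] by (simp_all add: sA)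
    show "range (\<lambda>_::nat. space P \<times> UNIV) \<subseteq> ?E"
      using sets.top[of P] UNIV_in_path_space by blast
    show "emeasure (distr ?A ?A renew) (space P \<times> UNIV) \<noteq> \<infinity>"
      using prob_space.finite_measure[OF A.prob_space_distr[OF T]] by (simp add: finite_measure.emeasure_finite)
    show "emeasure (distr ?A ?A renew) X = emeasure ?A X" if "X \<in> ?E" for X
    proof -
      have "\<exists>F G. X = F \<times> G \<and> F \<in> sets P \<and> G \<in> sets (path_space :: 'd path measure)"
        using that by simp
      then obtain F G where X: "X = F \<times> G" and F [measurable]: "F \<in> sets P" and G: "G \<in> sets (path_space :: 'd path measure)"
        by (elim exE conjE)
      let ?F = "shift 1 -` F \<inter> space P" and ?G = "{x. after x \<in> G}"
      have F': "?F \<in> sets P" by measurable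
      have G': "?G \<in> sets path_space"
        using measurable_sets[OF measurable_after G] by (simp add: vimage_def)
      have m: "(\<lambda>\<omega>. emeasure (quenched p q r \<omega> (\<mu> \<omega>)) G * indicator F \<omega>) \<in> borel_measurable P"
        by (intro borel_measurable_times_ennreal borel_measurable_indicator F
          measurable_compose[OF measurable_quenched[OF rw \<mu>] measurable_emeasure_subprob_algebra[OF G]])
      have "emeasure (distr ?A ?A renew) X = emeasure ?A (?F \<times> ?G)"
      proof (subst emeasure_distr[OF T])
        show "X \<in> sets ?A" unfolding X sA using F G by simp
        have "renew -` X \<inter> space ?A = ?F \<times> ?G"
          using shift_in_space by (auto simp: X renew_def space_annealed[OF \<mu>])
        then show "emeasure ?A (renew -` X \<inter> space ?A) = emeasure ?A (?F \<times> ?G)" by simp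
      qed
      also have "\<dots> = (\<integral>\<^sup>+\<omega>. emeasure (quenched p q r \<omega> (\<mu> \<omega>)) ?G * indicator ?F \<omega> \<partial>P)"
        by (rule emeasure_annealed[OF rw \<mu> F' G'])
      also have "\<dots> = (\<integral>\<^sup>+\<omega>. emeasure (quenched p q r (shift 1 \<omega>) (\<mu> (shift 1 \<omega>))) G * indicator F (shift 1 \<omega>) \<partial>P)"
      proof (rule nn_integral_cong_AE)
        show "AE \<omega> in P. emeasure (quenched p q r \<omega> (\<mu> \<omega>)) ?G * indicator ?F \<omega> =
          emeasure (quenched p q r (shift 1 \<omega>) (\<mu> (shift 1 \<omega>))) G * indicator F (shift 1 \<omega>)"
          using inv AE_space
        proof eventually_elim
          case (elim \<omega>)
          interpret Q: prob_space "quenched p q r \<omega> (\<mu> \<omega>)" by (rule prob_space_quenched)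
          have h1: "emeasure (quenched p q r \<omega> (\<mu> \<omega>)) {x. hits x} = 1"
            using elim by (intro quenched_hits[where m' = "\<mu> (shift 1 \<omega>)"]) simp
          have "AE x in quenched p q r \<omega> (\<mu> \<omega>). x \<in> {x. hits x}"
            using h1 by (intro Q.AE_prob_1) (simp add: measure_def)
          then have "emeasure (quenched p q r \<omega> (\<mu> \<omega>)) ?G =
              emeasure (quenched p q r \<omega> (\<mu> \<omega>)) {x. hits x \<and> after x \<in> G}"
          proof (intro emeasure_eq_AE)
            show "{x. hits x \<and> after x \<in> G} \<in> sets (quenched p q r \<omega> (\<mu> \<omega>))"
              using sets.Int[OF sets_hits G'] by (simp add: Collect_conj_eq)
          qed (use G' in auto)
          also have "\<dots> = (\<Sum>j\<in>UNIV. emeasure (quenched p q r \<omega> (\<mu> \<omega>)) (hitset j) *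
              emeasure (law1 (shift 1 \<omega>) (0, j)) G)"
            unfolding quenched_def by (rule emeasure_after[OF elim(2) G])
          also have "\<dots> = (\<Sum>j\<in>UNIV. ennreal (pmf (\<mu> (shift 1 \<omega>)) j) * emeasure (law1 (shift 1 \<omega>) (0, j)) G)"
            using elim(1) by (simp only: emeasure_quenched_hitset)
          also have "\<dots> = emeasure (quenched p q r (shift 1 \<omega>) (\<mu> (shift 1 \<omega>))) G"
            by (rule emeasure_quenched[OF G, symmetric])
          finally show ?case using elim(2) by (simp add: indicator_def)
        qed
      qed
      also have "\<dots> = (\<integral>\<^sup>+\<omega>. emeasure (quenched p q r \<omega> (\<mu> \<omega>)) G * indicator F \<omega> \<partial>P)"
        by (rule nn_integral_shift[OF m])
      also have "\<dots> = emeasure ?A X"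
        unfolding X by (rule emeasure_annealed[OF rw \<mu> F G, symmetric])
      finally show ?thesis .
    qed
  qed auto
qed

text \<open>The successive passage times add up: when all passages succeed, \<open>t n\<close> is
  the hitting time of level \<open>n\<close>, and iterating \<open>after\<close> restarts the path
  from there.\<close>

lemma after_funpow:
  fixes x :: "'d path"
  defines "t n \<equiv> \<Sum>k<n. htime ((after ^^ k) x)"
  shows "(after ^^ n) x = recentre (int n) (\<lambda>s. x (t n + s))"
proof (induction n)
  case 0
  then show ?case by (simp add: t_def)
next
  case (Suc n)
  have "(after ^^ Suc n) x = after ((after ^^ n) x)" by simp
  also have "\<dots> = recentre (int (Suc n)) (\<lambda>s. x (t (Suc n) + s))"
  proof -
    have "t (Suc n) = t n + htime ((after ^^ n) x)" by (simp add: t_def)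
    then show ?thesis
      unfolding after_def[of "(after ^^ n) x"] by (subst (1 3) Suc) (simp add: add.assoc fun_eq_iff)
  qed
  finally show ?case .
qed

text \<open>At the hitting time of level n the position is exactly n, so along this subsequence of
  times the ratio of position to time is n over the hitting time. Each passage takes at least one
  step, hence the hitting times tend to infinity.\<close>

lemma hitting_time_averages:
  fixes x :: "'d path"
  assumes lim: "(\<lambda>n. real_of_int (fst (x n)) / real n) \<longlonglongrightarrow> v" and v: "0 < v"
    and start: "\<And>k. fst ((after ^^ k) x 0) = 0" and hits: "\<And>k. hits ((after ^^ k) x)"
  shows "(\<lambda>n. (\<Sum>k<n. real (htime ((after ^^ k) x))) / real n) \<longlonglongrightarrow> 1 / v"
proof -
  define t where "t n = (\<Sum>k<n. htime ((after ^^ k) x))" for n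
  have pos: "1 \<le> htime ((after ^^ k) x)" for k
  proof (rule ccontr)
    assume "\<not> ?thesis"
    then have "htime ((after ^^ k) x) = 0" by simp
    then show False using htime_level[OF hits[of k]] start[of k] by simp
  qed
  have t_ge: "n \<le> t n" for n
  proof -
    have "(\<Sum>k<n. 1) \<le> t n" unfolding t_def by (intro sum_mono pos)
    then show ?thesis by simp
  qed
  have level: "fst (x (t n)) = int n" for n
    using start[of n] after_funpow[of n x] by (simp add: t_def)
  have "filterlim t at_top sequentially"
    by (rule filterlim_at_top_mono[OF filterlim_ident]) (simp add: t_ge)
  from filterlim_compose[OF lim this] have "(\<lambda>n. real n / real (t n)) \<longlonglongrightarrow> v"
    by (simp add: level)
  from tendsto_inverse[OF this] have "(\<lambda>n. real (t n) / real n) \<longlonglongrightarrow> 1 / v"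
    using v by (simp add: inverse_eq_divide)
  then show ?thesis by (simp add: t_def)
qed

text \<open>The passage times from one level to the next form a stationary sequence under
  \<open>renew\<close>, with averages tending to 1/v. Invariance carries the almost sure success of
  one passage, and the start at level 0, to all iterates.\<close>

lemma expected_hitting_time_le:
  assumes \<mu>: "\<mu> \<in> past_laws S"
    and inv: "AE \<omega> in P. \<forall>j. pmf (\<mu> (shift 1 \<omega>)) j = ((\<chi> i. pmf (\<mu> \<omega>) i) v* et \<omega>) $ j"
    and speed: "AE (\<omega>, x) in annealed P p q r \<mu>. (\<lambda>n. real_of_int (fst (x n)) / real n) \<longlonglongrightarrow> v"
    and v: "0 < v"
  shows "(\<integral>\<^sup>+z. ennreal (real (htime (snd z))) \<partial>annealed P p q r \<mu>) \<le> ennreal (1 / v)"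
proof -
  let ?A = "annealed P p q r \<mu>"
  note sA = sets_annealed[OF \<mu>]
  have T: "renew \<in> ?A \<rightarrow>\<^sub>M ?A"
    unfolding measurable_cong_sets[OF sA sA] by (rule measurable_renew)
  note inv_A = distr_renew[OF \<mu> inv]
  have AE_iter: "AE z in ?A. Q ((renew ^^ k) z)" if "AE z in ?A. Q z" for Q k
  proof (induction k)
    case (Suc k)
    have "AE z in distr ?A ?A renew. Q ((renew ^^ k) z)" unfolding inv_A by (rule Suc)
    from AE_distrD[OF T this] show ?case by (simp add: funpow_swap1)
  qed (simp add: that)
  have good: "AE z in ?A. hits (snd z) \<and> fst (snd z 0) = 0"
  proof (subst AE_annealed[OF \<mu>, where Q = "\<lambda>\<omega> x. hits x \<and> fst (x 0) = 0"])
    show "Measurable.pred (P \<Otimes>\<^sub>M path_space) (\<lambda>z. hits (snd z) \<and> fst (snd z 0) = 0)"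
      by (rule measurable_compose[OF measurable_snd, where g = "\<lambda>x. hits x \<and> fst (x 0) = 0"]) measurable
    show "AE \<omega> in P. AE x in quenched p q r \<omega> (\<mu> \<omega>). hits x \<and> fst (x 0) = 0"
      using inv
    proof eventually_elim
      case (elim \<omega>)
      interpret Q: prob_space "quenched p q r \<omega> (\<mu> \<omega>)" by (rule prob_space_quenched)
      have "emeasure (quenched p q r \<omega> (\<mu> \<omega>)) {x. hits x} = 1"
        using elim by (intro quenched_hits[where m' = "\<mu> (shift 1 \<omega>)"]) simp
      then have 1: "AE x in quenched p q r \<omega> (\<mu> \<omega>). x \<in> {x. hits x}"
        by (intro Q.AE_prob_1) (simp add: measure_def)
      have "AE x in quenched p q r \<omega> (\<mu> \<omega>). \<forall>z. fst z \<noteq> 0 \<longrightarrow> x 0 \<noteq> z"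
      proof (unfold AE_all_countable, intro allI)
        fix z :: "'d state"
        show "AE x in quenched p q r \<omega> (\<mu> \<omega>). fst z \<noteq> 0 \<longrightarrow> x 0 \<noteq> z"
        proof (cases "fst z = 0")
          case False
          have "{x. x 0 = z} \<in> null_sets (quenched p q r \<omega> (\<mu> \<omega>))"
            using emeasure_quenched_0[of \<omega> "\<mu> \<omega>" "fst z" "snd z"] False sets_at[of 0 z]
            by (intro null_setsI) simp_all
          from AE_not_in[OF this] show ?thesis by simp
        qed simp
      qed
      with 1 show ?case
      proof eventually_elim
        case (elim x)
        then show ?case using elim(2)[rule_format, of "x 0"] by auto
      qed
    qed
  qed
  have sp: "AE z in ?A. (\<lambda>n. real_of_int (fst (snd z n)) / real n) \<longlonglongrightarrow> v"
    using speed by (simp add: split_def)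
  have iter: "(renew ^^ k) z = (shift (int k) (fst z), (after ^^ k) (snd z))" for k z
    by (induction k) (auto simp: renew_def shift_def algebra_simps)
  have "AE z in ?A. \<forall>k. hits (snd ((renew ^^ k) z)) \<and> fst (snd ((renew ^^ k) z) 0) = 0"
    unfolding AE_all_countable using AE_iter[OF good] by blast
  with sp have avg: "AE z in ?A. (\<lambda>n. (\<Sum>k<n. real (htime (snd ((renew ^^ k) z)))) / real n) \<longlonglongrightarrow> 1 / v"
  proof eventually_elim
    case (elim z)
    then show ?case unfolding iter snd_conv using v by (intro hitting_time_averages) auto
  qed
  show ?thesis
  proof (rule expectation_le_limit_of_averages[OF prob_space_annealed[OF \<mu>] T inv_A _ _ avg])
    have "(\<lambda>z :: 's env \<times> 'd path. real (htime (snd z))) \<in> borel_measurable (P \<Otimes>\<^sub>M path_space)"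
      by (rule measurable_compose[OF measurable_compose[OF measurable_snd measurable_htime]]) simp
    then show "(\<lambda>z. real (htime (snd z))) \<in> borel_measurable ?A"
      unfolding measurable_cong_sets[OF sA refl] .
  qed simp
qed

end

section \<open>Typical environments\<close>

locale strip_model = ergodic_strip S P p q r
  for S :: "'s measure" and P :: "'s env measure" and p q r :: "'s \<Rightarrow> ('d::finite) mat" +
  fixes \<zeta> :: "int \<Rightarrow> 's env \<Rightarrow> 'd mat" and \<pi> :: "'s env \<Rightarrow> 'd pmf" and v :: real
  assumes C: "condition_C P p q r"
    and zeta: "zeta_sequence P p q r \<zeta>"
    and D: "condition_D P q r \<zeta>"
    and is_pi: "is_pi S P p q r \<pi>"
    and speed: "is_speed S P p q r v"
begin

abbreviation p0 :: "'s env \<Rightarrow> 'd mat" where "p0 \<omega> \<equiv> p (\<omega> 0)"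
abbreviation q0 :: "'s env \<Rightarrow> 'd mat" where "q0 \<omega> \<equiv> q (\<omega> 0)"
abbreviation r0 :: "'s env \<Rightarrow> 'd mat" where "r0 \<omega> \<equiv> r (\<omega> 0)"

abbreviation Z :: "'s env \<Rightarrow> 'd mat" where "Z \<equiv> \<zeta> 0"

text \<open>\<open>Ga\<close>, \<open>A\<close> and \<open>Pv\<close> are the matrices \<open>\<gamma>\<^sub>0\<close>, \<open>a\<^sub>0\<close> and the row vector \<open>\<pi>\<close>; their values at \<open>n\<close> are those at the
  origin of the environment shifted by \<open>n\<close>.\<close>

definition M :: "'s env \<Rightarrow> 'd mat" where
  "M \<omega> = q0 \<omega> ** Z (shift (- 1) \<omega>) + r0 \<omega>"

definition Ga :: "'s env \<Rightarrow> 'd mat" where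
  "Ga \<omega> = matrix_inv (mat 1 - M \<omega>)"

definition A :: "'s env \<Rightarrow> 'd mat" where
  "A \<omega> = Ga \<omega> ** q0 \<omega>"

definition Pv :: "'s env \<Rightarrow> real^'d" where
  "Pv \<omega> = (\<chi> j. pmf (\<pi> \<omega>) j)"

lemma measurable_coef:
  "(\<lambda>\<omega>. p (\<omega> n) $ i $ j) \<in> borel_measurable P" "(\<lambda>\<omega>. q (\<omega> n) $ i $ j) \<in> borel_measurable P"
  "(\<lambda>\<omega>. r (\<omega> n) $ i $ j) \<in> borel_measurable P"
  using rw by (auto simp: rwre_def intro!: borel_measurable_mat_entries measurable_compose[OF measurable_env_coord])

lemma measurable_shift_compose:
  "(\<lambda>\<omega>. f \<omega>) \<in> borel_measurable P \<Longrightarrow> (\<lambda>\<omega>. f (shift k \<omega>)) \<in> borel_measurable P"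
  by (rule measurable_compose[OF measurable_shift])

lemma measurable_zeta: "(\<lambda>\<omega>. \<zeta> n \<omega> $ i $ j) \<in> borel_measurable P"
  using zeta by (auto simp: zeta_sequence_def intro!: borel_measurable_mat_entries)

lemma measurable_M: "(\<lambda>\<omega>. M \<omega> $ i $ j) \<in> borel_measurable P"
  unfolding M_def vector_add_component
  by (intro borel_measurable_add borel_measurable_mat_mult measurable_coef
      measurable_shift_compose[where f = "\<lambda>\<omega>. Z \<omega> $ _ $ _"] measurable_zeta)

lemma measurable_Ga: "(\<lambda>\<omega>. Ga \<omega> $ i $ j) \<in> borel_measurable P"
  unfolding Ga_def
  by (intro borel_measurable_matrix_inv)
     (auto simp only: vector_minus_component intro!: borel_measurable_diff measurable_M borel_measurable_const)

lemma measurable_A: "(\<lambda>\<omega>. A \<omega> $ i $ j) \<in> borel_measurable P"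
  unfolding A_def by (intro borel_measurable_mat_mult measurable_Ga measurable_coef)

lemma measurable_past_law:
  assumes \<mu>: "\<mu> \<in> past_laws S"
  shows "(\<lambda>\<omega>. pmf (\<mu> \<omega>) j) \<in> borel_measurable P"
proof -
  have "sets (vimage_algebra (space (env_space S)) (\<lambda>\<omega>. restrict \<omega> {..0}) (PiM {..0} (\<lambda>_. S)))
      \<subseteq> sets (env_space S)"
    by (rule sets_image_in_sets) (simp_all add: measurable_restrict_subset)
  then show ?thesis
    using \<mu> unfolding past_laws_def measurable_cong_sets[OF sets_P refl]
    by (auto simp: measurable_def)
qed

lemma pi_past_laws: "\<pi> \<in> past_laws S"
  using is_pi by (simp add: is_pi_def)

lemma measurable_Pv: "(\<lambda>\<omega>. Pv \<omega> $ j) \<in> borel_measurable P"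
  using measurable_past_law[OF pi_past_laws] by (simp add: Pv_def)

lemma Pv_nonneg: "0 \<le> Pv \<omega> $ j"
  by (simp add: Pv_def)

lemma Pv_sum: "(\<Sum>j\<in>UNIV. Pv \<omega> $ j) = 1"
  by (simp add: Pv_def sum_pmf_eq_1)

section \<open>Products of the hitting matrices and their limit\<close>

lemma measurable_eta_prod: "(\<lambda>\<omega>. eta_prod p q r n \<omega> $ i $ j) \<in> borel_measurable P"
proof (induction n arbitrary: i j)
  case (Suc n)
  have "(\<lambda>\<omega>. eta p q r (- int (Suc n)) \<omega> $ i $ j) \<in> borel_measurable P" for i j
    unfolding eta_eq[of "- int (Suc n)"] by (rule measurable_shift_compose[OF measurable_et])
  then show ?case unfolding eta_prod.simps by (intro borel_measurable_mat_mult Suc)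
qed simp

lemma eta_prod_nonneg: "nonneg_matrix (eta_prod p q r n \<omega>)"
proof (induction n)
  case (Suc n)
  show ?case unfolding eta_prod.simps eta_eq[of "- int (Suc n)"]
    by (intro nonneg_matrix_mult nonneg_et Suc)
qed (simp add: nonneg_mat_1)

lemma eta_prod_row_sum: "(\<Sum>j\<in>UNIV. eta_prod p q r n \<omega> $ i $ j) \<le> 1"
proof (induction n arbitrary: i)
  case 0
  then show ?case by (simp add: mat_def)
next
  case (Suc n)
  let ?e = "et (shift (- int (Suc n)) \<omega>)"
  have "(\<Sum>j\<in>UNIV. eta_prod p q r (Suc n) \<omega> $ i $ j) =
      (\<Sum>k\<in>UNIV. ?e $ i $ k * (\<Sum>j\<in>UNIV. eta_prod p q r n \<omega> $ k $ j))"
    unfolding eta_prod.simps row_sum_mult eta_eq[of "- int (Suc n)"] ..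
  also have "\<dots> \<le> (\<Sum>k\<in>UNIV. ?e $ i $ k)"
    using Suc nonneg_et by (intro sum_mono mult_left_le) (auto simp: nonneg_matrix_def)
  also have "\<dots> \<le> 1" by (rule et_row_sum_le_1)
  finally show ?case .
qed

lemma axis_vector_matrix: "(axis i 1 v* B) $ j = (B :: 'd mat) $ i $ j"
  by (simp add: vector_matrix_mult_def axis_def if_distrib if_distribR cong: if_cong)

lemma pi_limit: "AE \<omega> in P. \<forall>i j. (\<lambda>n. eta_prod p q r n \<omega> $ i $ j) \<longlonglongrightarrow> Pv \<omega> $ j"
proof -
  have "AE \<omega> in P. \<forall>i. (\<lambda>n. axis i 1 v* eta_prod p q r n \<omega>) \<longlonglongrightarrow> Pv \<omega>"
    using is_pi by (simp add: is_pi_def Pv_def)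
  then show ?thesis
  proof eventually_elim
    case (elim \<omega>)
    show ?case
    proof (intro allI)
      fix i j
      have "(\<lambda>n. (axis i 1 v* eta_prod p q r n \<omega>) $ j) \<longlonglongrightarrow> Pv \<omega> $ j"
        using elim by (intro tendsto_vec_nth) blast
      then show "(\<lambda>n. eta_prod p q r n \<omega> $ i $ j) \<longlonglongrightarrow> Pv \<omega> $ j"
        by (simp only: axis_vector_matrix)
    qed
  qed
qed

text \<open>The rows of the products converge to a probability vector, so no mass is lost in the limit; by
  stationarity none is lost in a single factor.\<close>

lemma et_row_sum: "AE \<omega> in P. \<forall>i. (\<Sum>j\<in>UNIV. et \<omega> $ i $ j) = 1"
proof (unfold AE_all_countable, intro allI)
  fix i
  let ?s = "\<lambda>\<omega>. \<Sum>j\<in>UNIV. et \<omega> $ i $ j"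
  let ?t = "\<lambda>n \<omega>. \<Sum>j\<in>UNIV. eta_prod p q r (Suc n) \<omega> $ i $ j"
  have s_meas: "?s \<in> borel_measurable P" by (intro borel_measurable_sum measurable_et)
  have s01: "0 \<le> ?s \<omega>" "?s \<omega> \<le> 1" for \<omega>
    using nonneg_et et_row_sum_le_1 by (auto simp: nonneg_matrix_def intro!: sum_nonneg)
  have t01: "0 \<le> ?t n \<omega>" "?t n \<omega> \<le> 1" for n \<omega>
    using eta_prod_nonneg[of "Suc n"] eta_prod_row_sum[of "Suc n"] by (auto simp: nonneg_matrix_def simp del: eta_prod.simps intro!: sum_nonneg)
  have t_meas: "?t n \<in> borel_measurable P" for n by (intro borel_measurable_sum measurable_eta_prod)
  have s_int: "integrable P ?s"
    using s01 s_meas by (intro P.integrable_const_bound[where B = 1]) auto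
  have t_le: "(\<integral>\<omega>. ?t n \<omega> \<partial>P) \<le> (\<integral>\<omega>. ?s \<omega> \<partial>P)" for n
  proof -
    have "(\<integral>\<omega>. ?t n \<omega> \<partial>P) \<le> (\<integral>\<omega>. ?s (shift (- int (Suc n)) \<omega>) \<partial>P)"
    proof (rule integral_mono)
      show "integrable P (?t n)"
        using t01 t_meas by (intro P.integrable_const_bound[where B = 1]) auto
      show "integrable P (\<lambda>\<omega>. ?s (shift (- int (Suc n)) \<omega>))" by (rule integrable_shift[OF s_int])
      fix \<omega>
      show "?t n \<omega> \<le> ?s (shift (- int (Suc n)) \<omega>)"
        unfolding eta_prod.simps row_sum_mult eta_eq[of "- int (Suc n)"]
        using eta_prod_row_sum[of n] nonneg_et
        by (intro sum_mono mult_left_le) (auto simp: nonneg_matrix_def)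
    qed
    also have "\<dots> = (\<integral>\<omega>. ?s \<omega> \<partial>P)" by (rule integral_shift[OF s_meas])
    finally show ?thesis .
  qed
  have "(\<lambda>n. \<integral>\<omega>. ?t n \<omega> \<partial>P) \<longlonglongrightarrow> (\<integral>\<omega>. 1 \<partial>P)"
  proof (rule integral_dominated_convergence[where w = "\<lambda>_. 1"])
    show "AE \<omega> in P. (\<lambda>n. ?t n \<omega>) \<longlonglongrightarrow> 1"
      using pi_limit
    proof eventually_elim
      case (elim \<omega>)
      have "(\<lambda>n. ?t n \<omega>) \<longlonglongrightarrow> (\<Sum>j\<in>UNIV. Pv \<omega> $ j)"
        using elim by (intro tendsto_sum LIMSEQ_Suc) blast
      then show ?case by (simp only: Pv_sum)
    qed
  qed (use t01 t_meas in auto)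
  then have "1 \<le> (\<integral>\<omega>. ?s \<omega> \<partial>P)"
    using t_le by (intro LIMSEQ_le_const2[where X = "\<lambda>n. \<integral>\<omega>. ?t n \<omega> \<partial>P"]) (auto simp: P.prob_space)
  then have "(\<integral>\<omega>. 1 - ?s \<omega> \<partial>P) \<le> 0" using s_int by (simp add: P.prob_space)
  moreover have "0 \<le> (\<integral>\<omega>. 1 - ?s \<omega> \<partial>P)" using s01 by (intro Bochner_Integration.integral_nonneg) simp
  ultimately have "(\<integral>\<omega>. 1 - ?s \<omega> \<partial>P) = 0" by linarith
  moreover have "integrable P (\<lambda>\<omega>. 1 - ?s \<omega>)" using s_int by simp
  ultimately have "AE \<omega> in P. 1 - ?s \<omega> = 0"
    using s01 by (subst (asm) integral_nonneg_eq_0_iff_AE) auto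
  then show "AE \<omega> in P. ?s \<omega> = 1" by eventually_elim simp
qed

lemma eta_prod_shift: "eta_prod p q r (Suc n) (shift 1 \<omega>) = eta_prod p q r n \<omega> ** et \<omega>"
proof (induction n)
  case 0
  have "eta_prod p q r (Suc 0) (shift 1 \<omega>) = et (shift (- 1) (shift 1 \<omega>))"
    by (simp add: eta_eq[of "- 1"])
  then show ?case by simp
next
  case (Suc n)
  have "eta_prod p q r (Suc (Suc n)) (shift 1 \<omega>) =
      et (shift (- int (Suc (Suc n))) (shift 1 \<omega>)) ** eta_prod p q r (Suc n) (shift 1 \<omega>)"
    unfolding eta_prod.simps(2)[of p q r "Suc n"] eta_eq[of "- int (Suc (Suc n))"] ..
  also have "shift (- int (Suc (Suc n))) (shift 1 \<omega>) = shift (- int (Suc n)) \<omega>" by simp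
  also have "et (shift (- int (Suc n)) \<omega>) ** eta_prod p q r (Suc n) (shift 1 \<omega>) =
      eta_prod p q r (Suc n) \<omega> ** et \<omega>"
    unfolding Suc unfolding eta_prod.simps(2) eta_eq[of "- int (Suc n)"] by (simp only: matrix_mul_assoc)
  finally show ?case .
qed

text \<open>This is the limit of the identity \<open>eta_prod_shift\<close>. The limit is the same
  in every row, so an arbitrary one, \<open>undefined\<close>, is used.\<close>

lemma Pv_shift: "AE \<omega> in P. Pv (shift 1 \<omega>) = Pv \<omega> v* et \<omega>"
  using pi_limit AE_shift[OF pi_limit, of 1]
proof eventually_elim
  case (elim \<omega>)
  show ?case
  proof (rule vec_eq_iff[THEN iffD2], rule allI)
    fix j :: 'd and i :: 'd
    have "(\<lambda>n. (eta_prod p q r n \<omega> ** et \<omega>) $ undefined $ j) \<longlonglongrightarrow> (Pv \<omega> v* et \<omega>) $ j"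
    proof -
      have "(\<lambda>n. \<Sum>k\<in>UNIV. eta_prod p q r n \<omega> $ undefined $ k * et \<omega> $ k $ j) \<longlonglongrightarrow>
          (\<Sum>k\<in>UNIV. Pv \<omega> $ k * et \<omega> $ k $ j)"
        using elim(1) by (intro tendsto_sum tendsto_mult tendsto_const) blast
      then show ?thesis by (simp add: matrix_matrix_mult_def vector_matrix_mult_def mult.commute)
    qed
    moreover have "(\<lambda>n. eta_prod p q r (Suc n) (shift 1 \<omega>) $ undefined $ j) \<longlonglongrightarrow> Pv (shift 1 \<omega>) $ j"
      using elim(2) by (intro LIMSEQ_Suc) blast
    ultimately show "Pv (shift 1 \<omega>) $ j = (Pv \<omega> v* et \<omega>) $ j"
      unfolding eta_prod_shift by (rule LIMSEQ_unique[rotated])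
  qed
qed

text \<open>The unit-step equivariance is required simultaneously for all \<open>n\<close> and along
  the whole orbit of \<omega>; induction in both directions on \<open>n\<close> then expresses the
  sequence by the single function \<open>Z\<close>.\<close>

lemma zeta_shift: "AE \<omega> in P. \<forall>n. \<zeta> n \<omega> = Z (shift n \<omega>)"
proof -
  have "AE \<omega> in P. \<forall>n. \<zeta> (n + 1) \<omega> = \<zeta> n (shift 1 \<omega>)"
    unfolding AE_all_countable using zeta by (simp add: zeta_sequence_def)
  from AE_shift_all[OF this] show ?thesis
  proof eventually_elim
    case (elim \<omega>)
    have rel: "\<zeta> (n + 1) (shift k \<omega>) = \<zeta> n (shift (k + 1) \<omega>)" for n k
      using elim[rule_format, of n k] by (simp add: add.commute)
    have "\<forall>k. \<zeta> n (shift k \<omega>) = Z (shift (k + n) \<omega>)" for n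
    proof (induction n rule: int_induct[where k = 0])
      case base
      then show ?case by simp
    next
      case (step1 n)
      show ?case
      proof
        fix k
        show "\<zeta> (n + 1) (shift k \<omega>) = Z (shift (k + (n + 1)) \<omega>)"
          using rel[of n k] step1(2)[rule_format, of "k + 1"] by (simp add: ac_simps)
      qed
    next
      case (step2 n)
      show ?case
      proof
        fix k
        show "\<zeta> (n - 1) (shift k \<omega>) = Z (shift (k + (n - 1)) \<omega>)"
          using rel[of "n - 1" "k - 1"] step2(2)[rule_format, of "k - 1"] by (simp add: algebra_simps)
      qed
    qed
    from this[of _, rule_format, of _ 0] show ?case by simp
  qed
qed

section \<open>Moment conditions and typical environments\<close>

lemma log_inv_gap_finite:
  assumes [measurable]: "g \<in> borel_measurable P" and fin: "(\<integral>\<^sup>+\<omega>. log_inv_gap (g \<omega>) \<partial>P) < \<infinity>"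
    and g0: "AE \<omega> in P. 0 \<le> g \<omega>"
  shows "AE \<omega> in P. g \<omega> < 1" "integrable P (\<lambda>\<omega>. ln (1 / (1 - g \<omega>)))"
proof -
  have m: "(\<lambda>\<omega>. log_inv_gap (g \<omega>)) \<in> borel_measurable P"
    unfolding log_inv_gap_def by measurable
  have "AE \<omega> in P. log_inv_gap (g \<omega>) \<noteq> \<infinity>"
    by (rule nn_integral_PInf_AE[OF m]) (use fin in auto)
  then show lt: "AE \<omega> in P. g \<omega> < 1"
    by eventually_elim (auto simp: log_inv_gap_def split: if_splits)
  have "(\<integral>\<^sup>+\<omega>. ennreal (norm (ln (1 / (1 - g \<omega>)))) \<partial>P) = (\<integral>\<^sup>+\<omega>. log_inv_gap (g \<omega>) \<partial>P)"
  proof (rule nn_integral_cong_AE)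
    show "AE \<omega> in P. ennreal (norm (ln (1 / (1 - g \<omega>)))) = log_inv_gap (g \<omega>)"
      using lt g0
    proof eventually_elim
      case (elim \<omega>)
      then have "1 \<le> 1 / (1 - g \<omega>)" by (simp add: field_simps)
      then have "0 \<le> ln (1 / (1 - g \<omega>))" by (rule ln_ge_zero)
      then show ?case using elim by (simp add: log_inv_gap_def)
    qed
  qed
  then show "integrable P (\<lambda>\<omega>. ln (1 / (1 - g \<omega>)))"
    using fin by (intro integrableI_bounded) auto
qed

lemma opnorm_coef:
  shows measurable_opnorm_rp: "(\<lambda>\<omega>. opnorm (r0 \<omega> + p0 \<omega>)) \<in> borel_measurable P"
    and measurable_opnorm_rq: "(\<lambda>\<omega>. opnorm (r0 \<omega> + q0 \<omega>)) \<in> borel_measurable P"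
    and opnorm_rp_nonneg: "\<omega> \<in> space P \<Longrightarrow> 0 \<le> opnorm (r0 \<omega> + p0 \<omega>)"
    and opnorm_rq_nonneg: "\<omega> \<in> space P \<Longrightarrow> 0 \<le> opnorm (r0 \<omega> + q0 \<omega>)"
  using measurable_coef nonneg_pqr(4-6)
  by (auto intro!: borel_measurable_opnorm opnorm_nonneg nonneg_matrix_add borel_measurable_add)

lemma opnorm_rp: "AE \<omega> in P. opnorm (r0 \<omega> + p0 \<omega>) < 1" "integrable P (\<lambda>\<omega>. ln (1 / (1 - opnorm (r0 \<omega> + p0 \<omega>))))"
  using C opnorm_rp_nonneg by (auto simp: condition_C_def intro!: log_inv_gap_finite measurable_opnorm_rp)

lemma opnorm_rq: "AE \<omega> in P. opnorm (r0 \<omega> + q0 \<omega>) < 1" "integrable P (\<lambda>\<omega>. ln (1 / (1 - opnorm (r0 \<omega> + q0 \<omega>))))"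
  using C opnorm_rq_nonneg by (auto simp: condition_C_def intro!: log_inv_gap_finite measurable_opnorm_rq)

text \<open>The properties of a typical environment at the origin, without the identification of
  \<open>\<zeta>\<close> and \<open>\<eta>\<close>.\<close>

definition zeta_ok :: "'s env \<Rightarrow> bool" where
  "zeta_ok \<omega> \<longleftrightarrow> Z \<omega> = Ga \<omega> ** p0 \<omega> \<and> (\<forall>n. \<zeta> n \<omega> = Z (shift n \<omega>))"

definition good0 :: "'s env \<Rightarrow> bool" where
  "good0 \<omega> \<longleftrightarrow> \<omega> \<in> space P \<and> stochastic (Z \<omega>) \<and> zeta_ok \<omega> \<and>
     opnorm (r0 \<omega> + p0 \<omega>) < 1 \<and> opnorm (r0 \<omega> + q0 \<omega>) < 1 \<and>
     (\<forall>j. 0 < (\<Sum>i\<in>UNIV. q0 \<omega> $ i $ j)) \<and> (\<forall>i j. 0 < et \<omega> $ i $ j) \<and> (\<forall>i. (\<Sum>j\<in>UNIV. et \<omega> $ i $ j) = 1) \<and>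
     Pv (shift 1 \<omega>) = Pv \<omega> v* et \<omega> \<and>
     (\<forall>i j. (\<lambda>n. eta_prod p q r n \<omega> $ i $ j) \<longlonglongrightarrow> Pv \<omega> $ j)"

lemma AE_good0: "AE \<omega> in P. \<forall>k. good0 (shift k \<omega>)"
proof (rule AE_shift_all)
  have 1: "AE \<omega> in P. stochastic (Z \<omega>)" and 2: "AE \<omega> in P. Z \<omega> = gamma q r \<zeta> 0 \<omega> ** p0 \<omega>"
    using zeta by (auto simp: zeta_sequence_def)
  have 3: "AE \<omega> in P. \<forall>j. 0 < (\<Sum>i\<in>UNIV. q0 \<omega> $ i $ j) \<and> 0 < (\<Sum>i\<in>UNIV. p0 \<omega> $ i $ j)"
    unfolding AE_all_countable using C by (simp add: condition_C_def)
  have 4: "AE \<omega> in P. \<forall>i j. 0 < et \<omega> $ i $ j"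
    unfolding AE_all_countable using C by (simp add: condition_C_def)
  from 1 2 3 4 opnorm_rp(1) opnorm_rq(1) et_row_sum Pv_shift zeta_shift pi_limit AE_space
  show "AE \<omega> in P. good0 \<omega>"
  proof eventually_elim
    case (elim \<omega>)
    have "\<zeta> (0 - 1) \<omega> = Z (shift (- 1) \<omega>)" using elim(9)[rule_format, of "- 1"] by simp
    then have "gamma q r \<zeta> 0 \<omega> = Ga \<omega>"
      unfolding gamma_def Ga_def M_def by (simp only: diff_diff_eq)
    then have "zeta_ok \<omega>" using elim(2,9) unfolding zeta_ok_def by metis
    then show ?case using elim unfolding good0_def by blast
  qed
qed

text \<open>Multiplying \<open>q\<close> by a stochastic matrix keeps its row sums, so the rows of
  \<open>M\<close> have the sums of \<open>r + q\<close>, which are below one by the moment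
  condition. Since \<open>p + q + r\<close> is stochastic, the gaps of \<open>r + p\<close> and
  \<open>r + q\<close> bound the row sums of \<open>q\<close> and \<open>p\<close> from
  below.\<close>

lemma coef_rows:
  assumes "good0 \<omega>" and "stochastic (Z (shift (- 1) \<omega>))"
  shows M_nonneg: "nonneg_matrix (M \<omega>)"
    and M_row_sum: "(\<Sum>j\<in>UNIV. M \<omega> $ i $ j) \<le> opnorm (r0 \<omega> + q0 \<omega>)"
    and q_row_sum: "1 - opnorm (r0 \<omega> + p0 \<omega>) \<le> (\<Sum>j\<in>UNIV. q0 \<omega> $ i $ j)"
    and p_row_sum: "0 < (\<Sum>j\<in>UNIV. p0 \<omega> $ i $ j)"
proof -
  have \<omega>: "\<omega> \<in> space P" using assms by (simp add: good0_def)
  note nn = nonneg_pqr(4-6)[OF \<omega>]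
  have Zs: "nonneg_matrix (Z (shift (- 1) \<omega>))" "\<And>i. (\<Sum>j\<in>UNIV. Z (shift (- 1) \<omega>) $ i $ j) = 1"
    using assms by (auto simp: stochastic_def)
  show "nonneg_matrix (M \<omega>)"
    unfolding M_def by (intro nonneg_matrix_add nonneg_matrix_mult nn Zs)
  have "(\<Sum>j\<in>UNIV. M \<omega> $ i $ j) = (\<Sum>j\<in>UNIV. (r0 \<omega> + q0 \<omega>) $ i $ j)"
    unfolding M_def vector_add_component sum.distrib row_sum_mult Zs by simp
  then show "(\<Sum>j\<in>UNIV. M \<omega> $ i $ j) \<le> opnorm (r0 \<omega> + q0 \<omega>)"
    using row_sum_le_opnorm[where A = "r0 \<omega> + q0 \<omega>" and i = i] by simp
  show "1 - opnorm (r0 \<omega> + p0 \<omega>) \<le> (\<Sum>j\<in>UNIV. q0 \<omega> $ i $ j)"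
    using row_sum_le_opnorm[where A = "r0 \<omega> + p0 \<omega>" and i = i] row_sum_pqr[OF \<omega>, of 0 i] by (simp add: sum.distrib)
  have "opnorm (r0 \<omega> + q0 \<omega>) < 1" using assms by (simp add: good0_def)
  then show "0 < (\<Sum>j\<in>UNIV. p0 \<omega> $ i $ j)"
    using row_sum_le_opnorm[where A = "r0 \<omega> + q0 \<omega>" and i = i] row_sum_pqr[OF \<omega>, of 0 i] by (simp add: sum.distrib)
qed

text \<open>The matrix \<open>M\<close> is the kernel of the next visit to level 0 without a step
  up, by staying or through an excursion to the left that \<zeta> returns; \<open>Ga\<close> counts
  the visits produced by it.\<close>

lemma Ga_inverse:
  assumes "good0 \<omega>" and "stochastic (Z (shift (- 1) \<omega>))"
  shows Ga_left: "Ga \<omega> ** (mat 1 - M \<omega>) = mat 1" and Ga_right: "(mat 1 - M \<omega>) ** Ga \<omega> = mat 1"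
    and Ga_nonneg: "nonneg_matrix (Ga \<omega>)" and Ga_ge_1: "nonneg_matrix (Ga \<omega> - mat 1)"
    and Ga_row_sum: "(\<Sum>j\<in>UNIV. Ga \<omega> $ i $ j) \<le> 1 / (1 - opnorm (r0 \<omega> + q0 \<omega>))"
proof -
  have "opnorm (r0 \<omega> + q0 \<omega>) < 1" using assms by (simp add: good0_def)
  from matrix_inv_one_minus[OF M_nonneg[OF assms] this M_row_sum[OF assms]]
  show "Ga \<omega> ** (mat 1 - M \<omega>) = mat 1" "(mat 1 - M \<omega>) ** Ga \<omega> = mat 1"
    "nonneg_matrix (Ga \<omega>)" "nonneg_matrix (Ga \<omega> - mat 1)"
    "(\<Sum>j\<in>UNIV. Ga \<omega> $ i $ j) \<le> 1 / (1 - opnorm (r0 \<omega> + q0 \<omega>))"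
    unfolding Ga_def by auto
qed

section \<open>Identification of \<zeta> with \<eta>\<close>

lemma Z_harmonic:
  assumes "good0 \<omega>" and "stochastic (Z (shift (- 1) \<omega>))"
  shows "Z \<omega> = p0 \<omega> + r0 \<omega> ** Z \<omega> + q0 \<omega> ** (Z (shift (- 1) \<omega>) ** Z \<omega>)"
proof -
  have Z: "Z \<omega> = Ga \<omega> ** p0 \<omega>" using assms unfolding good0_def zeta_ok_def by blast
  have "(mat 1 - M \<omega>) ** Z \<omega> = p0 \<omega>"
    by (subst Z) (simp add: matrix_mul_assoc Ga_right[OF assms])
  moreover have "(mat 1 - M \<omega>) ** Z \<omega> = Z \<omega> - M \<omega> ** Z \<omega>"
    by (simp add: vec_eq_iff matrix_matrix_mult_def left_diff_distrib sum_subtractf mat_def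
        if_distrib[of "\<lambda>x. x * _"] cong: if_cong)
  moreover have "M \<omega> ** Z \<omega> = q0 \<omega> ** (Z (shift (- 1) \<omega>) ** Z \<omega>) + r0 \<omega> ** Z \<omega>"
    by (simp add: M_def matrix_mult_add_left matrix_mul_assoc)
  ultimately show ?thesis by (simp add: algebra_simps)
qed

text \<open>The products of the \<zeta> over the sites \<open>- m\<close> to 0 solve the first-step
  equations for reaching level 1 from level \<open>- m\<close>. Minimality gives \<eta> \<le>
  \<zeta> entrywise; as both have row sums one, they coincide.\<close>

lemma et_eq_Z:
  assumes good: "\<And>k. good0 (shift k \<omega>)"
  shows "et \<omega> = Z \<omega>"
proof -
  have g: "good0 \<omega>" using good[of 0] by simp
  have st: "stochastic (Z (shift k \<omega>))" for k using good[of k] by (simp add: good0_def)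
  define U where "U = rec_nat (Z \<omega>) (\<lambda>m V. Z (shift (- int (Suc m)) \<omega>) ** V)"
  have U0: "U 0 = Z \<omega>" and US: "U (Suc m) = Z (shift (- int (Suc m)) \<omega>) ** U m" for m
    by (simp_all add: U_def)
  have nn: "nonneg_matrix (U m)" for m
    using st[of 0] st by (induction m) (auto simp: U0 US stochastic_def intro: nonneg_matrix_mult simp del: of_nat_Suc)
  have harm: "Z (shift k \<omega>) = p (\<omega> k) + r (\<omega> k) ** Z (shift k \<omega>) + q (\<omega> k) ** (Z (shift (k - 1) \<omega>) ** Z (shift k \<omega>))" for k
    using Z_harmonic[OF good[of k]] st[of "k - 1"] by (simp add: shift_apply)
  have le: "et \<omega> $ i $ j \<le> U 0 $ i $ j" for i j
  proof (rule et_le_harmonic[OF _ nn])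
    show "\<omega> \<in> space P" using g by (simp add: good0_def)
    show "U 0 = p (\<omega> 0) + r (\<omega> 0) ** U 0 + q (\<omega> 0) ** U 1"
      using harm[of 0] US[of 0] by (simp add: U0)
    fix m
    let ?k = "- int (Suc m)"
    have "?k - 1 = - int (Suc (Suc m))" by simp
    then have "U (Suc (Suc m)) = Z (shift (?k - 1) \<omega>) ** U (Suc m)" using US[of "Suc m"] by (simp only:)
    then have "p (\<omega> ?k) ** U m + r (\<omega> ?k) ** U (Suc m) + q (\<omega> ?k) ** U (Suc (Suc m)) =
      (p (\<omega> ?k) + r (\<omega> ?k) ** Z (shift ?k \<omega>) + q (\<omega> ?k) ** (Z (shift (?k - 1) \<omega>) ** Z (shift ?k \<omega>))) ** U m"
      by (simp only: US[of m] matrix_mult_add_left matrix_mul_assoc)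
    also have "\<dots> = U (Suc m)" unfolding harm[symmetric] by (rule US[symmetric])
    finally show "U (Suc m) = p (\<omega> ?k) ** U m + r (\<omega> ?k) ** U (Suc m) + q (\<omega> ?k) ** U (Suc (Suc m))"
      by (rule sym)
  qed
  show ?thesis
  proof (intro vec_eq_iff[THEN iffD2] allI)
    fix i j
    have "(\<Sum>j\<in>UNIV. Z \<omega> $ i $ j - et \<omega> $ i $ j) = 0"
      using g by (simp add: good0_def stochastic_def sum_subtractf)
    moreover have "0 \<le> Z \<omega> $ i $ j - et \<omega> $ i $ j" for j using le by (simp add: U0)
    ultimately have "Z \<omega> $ i $ j - et \<omega> $ i $ j = 0" by (simp add: sum_nonneg_eq_0_iff)
    then show "et \<omega> $ i $ j = Z \<omega> $ i $ j" by simp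
  qed
qed

definition good :: "'s env \<Rightarrow> bool" where
  "good \<omega> \<longleftrightarrow> (\<forall>k. good0 (shift k \<omega>))"

lemma AE_good: "AE \<omega> in P. good \<omega>"
  unfolding good_def by (rule AE_good0)

lemma good_shift: "good \<omega> \<Longrightarrow> good (shift k \<omega>)"
  by (simp add: good_def)

lemma goodD:
  assumes "good \<omega>"
  shows good_good0: "good0 \<omega>" and good_Z_prev: "stochastic (Z (shift (- 1) \<omega>))"
    and good_space: "\<omega> \<in> space P"
    and good_Z: "stochastic (Z \<omega>)" "nonneg_matrix (Z \<omega>)" "(\<Sum>j\<in>UNIV. Z \<omega> $ i $ j) = 1"
    and good_et: "et \<omega> = Z \<omega>" and good_Pv: "Pv (shift 1 \<omega>) = Pv \<omega> v* Z \<omega>"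
    and good_Z_eq: "Z \<omega> = Ga \<omega> ** p0 \<omega>"
    and good_q_pos: "0 < (\<Sum>i\<in>UNIV. q0 \<omega> $ i $ j)"
    and good_Pv_pos: "0 < Pv \<omega> $ j"
proof -
  have g: "good0 (shift k \<omega>)" for k using assms by (simp add: good_def)
  show g0: "good0 \<omega>" using g[of 0] by simp
  show "stochastic (Z (shift (- 1) \<omega>))" using g[of "- 1"] by (simp add: good0_def)
  show "\<omega> \<in> space P" "stochastic (Z \<omega>)" "nonneg_matrix (Z \<omega>)" "(\<Sum>j\<in>UNIV. Z \<omega> $ i $ j) = 1"
    "0 < (\<Sum>i\<in>UNIV. q0 \<omega> $ i $ j)"
    using g0 by (auto simp: good0_def stochastic_def)
  show "Z \<omega> = Ga \<omega> ** p0 \<omega>" using g0 unfolding good0_def zeta_ok_def by blast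
  show e: "et \<omega> = Z \<omega>" by (rule et_eq_Z[OF g])
  show "Pv (shift 1 \<omega>) = Pv \<omega> v* Z \<omega>" using g0 by (simp add: good0_def e)
  show "0 < Pv \<omega> $ j"
  proof -
    \<comment> \<open>Invariance writes \<pi> as the image of the \<pi> of the previous site under a
      matrix with strictly positive entries; one positive coordinate there suffices.\<close>
    let ?w = "shift (- 1) \<omega>"
    have "Pv \<omega> = Pv ?w v* et ?w" "\<And>i j. 0 < et ?w $ i $ j"
      using g[of "- 1"] by (simp_all add: good0_def)
    moreover obtain i where "0 < Pv ?w $ i"
    proof -
      have "\<exists>i. Pv ?w $ i \<noteq> 0"
      proof (rule ccontr)
        assume "\<not> ?thesis"
        then have "(\<Sum>i\<in>UNIV. Pv ?w $ i) = 0" by simp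
        then show False using Pv_sum[of ?w] by simp
      qed
      then show ?thesis using that Pv_nonneg[of ?w] by (metis less_eq_real_def)
    qed
    ultimately show ?thesis
      by (auto simp: vector_matrix_mult_def Pv_nonneg less_imp_le intro!: sum_pos2[of _ i])
  qed
qed

section \<open>The contraction by the products of the \<open>a_n\<close>\<close>

text \<open>The inverse dominates the identity, so the rows of \<open>A\<close> are at least those
  of \<open>q\<close>; above, the row sums of \<open>q\<close> are at most one and those of
  \<open>Ga\<close> are controlled by the gap. The two-sided bound keeps the logarithms of the norms
  integrable.\<close>

lemma A_rows:
  assumes "good \<omega>"
  shows A_nonneg: "nonneg_matrix (A \<omega>)"
    and A_lower: "1 - opnorm (r0 \<omega> + p0 \<omega>) \<le> (\<Sum>j\<in>UNIV. A \<omega> $ i $ j)"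
    and A_upper: "(\<Sum>j\<in>UNIV. A \<omega> $ i $ j) \<le> 1 / (1 - opnorm (r0 \<omega> + q0 \<omega>))"
proof -
  note g = good_good0[OF assms] good_Z_prev[OF assms]
  note nn = nonneg_pqr(4-6)[OF good_space[OF assms]]
  show "nonneg_matrix (A \<omega>)"
    unfolding A_def by (intro nonneg_matrix_mult Ga_nonneg[OF g] nn)
  have q1: "(\<Sum>j\<in>UNIV. q0 \<omega> $ k $ j) \<le> 1" for k
  proof -
    have "0 \<le> (\<Sum>j\<in>UNIV. p0 \<omega> $ k $ j)" "0 \<le> (\<Sum>j\<in>UNIV. r0 \<omega> $ k $ j)"
      using nn by (auto simp: nonneg_matrix_def intro!: sum_nonneg)
    then show ?thesis using row_sum_pqr[OF good_space[OF assms], of 0 k] by linarith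
  qed
  have q0': "0 \<le> (\<Sum>j\<in>UNIV. q0 \<omega> $ k $ j)" for k
    using nn by (auto simp: nonneg_matrix_def intro!: sum_nonneg)
  have Gn: "0 \<le> Ga \<omega> $ i $ k" for i k using Ga_nonneg[OF g] by (simp add: nonneg_matrix_def)
  have A1: "(\<Sum>j\<in>UNIV. A \<omega> $ i $ j) = (\<Sum>k\<in>UNIV. Ga \<omega> $ i $ k * (\<Sum>j\<in>UNIV. q0 \<omega> $ k $ j))"
    unfolding A_def by (rule row_sum_mult)
  also have "\<dots> \<le> (\<Sum>k\<in>UNIV. Ga \<omega> $ i $ k)"
    by (intro sum_mono mult_left_le q1 Gn)
  also have "\<dots> \<le> 1 / (1 - opnorm (r0 \<omega> + q0 \<omega>))" by (rule Ga_row_sum[OF g])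
  finally show "(\<Sum>j\<in>UNIV. A \<omega> $ i $ j) \<le> 1 / (1 - opnorm (r0 \<omega> + q0 \<omega>))" .
  have "0 \<le> (Ga \<omega> - mat 1) $ i $ i" using Ga_ge_1[OF g] unfolding nonneg_matrix_def by blast
  then have "1 \<le> Ga \<omega> $ i $ i" by (simp add: mat_def)
  then have "(\<Sum>j\<in>UNIV. q0 \<omega> $ i $ j) \<le> Ga \<omega> $ i $ i * (\<Sum>j\<in>UNIV. q0 \<omega> $ i $ j)"
    using q0'[of i] by (simp add: mult_le_cancel_right1)
  also have "\<dots> \<le> (\<Sum>k\<in>UNIV. Ga \<omega> $ i $ k * (\<Sum>j\<in>UNIV. q0 \<omega> $ k $ j))"
    by (rule member_le_sum[where f = "\<lambda>k. Ga \<omega> $ i $ k * (\<Sum>j\<in>UNIV. q0 \<omega> $ k $ j)"])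
       (auto intro!: mult_nonneg_nonneg Gn q0')
  finally show "1 - opnorm (r0 \<omega> + p0 \<omega>) \<le> (\<Sum>j\<in>UNIV. A \<omega> $ i $ j)"
    unfolding A1[symmetric] using q_row_sum[OF g, of i] by linarith
qed

text \<open>The cocycle form of \<open>a_prod\<close>, built from shifts of the single function
  \<open>A\<close> so that stationarity applies; the two agree on good environments.\<close>

primrec ap :: "nat \<Rightarrow> 's env \<Rightarrow> 'd mat" where
  "ap 0 \<omega> = mat 1"
| "ap (Suc n) \<omega> = A (shift (int (Suc n)) \<omega>) ** ap n \<omega>"

lemma measurable_ap: "(\<lambda>\<omega>. ap n \<omega> $ i $ j) \<in> borel_measurable P"
proof (induction n arbitrary: i j)
  case (Suc n)
  then show ?case unfolding ap.simps
    by (intro borel_measurable_mat_mult measurable_shift_compose[where f = "\<lambda>\<omega>. A \<omega> $ _ $ _"] measurable_A)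
qed simp

lemma measurable_a_prod: "(\<lambda>\<omega>. a_prod q r \<zeta> n \<omega> $ i $ j) \<in> borel_measurable P"
proof (induction n arbitrary: i j)
  case (Suc n)
  have "(\<lambda>\<omega>. gamma q r \<zeta> k \<omega> $ i $ j) \<in> borel_measurable P" for k i j
    unfolding gamma_def
    by (intro borel_measurable_matrix_inv)
       (auto simp only: vector_minus_component intro!: borel_measurable_diff borel_measurable_mat_mult
         measurable_coef measurable_zeta borel_measurable_const)
  with Suc show ?case unfolding a_prod.simps
    by (intro borel_measurable_mat_mult measurable_coef)
qed simp

lemma a_prod_eq_ap:
  assumes "good \<omega>"
  shows "a_prod q r \<zeta> n \<omega> = ap n \<omega>"
proof (induction n)
  case (Suc n)
  have "gamma q r \<zeta> k \<omega> ** q (\<omega> k) = A (shift k \<omega>)" for k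
  proof -
    have "\<zeta> (k - 1) \<omega> = Z (shift (k - 1) \<omega>)" using good_good0[OF assms] unfolding good0_def zeta_ok_def by blast
    then show ?thesis by (simp add: gamma_def A_def Ga_def M_def diff_diff_eq shift_apply)
  qed
  then show ?case using Suc by simp
qed simp

lemma ap_add: "ap (m + n) \<omega> = ap n (shift (int m) \<omega>) ** ap m \<omega>"
proof (induction n)
  case (Suc n)
  have "shift (int (Suc (m + n))) \<omega> = shift (int (Suc n)) (shift (int m) \<omega>)" by (simp add: ac_simps)
  then show ?case using Suc by (simp add: matrix_mul_assoc)
qed simp

lemma ap_rows:
  assumes "good \<omega>"
  shows ap_nonneg: "nonneg_matrix (ap n \<omega>)"
    and ap_lower: "(\<Prod>k\<in>{1..n}. 1 - opnorm (r0 (shift (int k) \<omega>) + p0 (shift (int k) \<omega>))) \<le> (\<Sum>j\<in>UNIV. ap n \<omega> $ i $ j)"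
    and ap_upper: "(\<Sum>j\<in>UNIV. ap n \<omega> $ i $ j) \<le> (\<Prod>k\<in>{1..n}. 1 / (1 - opnorm (r0 (shift (int k) \<omega>) + q0 (shift (int k) \<omega>))))"
proof -
  let ?l = "\<lambda>\<omega>. 1 - opnorm (r0 \<omega> + p0 \<omega>)" and ?u = "\<lambda>\<omega>. 1 / (1 - opnorm (r0 \<omega> + q0 \<omega>))"
  have gk: "good (shift k \<omega>)" for k using assms by (rule good_shift)
  have lu: "0 < ?l (shift k \<omega>)" "0 < ?u (shift k \<omega>)" for k
    using good_good0[OF gk[of k]] by (auto simp: good0_def)
  have nn: "nonneg_matrix (ap n \<omega>)" for n
    by (induction n) (auto simp: nonneg_mat_1 simp del: of_nat_Suc intro!: nonneg_matrix_mult A_nonneg gk)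
  then show "nonneg_matrix (ap n \<omega>)" .
  have "(\<Prod>k\<in>{1..n}. ?l (shift (int k) \<omega>)) \<le> (\<Sum>j\<in>UNIV. ap n \<omega> $ i $ j) \<and>
      (\<Sum>j\<in>UNIV. ap n \<omega> $ i $ j) \<le> (\<Prod>k\<in>{1..n}. ?u (shift (int k) \<omega>))" for i
  proof (induction n arbitrary: i)
    case 0
    then show ?case by (simp add: mat_def)
  next
    case (Suc n)
    let ?A = "A (shift (int (Suc n)) \<omega>)"
    let ?L = "\<Prod>k\<in>{1..n}. ?l (shift (int k) \<omega>)" and ?U = "\<Prod>k\<in>{1..n}. ?u (shift (int k) \<omega>)"
    have An: "0 \<le> ?A $ i $ k" for i k using A_nonneg[OF gk] by (simp add: nonneg_matrix_def)
    have L0: "0 \<le> ?L" and U0: "0 \<le> ?U" by (intro prod_nonneg less_imp_le lu)+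
    have e: "(\<Sum>j\<in>UNIV. ap (Suc n) \<omega> $ i $ j) = (\<Sum>k\<in>UNIV. ?A $ i $ k * (\<Sum>j\<in>UNIV. ap n \<omega> $ k $ j))"
      unfolding ap.simps by (rule row_sum_mult)
    have "?l (shift (int (Suc n)) \<omega>) * ?L \<le> (\<Sum>k\<in>UNIV. ?A $ i $ k) * ?L"
      by (intro mult_right_mono A_lower gk L0)
    also have "\<dots> \<le> (\<Sum>j\<in>UNIV. ap (Suc n) \<omega> $ i $ j)"
      unfolding e sum_distrib_right using Suc An by (intro sum_mono mult_left_mono) auto
    finally have 1: "?l (shift (int (Suc n)) \<omega>) * ?L \<le> (\<Sum>j\<in>UNIV. ap (Suc n) \<omega> $ i $ j)" .
    have "(\<Sum>j\<in>UNIV. ap (Suc n) \<omega> $ i $ j) \<le> (\<Sum>k\<in>UNIV. ?A $ i $ k) * ?U"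
      unfolding e sum_distrib_right using Suc An by (intro sum_mono mult_left_mono) auto
    also have "\<dots> \<le> ?u (shift (int (Suc n)) \<omega>) * ?U"
      by (intro mult_right_mono A_upper gk U0)
    finally have 2: "(\<Sum>j\<in>UNIV. ap (Suc n) \<omega> $ i $ j) \<le> ?u (shift (int (Suc n)) \<omega>) * ?U" .
    have "{1..Suc n} = insert (Suc n) {1..n}" by auto
    then show ?case using 1 2 by (simp only: prod.insert finite_atLeastAtMost atLeastAtMost_iff) simp
  qed
  then show "(\<Prod>k\<in>{1..n}. ?l (shift (int k) \<omega>)) \<le> (\<Sum>j\<in>UNIV. ap n \<omega> $ i $ j)"
    "(\<Sum>j\<in>UNIV. ap n \<omega> $ i $ j) \<le> (\<Prod>k\<in>{1..n}. ?u (shift (int k) \<omega>))" by auto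
qed

text \<open>The product bounds on the row sums become additive under the logarithm, with the
  integrands of the two moment conditions as summands.\<close>

lemma opnorm_ap:
  assumes "good \<omega>"
  shows opnorm_ap_pos: "0 < opnorm (ap n \<omega>)"
    and ln_opnorm_ap_bound: "\<bar>ln (opnorm (ap n \<omega>))\<bar> \<le>
      (\<Sum>k\<in>{1..n}. ln (1 / (1 - opnorm (r0 (shift (int k) \<omega>) + p0 (shift (int k) \<omega>))))
        + ln (1 / (1 - opnorm (r0 (shift (int k) \<omega>) + q0 (shift (int k) \<omega>)))))"
proof -
  let ?l = "\<lambda>k. 1 - opnorm (r0 (shift (int k) \<omega>) + p0 (shift (int k) \<omega>))"
  let ?u = "\<lambda>k. 1 / (1 - opnorm (r0 (shift (int k) \<omega>) + q0 (shift (int k) \<omega>)))"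
  have g: "good0 (shift k \<omega>)" for k using assms by (simp add: good_def)
  have l: "0 < ?l k" "?l k \<le> 1" and u: "1 \<le> ?u k" for k
    using g[of "int k"] opnorm_rp_nonneg[of "shift (int k) \<omega>"] opnorm_rq_nonneg[of "shift (int k) \<omega>"]
    by (auto simp: good0_def field_simps)
  have lo: "(\<Prod>k\<in>{1..n}. ?l k) \<le> opnorm (ap n \<omega>)"
    using ap_lower[OF assms, of n] row_sum_le_opnorm[of "ap n \<omega>"] order_trans by blast
  have up: "opnorm (ap n \<omega>) \<le> (\<Prod>k\<in>{1..n}. ?u k)"
    by (rule opnorm_le[OF ap_nonneg[OF assms] ap_upper[OF assms]])
  have pos: "0 < (\<Prod>k\<in>{1..n}. ?l k)" using l by (intro prod_pos) auto
  then show o: "0 < opnorm (ap n \<omega>)" using lo by linarith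
  have "ln (opnorm (ap n \<omega>)) \<le> ln (\<Prod>k\<in>{1..n}. ?u k)" using up o by (subst ln_le_cancel_iff) auto
  also have "\<dots> = (\<Sum>k\<in>{1..n}. ln (?u k))" 
    by (rule ln_prod[OF finite_atLeastAtMost]) (metis not_one_le_zero u)
  finally have 1: "ln (opnorm (ap n \<omega>)) \<le> (\<Sum>k\<in>{1..n}. ln (?u k))" .
  have "(\<Sum>k\<in>{1..n}. ln (?l k)) = ln (\<Prod>k\<in>{1..n}. ?l k)" by (rule ln_prod[OF finite_atLeastAtMost, symmetric]) (metis less_irrefl l(1))
  also have "\<dots> \<le> ln (opnorm (ap n \<omega>))" using lo pos by (subst ln_le_cancel_iff) auto
  finally have "- ln (opnorm (ap n \<omega>)) \<le> - (\<Sum>k\<in>{1..n}. ln (?l k))" by simp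
  also have "- (\<Sum>k\<in>{1..n}. ln (?l k)) = (\<Sum>k\<in>{1..n}. ln (1 / ?l k))"
  proof -
    have "ln (1 / ?l k) = - ln (?l k)" for k
      by (metis ln_inverse inverse_eq_divide l(1))
    then show ?thesis by (simp only: sum_negf)
  qed
  finally have 2: "- ln (opnorm (ap n \<omega>)) \<le> (\<Sum>k\<in>{1..n}. ln (1 / ?l k))" .
  have "0 \<le> (\<Sum>k\<in>{1..n}. ln (?u k))" using u by (intro sum_nonneg ln_ge_zero) auto
  moreover have "0 \<le> (\<Sum>k\<in>{1..n}. ln (1 / ?l k))"
    using l by (intro sum_nonneg ln_ge_zero) (simp add: field_simps)
  ultimately show "\<bar>ln (opnorm (ap n \<omega>))\<bar> \<le> (\<Sum>k\<in>{1..n}. ln (1 / ?l k) + ln (?u k))"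
    using 1 2 unfolding sum.distrib abs_le_iff by linarith
qed

lemma integrable_ln_ap: "integrable P (\<lambda>\<omega>. ln (opnorm (ap n \<omega>)))"
proof (rule Bochner_Integration.integrable_bound)
  let ?b = "\<lambda>\<omega>. ln (1 / (1 - opnorm (r0 \<omega> + p0 \<omega>))) + ln (1 / (1 - opnorm (r0 \<omega> + q0 \<omega>)))"
  have "integrable P ?b" using opnorm_rp(2) opnorm_rq(2) by (rule Bochner_Integration.integrable_add)
  then show "integrable P (\<lambda>\<omega>. \<Sum>k\<in>{1..n}. ?b (shift (int k) \<omega>))"
    by (intro Bochner_Integration.integrable_sum integrable_shift)
  show "(\<lambda>\<omega>. ln (opnorm (ap n \<omega>))) \<in> borel_measurable P"
    by (intro borel_measurable_ln borel_measurable_opnorm measurable_ap)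
  show "AE \<omega> in P. norm (ln (opnorm (ap n \<omega>))) \<le> norm (\<Sum>k\<in>{1..n}. ?b (shift (int k) \<omega>))"
    using AE_good
  proof eventually_elim
    case (elim \<omega>)
    show ?case using ln_opnorm_ap_bound[OF elim, of n] unfolding real_norm_def by linarith
  qed
qed

text \<open>The norms are submultiplicative along the cocycle, so by stationarity the means of their
  logarithms are subadditive. The negative limit then yields one block with negative mean, which is
  all that the contraction argument uses.\<close>

lemma exists_contracting: "\<exists>N>0. (\<integral>\<omega>. ln (opnorm (ap N \<omega>)) \<partial>P) < 0"
proof (rule subadditive_exists_negative)
  have "lyapunov P q r \<zeta> = lim (\<lambda>n. 1 / real n * (\<integral>\<omega>. ln (opnorm (ap n \<omega>)) \<partial>P))"
  proof -
    have "(\<integral>\<omega>. ln (opnorm (a_prod q r \<zeta> n \<omega>)) \<partial>P) = (\<integral>\<omega>. ln (opnorm (ap n \<omega>)) \<partial>P)" for n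
    proof (rule integral_cong_AE)
      show "AE \<omega> in P. ln (opnorm (a_prod q r \<zeta> n \<omega>)) = ln (opnorm (ap n \<omega>))"
        using AE_good by eventually_elim (simp add: a_prod_eq_ap)
    qed (intro borel_measurable_ln borel_measurable_opnorm measurable_ap measurable_a_prod)+
    then show ?thesis by (simp add: lyapunov_def)
  qed
  then show "lim (\<lambda>n. 1 / real n * (\<integral>\<omega>. ln (opnorm (ap n \<omega>)) \<partial>P)) < 0"
    using D by (simp add: condition_D_def)
  fix m n
  have "(\<integral>\<omega>. ln (opnorm (ap (m + n) \<omega>)) \<partial>P) \<le>
      (\<integral>\<omega>. ln (opnorm (ap m \<omega>)) + ln (opnorm (ap n (shift (int m) \<omega>))) \<partial>P)"
  proof (rule integral_mono_AE)
    show "integrable P (\<lambda>\<omega>. ln (opnorm (ap m \<omega>)) + ln (opnorm (ap n (shift (int m) \<omega>))))"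
      by (intro Bochner_Integration.integrable_add integrable_ln_ap integrable_shift[OF integrable_ln_ap])
    show "AE \<omega> in P. ln (opnorm (ap (m + n) \<omega>)) \<le> ln (opnorm (ap m \<omega>)) + ln (opnorm (ap n (shift (int m) \<omega>)))"
      using AE_good
    proof eventually_elim
      case (elim \<omega>)
      note g = good_shift[OF elim, of "int m"]
      have "opnorm (ap (m + n) \<omega>) \<le> opnorm (ap n (shift (int m) \<omega>)) * opnorm (ap m \<omega>)"
        unfolding ap_add by (intro opnorm_mult_le ap_nonneg elim g)
      then have "ln (opnorm (ap (m + n) \<omega>)) \<le> ln (opnorm (ap n (shift (int m) \<omega>)) * opnorm (ap m \<omega>))"
        using opnorm_ap_pos[OF elim] opnorm_ap_pos[OF g] by (subst ln_le_cancel_iff) auto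
      also have "\<dots> = ln (opnorm (ap n (shift (int m) \<omega>))) + ln (opnorm (ap m \<omega>))"
        using opnorm_ap_pos[OF elim] opnorm_ap_pos[OF g] by (intro ln_mult_pos) auto
      finally show ?case by simp
    qed
  qed (rule integrable_ln_ap)
  also have "\<dots> = (\<integral>\<omega>. ln (opnorm (ap m \<omega>)) \<partial>P) + (\<integral>\<omega>. ln (opnorm (ap n \<omega>)) \<partial>P)"
    using integral_shift[of "\<lambda>\<omega>. ln (opnorm (ap n \<omega>))" "int m"] integrable_ln_ap integrable_shift[OF integrable_ln_ap]
    by simp
  finally show "(\<integral>\<omega>. ln (opnorm (ap (m + n) \<omega>)) \<partial>P) \<le>
    (\<integral>\<omega>. ln (opnorm (ap m \<omega>)) \<partial>P) + (\<integral>\<omega>. ln (opnorm (ap n \<omega>)) \<partial>P)" .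
qed

text \<open>A nonzero solution would, by ergodicity, vanish nowhere, and the logarithm of its mass would have
  stationary increments over blocks of length \<open>N\<close> with a strict drift.\<close>

lemma subsolution_vanishes:
  fixes Dv :: "'s env \<Rightarrow> real^'d"
  assumes meas: "\<And>j. (\<lambda>\<omega>. Dv \<omega> $ j) \<in> borel_measurable P"
    and nn: "AE \<omega> in P. \<forall>j. 0 \<le> Dv \<omega> $ j"
    and le: "AE \<omega> in P. \<forall>j. Dv \<omega> $ j \<le> (Dv (shift 1 \<omega>) v* A \<omega>) $ j"
  shows "AE \<omega> in P. Dv \<omega> = 0"
proof -
  let ?d = "\<lambda>\<omega>. \<Sum>j\<in>UNIV. Dv \<omega> $ j"
  have d_meas [measurable]: "?d \<in> borel_measurable P" by (intro borel_measurable_sum meas)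
  have all: "AE \<omega> in P. \<forall>k. good (shift k \<omega>) \<and> (\<forall>j. 0 \<le> Dv (shift k \<omega>) $ j) \<and>
      (\<forall>j. Dv (shift k \<omega>) $ j \<le> (Dv (shift 1 (shift k \<omega>)) v* A (shift k \<omega>)) $ j)"
    by (rule AE_shift_all) (use AE_good nn le in eventually_elim, simp)
  let ?E = "{\<omega> \<in> space P. ?d \<omega> \<le> 0}"
  have E: "?E \<in> sets P" by measurable
  have zero: "Dv \<omega> = 0" if "\<forall>j. 0 \<le> Dv \<omega> $ j" "?d \<omega> \<le> 0" for \<omega>
  proof -
    have "?d \<omega> = 0" using that by (intro antisym) (auto intro: sum_nonneg)
    then show ?thesis using that by (simp add: sum_nonneg_eq_0_iff vec_eq_iff)
  qed
  have "measure P ?E = 0 \<or> measure P ?E = 1"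
  \<comment> \<open>Vanishing passes only from the shifted environment to \<omega>, because the
    inequality bounds \<open>Dv \<omega>\<close> by \<open>Dv (shift 1 \<omega>)\<close>. The
    one-sided form of ergodicity is therefore used.\<close>
  proof (rule backward_invariant_event[OF E])
    show "AE \<omega> in P. shift 1 \<omega> \<in> ?E \<longrightarrow> \<omega> \<in> ?E"
      using all AE_space
    proof eventually_elim
      case (elim \<omega>)
      show ?case
      proof
        assume "shift 1 \<omega> \<in> ?E"
        then have "Dv (shift 1 \<omega>) = 0" using zero elim(1)[rule_format, of 1] by simp
        then have "Dv \<omega> $ j \<le> 0" for j
          using elim(1)[rule_format, of 0] by (simp add: vector_matrix_mult_def)
        then have "?d \<omega> \<le> 0" by (simp add: sum_nonpos)
        then show "\<omega> \<in> ?E" using elim by simp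
      qed
    qed
  qed
  moreover have "measure P ?E \<noteq> 0"
  proof
    assume "measure P ?E = 0"
    then have "?E \<in> null_sets P" using E by (simp add: P.emeasure_eq_measure null_sets_def)
    from AE_not_in[OF this] AE_space have pos: "AE \<omega> in P. 0 < ?d \<omega>" by eventually_elim auto
    obtain N where N: "N > 0" and neg: "(\<integral>\<omega>. ln (opnorm (ap N \<omega>)) \<partial>P) < 0"
      using exists_contracting by auto
    \<comment> \<open>The shift by one matches \<open>ap N\<close>, which runs over the sites 1 to
      \<open>N\<close>: the iterated inequality compares the masses at 1 and
      \<open>N + 1\<close>.\<close>
    let ?f = "\<lambda>\<omega>. ln (?d (shift 1 \<omega>))"
    have "0 \<le> (\<integral>\<omega>. ln (opnorm (ap N \<omega>)) \<partial>P)"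
    proof (rule coboundary_bound[where f = ?f and k = "int N"])
      show "?f \<in> borel_measurable P"
        by (intro borel_measurable_ln measurable_shift_compose[OF d_meas])
      show "integrable P (\<lambda>\<omega>. ln (opnorm (ap N \<omega>)))" by (rule integrable_ln_ap)
      show "AE \<omega> in P. ?f \<omega> \<le> ?f (shift (int N) \<omega>) + ln (opnorm (ap N \<omega>))"
        using all AE_shift_all[OF pos]
      proof eventually_elim
        case (elim \<omega>)
        have g: "good \<omega>" using elim(1)[rule_format, of 0] by simp
        have iter: "Dv (shift 1 \<omega>) $ j \<le> (Dv (shift (int n + 1) \<omega>) v* ap n \<omega>) $ j" for n j
        proof (induction n)
          case 0
          then show ?case by simp
        next
          case (Suc n)
          have "(Dv (shift (int n + 1) \<omega>) v* ap n \<omega>) $ j \<le>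
              ((Dv (shift (int (Suc n) + 1) \<omega>) v* A (shift (int (Suc n)) \<omega>)) v* ap n \<omega>) $ j"
          proof (rule vector_matrix_mono[OF ap_nonneg[OF g]])
            fix k
            show "Dv (shift (int n + 1) \<omega>) $ k \<le> (Dv (shift (int (Suc n) + 1) \<omega>) v* A (shift (int (Suc n)) \<omega>)) $ k"
              using elim(1)[rule_format, of "int (Suc n)"] by (simp add: ac_simps)
          qed
          with Suc show ?case by (simp add: vector_matrix_mul_assoc)
        qed
        have "?d (shift 1 \<omega>) \<le> (\<Sum>j\<in>UNIV. (Dv (shift (int N + 1) \<omega>) v* ap N \<omega>) $ j)"
          by (intro sum_mono iter)
        also have "\<dots> \<le> ?d (shift (int N + 1) \<omega>) * opnorm (ap N \<omega>)"
          using elim(1) by (intro sum_vector_matrix_le_opnorm) blast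
        finally have "ln (?d (shift 1 \<omega>)) \<le> ln (?d (shift (int N + 1) \<omega>) * opnorm (ap N \<omega>))"
          using elim(2) opnorm_ap_pos[OF g] by (subst ln_le_cancel_iff) auto
        also have "\<dots> = ln (?d (shift (int N + 1) \<omega>)) + ln (opnorm (ap N \<omega>))"
          using elim(2) opnorm_ap_pos[OF g] by (intro ln_mult_pos) auto
        finally show ?case by (simp add: add.commute)
      qed
    qed
    with neg show False by simp
  qed
  ultimately have "measure P ?E = 1" by simp
  then have "AE \<omega> in P. \<omega> \<in> ?E" by (rule P.AE_prob_1)
  with nn show ?thesis by eventually_elim (rule zero, auto)
qed

end

context strip_model
begin

section \<open>The density of the occupation measure\<close>

lemma good_Pv_prev:
  assumes "good \<omega>"
  shows "Pv \<omega> = Pv (shift (- 1) \<omega>) v* Z (shift (- 1) \<omega>)"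
  using good_Pv[OF good_shift[OF assms, of "- 1"]] by simp

text \<open>Multiplication by the identity minus \<open>M\<close>. Read probabilistically, visits
  \<open>y\<close> to level 0 consist of external arrivals \<open>x\<close>, returns from excursions
  to the left and steps within the level.\<close>

lemma Ga_solve:
  assumes g: "good \<omega>"
  shows "y = x v* Ga \<omega> \<longleftrightarrow> y = x + (y v* q0 \<omega>) v* Z (shift (- 1) \<omega>) + y v* r0 \<omega>"
proof -
  note gg = good_good0[OF g] good_Z_prev[OF g]
  have expand: "y v* (mat 1 - M \<omega>) = y - ((y v* q0 \<omega>) v* Z (shift (- 1) \<omega>) + y v* r0 \<omega>)" for y :: "real^'d"
    by (simp add: vector_matrix_mul_diff_mat M_def vector_matrix_mul_add_mat vector_matrix_mul_assoc)
  have "y = x v* Ga \<omega> \<longleftrightarrow> y v* (mat 1 - M \<omega>) = x"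
  proof
    assume "y = x v* Ga \<omega>"
    then show "y v* (mat 1 - M \<omega>) = x" by (simp add: vector_matrix_mul_assoc Ga_left[OF gg])
  next
    assume "y v* (mat 1 - M \<omega>) = x"
    then have "x v* Ga \<omega> = (y v* (mat 1 - M \<omega>)) v* Ga \<omega>" by simp
    then show "y = x v* Ga \<omega>" by (simp add: vector_matrix_mul_assoc Ga_right[OF gg])
  qed
  also have "\<dots> \<longleftrightarrow> y = x + (y v* q0 \<omega>) v* Z (shift (- 1) \<omega>) + y v* r0 \<omega>"
    unfolding expand by (auto simp: algebra_simps)
  finally show ?thesis .
qed

lemma Ga_p0:
  assumes "good \<omega>"
  shows "(x v* Ga \<omega>) v* p0 \<omega> = x v* Z \<omega>"
  using good_Z_eq[OF assms] by (simp add: vector_matrix_mul_assoc)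

lemma vec_Ga_nonneg:
  assumes "good \<omega>" "\<And>k. 0 \<le> x $ k"
  shows "0 \<le> (x v* Ga \<omega>) $ j"
  by (rule vector_matrix_nonneg[OF Ga_nonneg[OF good_good0[OF assms(1)] good_Z_prev[OF assms(1)]] assms(2)])

lemma vec_Ga_ge:
  assumes "good \<omega>" "\<And>k. 0 \<le> x $ k"
  shows "x $ j \<le> (x v* Ga \<omega>) $ j"
proof -
  have "0 \<le> (x v* (Ga \<omega> - mat 1)) $ j"
    by (rule vector_matrix_nonneg[OF Ga_ge_1[OF good_good0[OF assms(1)] good_Z_prev[OF assms(1)]] assms(2)])
  then show ?thesis by (simp add: vector_matrix_mul_diff_mat)
qed

text \<open>\<open>occ_term m\<close> is \<open>\<pi>\<^sub>m a\<^sub>m \<dots> a\<^sub>1 \<gamma>\<^sub>0\<close>, the mean occupation of level \<open>0\<close> before \<open>T\<^sub>m\<^sub>+\<^sub>1\<close> by the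
  walk started at level \<open>m\<close> with phase law \<open>\<pi>\<^sub>m\<close>.\<close>

primrec occ_term :: "nat \<Rightarrow> 's env \<Rightarrow> real^'d" where
  "occ_term 0 \<omega> = Pv \<omega> v* Ga \<omega>"
| "occ_term (Suc m) \<omega> = (occ_term m (shift 1 \<omega>) v* q0 (shift 1 \<omega>)) v* Ga \<omega>"

lemma measurable_q0_shift: "(\<lambda>\<omega>. q0 (shift k \<omega>) $ i $ j) \<in> borel_measurable P"
  "(\<lambda>\<omega>. p0 (shift k \<omega>) $ i $ j) \<in> borel_measurable P" "(\<lambda>\<omega>. r0 (shift k \<omega>) $ i $ j) \<in> borel_measurable P"
  by (simp_all add: shift_apply measurable_coef)

lemma measurable_occ_term: "(\<lambda>\<omega>. occ_term m \<omega> $ i) \<in> borel_measurable P"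
proof (induction m arbitrary: i)
  case 0
  then show ?case unfolding occ_term.simps by (intro borel_measurable_vec_mat_mult measurable_Pv measurable_Ga)
next
  case (Suc m)
  show ?case unfolding occ_term.simps
    by (intro borel_measurable_vec_mat_mult measurable_Ga measurable_q0_shift
        measurable_shift_compose[where f = "\<lambda>\<omega>. occ_term m \<omega> $ _"] Suc)
qed

lemma occ_term_nonneg: "good \<omega> \<Longrightarrow> 0 \<le> occ_term m \<omega> $ i"
proof (induction m arbitrary: \<omega> i)
  case 0
  then show ?case by (simp add: vec_Ga_nonneg Pv_nonneg)
next
  case (Suc m)
  have g: "good (shift 1 \<omega>)" using Suc.prems by (rule good_shift)
  have "0 \<le> (occ_term m (shift 1 \<omega>) v* q0 (shift 1 \<omega>)) $ k" for k
    by (rule vector_matrix_nonneg[OF nonneg_pqr(5)[OF good_space[OF g]] Suc.IH[OF g]])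
  then show ?case unfolding occ_term.simps by (rule vec_Ga_nonneg[OF Suc.prems])
qed

text \<open>Seen from level \<open>- l\<close>, the starting level 0 lies l sites to the right,
  which explains the shift. The vectors \<open>H l\<close> solve the equations of the Green function
  of the killed walk, but these may have larger solutions; the exit mass, equal to one on both
  sides, selects \<open>H\<close>.\<close>

lemma kill_sums_occ_term:
  assumes g: "good \<omega>"
  shows "(\<lambda>n. kill \<omega> (\<pi> \<omega>) n (- int l, i)) sums (occ_term l (shift (- int l) \<omega>) $ i)"
proof -
  have \<omega>: "\<omega> \<in> space P" by (rule good_space[OF g])
  define H where "H l = occ_term l (shift (- int l) \<omega>)" for l
  have gl: "good (shift k \<omega>)" for k by (rule good_shift[OF g])
  \<comment> \<open>The external arrivals at level \<open>- l\<close>: the initial law at level 0,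
    and otherwise the downward flux from the level above.\<close>
  define X where "X l = (if l = 0 then Pv \<omega> else H (l - 1) v* q (\<omega> (- int (l - 1))))" for l
  have HS: "H (Suc l) = (H l v* q (\<omega> (- int l))) v* Ga (shift (- int (Suc l)) \<omega>)" for l
  proof -
    have "shift 1 (shift (- int (Suc l)) \<omega>) = shift (- int l) \<omega>" by simp
    then show ?thesis unfolding H_def occ_term.simps by (simp only: shift_apply add_0)
  qed
  have H: "H l = X l v* Ga (shift (- int l) \<omega>)" for l
  proof (cases l)
    case 0
    then show ?thesis by (simp add: H_def X_def)
  next
    case (Suc l')
    then show ?thesis using HS[of l'] by (simp add: X_def)
  qed
  \<comment> \<open>The returns from the left in \<open>Ga_solve\<close> are rewritten as the upward
    flux out of level \<open>- int (Suc l)\<close>, which gives the local balance equation.\<close>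
  have image_density: "H l = X l + H (Suc l) v* p (\<omega> (- int (Suc l))) + H l v* r (\<omega> (- int l))" for l
  proof -
    have "H l = X l + (H l v* q0 (shift (- int l) \<omega>)) v* Z (shift (- 1) (shift (- int l) \<omega>)) + H l v* r0 (shift (- int l) \<omega>)"
      using H[of l] Ga_solve[OF gl, of "H l" "X l" "- int l"] by blast
    also have "shift (- 1) (shift (- int l) \<omega>) = shift (- int (Suc l)) \<omega>" by simp
    also have "(H l v* q0 (shift (- int l) \<omega>)) v* Z (shift (- int (Suc l)) \<omega>) = H (Suc l) v* p0 (shift (- int (Suc l)) \<omega>)"
      unfolding HS using Ga_p0[OF gl, of "H l v* q (\<omega> (- int l))" "- int (Suc l)"] by (simp only: shift_apply add_0)
    finally show ?thesis by (simp only: shift_apply add_0)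
  qed
  have nn: "0 \<le> H l $ i" for l i unfolding H_def by (rule occ_term_nonneg[OF gl])
  have "(\<lambda>n. kill \<omega> (\<pi> \<omega>) n (- int l, i)) sums (H l $ i)"
  proof (rule green_function_unique[where k = "\<lambda>n l i. kill \<omega> (\<pi> \<omega>) n (- int l, i)" and h = "\<lambda>l i. H l $ i"
        and \<nu> = "\<lambda>j. pmf (\<pi> \<omega>) j" and a = "\<lambda>l i j. p (\<omega> (- int (Suc l))) $ i $ j"
        and b = "\<lambda>l i j. r (\<omega> (- int l)) $ i $ j" and c = "\<lambda>l i j. q (\<omega> (- int l)) $ i $ j"
        and w = "\<lambda>i. \<Sum>j\<in>UNIV. p0 \<omega> $ i $ j"])
    show "kill \<omega> (\<pi> \<omega>) 0 (- int l, j) = (if l = 0 then pmf (\<pi> \<omega>) j else 0)" for l j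
      by (simp add: kill_0)
    show "kill \<omega> (\<pi> \<omega>) (Suc n) (- int l, j) =
       (\<Sum>i\<in>UNIV. kill \<omega> (\<pi> \<omega>) n (- int (Suc l), i) * p (\<omega> (- int (Suc l))) $ i $ j +
          kill \<omega> (\<pi> \<omega>) n (- int l, i) * r (\<omega> (- int l)) $ i $ j +
          (if l = 0 then 0 else kill \<omega> (\<pi> \<omega>) n (- int (l - 1), i) * q (\<omega> (- int (l - 1))) $ i $ j))" for n l j
    proof -
      have 1: "- int l - 1 = - int (Suc l)" by simp
      have 2: "kill \<omega> (\<pi> \<omega>) n (- int l + 1, i) * q (\<omega> (- int l + 1)) $ i $ j =
          (if l = 0 then 0 else kill \<omega> (\<pi> \<omega>) n (- int (l - 1), i) * q (\<omega> (- int (l - 1))) $ i $ j)" for i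
      proof (cases l)
        case 0
        then show ?thesis by (simp add: kill_1)
      next
        case (Suc l')
        then have "- int l + 1 = - int (l - 1)" by simp
        then show ?thesis using Suc by (simp only: nat.distinct if_False)
      qed
      have "- int l \<noteq> 1" by simp
      then show ?thesis by (simp only: kill_Suc[OF \<omega>] 1 2 not_False_eq_True)
    qed
    show "H l $ j = (if l = 0 then pmf (\<pi> \<omega>) j else 0) +
       (\<Sum>i\<in>UNIV. H (Suc l) $ i * p (\<omega> (- int (Suc l))) $ i $ j + H l $ i * r (\<omega> (- int l)) $ i $ j +
          (if l = 0 then 0 else H (l - 1) $ i * q (\<omega> (- int (l - 1))) $ i $ j))" for l j
    proof -
      have "H l $ j = (X l + H (Suc l) v* p (\<omega> (- int (Suc l))) + H l v* r (\<omega> (- int l))) $ j"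
        using image_density[of l] by (rule arg_cong)
      then show ?thesis
        by (cases "l = 0") (simp_all add: X_def Pv_def vector_matrix_mult_def sum.distrib mult.commute del: of_nat_Suc)
    qed
    show "0 < (\<Sum>j\<in>UNIV. p0 \<omega> $ i $ j)" for i by (rule p_row_sum[OF good_good0[OF g] good_Z_prev[OF g]])
    show "0 < (\<Sum>j\<in>UNIV. p (\<omega> (- int (Suc l))) $ i $ j)" for l i
      using p_row_sum[OF good_good0[OF gl] good_Z_prev[OF gl], of "- int (Suc l)" i] by (simp only: shift_apply add_0)
    \<comment> \<open>The exit flux is \<pi> \<gamma> p = \<pi> \<zeta>, of mass one, in agreement
      with the almost sure passage to level 1.\<close>
    have "(\<Sum>i\<in>UNIV. H 0 $ i * (\<Sum>j\<in>UNIV. p0 \<omega> $ i $ j)) = (\<Sum>j\<in>UNIV. (H 0 v* p0 \<omega>) $ j)"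
      by (rule sum_vector_matrix_mult[symmetric])
    also have "H 0 v* p0 \<omega> = Pv \<omega> v* Z \<omega>"
      using Ga_p0[OF g, of "Pv \<omega>"] by (simp add: H_def)
    also have "(\<Sum>j\<in>UNIV. (Pv \<omega> v* Z \<omega>) $ j) = 1"
      unfolding sum_vector_matrix_mult good_Z(3)[OF g] by (simp add: Pv_sum)
    finally have H0: "(\<Sum>i\<in>UNIV. H 0 $ i * (\<Sum>j\<in>UNIV. p0 \<omega> $ i $ j)) = 1" .
    have "emeasure (quenched p q r \<omega> (\<pi> \<omega>)) {x. hits x} = 1"
    proof (rule quenched_hits[where m' = "\<pi> (shift 1 \<omega>)"])
      fix j
      have "Pv (shift 1 \<omega>) $ j = (Pv \<omega> v* et \<omega>) $ j" using good_Pv[OF g] good_et[OF g] by simp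
      then show "pmf (\<pi> (shift 1 \<omega>)) j = ((\<chi> i. pmf (\<pi> \<omega>) i) v* et \<omega>) $ j" by (simp add: Pv_def)
    qed
    then have "measure (quenched p q r \<omega> (\<pi> \<omega>)) {x. hits x} = 1" by (simp add: measure_def)
    then show "(\<lambda>n. \<Sum>i\<in>UNIV. kill \<omega> (\<pi> \<omega>) n (- int 0, i) * (\<Sum>j\<in>UNIV. p0 \<omega> $ i $ j)) sums
        (\<Sum>i\<in>UNIV. H 0 $ i * (\<Sum>j\<in>UNIV. p0 \<omega> $ i $ j))"
      using exit_sums[OF \<omega>, of "\<pi> \<omega>"] unfolding H0 by simp
  qed (auto simp: nn nonneg_pqr(1-3)[OF \<omega>])
  then show ?thesis by (simp only: H_def)
qed

section \<open>The occupation density and its mass\<close>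

lemma measurable_occupation:
  assumes B: "B \<in> sets P"
  shows "(\<lambda>z. occupation B (i :: 'd) (fst z) (snd z)) \<in> borel_measurable (P \<Otimes>\<^sub>M path_space)"
  unfolding occupation_def less_hit_iff
proof (intro borel_measurable_suminf_order measurable_If)
  fix n
  show "{z \<in> space (P \<Otimes>\<^sub>M path_space). \<forall>s\<le>n. fst ((snd z :: 'd path) s) \<noteq> 1} \<in> sets (P \<Otimes>\<^sub>M path_space)"
    unfolding pred_def[symmetric]
    by (rule measurable_compose[OF measurable_snd, where g = "\<lambda>x. \<forall>s\<le>n. fst (x s) \<noteq> 1"]) measurable
  have "(\<lambda>z. indicator B (shift k (fst z)) :: ennreal) \<in> borel_measurable (P \<Otimes>\<^sub>M (path_space :: 'd path measure))" for k
    by (rule measurable_compose[OF measurable_compose[OF measurable_fst measurable_shift] borel_measurable_indicator[OF B]])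
  moreover have "(\<lambda>z. fst (snd z n)) \<in> P \<Otimes>\<^sub>M (path_space :: 'd path measure) \<rightarrow>\<^sub>M count_space UNIV"
    by (rule measurable_compose[OF measurable_snd measurable_path_fst])
  ultimately have "(\<lambda>z. indicator B (shift (fst (snd z n)) (fst z)) :: ennreal) \<in> borel_measurable (P \<Otimes>\<^sub>M (path_space :: 'd path measure))"
    by (rule measurable_compose_countable)
  moreover have "(\<lambda>z. indicator {i} (snd (snd z n)) :: ennreal) \<in> borel_measurable (P \<Otimes>\<^sub>M (path_space :: 'd path measure))"
    by (rule measurable_compose[OF measurable_compose[OF measurable_snd measurable_path_snd]]) simp
  ultimately show "(\<lambda>z. indicator B (shift (fst (snd z n)) (fst z)) * indicator {i} (snd (snd z n)) :: ennreal)
      \<in> borel_measurable (P \<Otimes>\<^sub>M path_space)"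
    by (rule borel_measurable_times_ennreal)
qed simp

text \<open>Extended-valued, since finiteness is only obtained later: from positive speed through
  the mean hitting time, or from a stationary density that dominates the partial sums.\<close>

definition occ_density :: "'s env \<Rightarrow> 'd \<Rightarrow> ennreal" where
  "occ_density \<omega> i = (\<Sum>m. ennreal (occ_term m \<omega> $ i))"

lemma measurable_occ_density: "(\<lambda>\<omega>. occ_density \<omega> i) \<in> borel_measurable P"
  unfolding occ_density_def
  by (intro borel_measurable_suminf_order measurable_compose[OF measurable_occ_term measurable_ennreal])

text \<open>In a fixed environment the occupation of level \<open>- m\<close> involves the
  environment shifted by \<open>- m\<close>. Stationarity moves each term back to the origin, and
  the sum over levels becomes the series of \<open>occ_term\<close>.\<close>

lemma occupation_annealed:
  assumes B: "B \<in> sets P"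
  shows "(\<integral>\<^sup>+(\<omega>, x). occupation B i \<omega> x \<partial>annealed P p q r \<pi>) = (\<integral>\<^sup>+\<omega>. occ_density \<omega> i * indicator B \<omega> \<partial>P)"
proof -
  let ?h = "\<lambda>m \<omega>. ennreal (occ_term m \<omega> $ i) * indicator B \<omega>"
  have h_meas: "?h m \<in> borel_measurable P" for m
    by (intro borel_measurable_times_ennreal borel_measurable_indicator B
        measurable_compose[OF measurable_occ_term measurable_ennreal])
  have "(\<integral>\<^sup>+(\<omega>, x). occupation B i \<omega> x \<partial>annealed P p q r \<pi>) =
      (\<integral>\<^sup>+\<omega>. \<integral>\<^sup>+x. occupation B i \<omega> x \<partial>quenched p q r \<omega> (\<pi> \<omega>) \<partial>P)"
    unfolding split_def by (rule nn_integral_annealed[OF pi_past_laws measurable_occupation[OF B]])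
  also have "\<dots> = (\<integral>\<^sup>+\<omega>. (\<Sum>m. ?h m (shift (- int m) \<omega>)) \<partial>P)"
    by (rule nn_integral_cong_AE)
       (use AE_good in eventually_elim, rule nn_integral_occupation[OF good_space kill_sums_occ_term])
  also have "\<dots> = (\<Sum>m. \<integral>\<^sup>+\<omega>. ?h m (shift (- int m) \<omega>) \<partial>P)"
    by (rule nn_integral_suminf) (rule measurable_shift_compose[OF h_meas])
  also have "\<dots> = (\<Sum>m. \<integral>\<^sup>+\<omega>. ?h m \<omega> \<partial>P)"
    by (simp only: nn_integral_shift[OF h_meas])
  also have "\<dots> = (\<integral>\<^sup>+\<omega>. (\<Sum>m. ?h m \<omega>) \<partial>P)"
    by (rule nn_integral_suminf[symmetric]) (rule h_meas)
  also have "\<dots> = (\<integral>\<^sup>+\<omega>. occ_density \<omega> i * indicator B \<omega> \<partial>P)"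
    unfolding occ_density_def by (simp only: ennreal_suminf_multc)
  finally show ?thesis .
qed

lemma AE_Pv_et:
  "AE \<omega> in P. \<forall>j. pmf (\<pi> (shift 1 \<omega>)) j = ((\<chi> i. pmf (\<pi> \<omega>) i) v* et \<omega>) $ j"
  using AE_good
proof eventually_elim
  case (elim \<omega>)
  have "Pv (shift 1 \<omega>) $ j = (Pv \<omega> v* et \<omega>) $ j" for j using good_Pv[OF elim] good_et[OF elim] by simp
  then show ?case by (simp add: Pv_def)
qed

lemma sum_occupation:
  assumes "\<omega> \<in> space P" "hits x"
  shows "(\<Sum>i\<in>UNIV. occupation (space P) i \<omega> x) = ennreal (real (htime x))"
proof -
  have "(\<Sum>i\<in>UNIV. occupation (space P) i \<omega> x) =
      (\<Sum>n. \<Sum>i\<in>UNIV. if enat n < hit 1 x then indicator (space P) (shift (fst (x n)) \<omega>) * indicator {i} (snd (x n)) else 0)"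
    unfolding occupation_def by (rule suminf_sum[symmetric]) simp
  also have "\<dots> = (\<Sum>n. if n < htime x then 1 else 0)"
    using assms shift_in_space by (intro suminf_cong) (auto simp: hit_eq indicator_def)
  also have "\<dots> = (\<Sum>n<htime x. 1)"
    by (subst suminf_finite[of "{..<htime x}"]) auto
  also have "\<dots> = ennreal (real (htime x))" by (simp add: ennreal_of_nat_eq_real_of_nat)
  finally show ?thesis .
qed

text \<open>Summed over the phases and over all environments, the occupation counts every time
  before the hit, so the total mass is the mean hitting time.\<close>

lemma mass_of_occupation:
  assumes v: "0 < v"
  shows "(\<integral>\<^sup>+\<omega>. (\<Sum>i\<in>UNIV. occ_density \<omega> i) \<partial>P) \<le> ennreal (1 / v)"
proof -
  let ?A = "annealed P p q r \<pi>"
  have "(\<integral>\<^sup>+\<omega>. (\<Sum>i\<in>UNIV. occ_density \<omega> i) \<partial>P) = (\<Sum>i\<in>UNIV. \<integral>\<^sup>+\<omega>. occ_density \<omega> i * indicator (space P) \<omega> \<partial>P)"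
    by (subst nn_integral_sum) (auto intro!: measurable_occ_density sum.cong nn_integral_cong)
  also have "\<dots> = (\<Sum>i\<in>UNIV. \<integral>\<^sup>+(\<omega>, x). occupation (space P) i \<omega> x \<partial>?A)"
    by (simp only: occupation_annealed[OF sets.top])
  also have "\<dots> = (\<integral>\<^sup>+(\<omega>, x). (\<Sum>i\<in>UNIV. occupation (space P) i \<omega> x) \<partial>?A)"
    unfolding split_def
    by (rule nn_integral_sum[symmetric])
       (unfold measurable_cong_sets[OF sets_annealed[OF pi_past_laws] refl], rule measurable_occupation[OF sets.top])
  also have "\<dots> = (\<integral>\<^sup>+z. ennreal (real (htime (snd z))) \<partial>?A)"
    unfolding split_def
  proof (rule nn_integral_cong_AE)
    have "AE z in ?A. hits (snd z)"
    proof (subst AE_annealed[OF pi_past_laws, where Q = "\<lambda>\<omega> x. hits x"])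
      show "Measurable.pred (P \<Otimes>\<^sub>M path_space) (\<lambda>z. hits (snd z))"
        by (rule measurable_compose[OF measurable_snd measurable_hits])
      show "AE \<omega> in P. AE x in quenched p q r \<omega> (\<pi> \<omega>). hits x"
        using AE_Pv_et
      proof eventually_elim
        case (elim \<omega>)
        interpret Q: prob_space "quenched p q r \<omega> (\<pi> \<omega>)" by (rule prob_space_quenched)
        have "emeasure (quenched p q r \<omega> (\<pi> \<omega>)) {x. hits x} = 1"
          using elim by (intro quenched_hits[where m' = "\<pi> (shift 1 \<omega>)"]) simp
        then have "AE x in quenched p q r \<omega> (\<pi> \<omega>). x \<in> {x. hits x}"
          by (intro Q.AE_prob_1) (simp add: measure_def)
        then show ?case by simp
      qed
    qed
    then show "AE z in ?A. (\<Sum>i\<in>UNIV. occupation (space P) i (fst z) (snd z)) = ennreal (real (htime (snd z)))"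
      using AE_space[of ?A]
    proof eventually_elim
      case (elim z)
      then show ?case
        by (intro sum_occupation) (auto simp: space_annealed[OF pi_past_laws])
    qed
  qed
  also have "\<dots> \<le> ennreal (1 / v)"
  proof (rule expected_hitting_time_le[OF pi_past_laws AE_Pv_et _ v])
    show "AE (\<omega>, x) in ?A. (\<lambda>n. real_of_int (fst (x n)) / real n) \<longlonglongrightarrow> v"
      using speed pi_past_laws by (auto simp: is_speed_def)
  qed
  finally show ?thesis .
qed

text \<open>The real-valued version of \<open>occ_density\<close>, equal to 0 where the series
  diverges.\<close>

definition R :: "'s env \<Rightarrow> real^'d" where
  "R \<omega> = (\<chi> i. enn2real (occ_density \<omega> i))"

lemma measurable_R: "(\<lambda>\<omega>. R \<omega> $ i) \<in> borel_measurable P"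
  using measurable_compose[OF measurable_occ_density[of i] borel_measurable_enn2real] by (simp add: R_def)

lemma R_nonneg: "0 \<le> R \<omega> $ i"
  by (simp add: R_def)

lemma R_sums:
  assumes "good \<omega>" "occ_density \<omega> i < \<infinity>"
  shows "(\<lambda>m. occ_term m \<omega> $ i) sums (R \<omega> $ i)"
proof -
  note nn = occ_term_nonneg[OF assms(1), of _ i]
  have s: "summable (\<lambda>m. occ_term m \<omega> $ i)"
    by (rule summable_suminf_not_top[OF nn]) (use assms in \<open>auto simp: occ_density_def\<close>)
  have "R \<omega> $ i = (\<Sum>m. occ_term m \<omega> $ i)"
    using suminf_ennreal2[OF nn s] suminf_nonneg[OF s nn] by (simp add: R_def occ_density_def)
  then show ?thesis using s by (simp add: summable_sums)
qed

text \<open>Splitting off the first term of the series leaves the series of the next site, sent down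
  by \<open>q0\<close> and multiplied by \<open>Ga\<close>. Finiteness at both sites allows the
  termwise manipulation over the reals.\<close>

lemma R_recursion:
  assumes g: "good \<omega>" and fin: "\<And>i. occ_density \<omega> i < \<infinity>" "\<And>i. occ_density (shift 1 \<omega>) i < \<infinity>"
  shows "R \<omega> = (Pv \<omega> + R (shift 1 \<omega>) v* q0 (shift 1 \<omega>)) v* Ga \<omega>"
proof (intro vec_eq_iff[THEN iffD2] allI)
  fix j
  let ?B = "q0 (shift 1 \<omega>) ** Ga \<omega>"
  have comp: "((x v* q0 (shift 1 \<omega>)) v* Ga \<omega>) $ j = (\<Sum>i\<in>UNIV. ?B $ i $ j * x $ i)" for x
    unfolding vector_matrix_mul_assoc by (simp add: vector_matrix_mult_def mult.commute)
  have "(\<lambda>m. \<Sum>i\<in>UNIV. ?B $ i $ j * occ_term m (shift 1 \<omega>) $ i) sums (\<Sum>i\<in>UNIV. ?B $ i $ j * R (shift 1 \<omega>) $ i)"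
    by (intro sums_sum sums_mult R_sums good_shift g fin)
  then have "(\<lambda>m. occ_term (Suc m) \<omega> $ j) sums ((R (shift 1 \<omega>) v* q0 (shift 1 \<omega>)) v* Ga \<omega>) $ j"
    unfolding occ_term.simps comp .
  from sums_unique2[OF R_sums[OF g fin(1)] sums_Suc[OF this]]
  show "R \<omega> $ j = ((Pv \<omega> + R (shift 1 \<omega>) v* q0 (shift 1 \<omega>)) v* Ga \<omega>) $ j"
    by (simp add: vector_matrix_mul_add)
qed

section \<open>Measures with a density on the environments with phase\<close>

lemma measurable_pair_count:
  assumes "\<And>i. (\<lambda>\<omega>. g \<omega> i) \<in> P \<rightarrow>\<^sub>M N"
  shows "(\<lambda>z. g (fst z) (snd z)) \<in> P \<Otimes>\<^sub>M (count_space UNIV :: 'd measure) \<rightarrow>\<^sub>M N"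
  by (rule measurable_compose_countable[where f = "\<lambda>i z. g (fst z) i" and g = snd])
     (rule measurable_compose[OF measurable_fst assms], rule measurable_snd)

lemma nn_integral_pair_count:
  assumes "\<And>i. (\<lambda>\<omega>. g \<omega> i) \<in> borel_measurable P"
  shows "(\<integral>\<^sup>+z. g (fst z) (snd z) \<partial>(P \<Otimes>\<^sub>M (count_space UNIV :: 'd measure))) = (\<Sum>i\<in>UNIV. \<integral>\<^sup>+\<omega>. g \<omega> i \<partial>P)"
proof -
  interpret cnt: sigma_finite_measure "count_space UNIV :: 'd measure"
    by (rule sigma_finite_measure_count_space_finite) simp
  have "(\<integral>\<^sup>+z. g (fst z) (snd z) \<partial>(P \<Otimes>\<^sub>M (count_space UNIV :: 'd measure))) =
      (\<integral>\<^sup>+\<omega>. \<integral>\<^sup>+i. g \<omega> i \<partial>count_space UNIV \<partial>P)"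
    by (subst cnt.nn_integral_fst[symmetric]) (use measurable_pair_count[OF assms] in auto)
  also have "\<dots> = (\<integral>\<^sup>+\<omega>. (\<Sum>i\<in>UNIV. g \<omega> i) \<partial>P)"
    by (simp add: nn_integral_count_space_finite)
  finally show ?thesis by (simp add: nn_integral_sum assms)
qed

definition Qm :: "('s env \<Rightarrow> real^'d) \<Rightarrow> ('s env \<times> 'd) measure" where
  "Qm \<rho> = density (P \<Otimes>\<^sub>M count_space UNIV) (\<lambda>z. ennreal (\<rho> (fst z) $ snd z))"

context
  fixes \<rho> :: "'s env \<Rightarrow> real^'d"
  assumes \<rho>_meas: "\<And>i. (\<lambda>\<omega>. \<rho> \<omega> $ i) \<in> borel_measurable P"
begin

lemma \<rho>_meas': "(\<lambda>\<omega>. ennreal (\<rho> \<omega> $ i)) \<in> borel_measurable P"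
  by (rule measurable_compose[OF \<rho>_meas measurable_ennreal])

lemma sets_Qm [simp]: "sets (Qm \<rho>) = sets (P \<Otimes>\<^sub>M count_space UNIV)"
  by (simp add: Qm_def)

lemma nn_integral_Qm:
  assumes "\<And>i. (\<lambda>\<omega>. g \<omega> i) \<in> borel_measurable P"
  shows "(\<integral>\<^sup>+z. g (fst z) (snd z) \<partial>Qm \<rho>) = (\<Sum>i\<in>UNIV. \<integral>\<^sup>+\<omega>. ennreal (\<rho> \<omega> $ i) * g \<omega> i \<partial>P)"
proof -
  have "(\<integral>\<^sup>+z. g (fst z) (snd z) \<partial>Qm \<rho>) =
      (\<integral>\<^sup>+z. ennreal (\<rho> (fst z) $ snd z) * g (fst z) (snd z) \<partial>(P \<Otimes>\<^sub>M count_space UNIV))"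
    unfolding Qm_def
    by (rule nn_integral_density[OF measurable_pair_count[OF \<rho>_meas'] measurable_pair_count[OF assms]])
  also have "\<dots> = (\<Sum>i\<in>UNIV. \<integral>\<^sup>+\<omega>. ennreal (\<rho> \<omega> $ i) * g \<omega> i \<partial>P)"
    by (rule nn_integral_pair_count) (intro borel_measurable_times_ennreal \<rho>_meas' assms)
  finally show ?thesis .
qed

lemma emeasure_Qm:
  assumes B: "B \<in> sets P"
  shows "emeasure (Qm \<rho>) (B \<times> {j}) = (\<integral>\<^sup>+\<omega>. ennreal (\<rho> \<omega> $ j) * indicator B \<omega> \<partial>P)"
proof -
  have BJ: "B \<times> {j} \<in> sets (P \<Otimes>\<^sub>M count_space UNIV)" using B by simp
  have "emeasure (Qm \<rho>) (B \<times> {j}) = (\<integral>\<^sup>+z. indicator (B \<times> {j}) z \<partial>Qm \<rho>)"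
    using BJ by (intro nn_integral_indicator[symmetric]) simp
  also have "\<dots> = (\<integral>\<^sup>+z. indicator B (fst z) * indicator {j} (snd z) \<partial>Qm \<rho>)"
    by (intro nn_integral_cong) (auto simp: indicator_def)
  also have "\<dots> = (\<Sum>i\<in>UNIV. \<integral>\<^sup>+\<omega>. ennreal (\<rho> \<omega> $ i) * (indicator B \<omega> * indicator {j} i) \<partial>P)"
    by (rule nn_integral_Qm) (intro borel_measurable_times_ennreal borel_measurable_indicator B borel_measurable_const)
  also have "\<dots> = (\<Sum>i\<in>UNIV. if i = j then \<integral>\<^sup>+\<omega>. ennreal (\<rho> \<omega> $ j) * indicator B \<omega> \<partial>P else 0)"
    by (intro sum.cong refl) simp
  also have "\<dots> = (\<integral>\<^sup>+\<omega>. ennreal (\<rho> \<omega> $ j) * indicator B \<omega> \<partial>P)"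
    by (subst sum.delta) simp_all
  finally show ?thesis .
qed

lemma emeasure_Qm_space: "emeasure (Qm \<rho>) (space (Qm \<rho>)) = (\<integral>\<^sup>+\<omega>. (\<Sum>i\<in>UNIV. ennreal (\<rho> \<omega> $ i)) \<partial>P)"
proof -
  have "emeasure (Qm \<rho>) (space (Qm \<rho>)) = (\<integral>\<^sup>+z. 1 \<partial>Qm \<rho>)" by simp
  also have "\<dots> = (\<Sum>i\<in>UNIV. \<integral>\<^sup>+\<omega>. ennreal (\<rho> \<omega> $ i) * 1 \<partial>P)"
    by (rule nn_integral_Qm) simp
  also have "\<dots> = (\<integral>\<^sup>+\<omega>. (\<Sum>i\<in>UNIV. ennreal (\<rho> \<omega> $ i)) \<partial>P)"
    by (simp add: nn_integral_sum \<rho>_meas')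
  finally show ?thesis .
qed

definition image_density :: "'s env \<Rightarrow> real^'d" where
  "image_density \<omega> = \<rho> (shift (- 1) \<omega>) v* p0 (shift (- 1) \<omega>) + \<rho> \<omega> v* r0 \<omega> + \<rho> (shift 1 \<omega>) v* q0 (shift 1 \<omega>)"

lemma measurable_image_density: "(\<lambda>\<omega>. image_density \<omega> $ j) \<in> borel_measurable P"
  unfolding image_density_def vector_add_component
  by (intro borel_measurable_add borel_measurable_vec_mat_mult \<rho>_meas measurable_coef measurable_q0_shift
      measurable_shift_compose[where f = "\<lambda>\<omega>. \<rho> \<omega> $ _"])

text \<open>Stationarity transfers the shift from the test set to the density: mass arrives at
  \<omega> by a step up from the left neighbour, by staying, or by a step down from the right
  neighbour.\<close>

lemma kernel_Qm:
  assumes B: "B \<in> sets P" and \<rho>_nonneg: "\<And>\<omega> i. 0 \<le> \<rho> \<omega> $ i"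
  shows "(\<integral>\<^sup>+(\<omega>, i). ennreal (env_kernel p q r \<omega> i B j) \<partial>Qm \<rho>) =
    (\<integral>\<^sup>+\<omega>. ennreal (image_density \<omega> $ j) * indicator B \<omega> \<partial>P)"
proof -
  let ?h = "\<lambda>c i \<omega>. ennreal (\<rho> \<omega> $ i * c \<omega> $ i $ j)"
  have hm: "?h p0 i \<in> borel_measurable P" "?h q0 i \<in> borel_measurable P" "?h r0 i \<in> borel_measurable P" for i
    by (intro measurable_compose[OF _ measurable_ennreal] borel_measurable_times \<rho>_meas measurable_coef)+
  have ind: "(\<lambda>\<omega>. indicator B (shift k \<omega>) :: 'b :: {zero_neq_one, second_countable_topology, t0_space}) \<in> borel_measurable P" for k
    by (rule measurable_compose[OF measurable_shift borel_measurable_indicator[OF B]])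
  have ind0: "(\<lambda>\<omega>. indicator B \<omega> :: 'b :: {zero_neq_one, second_countable_topology, t0_space}) \<in> borel_measurable P"
    by (rule borel_measurable_indicator[OF B])
  have km: "(\<lambda>\<omega>. ennreal (env_kernel p q r \<omega> i B j)) \<in> borel_measurable P" for i
    unfolding env_kernel_def
    by (intro measurable_compose[OF _ measurable_ennreal] borel_measurable_add borel_measurable_times measurable_coef ind ind0)
  have sh: "(\<integral>\<^sup>+\<omega>. g \<omega> * indicator B (shift k \<omega>) \<partial>P) = (\<integral>\<^sup>+\<omega>. g (shift (- k) \<omega>) * indicator B \<omega> \<partial>P)"
    if g: "g \<in> borel_measurable P" for g :: "'s env \<Rightarrow> ennreal" and k
  proof -
    have "(\<lambda>\<omega>. g (shift (- k) \<omega>) * indicator B \<omega>) \<in> borel_measurable P"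
      by (intro borel_measurable_times_ennreal measurable_shift_compose[OF g] ind0)
    from nn_integral_shift[OF this, of k] show ?thesis by simp
  qed
  have "(\<integral>\<^sup>+(\<omega>, i). ennreal (env_kernel p q r \<omega> i B j) \<partial>Qm \<rho>) =
      (\<Sum>i\<in>UNIV. \<integral>\<^sup>+\<omega>. ennreal (\<rho> \<omega> $ i) * ennreal (env_kernel p q r \<omega> i B j) \<partial>P)"
    unfolding split_def by (rule nn_integral_Qm[OF km])
  also have "\<dots> = (\<Sum>i\<in>UNIV. \<integral>\<^sup>+\<omega>. ?h p0 i \<omega> * indicator B (shift 1 \<omega>) + ?h r0 i \<omega> * indicator B \<omega>
      + ?h q0 i \<omega> * indicator B (shift (- 1) \<omega>) \<partial>P)"
  proof (intro sum.cong refl nn_integral_cong)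
    fix i \<omega> assume \<omega>: "\<omega> \<in> space P"
    note nn = nonneg_pqr(1-3)[OF \<omega>, of 0 i j]
    show "ennreal (\<rho> \<omega> $ i) * ennreal (env_kernel p q r \<omega> i B j) =
      ?h p0 i \<omega> * indicator B (shift 1 \<omega>) + ?h r0 i \<omega> * indicator B \<omega> + ?h q0 i \<omega> * indicator B (shift (- 1) \<omega>)"
      unfolding env_kernel_def using nn \<rho>_nonneg
      by (auto simp: indicator_def ennreal_mult' ennreal_plus distrib_left)
  qed
  also have "\<dots> = (\<Sum>i\<in>UNIV. (\<integral>\<^sup>+\<omega>. ?h p0 i (shift (- 1) \<omega>) * indicator B \<omega> \<partial>P) +
      (\<integral>\<^sup>+\<omega>. ?h r0 i \<omega> * indicator B \<omega> \<partial>P) + (\<integral>\<^sup>+\<omega>. ?h q0 i (shift 1 \<omega>) * indicator B \<omega> \<partial>P))"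
    using sh[OF hm(1), of _ 1] sh[OF hm(2), of _ "- 1"]
    by (subst nn_integral_add, (intro borel_measurable_add borel_measurable_times_ennreal hm ind ind0)+)+ simp
  also have "\<dots> = (\<Sum>i\<in>UNIV. \<integral>\<^sup>+\<omega>. (?h p0 i (shift (- 1) \<omega>) + ?h r0 i \<omega> + ?h q0 i (shift 1 \<omega>)) * indicator B \<omega> \<partial>P)"
  proof (intro sum.cong refl)
    fix i
    have m: "(\<lambda>\<omega>. ?h p0 i (shift (- 1) \<omega>) * indicator B \<omega>) \<in> borel_measurable P"
      "(\<lambda>\<omega>. ?h r0 i \<omega> * indicator B \<omega>) \<in> borel_measurable P"
      "(\<lambda>\<omega>. ?h q0 i (shift 1 \<omega>) * indicator B \<omega>) \<in> borel_measurable P"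
      by (intro borel_measurable_times_ennreal measurable_shift_compose[OF hm(1)]
          measurable_shift_compose[OF hm(2)] hm ind0)+
    show "(\<integral>\<^sup>+\<omega>. ?h p0 i (shift (- 1) \<omega>) * indicator B \<omega> \<partial>P) + (\<integral>\<^sup>+\<omega>. ?h r0 i \<omega> * indicator B \<omega> \<partial>P) +
        (\<integral>\<^sup>+\<omega>. ?h q0 i (shift 1 \<omega>) * indicator B \<omega> \<partial>P) =
      (\<integral>\<^sup>+\<omega>. (?h p0 i (shift (- 1) \<omega>) + ?h r0 i \<omega> + ?h q0 i (shift 1 \<omega>)) * indicator B \<omega> \<partial>P)"
      unfolding distrib_right
      by (simp only: nn_integral_add[OF borel_measurable_add[OF m(1,2)] m(3)] nn_integral_add[OF m(1,2)])
  qed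
  also have "\<dots> = (\<integral>\<^sup>+\<omega>. (\<Sum>i\<in>UNIV. (?h p0 i (shift (- 1) \<omega>) + ?h r0 i \<omega> + ?h q0 i (shift 1 \<omega>)) * indicator B \<omega>) \<partial>P)"
    by (rule nn_integral_sum[symmetric])
       (intro borel_measurable_times_ennreal borel_measurable_add measurable_shift_compose[OF hm(1)]
          measurable_shift_compose[OF hm(2)] hm ind0)
  also have "\<dots> = (\<integral>\<^sup>+\<omega>. ennreal (image_density \<omega> $ j) * indicator B \<omega> \<partial>P)"
  proof (rule nn_integral_cong)
    fix \<omega> assume \<omega>: "\<omega> \<in> space P"
    have nn: "0 \<le> \<rho> (shift (- 1) \<omega>) $ i * p0 (shift (- 1) \<omega>) $ i $ j" "0 \<le> \<rho> \<omega> $ i * r0 \<omega> $ i $ j"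
      "0 \<le> \<rho> (shift 1 \<omega>) $ i * q0 (shift 1 \<omega>) $ i $ j" for i
      using \<rho>_nonneg nonneg_pqr(1-3) shift_in_space[OF \<omega>] \<omega> by (auto intro!: mult_nonneg_nonneg)
    have "(\<Sum>i\<in>UNIV. ?h p0 i (shift (- 1) \<omega>) + ?h r0 i \<omega> + ?h q0 i (shift 1 \<omega>)) =
        (\<Sum>i\<in>UNIV. ennreal (\<rho> (shift (- 1) \<omega>) $ i * p0 (shift (- 1) \<omega>) $ i $ j + \<rho> \<omega> $ i * r0 \<omega> $ i $ j
          + \<rho> (shift 1 \<omega>) $ i * q0 (shift 1 \<omega>) $ i $ j))"
      using nn by (intro sum.cong refl) (simp add: ennreal_plus)
    also have "\<dots> = ennreal (\<Sum>i\<in>UNIV. \<rho> (shift (- 1) \<omega>) $ i * p0 (shift (- 1) \<omega>) $ i $ j + \<rho> \<omega> $ i * r0 \<omega> $ i $ j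
          + \<rho> (shift 1 \<omega>) $ i * q0 (shift 1 \<omega>) $ i $ j)"
      using nn by (intro sum_ennreal add_nonneg_nonneg)
    also have "\<dots> = ennreal (image_density \<omega> $ j)"
      by (simp add: image_density_def vector_matrix_mult_def sum.distrib mult.commute)
    finally show "(\<Sum>i\<in>UNIV. (?h p0 i (shift (- 1) \<omega>) + ?h r0 i \<omega> + ?h q0 i (shift 1 \<omega>)) * indicator B \<omega>) =
        ennreal (image_density \<omega> $ j) * indicator B \<omega>"
      by (simp only: sum_distrib_right[symmetric])
  qed
  finally show ?thesis .
qed

lemma equivalent_Qm:
  assumes pos: "AE \<omega> in P. \<forall>i. 0 < \<rho> \<omega> $ i"
  shows "equivalent_measures (Qm \<rho>) (P \<Otimes>\<^sub>M count_space UNIV)"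
proof -
  let ?N = "P \<Otimes>\<^sub>M (count_space UNIV :: 'd measure)"
  let ?g = "\<lambda>z :: 's env \<times> 'd. ennreal (\<rho> (fst z) $ snd z)"
  have gm: "?g \<in> borel_measurable ?N" by (rule measurable_pair_count[OF \<rho>_meas'])
  have "(\<lambda>z. \<rho> (fst z) $ snd z) \<in> borel_measurable ?N" by (rule measurable_pair_count[OF \<rho>_meas])
  note [measurable] = this
  have set: "{z \<in> space ?N. 0 < \<rho> (fst z) $ snd z} \<in> sets ?N" by measurable
  have "AE z in ?N. 0 < \<rho> (fst z) $ snd z"
  proof (subst AE_iff_nn_integral[OF set])
    have "(\<integral>\<^sup>+z. indicator {z. \<not> 0 < \<rho> (fst z) $ snd z} z \<partial>?N) =
        (\<integral>\<^sup>+z. (\<lambda>\<omega> i. indicator {\<omega>. \<not> 0 < \<rho> \<omega> $ i} \<omega>) (fst z) (snd z) \<partial>?N)"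
      by (intro nn_integral_cong) (auto simp: indicator_def)
    also have "\<dots> = (\<Sum>i\<in>UNIV. \<integral>\<^sup>+\<omega>. indicator {\<omega>. \<not> 0 < \<rho> \<omega> $ i} \<omega> \<partial>P)"
    proof (rule nn_integral_pair_count)
      fix i
      note [measurable] = \<rho>_meas[of i]
      have "(\<lambda>\<omega>. if 0 < \<rho> \<omega> $ i then 0 else 1 :: ennreal) \<in> borel_measurable P" by measurable
      moreover have "indicator {\<omega>. \<not> 0 < \<rho> \<omega> $ i} = (\<lambda>\<omega>. if 0 < \<rho> \<omega> $ i then 0 else 1 :: ennreal)"
        by (auto simp: indicator_def)
      ultimately show "(\<lambda>\<omega>. indicator {\<omega>. \<not> 0 < \<rho> \<omega> $ i} \<omega> :: ennreal) \<in> borel_measurable P" by simp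
    qed
    also have "\<dots> = (\<Sum>i\<in>(UNIV :: 'd set). \<integral>\<^sup>+\<omega>. 0 \<partial>P)"
    proof (intro sum.cong refl nn_integral_cong_AE)
      fix i
      show "AE \<omega> in P. indicator {\<omega>. \<not> 0 < \<rho> \<omega> $ i} \<omega> = (0 :: ennreal)"
        using pos by eventually_elim (auto simp: indicator_def)
    qed
    finally show "(\<integral>\<^sup>+z. indicator {z. \<not> 0 < \<rho> (fst z) $ snd z} z \<partial>?N) = 0" by simp
  qed
  then have g_pos: "AE z in ?N. ?g z \<noteq> 0" by eventually_elim simp
  have "absolutely_continuous ?N (Qm \<rho>)"
    unfolding Qm_def by (rule absolutely_continuousI_density[OF gm])
  moreover have "absolutely_continuous (Qm \<rho>) ?N"
    unfolding absolutely_continuous_def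
  proof
    fix X assume "X \<in> null_sets (Qm \<rho>)"
    then have X: "X \<in> sets ?N" "AE z in ?N. z \<in> X \<longrightarrow> ?g z = 0"
      by (auto simp: Qm_def null_sets_density_iff[OF gm])
    have "AE z in ?N. z \<notin> X" using X(2) g_pos by eventually_elim auto
    then show "X \<in> null_sets ?N" using X(1) by (simp add: AE_iff_null_sets)
  qed
  ultimately show ?thesis by (simp add: equivalent_measures_def)
qed

lemma stationary_Qm:
  assumes nn: "\<And>\<omega> i. 0 \<le> \<rho> \<omega> $ i" and image_density: "AE \<omega> in P. image_density \<omega> = \<rho> \<omega>"
    and mass: "(\<integral>\<^sup>+\<omega>. (\<Sum>i\<in>UNIV. ennreal (\<rho> \<omega> $ i)) \<partial>P) = 1"
  shows "stationary_distribution P p q r (Qm \<rho>)"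
proof -
  have "prob_space (Qm \<rho>)" by (rule prob_spaceI) (simp only: emeasure_Qm_space mass)
  moreover have "emeasure (Qm \<rho>) (B \<times> {j}) = (\<integral>\<^sup>+(\<omega>, i). ennreal (env_kernel p q r \<omega> i B j) \<partial>Qm \<rho>)"
    if B: "B \<in> sets P" for B j
    unfolding emeasure_Qm[OF B] kernel_Qm[OF B nn]
    by (rule nn_integral_cong_AE) (use image_density in eventually_elim, simp)
  ultimately show ?thesis by (simp add: stationary_distribution_def)
qed

text \<open>Invariance on rectangles gives, phase by phase, two densities of the same measure; they
  agree almost surely, and nonnegativity lets the equality pass from \<open>ennreal\<close> to the
  reals.\<close>

lemma stationary_Qm_imp_image_density:
  assumes nn: "\<And>\<omega> i. 0 \<le> \<rho> \<omega> $ i" and st: "stationary_distribution P p q r (Qm \<rho>)"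
  shows "AE \<omega> in P. image_density \<omega> = \<rho> \<omega>"
proof -
  have bal_nn: "AE \<omega> in P. \<forall>j. 0 \<le> image_density \<omega> $ j"
    using AE_space
  proof eventually_elim
    case (elim \<omega>)
    show ?case
      unfolding image_density_def vector_add_component
      by (intro allI add_nonneg_nonneg vector_matrix_nonneg nn nonneg_pqr shift_in_space elim)
  qed
  have "AE \<omega> in P. ennreal (\<rho> \<omega> $ j) = ennreal (image_density \<omega> $ j)" for j
  proof (rule P.density_unique)
    show m: "(\<lambda>\<omega>. ennreal (\<rho> \<omega> $ j)) \<in> borel_measurable P" by (rule \<rho>_meas')
    show m': "(\<lambda>\<omega>. ennreal (image_density \<omega> $ j)) \<in> borel_measurable P"
      by (rule measurable_compose[OF measurable_image_density measurable_ennreal])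
    show "density P (\<lambda>\<omega>. ennreal (\<rho> \<omega> $ j)) = density P (\<lambda>\<omega>. ennreal (image_density \<omega> $ j))"
    proof (rule measure_eqI)
      fix B assume "B \<in> sets (density P (\<lambda>\<omega>. ennreal (\<rho> \<omega> $ j)))"
      then have B: "B \<in> sets P" by simp
      have "emeasure (Qm \<rho>) (B \<times> {j}) = (\<integral>\<^sup>+(\<omega>, i). ennreal (env_kernel p q r \<omega> i B j) \<partial>Qm \<rho>)"
        using st B by (simp add: stationary_distribution_def)
      then show "emeasure (density P (\<lambda>\<omega>. ennreal (\<rho> \<omega> $ j))) B = emeasure (density P (\<lambda>\<omega>. ennreal (image_density \<omega> $ j))) B"
        unfolding emeasure_Qm[OF B] kernel_Qm[OF B nn] by (simp only: emeasure_density[OF m B] emeasure_density[OF m' B])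
    qed simp
  qed
  then have "AE \<omega> in P. \<forall>j. ennreal (\<rho> \<omega> $ j) = ennreal (image_density \<omega> $ j)" by (simp add: AE_all_countable)
  with bal_nn show ?thesis
  proof eventually_elim
    case (elim \<omega>)
    have "image_density \<omega> $ j = \<rho> \<omega> $ j" for j
      using elim(2)[rule_format, of j] ennreal_inj[OF nn elim(1)[rule_format], of \<omega> j j] by simp
    then show ?case by (simp add: vec_eq_iff)
  qed
qed

end

section \<open>Existence of a stationary distribution for positive speed\<close>

lemma positive_speed_imp_stationary:
  assumes v: "0 < v"
  shows "\<exists>Q. equivalent_stationary P p q r Q"
proof -
  \<comment> \<open>The normalising constant: finite because it is at most 1/v, and positive because
    \<open>R\<close> dominates the positive vector \<pi>.\<close>
  define c where "c = (\<integral>\<^sup>+\<omega>. (\<Sum>i\<in>UNIV. occ_density \<omega> i) \<partial>P)"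
  have c_fin: "c < \<infinity>" using mass_of_occupation[OF v] unfolding c_def by (rule le_less_trans) simp
  have "AE \<omega> in P. (\<Sum>i\<in>UNIV. occ_density \<omega> i) \<noteq> \<infinity>"
    by (rule nn_integral_PInf_AE) (use c_fin in \<open>auto simp: c_def intro!: borel_measurable_sum measurable_occ_density\<close>)
  then have fin: "AE \<omega> in P. \<forall>i. occ_density \<omega> i < \<infinity>"
    by eventually_elim (auto simp: less_top)
  have all: "AE \<omega> in P. \<forall>k. good (shift k \<omega>) \<and> (\<forall>i. occ_density (shift k \<omega>) i < \<infinity>)"
    by (rule AE_shift_all) (use AE_good fin in eventually_elim, simp)
  have R_pos: "AE \<omega> in P. \<forall>i. 0 < R \<omega> $ i"
    using all
  proof eventually_elim
    case (elim \<omega>)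
    have g: "good \<omega>" using elim[rule_format, of 0] by simp
    have g1: "good (shift 1 \<omega>)" using elim by blast
    have rec: "R \<omega> = (Pv \<omega> + R (shift 1 \<omega>) v* q0 (shift 1 \<omega>)) v* Ga \<omega>"
      using elim[rule_format, of 0] elim[rule_format, of 1] by (intro R_recursion) auto
    have nn: "0 \<le> (R (shift 1 \<omega>) v* q0 (shift 1 \<omega>)) $ k" for k
      by (rule vector_matrix_nonneg[OF nonneg_pqr(5)[OF good_space[OF g1]] R_nonneg])
    show ?case
    proof
      fix i
      have "0 < Pv \<omega> $ i" by (rule good_Pv_pos[OF g])
      also have "\<dots> \<le> (Pv \<omega> + R (shift 1 \<omega>) v* q0 (shift 1 \<omega>)) $ i" using nn[of i] by simp
      also have "\<dots> \<le> R \<omega> $ i"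
        unfolding rec by (rule vec_Ga_ge[OF g]) (simp add: nn Pv_nonneg)
      finally show "0 < R \<omega> $ i" .
    qed
  qed
  have ennR: "AE \<omega> in P. \<forall>i. ennreal (R \<omega> $ i) = occ_density \<omega> i"
    using fin by eventually_elim (simp add: R_def less_top)
  have c_eq: "(\<integral>\<^sup>+\<omega>. (\<Sum>i\<in>UNIV. ennreal (R \<omega> $ i)) \<partial>P) = c"
    unfolding c_def by (rule nn_integral_cong_AE) (use ennR in eventually_elim, simp)
  have c_pos: "c \<noteq> 0"
  proof
    assume "c = 0"
    then have "AE \<omega> in P. (\<Sum>i\<in>UNIV. occ_density \<omega> i) = 0"
      unfolding c_def by (subst (asm) nn_integral_0_iff_AE) (auto intro!: borel_measurable_sum measurable_occ_density)
    with ennR R_pos have "AE \<omega> in P. False"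
    proof eventually_elim
      case (elim \<omega>)
      then have "\<forall>i. ennreal (R \<omega> $ i) = 0" by simp
      then show ?case using elim by (metis ennreal_eq_0_iff not_less)
    qed
    then show False by simp
  qed
  define C where "C = enn2real c"
  have C: "ennreal C = c" "0 < C"
    using c_fin c_pos by (auto simp: C_def enn2real_positive_iff less_top zero_less_iff_neq_zero)
  define \<rho> where "\<rho> \<omega> = (1 / C) *\<^sub>R R \<omega>" for \<omega>
  have \<rho>m: "(\<lambda>\<omega>. \<rho> \<omega> $ i) \<in> borel_measurable P" for i
    unfolding \<rho>_def by (simp add: borel_measurable_divide measurable_R)
  have \<rho>0: "0 \<le> \<rho> \<omega> $ i" for \<omega> i using C R_nonneg by (simp add: \<rho>_def)
  have "stationary_distribution P p q r (Qm \<rho>)"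
  proof (rule stationary_Qm[OF \<rho>m \<rho>0])
    show "AE \<omega> in P. image_density \<rho> \<omega> = \<rho> \<omega>"
      using all
    proof eventually_elim
      case (elim \<omega>)
      let ?\<omega>' = "shift (- 1) \<omega>"
      have g: "good \<omega>" "good ?\<omega>'" using elim[rule_format, of 0] elim by auto
      have rec: "R \<omega> = (Pv \<omega> + R (shift 1 \<omega>) v* q0 (shift 1 \<omega>)) v* Ga \<omega>"
        using elim[rule_format, of 0] elim[rule_format, of 1] by (intro R_recursion) auto
      have rec': "R ?\<omega>' = (Pv ?\<omega>' + R \<omega> v* q0 \<omega>) v* Ga ?\<omega>'"
        using R_recursion[of ?\<omega>'] elim[rule_format, of 0] elim[rule_format, of "- 1"] by simp
      \<comment> \<open>By the recursion one site to the left and the invariance of \<pi>, the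
        upward flux into \<omega> is \<pi> plus the returns of the downward flux. Inserting this
        into \<open>Ga_solve\<close> is the balance equation.\<close>
      have 1: "R ?\<omega>' v* p0 ?\<omega>' = Pv \<omega> + (R \<omega> v* q0 \<omega>) v* Z ?\<omega>'"
        unfolding rec' Ga_p0[OF g(2)] vector_matrix_mul_add good_Pv_prev[OF g(1), symmetric] ..
      have 2: "R \<omega> = (Pv \<omega> + R (shift 1 \<omega>) v* q0 (shift 1 \<omega>)) + (R \<omega> v* q0 \<omega>) v* Z ?\<omega>' + R \<omega> v* r0 \<omega>"
        using Ga_solve[OF g(1)] rec by blast
      have "R ?\<omega>' v* p0 ?\<omega>' + R \<omega> v* r0 \<omega> + R (shift 1 \<omega>) v* q0 (shift 1 \<omega>) =
          (Pv \<omega> + R (shift 1 \<omega>) v* q0 (shift 1 \<omega>)) + (R \<omega> v* q0 \<omega>) v* Z ?\<omega>' + R \<omega> v* r0 \<omega>"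
        unfolding 1 by (simp add: algebra_simps)
      also have "\<dots> = R \<omega>" by (rule 2[symmetric])
      finally have "R ?\<omega>' v* p0 ?\<omega>' + R \<omega> v* r0 \<omega> + R (shift 1 \<omega>) v* q0 (shift 1 \<omega>) = R \<omega>" .
      then show ?case
        unfolding image_density_def[OF \<rho>m] \<rho>_def vector_matrix_mul_scaleR scaleR_add_right[symmetric] by simp
    qed
    have "(\<integral>\<^sup>+\<omega>. (\<Sum>i\<in>UNIV. ennreal (\<rho> \<omega> $ i)) \<partial>P) = (\<integral>\<^sup>+\<omega>. ennreal (1 / C) * (\<Sum>i\<in>UNIV. ennreal (R \<omega> $ i)) \<partial>P)"
      unfolding sum_distrib_left using C
      by (intro nn_integral_cong sum.cong refl) (simp add: \<rho>_def ennreal_mult'[symmetric])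
    also have "\<dots> = ennreal (1 / C) * c"
      unfolding c_eq[symmetric]
      by (rule nn_integral_cmult) (intro borel_measurable_sum measurable_compose[OF measurable_R measurable_ennreal])
    also have "\<dots> = 1" using C by (simp add: C(1)[symmetric] ennreal_mult'[symmetric])
    finally show "(\<integral>\<^sup>+\<omega>. (\<Sum>i\<in>UNIV. ennreal (\<rho> \<omega> $ i)) \<partial>P) = 1" .
  qed
  moreover have "equivalent_measures (Qm \<rho>) (P \<Otimes>\<^sub>M count_space UNIV)"
  proof (rule equivalent_Qm[OF \<rho>m])
    show "AE \<omega> in P. \<forall>i. 0 < \<rho> \<omega> $ i"
      using R_pos by eventually_elim (simp add: \<rho>_def C)
  qed
  ultimately show ?thesis unfolding equivalent_stationary_def by blast
qed

end

section \<open>The mean displacement\<close>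

context strip
begin

lemma sets_Collect_coord: "{x :: 'd path. Q (x n)} \<in> sets path_space"
  by (rule sets_Collect_path) (rule measurable_compose[OF measurable_path_coord], simp)

lemma nn_integral_law:
  assumes F: "F \<in> borel_measurable path_space"
  shows "(\<integral>\<^sup>+x. F x \<partial>law \<omega> \<nu>) = (\<integral>\<^sup>+z. \<integral>\<^sup>+x. F x \<partial>law1 \<omega> z \<partial>\<nu>)"
proof -
  have K: "(\<lambda>z. law1 \<omega> z) \<in> measure_pmf \<nu> \<rightarrow>\<^sub>M subprob_algebra path_space"
    by (auto simp: space_subprob_algebra intro!: prob_space_imp_subprob_space prob_space_walk_law)
  have "law \<omega> \<nu> = measure_pmf \<nu> \<bind> (\<lambda>z. law1 \<omega> z)"
  proof (rule measure_eqI)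
    show "sets (law \<omega> \<nu>) = sets (measure_pmf \<nu> \<bind> (\<lambda>z. law1 \<omega> z))"
      by (subst sets_bind_measurable[OF K]) simp_all
    fix X assume "X \<in> sets (law \<omega> \<nu>)"
    then have X: "X \<in> sets path_space" by simp
    have "emeasure (measure_pmf \<nu> \<bind> (\<lambda>z. law1 \<omega> z)) X = (\<integral>\<^sup>+z. emeasure (law1 \<omega> z) X \<partial>\<nu>)"
      by (rule emeasure_bind[OF _ K X]) simp
    then show "emeasure (law \<omega> \<nu>) X = emeasure (measure_pmf \<nu> \<bind> (\<lambda>z. law1 \<omega> z)) X"
      using emeasure_law_start[OF X] by (rule trans[OF _ sym, rotated])
  qed
  then have "(\<integral>\<^sup>+x. F x \<partial>law \<omega> \<nu>) = (\<integral>\<^sup>+x. F x \<partial>(measure_pmf \<nu> \<bind> (\<lambda>z. law1 \<omega> z)))"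
    by (rule arg_cong)
  also have "\<dots> = (\<integral>\<^sup>+z. \<integral>\<^sup>+x. F x \<partial>law1 \<omega> z \<partial>\<nu>)"
    by (rule nn_integral_bind[OF F K])
  finally show ?thesis .
qed

lemma nn_integral_law1_step:
  assumes F: "F \<in> borel_measurable path_space"
  shows "(\<integral>\<^sup>+x. F (\<lambda>t. x (Suc t)) \<partial>law1 \<omega> z) = (\<integral>\<^sup>+z'. \<integral>\<^sup>+x. F x \<partial>law1 \<omega> z' \<partial>jmp \<omega> z)"
proof -
  have sh: "(\<lambda>x t. x (Suc t)) \<in> law1 \<omega> z \<rightarrow>\<^sub>M path_space"
    unfolding measurable_cong_sets[OF sets_walk_law refl] using measurable_path_shift[of 1] by simp
  have "(\<integral>\<^sup>+x. F (\<lambda>t. x (Suc t)) \<partial>law1 \<omega> z) = (\<integral>\<^sup>+x. F x \<partial>distr (law1 \<omega> z) path_space (\<lambda>x t. x (Suc t)))"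
    by (rule nn_integral_distr[OF sh, symmetric]) (simp add: F)
  also have "\<dots> = (\<integral>\<^sup>+x. F x \<partial>law \<omega> (jmp \<omega> z))" by (simp only: distr_law1_step)
  also have "\<dots> = (\<integral>\<^sup>+z'. \<integral>\<^sup>+x. F x \<partial>law1 \<omega> z' \<partial>jmp \<omega> z)" by (rule nn_integral_law[OF F])
  finally show ?thesis .
qed

lemma AE_law1_start: "AE x in law1 \<omega> z. x 0 = z"
proof -
  interpret prob_space "law1 \<omega> z" by (rule prob_space_walk_law)
  have "prob {x. x 0 = z} = 1" by (simp add: measure_def emeasure_law_0)
  from AE_prob_1[OF this] show ?thesis by simp
qed

lemma law1_far:
  assumes \<omega>: "\<omega> \<in> space P"
  shows "emeasure (law1 \<omega> z) {x. \<not> \<bar>fst (x n) - fst z\<bar> \<le> int n} = 0"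
proof (induction n arbitrary: z)
  case 0
  let ?N = "{x. \<not> \<bar>fst (x 0) - fst z\<bar> \<le> int 0}"
  have N: "?N \<in> sets (law1 \<omega> z)"
    unfolding sets_walk_law by (rule sets_Collect_coord)
  have "AE x in law1 \<omega> z. x \<notin> ?N"
    using AE_law1_start[where \<omega> = \<omega> and z = z] by eventually_elim simp
  then have "?N \<in> null_sets (law1 \<omega> z)" using AE_iff_null_sets[OF N] by blast
  then show ?case by (rule null_setsD1)
next
  case (Suc n)
  obtain k i where z: "z = (k, i)" by (cases z)
  let ?B = "{x :: 'd path. \<not> \<bar>fst (x n) - k\<bar> \<le> int (Suc n)}"
  have B: "?B \<in> sets path_space" by (rule sets_Collect_coord)
  have near: "emeasure (law1 \<omega> (l, j)) ?B = 0" if "\<bar>l - k\<bar> \<le> 1" for l j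
  proof -
    have "emeasure (law1 \<omega> (l, j)) ?B \<le> emeasure (law1 \<omega> (l, j)) {x. \<not> \<bar>fst (x n) - fst (l, j)\<bar> \<le> int n}"
    proof (rule emeasure_mono)
      show "?B \<subseteq> {x. \<not> \<bar>fst (x n) - fst (l, j)\<bar> \<le> int n}" using that by auto
      show "{x. \<not> \<bar>fst (x n) - fst (l, j)\<bar> \<le> int n} \<in> sets (law1 \<omega> (l, j))"
        unfolding sets_walk_law by (rule sets_Collect_coord)
    qed
    then show ?thesis using Suc[of "(l, j)"] by simp
  qed
  have "emeasure (law1 \<omega> z) {x. (\<lambda>t. x (Suc t)) \<in> ?B} = 0"
    unfolding emeasure_law1_step[OF B] z nn_integral_jmp[OF \<omega>] by (simp only: near) (simp add: near)
  then show ?case by (simp add: z)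
qed

lemma AE_law1_near:
  assumes "\<omega> \<in> space P"
  shows "AE x in law1 \<omega> z. \<bar>fst (x n) - fst z\<bar> \<le> int n"
proof -
  have "{x. \<not> \<bar>fst (x n) - fst z\<bar> \<le> int n} \<in> sets (law1 \<omega> z)"
    unfolding sets_walk_law by (rule sets_Collect_coord)
  then have "{x. \<not> \<bar>fst (x n) - fst z\<bar> \<le> int n} \<in> null_sets (law1 \<omega> z)"
    using law1_far[OF assms] by (intro null_setsI)
  from AE_not_in[OF this] show ?thesis by simp
qed

text \<open>The quenched mean position after n steps, defined by the backward equation:
  measurability, translation covariance and the bound by n then follow by induction. The
  identification with an expectation is \<open>integral_position\<close>.\<close>

primrec mean_pos :: "nat \<Rightarrow> 's env \<Rightarrow> 'd state \<Rightarrow> real" where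
  "mean_pos 0 \<omega> z = real_of_int (fst z)"
| "mean_pos (Suc n) \<omega> z = (\<Sum>j\<in>UNIV. p (\<omega> (fst z)) $ snd z $ j * mean_pos n \<omega> (fst z + 1, j)
     + r (\<omega> (fst z)) $ snd z $ j * mean_pos n \<omega> (fst z, j) + q (\<omega> (fst z)) $ snd z $ j * mean_pos n \<omega> (fst z - 1, j))"

lemma sum_weights:
  assumes "\<omega> \<in> space P"
  shows "(\<Sum>j\<in>UNIV. p (\<omega> n) $ i $ j + r (\<omega> n) $ i $ j + q (\<omega> n) $ i $ j) = 1"
  using row_sum_pqr[OF assms, of n i] by (simp add: sum.distrib)

text \<open>The jump weights sum to one, so the backward equation is unaffected by subtracting a
  constant; this serves both the bound around the starting level and the change of origin.\<close>

lemma mean_pos_minus: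
  assumes "\<omega> \<in> space P"
  shows "mean_pos (Suc n) \<omega> (k, i) - c = (\<Sum>j\<in>UNIV. p (\<omega> k) $ i $ j * (mean_pos n \<omega> (k + 1, j) - c)
     + r (\<omega> k) $ i $ j * (mean_pos n \<omega> (k, j) - c) + q (\<omega> k) $ i $ j * (mean_pos n \<omega> (k - 1, j) - c))"
proof -
  have "(\<Sum>j\<in>UNIV. p (\<omega> k) $ i $ j * (mean_pos n \<omega> (k + 1, j) - c)
     + r (\<omega> k) $ i $ j * (mean_pos n \<omega> (k, j) - c) + q (\<omega> k) $ i $ j * (mean_pos n \<omega> (k - 1, j) - c)) =
    (\<Sum>j\<in>UNIV. (p (\<omega> k) $ i $ j * mean_pos n \<omega> (k + 1, j)
     + r (\<omega> k) $ i $ j * mean_pos n \<omega> (k, j) + q (\<omega> k) $ i $ j * mean_pos n \<omega> (k - 1, j))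
     - (p (\<omega> k) $ i $ j + r (\<omega> k) $ i $ j + q (\<omega> k) $ i $ j) * c)"
    by (intro sum.cong refl) (simp add: algebra_simps)
  also have "\<dots> = mean_pos (Suc n) \<omega> (k, i) - c"
    by (simp add: sum_subtractf sum_distrib_right[symmetric] sum_weights[OF assms])
  finally show ?thesis by simp
qed

lemma mean_pos_bound:
  assumes \<omega>: "\<omega> \<in> space P"
  shows "\<bar>mean_pos n \<omega> (k, i) - real_of_int k\<bar> \<le> real n"
proof (induction n arbitrary: k i)
  case 0
  then show ?case by simp
next
  case (Suc n)
  note nn = nonneg_pqr(1-3)[OF \<omega>]
  let ?c = "real_of_int k"
  have b: "\<bar>mean_pos n \<omega> (k + 1, j) - ?c\<bar> \<le> real (Suc n)" "\<bar>mean_pos n \<omega> (k, j) - ?c\<bar> \<le> real (Suc n)"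
    "\<bar>mean_pos n \<omega> (k - 1, j) - ?c\<bar> \<le> real (Suc n)" for j
    using Suc[of "k + 1" j] Suc[of k j] Suc[of "k - 1" j] by (auto simp: abs_le_iff)
  have "\<bar>mean_pos (Suc n) \<omega> (k, i) - ?c\<bar> \<le> (\<Sum>j\<in>UNIV. \<bar>p (\<omega> k) $ i $ j * (mean_pos n \<omega> (k + 1, j) - ?c)
     + r (\<omega> k) $ i $ j * (mean_pos n \<omega> (k, j) - ?c) + q (\<omega> k) $ i $ j * (mean_pos n \<omega> (k - 1, j) - ?c)\<bar>)"
    unfolding mean_pos_minus[OF \<omega>] by (rule sum_abs)
  also have "\<dots> \<le> (\<Sum>j\<in>UNIV. (p (\<omega> k) $ i $ j + r (\<omega> k) $ i $ j + q (\<omega> k) $ i $ j) * real (Suc n))"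
  proof (rule sum_mono)
    fix j
    have "\<bar>p (\<omega> k) $ i $ j * (mean_pos n \<omega> (k + 1, j) - ?c)\<bar> \<le> p (\<omega> k) $ i $ j * real (Suc n)"
      "\<bar>r (\<omega> k) $ i $ j * (mean_pos n \<omega> (k, j) - ?c)\<bar> \<le> r (\<omega> k) $ i $ j * real (Suc n)"
      "\<bar>q (\<omega> k) $ i $ j * (mean_pos n \<omega> (k - 1, j) - ?c)\<bar> \<le> q (\<omega> k) $ i $ j * real (Suc n)"
      unfolding abs_mult using nn by (auto intro!: mult_mono b simp del: of_nat_Suc)
    then show "\<bar>p (\<omega> k) $ i $ j * (mean_pos n \<omega> (k + 1, j) - ?c) + r (\<omega> k) $ i $ j * (mean_pos n \<omega> (k, j) - ?c)
        + q (\<omega> k) $ i $ j * (mean_pos n \<omega> (k - 1, j) - ?c)\<bar> \<le>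
      (p (\<omega> k) $ i $ j + r (\<omega> k) $ i $ j + q (\<omega> k) $ i $ j) * real (Suc n)"
      unfolding distrib_right by linarith
  qed
  also have "\<dots> = real (Suc n)"
    by (simp only: sum_distrib_right[symmetric] sum_weights[OF \<omega>] mult_1_left)
  finally show ?case .
qed

lemma mean_pos_translate:
  assumes \<omega>: "\<omega> \<in> space P"
  shows "mean_pos n \<omega> (k + m, i) - real_of_int k = mean_pos n (shift k \<omega>) (m, i)"
proof (induction n arbitrary: m i)
  case 0
  then show ?case by simp
next
  case (Suc n)
  have F: "mean_pos n \<omega> (k + m + 1, j) - real_of_int k = mean_pos n (shift k \<omega>) (m + 1, j)"
    "mean_pos n \<omega> (k + m - 1, j) - real_of_int k = mean_pos n (shift k \<omega>) (m - 1, j)" for j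
    using Suc[of "m + 1" j] Suc[of "m - 1" j] by (simp_all add: algebra_simps)
  show ?case
    unfolding mean_pos_minus[OF \<omega>] by (simp only: F Suc mean_pos.simps fst_conv snd_conv shift_apply[of k \<omega> m] add.commute[of m k])
qed

text \<open>The constant \<open>c\<close> lifts the walk high enough to stay nonnegative for
  \<open>n\<close> steps, so that integrals of nonnegative functions suffice. One step lowers the
  level by at most one, hence the condition is inherited by the three neighbours with one step
  less.\<close>

lemma nn_integral_position:
  assumes \<omega>: "\<omega> \<in> space P"
  shows "int n \<le> k + c \<Longrightarrow> (\<integral>\<^sup>+x. ennreal (real_of_int (fst (x n) + c)) \<partial>law1 \<omega> (k, i)) =
    ennreal (mean_pos n \<omega> (k, i) + real_of_int c)"
proof (induction n arbitrary: k i)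
  case 0
  interpret prob_space "law1 \<omega> (k, i)" by (rule prob_space_walk_law)
  have "(\<integral>\<^sup>+x. ennreal (real_of_int (fst (x 0) + c)) \<partial>law1 \<omega> (k, i)) = (\<integral>\<^sup>+x. ennreal (real_of_int (k + c)) \<partial>law1 \<omega> (k, i))"
    by (rule nn_integral_cong_AE) (use AE_law1_start[where \<omega> = \<omega> and z = "(k, i)"] in eventually_elim, simp)
  then show ?case by simp
next
  case (Suc n)
  note nn = nonneg_pqr(1-3)[OF \<omega>, of k i]
  let ?F = "\<lambda>x :: 'd path. ennreal (real_of_int (fst (x n) + c))"
  have F: "?F \<in> borel_measurable path_space" by measurable
  have pos: "0 \<le> mean_pos n \<omega> (k + 1, j) + real_of_int c" "0 \<le> mean_pos n \<omega> (k, j) + real_of_int c" "0 \<le> mean_pos n \<omega> (k - 1, j) + real_of_int c" for j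
    using mean_pos_bound[OF \<omega>, of n "k + 1" j] mean_pos_bound[OF \<omega>, of n k j] mean_pos_bound[OF \<omega>, of n "k - 1" j] Suc.prems
    by (auto simp: abs_le_iff)
  have "(\<integral>\<^sup>+x. ennreal (real_of_int (fst (x (Suc n)) + c)) \<partial>law1 \<omega> (k, i)) = (\<integral>\<^sup>+z. \<integral>\<^sup>+x. ?F x \<partial>law1 \<omega> z \<partial>jmp \<omega> (k, i))"
    by (rule nn_integral_law1_step[OF F])
  also have "\<dots> = (\<Sum>j\<in>UNIV. ennreal (p (\<omega> k) $ i $ j) * ennreal (mean_pos n \<omega> (k + 1, j) + real_of_int c)
     + ennreal (r (\<omega> k) $ i $ j) * ennreal (mean_pos n \<omega> (k, j) + real_of_int c)
     + ennreal (q (\<omega> k) $ i $ j) * ennreal (mean_pos n \<omega> (k - 1, j) + real_of_int c))"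
  proof -
    have "int n \<le> k + 1 + c" "int n \<le> k + c" "int n \<le> k - 1 + c" using Suc.prems by auto
    then show ?thesis unfolding nn_integral_jmp[OF \<omega>] by (simp only: Suc.IH)
  qed
  also have "\<dots> = (\<Sum>j\<in>UNIV. ennreal (p (\<omega> k) $ i $ j * (mean_pos n \<omega> (k + 1, j) + real_of_int c)
     + r (\<omega> k) $ i $ j * (mean_pos n \<omega> (k, j) + real_of_int c) + q (\<omega> k) $ i $ j * (mean_pos n \<omega> (k - 1, j) + real_of_int c)))"
    using nn pos by (intro sum.cong refl) (simp add: ennreal_mult ennreal_plus)
  also have "\<dots> = ennreal (\<Sum>j\<in>UNIV. p (\<omega> k) $ i $ j * (mean_pos n \<omega> (k + 1, j) + real_of_int c)
     + r (\<omega> k) $ i $ j * (mean_pos n \<omega> (k, j) + real_of_int c) + q (\<omega> k) $ i $ j * (mean_pos n \<omega> (k - 1, j) + real_of_int c))"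
    using nn pos by (intro sum_ennreal) simp
  also have "\<dots> = ennreal (mean_pos (Suc n) \<omega> (k, i) + real_of_int c)"
    using mean_pos_minus[OF \<omega>, of n k i "- real_of_int c"] by simp
  finally show ?case .
qed

lemma integral_position:
  assumes \<omega>: "\<omega> \<in> space P"
  shows "(\<integral>x. real_of_int (fst (x n)) \<partial>law1 \<omega> (0, i)) = mean_pos n \<omega> (0, i)"
proof -
  interpret prob_space "law1 \<omega> (0, i)" by (rule prob_space_walk_law)
  let ?h = "\<lambda>x :: 'd path. real_of_int (fst (x n) + int n)"
  have m: "(\<lambda>x. real_of_int (fst (x n))) \<in> borel_measurable (law1 \<omega> (0, i))" "?h \<in> borel_measurable (law1 \<omega> (0, i))"
    unfolding measurable_cong_sets[OF sets_walk_law refl] by measurable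
  have near: "AE x in law1 \<omega> (0, i). \<bar>fst (x n)\<bar> \<le> int n" using AE_law1_near[OF \<omega>, where z = "(0, i)" and n = n] by simp
  have int: "integrable (law1 \<omega> (0, i)) (\<lambda>x. real_of_int (fst (x n)))"
    by (rule integrable_const_bound[where B = "real n", OF _ m(1)]) (use near in eventually_elim, simp)
  have int': "integrable (law1 \<omega> (0, i)) ?h" using int by simp
  have "ennreal (\<integral>x. ?h x \<partial>law1 \<omega> (0, i)) = (\<integral>\<^sup>+x. ennreal (?h x) \<partial>law1 \<omega> (0, i))"
    by (rule nn_integral_eq_integral[symmetric, OF int']) (use near in eventually_elim, simp)
  also have "\<dots> = ennreal (mean_pos n \<omega> (0, i) + real n)"
    using nn_integral_position[OF \<omega>, of n 0 "int n" i] by simp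
  finally have "ennreal (\<integral>x. ?h x \<partial>law1 \<omega> (0, i)) = ennreal (mean_pos n \<omega> (0, i) + real n)" .
  moreover have "0 \<le> (\<integral>x. ?h x \<partial>law1 \<omega> (0, i))"
    by (rule integral_nonneg_AE) (use near in eventually_elim, simp)
  moreover have "0 \<le> mean_pos n \<omega> (0, i) + real n" using mean_pos_bound[OF \<omega>, of n 0 i] by (simp add: abs_le_iff)
  ultimately have "(\<integral>x. ?h x \<partial>law1 \<omega> (0, i)) = mean_pos n \<omega> (0, i) + real n" by simp
  then show ?thesis using int by (simp add: prob_space[unfolded space_walk_law])
qed

end

context strip_model
begin

section \<open>The mean displacement and the speed\<close>

lemma pred_speed: "Measurable.pred path_space (\<lambda>x :: 'd path. (\<lambda>n. real_of_int (fst (x n)) / real n) \<longlonglongrightarrow> v)"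
proof -
  have "(\<lambda>n. real_of_int (fst (x n)) / real n) \<longlonglongrightarrow> v \<longleftrightarrow>
      (\<forall>m. \<exists>N. \<forall>n\<ge>N. \<bar>real_of_int (fst (x n)) / real n - v\<bar> < 1 / real (Suc m))" for x :: "'d path"
  proof
    assume "(\<lambda>n. real_of_int (fst (x n)) / real n) \<longlonglongrightarrow> v"
    then show "\<forall>m. \<exists>N. \<forall>n\<ge>N. \<bar>real_of_int (fst (x n)) / real n - v\<bar> < 1 / real (Suc m)"
      unfolding LIMSEQ_iff real_norm_def by (metis of_nat_0_less_iff zero_less_Suc zero_less_divide_1_iff)
  next
    assume *: "\<forall>m. \<exists>N. \<forall>n\<ge>N. \<bar>real_of_int (fst (x n)) / real n - v\<bar> < 1 / real (Suc m)"
    show "(\<lambda>n. real_of_int (fst (x n)) / real n) \<longlonglongrightarrow> v"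
    proof (rule LIMSEQ_I)
      fix \<epsilon> :: real assume "0 < \<epsilon>"
      then obtain m where m: "1 / real (Suc m) < \<epsilon>" by (rule nat_approx_posE)
      then show "\<exists>no. \<forall>n\<ge>no. norm (real_of_int (fst (x n)) / real n - v) < \<epsilon>"
        unfolding real_norm_def using *[rule_format, of m] by (meson less_trans)
    qed
  qed
  then show ?thesis by simp
qed

text \<open>A deterministic initial phase is an admissible constant law, so the speed hypothesis
  applies in almost every environment. The displacement over time is bounded by one, and dominated
  convergence passes to the quenched means.\<close>

lemma mean_pos_limit: "AE \<omega> in P. \<forall>i. (\<lambda>n. mean_pos n \<omega> (0, i) / real n) \<longlonglongrightarrow> v"
proof (unfold AE_all_countable, intro allI)
  fix i
  have "AE z in annealed P p q r (\<lambda>_. return_pmf i). (\<lambda>n. real_of_int (fst (snd z n)) / real n) \<longlonglongrightarrow> v"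
    using speed const_past_laws[of "return_pmf i"] by (auto simp: is_speed_def split_def)
  then have "AE \<omega> in P. AE x in quenched p q r \<omega> (return_pmf i). (\<lambda>n. real_of_int (fst (x n)) / real n) \<longlonglongrightarrow> v"
    by (subst (asm) AE_annealed[OF const_past_laws, where Q = "\<lambda>\<omega> x. (\<lambda>n. real_of_int (fst (x n)) / real n) \<longlonglongrightarrow> v"])
       (rule measurable_compose[OF measurable_snd pred_speed])
  with AE_space show "AE \<omega> in P. (\<lambda>n. mean_pos n \<omega> (0, i) / real n) \<longlonglongrightarrow> v"
  proof eventually_elim
    case (elim \<omega>)
    interpret prob_space "law1 \<omega> (0, i)" by (rule prob_space_walk_law)
    have "(\<lambda>n. \<integral>x. real_of_int (fst (x n)) / real n \<partial>law1 \<omega> (0, i)) \<longlonglongrightarrow> (\<integral>x. v \<partial>law1 \<omega> (0, i))"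
    proof (rule integral_dominated_convergence[where w = "\<lambda>_. 1"])
      show "(\<lambda>x. real_of_int (fst (x n)) / real n) \<in> borel_measurable (law1 \<omega> (0, i))" for n
        unfolding measurable_cong_sets[OF sets_walk_law refl] by measurable
      show "AE x in law1 \<omega> (0, i). (\<lambda>n. real_of_int (fst (x n)) / real n) \<longlonglongrightarrow> v"
        using elim(2) unfolding quenched_return .
      show "AE x in law1 \<omega> (0, i). norm (real_of_int (fst (x n)) / real n) \<le> 1" for n
        using AE_law1_near[OF elim(1), where z = "(0, i)" and n = n]
      proof eventually_elim
        case (elim x)
        then have "\<bar>fst (x n)\<bar> \<le> int n" by simp
        then have "real_of_int \<bar>fst (x n)\<bar> \<le> real_of_int (int n)" by (simp only: of_int_le_iff)
        then have "\<bar>real_of_int (fst (x n))\<bar> \<le> real n" by simp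
        then show ?case by (cases "n = 0") (auto simp: divide_le_eq)
      qed
    qed auto
    moreover have "(\<integral>x. real_of_int (fst (x n)) / real n \<partial>law1 \<omega> (0, i)) = mean_pos n \<omega> (0, i) / real n" for n
      using integral_position[OF elim(1), where n = n and i = i] by simp
    ultimately have "(\<lambda>n. mean_pos n \<omega> (0, i) / real n) \<longlonglongrightarrow> (\<integral>x. v \<partial>law1 \<omega> (0, i))" by (simp only:)
    then show ?case by (simp add: prob_space[unfolded space_walk_law])
  qed
qed

lemma measurable_mean_pos: "(\<lambda>\<omega>. mean_pos n \<omega> z) \<in> borel_measurable P"
proof (induction n arbitrary: z)
  case (Suc n)
  show ?case unfolding mean_pos.simps
    by (intro borel_measurable_sum borel_measurable_add borel_measurable_times measurable_coef Suc)
qed simp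

section \<open>Stationary densities\<close>

context
  fixes \<rho> :: "'s env \<Rightarrow> real^'d"
  assumes \<rho>m: "\<And>i. (\<lambda>\<omega>. \<rho> \<omega> $ i) \<in> borel_measurable P"
    and \<rho>0: "\<And>\<omega> i. 0 \<le> \<rho> \<omega> $ i"
    and \<rho>_pos: "AE \<omega> in P. \<forall>i. 0 < \<rho> \<omega> $ i"
    and \<rho>_bal: "AE \<omega> in P. image_density \<rho> \<omega> = \<rho> \<omega>"
    and \<rho>_mass: "(\<integral>\<^sup>+\<omega>. (\<Sum>i\<in>UNIV. ennreal (\<rho> \<omega> $ i)) \<partial>P) = 1"
begin

section \<open>Fluxes of a stationary density\<close>

definition up :: "'s env \<Rightarrow> real^'d" where "up \<omega> = \<rho> \<omega> v* p0 \<omega>"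
definition lev :: "'s env \<Rightarrow> real^'d" where "lev \<omega> = \<rho> \<omega> v* r0 \<omega>"
definition dn :: "'s env \<Rightarrow> real^'d" where "dn \<omega> = \<rho> \<omega> v* q0 \<omega>"

lemma flux_measurable:
  "(\<lambda>\<omega>. up \<omega> $ j) \<in> borel_measurable P" "(\<lambda>\<omega>. lev \<omega> $ j) \<in> borel_measurable P"
  "(\<lambda>\<omega>. dn \<omega> $ j) \<in> borel_measurable P"
  unfolding up_def lev_def dn_def by (intro borel_measurable_vec_mat_mult \<rho>m measurable_coef)+

lemma flux_nonneg:
  assumes "\<omega> \<in> space P"
  shows "0 \<le> up \<omega> $ j" "0 \<le> lev \<omega> $ j" "0 \<le> dn \<omega> $ j"
  unfolding up_def lev_def dn_def using nonneg_pqr(4-6)[OF assms]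
  by (auto intro!: vector_matrix_nonneg \<rho>0)

lemma flux_sum:
  assumes "\<omega> \<in> space P"
  shows "(\<Sum>j\<in>UNIV. up \<omega> $ j) + (\<Sum>j\<in>UNIV. lev \<omega> $ j) + (\<Sum>j\<in>UNIV. dn \<omega> $ j) = (\<Sum>i\<in>UNIV. \<rho> \<omega> $ i)"
proof -
  have "(\<Sum>j\<in>UNIV. up \<omega> $ j) + (\<Sum>j\<in>UNIV. lev \<omega> $ j) + (\<Sum>j\<in>UNIV. dn \<omega> $ j) =
    (\<Sum>i\<in>UNIV. \<rho> \<omega> $ i * ((\<Sum>j\<in>UNIV. p0 \<omega> $ i $ j) + (\<Sum>j\<in>UNIV. q0 \<omega> $ i $ j) + (\<Sum>j\<in>UNIV. r0 \<omega> $ i $ j)))"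
    unfolding up_def lev_def dn_def sum_vector_matrix_mult by (simp add: sum.distrib algebra_simps)
  then show ?thesis by (simp only: row_sum_pqr[OF assms] mult_1_right)
qed

lemma flux_le:
  assumes "\<omega> \<in> space P"
  shows "up \<omega> $ j \<le> (\<Sum>i\<in>UNIV. \<rho> \<omega> $ i)" "lev \<omega> $ j \<le> (\<Sum>i\<in>UNIV. \<rho> \<omega> $ i)" "dn \<omega> $ j \<le> (\<Sum>i\<in>UNIV. \<rho> \<omega> $ i)"
proof -
  note nn = flux_nonneg[OF assms]
  have "up \<omega> $ j \<le> (\<Sum>j\<in>UNIV. up \<omega> $ j)" "lev \<omega> $ j \<le> (\<Sum>j\<in>UNIV. lev \<omega> $ j)" "dn \<omega> $ j \<le> (\<Sum>j\<in>UNIV. dn \<omega> $ j)"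
    using nn by (auto intro!: member_le_sum)
  moreover have "0 \<le> (\<Sum>j\<in>UNIV. up \<omega> $ j)" "0 \<le> (\<Sum>j\<in>UNIV. lev \<omega> $ j)" "0 \<le> (\<Sum>j\<in>UNIV. dn \<omega> $ j)"
    using nn by (auto intro!: sum_nonneg)
  ultimately show "up \<omega> $ j \<le> (\<Sum>i\<in>UNIV. \<rho> \<omega> $ i)" "lev \<omega> $ j \<le> (\<Sum>i\<in>UNIV. \<rho> \<omega> $ i)" "dn \<omega> $ j \<le> (\<Sum>i\<in>UNIV. \<rho> \<omega> $ i)"
    unfolding flux_sum[OF assms, symmetric] by linarith+
qed

lemma \<rho>_integrable: "integrable P (\<lambda>\<omega>. \<Sum>i\<in>UNIV. \<rho> \<omega> $ i)"
  and \<rho>_integral: "(\<integral>\<omega>. (\<Sum>i\<in>UNIV. \<rho> \<omega> $ i) \<partial>P) = 1"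
proof -
  have m: "(\<lambda>\<omega>. \<Sum>i\<in>UNIV. \<rho> \<omega> $ i) \<in> borel_measurable P" by (intro borel_measurable_sum \<rho>m)
  have "(\<Sum>i\<in>UNIV. ennreal (\<rho> \<omega> $ i)) = ennreal (\<Sum>i\<in>UNIV. \<rho> \<omega> $ i)" for \<omega>
    by (rule sum_ennreal) (rule \<rho>0)
  then have nn: "(\<integral>\<^sup>+\<omega>. ennreal (\<Sum>i\<in>UNIV. \<rho> \<omega> $ i) \<partial>P) = ennreal 1" using \<rho>_mass by simp
  show "integrable P (\<lambda>\<omega>. \<Sum>i\<in>UNIV. \<rho> \<omega> $ i)"
    by (rule integrableI_nn_integral_finite[OF m _ nn]) (simp add: sum_nonneg \<rho>0)
  show "(\<integral>\<omega>. (\<Sum>i\<in>UNIV. \<rho> \<omega> $ i) \<partial>P) = 1"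
    by (rule integral_eq_nn_integral[THEN trans, OF m]) (simp_all add: sum_nonneg \<rho>0 nn)
qed

lemma integrable_by_\<rho>:
  assumes m: "h \<in> borel_measurable P" and b: "\<And>\<omega>. \<omega> \<in> space P \<Longrightarrow> \<bar>h \<omega>\<bar> \<le> B * (\<Sum>i\<in>UNIV. \<rho> \<omega> $ i)"
  shows "integrable P (h :: 's env \<Rightarrow> real)"
proof (rule Bochner_Integration.integrable_bound[OF _ m])
  show "integrable P (\<lambda>\<omega>. B * (\<Sum>i\<in>UNIV. \<rho> \<omega> $ i))" using \<rho>_integrable by simp
  show "AE \<omega> in P. norm (h \<omega>) \<le> norm (B * (\<Sum>i\<in>UNIV. \<rho> \<omega> $ i))"
    using AE_space by eventually_elim (use b in force)
qed

definition mean_step :: real where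
  "mean_step = (\<integral>\<omega>. (\<Sum>j\<in>UNIV. up \<omega> $ j) - (\<Sum>j\<in>UNIV. dn \<omega> $ j) \<partial>P)"

lemma flux_integrable:
  "integrable P (\<lambda>\<omega>. up \<omega> $ j)" "integrable P (\<lambda>\<omega>. lev \<omega> $ j)" "integrable P (\<lambda>\<omega>. dn \<omega> $ j)"
  using flux_nonneg flux_le
  by (auto intro!: integrable_by_\<rho>[where B = 1] flux_measurable)

lemma image_density_flux: "image_density \<rho> \<omega> = up (shift (- 1) \<omega>) + lev \<omega> + dn (shift 1 \<omega>)"
  by (simp add: image_density_def[OF \<rho>m] up_def lev_def dn_def)

text \<open>After one step the chain again has density \<rho>, so each step contributes the same
  mean displacement. In the proof the first step is split off, and shifting the integrals by one
  site reassembles the three fluxes into \<open>image_density \<rho>\<close>.\<close>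

lemma mean_position: "(\<integral>\<omega>. (\<Sum>i\<in>UNIV. \<rho> \<omega> $ i * mean_pos n \<omega> (0, i)) \<partial>P) = real n * mean_step"
proof (induction n)
  case 0
  then show ?case by simp
next
  case (Suc n)
  define g where "g j \<omega> = mean_pos n \<omega> (0, j)" for j \<omega>
  have gm: "g j \<in> borel_measurable P" for j unfolding g_def by (rule measurable_mean_pos)
  have gb: "\<bar>g j \<omega>\<bar> \<le> real n" if "\<omega> \<in> space P" for j \<omega>
    using mean_pos_bound[OF that, of n 0 j] by (simp add: g_def)
  let ?u = "\<lambda>\<omega>. (\<Sum>j\<in>UNIV. up \<omega> $ j) - (\<Sum>j\<in>UNIV. dn \<omega> $ j)"
  have step: "(\<Sum>i\<in>UNIV. \<rho> \<omega> $ i * mean_pos (Suc n) \<omega> (0, i)) =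
      ?u \<omega> + ((\<Sum>j\<in>UNIV. up \<omega> $ j * g j (shift 1 \<omega>)) + (\<Sum>j\<in>UNIV. lev \<omega> $ j * g j \<omega>)
        + (\<Sum>j\<in>UNIV. dn \<omega> $ j * g j (shift (- 1) \<omega>)))" if \<omega>: "\<omega> \<in> space P" for \<omega>
  proof -
    \<comment> \<open>Starting one level higher or lower amounts to starting at 0 in the shifted
      environment, with 1 added or subtracted.\<close>
    have e1: "mean_pos n \<omega> (1, j) = 1 + g j (shift 1 \<omega>)" "mean_pos n \<omega> (- 1, j) = - 1 + g j (shift (- 1) \<omega>)" for j
      using mean_pos_translate[OF \<omega>, of n 1 0 j] mean_pos_translate[OF \<omega>, of n "- 1" 0 j] by (simp_all add: g_def)
    have dist: "(\<Sum>j\<in>UNIV. (\<rho> \<omega> v* c) $ j * h j) = (\<Sum>i\<in>UNIV. \<rho> \<omega> $ i * (\<Sum>j\<in>UNIV. c $ i $ j * h j))" for c :: "'d mat" and h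
    proof -
      have "(\<Sum>j\<in>UNIV. (\<rho> \<omega> v* c) $ j * h j) = (\<Sum>j\<in>UNIV. \<Sum>i\<in>UNIV. \<rho> \<omega> $ i * (c $ i $ j * h j))"
        by (simp add: vector_matrix_mult_def sum_distrib_left sum_distrib_right mult_ac)
      also have "\<dots> = (\<Sum>i\<in>UNIV. \<Sum>j\<in>UNIV. \<rho> \<omega> $ i * (c $ i $ j * h j))" by (rule sum.swap)
      finally show ?thesis by (simp add: sum_distrib_left)
    qed
    have "(\<Sum>i\<in>UNIV. \<rho> \<omega> $ i * mean_pos (Suc n) \<omega> (0, i)) =
      (\<Sum>i\<in>UNIV. \<rho> \<omega> $ i * ((\<Sum>j\<in>UNIV. p0 \<omega> $ i $ j * (1 + g j (shift 1 \<omega>))) + (\<Sum>j\<in>UNIV. r0 \<omega> $ i $ j * g j \<omega>)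
        + (\<Sum>j\<in>UNIV. q0 \<omega> $ i $ j * (- 1 + g j (shift (- 1) \<omega>)))))"
      by (simp add: e1 g_def[symmetric] sum.distrib)
    also have "\<dots> = (\<Sum>j\<in>UNIV. up \<omega> $ j * (1 + g j (shift 1 \<omega>))) + (\<Sum>j\<in>UNIV. lev \<omega> $ j * g j \<omega>)
        + (\<Sum>j\<in>UNIV. dn \<omega> $ j * (- 1 + g j (shift (- 1) \<omega>)))"
      unfolding up_def lev_def dn_def dist by (simp only: distrib_left sum.distrib)
    also have "\<dots> = ?u \<omega> + ((\<Sum>j\<in>UNIV. up \<omega> $ j * g j (shift 1 \<omega>)) + (\<Sum>j\<in>UNIV. lev \<omega> $ j * g j \<omega>)
        + (\<Sum>j\<in>UNIV. dn \<omega> $ j * g j (shift (- 1) \<omega>)))"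
      by (simp add: distrib_left right_diff_distrib sum.distrib sum_subtractf sum_negf)
    finally show ?thesis .
  qed
  have bnd: "\<bar>x * g j \<omega>'\<bar> \<le> real n * (\<Sum>i\<in>UNIV. \<rho> \<omega> $ i)"
    if "0 \<le> x" "x \<le> (\<Sum>i\<in>UNIV. \<rho> \<omega> $ i)" "\<omega>' \<in> space P" for x j \<omega> \<omega>'
  proof -
    have "\<bar>x * g j \<omega>'\<bar> = \<bar>g j \<omega>'\<bar> * x" using that by (simp add: abs_mult)
    also have "\<dots> \<le> real n * (\<Sum>i\<in>UNIV. \<rho> \<omega> $ i)" using that gb by (intro mult_mono) auto
    finally show ?thesis .
  qed
  have iu: "integrable P (\<lambda>\<omega>. up \<omega> $ j * g j (shift 1 \<omega>))" for j
    by (rule integrable_by_\<rho>[where B = "real n"])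
       (auto intro!: bnd borel_measurable_times flux_measurable measurable_shift_compose[OF gm] flux_nonneg flux_le shift_in_space)
  have il: "integrable P (\<lambda>\<omega>. lev \<omega> $ j * g j \<omega>)" for j
    by (rule integrable_by_\<rho>[where B = "real n"])
       (auto intro!: bnd borel_measurable_times flux_measurable gm flux_nonneg flux_le)
  have id: "integrable P (\<lambda>\<omega>. dn \<omega> $ j * g j (shift (- 1) \<omega>))" for j
    by (rule integrable_by_\<rho>[where B = "real n"])
       (auto intro!: bnd borel_measurable_times flux_measurable measurable_shift_compose[OF gm] flux_nonneg flux_le shift_in_space)
  have iu': "integrable P (\<lambda>\<omega>. up (shift (- 1) \<omega>) $ j * g j \<omega>)" for j
    using integrable_shift[OF iu, of "- 1"] by simp
  have id': "integrable P (\<lambda>\<omega>. dn (shift 1 \<omega>) $ j * g j \<omega>)" for j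
    using integrable_shift[OF id, of 1] by simp
  \<comment> \<open>Stationarity brings the argument of \<open>g\<close> back to the origin, at the
    price of a shift in the flux.\<close>
  have eu: "(\<integral>\<omega>. up \<omega> $ j * g j (shift 1 \<omega>) \<partial>P) = (\<integral>\<omega>. up (shift (- 1) \<omega>) $ j * g j \<omega> \<partial>P)" for j
    using integral_shift[OF borel_measurable_integrable[OF iu[of j]], of "- 1"] by simp
  have ed: "(\<integral>\<omega>. dn \<omega> $ j * g j (shift (- 1) \<omega>) \<partial>P) = (\<integral>\<omega>. dn (shift 1 \<omega>) $ j * g j \<omega> \<partial>P)" for j
    using integral_shift[OF borel_measurable_integrable[OF id[of j]], of 1] by simp
  have "(\<integral>\<omega>. (\<Sum>i\<in>UNIV. \<rho> \<omega> $ i * mean_pos (Suc n) \<omega> (0, i)) \<partial>P) =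
      (\<integral>\<omega>. ?u \<omega> + ((\<Sum>j\<in>UNIV. up \<omega> $ j * g j (shift 1 \<omega>)) + (\<Sum>j\<in>UNIV. lev \<omega> $ j * g j \<omega>)
        + (\<Sum>j\<in>UNIV. dn \<omega> $ j * g j (shift (- 1) \<omega>))) \<partial>P)"
    by (rule Bochner_Integration.integral_cong[OF refl step])
  also have "\<dots> = mean_step + ((\<Sum>j\<in>UNIV. \<integral>\<omega>. up \<omega> $ j * g j (shift 1 \<omega>) \<partial>P) + (\<Sum>j\<in>UNIV. \<integral>\<omega>. lev \<omega> $ j * g j \<omega> \<partial>P)
        + (\<Sum>j\<in>UNIV. \<integral>\<omega>. dn \<omega> $ j * g j (shift (- 1) \<omega>) \<partial>P))"
    by (simp add: mean_step_def iu il id flux_integrable)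
  also have "\<dots> = mean_step + (\<integral>\<omega>. (\<Sum>j\<in>UNIV. image_density \<rho> \<omega> $ j * g j \<omega>) \<partial>P)"
    unfolding eu ed image_density_flux by (simp add: distrib_right sum.distrib iu' il id')
  also have "(\<integral>\<omega>. (\<Sum>j\<in>UNIV. image_density \<rho> \<omega> $ j * g j \<omega>) \<partial>P) = (\<integral>\<omega>. (\<Sum>j\<in>UNIV. \<rho> \<omega> $ j * g j \<omega>) \<partial>P)"
  proof (rule integral_cong_AE)
    show "AE \<omega> in P. (\<Sum>j\<in>UNIV. image_density \<rho> \<omega> $ j * g j \<omega>) = (\<Sum>j\<in>UNIV. \<rho> \<omega> $ j * g j \<omega>)"
      using \<rho>_bal by eventually_elim simp
  qed (intro borel_measurable_sum borel_measurable_times gm \<rho>m measurable_image_density[OF \<rho>m])+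
  also have "\<dots> = real n * mean_step" unfolding g_def by (rule Suc)
  finally show ?case by (simp add: algebra_simps)
qed

text \<open>The mean displacement divided by n, averaged against \<rho>, is constantly
  \<open>mean_step\<close> for positive n and tends to \<open>v\<close>; \<rho> itself is the
  dominating function.\<close>

lemma drift: "mean_step = v"
proof -
  let ?s = "\<lambda>n \<omega>. (\<Sum>i\<in>UNIV. \<rho> \<omega> $ i * (mean_pos n \<omega> (0, i) / real n))"
  have "(\<lambda>n. \<integral>\<omega>. ?s n \<omega> \<partial>P) \<longlonglongrightarrow> (\<integral>\<omega>. (\<Sum>i\<in>UNIV. \<rho> \<omega> $ i * v) \<partial>P)"
  proof (rule integral_dominated_convergence[where w = "\<lambda>\<omega>. \<Sum>i\<in>UNIV. \<rho> \<omega> $ i"])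
    show "AE \<omega> in P. (\<lambda>n. ?s n \<omega>) \<longlonglongrightarrow> (\<Sum>i\<in>UNIV. \<rho> \<omega> $ i * v)"
      using mean_pos_limit by eventually_elim (intro tendsto_sum tendsto_mult tendsto_const, blast)
    show "AE \<omega> in P. norm (?s n \<omega>) \<le> (\<Sum>i\<in>UNIV. \<rho> \<omega> $ i)" for n
      using AE_space
    proof eventually_elim
      case (elim \<omega>)
      have "norm (?s n \<omega>) \<le> (\<Sum>i\<in>UNIV. norm (\<rho> \<omega> $ i * (mean_pos n \<omega> (0, i) / real n)))" by (rule norm_sum)
      also have "\<dots> \<le> (\<Sum>i\<in>UNIV. \<rho> \<omega> $ i)"
      proof (rule sum_mono)
        fix i
        have "\<bar>mean_pos n \<omega> (0, i) / real n\<bar> \<le> 1"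
          using mean_pos_bound[OF elim, of n 0 i] by (cases "n = 0") (auto simp: divide_le_eq)
        then show "norm (\<rho> \<omega> $ i * (mean_pos n \<omega> (0, i) / real n)) \<le> \<rho> \<omega> $ i"
          using \<rho>0[of \<omega> i] by (simp only: real_norm_def abs_mult abs_of_nonneg mult_left_le)
      qed
      finally show ?case .
    qed
    show "?s n \<in> borel_measurable P" for n
      by (intro borel_measurable_sum borel_measurable_times \<rho>m borel_measurable_divide measurable_mean_pos borel_measurable_const)
    show "(\<lambda>\<omega>. \<Sum>i\<in>UNIV. \<rho> \<omega> $ i * v) \<in> borel_measurable P"
      by (intro borel_measurable_sum borel_measurable_times \<rho>m borel_measurable_const)
  qed (rule \<rho>_integrable)
  also have "(\<integral>\<omega>. (\<Sum>i\<in>UNIV. \<rho> \<omega> $ i * v) \<partial>P) = v"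
    using \<rho>_integral \<rho>_integrable by (simp add: sum_distrib_right[symmetric])
  finally have 1: "(\<lambda>n. \<integral>\<omega>. ?s n \<omega> \<partial>P) \<longlonglongrightarrow> v" .
  have const: "(\<integral>\<omega>. ?s n \<omega> \<partial>P) = mean_step" if "n > 0" for n
  proof -
    have "(\<integral>\<omega>. ?s n \<omega> \<partial>P) = (\<integral>\<omega>. (\<Sum>i\<in>UNIV. \<rho> \<omega> $ i * mean_pos n \<omega> (0, i)) / real n \<partial>P)"
      by (simp add: sum_divide_distrib)
    also have "\<dots> = mean_step" using that mean_position[of n] by simp
    finally show ?thesis .
  qed
  have "eventually (\<lambda>n. (\<integral>\<omega>. ?s n \<omega> \<partial>P) = mean_step) sequentially"
    by (rule eventually_mono[OF eventually_gt_at_top[of 0] const])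
  then have "(\<lambda>n. \<integral>\<omega>. ?s n \<omega> \<partial>P) \<longlonglongrightarrow> mean_step" by (rule tendsto_eventually)
  with 1 show ?thesis using LIMSEQ_unique by blast
qed

text \<open>This is the net flux across the edge between the sites -1 and 0. The balance equation
  summed over phases says that the net flux is the same across neighbouring edges, so ergodicity
  makes it equal to its mean, which is \<open>mean_step\<close>.\<close>

lemma flux_constant: "AE \<omega> in P. (\<Sum>j\<in>UNIV. up (shift (- 1) \<omega>) $ j) - (\<Sum>j\<in>UNIV. dn \<omega> $ j) = v"
proof -
  let ?c = "\<lambda>\<omega>. (\<Sum>j\<in>UNIV. up (shift (- 1) \<omega>) $ j) - (\<Sum>j\<in>UNIV. dn \<omega> $ j)"
  have iu: "integrable P (\<lambda>\<omega>. \<Sum>j\<in>UNIV. up \<omega> $ j)" and id: "integrable P (\<lambda>\<omega>. \<Sum>j\<in>UNIV. dn \<omega> $ j)"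
    by (intro Bochner_Integration.integrable_sum flux_integrable)+
  have ic: "integrable P ?c"
    by (intro Bochner_Integration.integrable_diff integrable_shift[OF iu] id)
  have "AE \<omega> in P. ?c (shift 1 \<omega>) = ?c \<omega>"
    using \<rho>_bal AE_space
  proof eventually_elim
    case (elim \<omega>)
    have "(\<Sum>j\<in>UNIV. image_density \<rho> \<omega> $ j) = (\<Sum>j\<in>UNIV. \<rho> \<omega> $ j)" using elim by simp
    then have "(\<Sum>j\<in>UNIV. up (shift (- 1) \<omega>) $ j) + (\<Sum>j\<in>UNIV. lev \<omega> $ j) + (\<Sum>j\<in>UNIV. dn (shift 1 \<omega>) $ j) =
        (\<Sum>j\<in>UNIV. up \<omega> $ j) + (\<Sum>j\<in>UNIV. lev \<omega> $ j) + (\<Sum>j\<in>UNIV. dn \<omega> $ j)"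
      unfolding flux_sum[OF elim(2)] image_density_flux by (simp add: sum.distrib)
    then show ?case by simp
  qed
  from invariant_function[OF ic this]
  have "AE \<omega> in P. ?c \<omega> = (\<integral>\<omega>. ?c \<omega> \<partial>P)" .
  moreover have "(\<integral>\<omega>. ?c \<omega> \<partial>P) = mean_step"
    unfolding mean_step_def using iu id integrable_shift[OF iu, of "- 1"] integral_shift[OF borel_measurable_integrable[OF iu], of "- 1"]
    by simp
  ultimately show ?thesis by (simp add: drift)
qed

text \<open>The upward crossings into level 0 minus those that merely return a downward crossing. A
  difference of nonnegative vectors, its sign is unknown until it is identified with a multiple of
  \<pi>.\<close>

definition \<kappa> :: "'s env \<Rightarrow> real^'d" where
  "\<kappa> \<omega> = up (shift (- 1) \<omega>) - dn \<omega> v* Z (shift (- 1) \<omega>)"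

text \<open>Written with \<kappa>, the balance equation has the form inverted by \<open>Ga\<close>.
  Multiplying the solution by \<open>p0\<close> gives the upward flux as (\<kappa> + dn) times
  \<zeta>; the second part is precisely what is subtracted in \<kappa> at the next site.\<close>

lemma \<kappa>_step:
  assumes g: "good \<omega>" and b: "image_density \<rho> \<omega> = \<rho> \<omega>"
  shows "\<rho> \<omega> = (\<kappa> \<omega> + dn (shift 1 \<omega>)) v* Ga \<omega>" and "\<kappa> (shift 1 \<omega>) = \<kappa> \<omega> v* Z \<omega>"
proof -
  have "\<rho> \<omega> = (\<kappa> \<omega> + dn (shift 1 \<omega>)) + (\<rho> \<omega> v* q0 \<omega>) v* Z (shift (- 1) \<omega>) + \<rho> \<omega> v* r0 \<omega>"
    using b[symmetric] by (subst (asm) image_density_flux) (simp add: \<kappa>_def dn_def lev_def algebra_simps)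
  then show 1: "\<rho> \<omega> = (\<kappa> \<omega> + dn (shift 1 \<omega>)) v* Ga \<omega>" using Ga_solve[OF g] by blast
  have "up \<omega> = (\<kappa> \<omega> + dn (shift 1 \<omega>)) v* Z \<omega>"
    unfolding up_def using Ga_p0[OF g, of "\<kappa> \<omega> + dn (shift 1 \<omega>)"] 1 by simp
  then show "\<kappa> (shift 1 \<omega>) = \<kappa> \<omega> v* Z \<omega>"
    unfolding \<kappa>_def[of "shift 1 \<omega>"] by (simp add: vector_matrix_mul_add)
qed

lemma measurable_\<kappa>: "(\<lambda>\<omega>. \<kappa> \<omega> $ j) \<in> borel_measurable P"
  unfolding \<kappa>_def vector_minus_component
  by (intro borel_measurable_diff borel_measurable_vec_mat_mult flux_measurable
      measurable_shift_compose[where f = "\<lambda>\<omega>. up \<omega> $ _"] measurable_shift_compose[where f = "\<lambda>\<omega>. Z \<omega> $ _ $ _"] measurable_zeta)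

text \<open>The stochastic matrix \<zeta> preserves mass, so the absolute values are dominated by
  the total fluxes up and down.\<close>

lemma \<kappa>_integrable: "integrable P (\<lambda>\<omega>. \<Sum>j\<in>UNIV. \<bar>\<kappa> \<omega> $ j\<bar>)"
proof (rule Bochner_Integration.integrable_bound)
  let ?b = "\<lambda>\<omega>. (\<Sum>j\<in>UNIV. up (shift (- 1) \<omega>) $ j) + (\<Sum>j\<in>UNIV. dn \<omega> $ j)"
  show "integrable P ?b"
    by (intro Bochner_Integration.integrable_add Bochner_Integration.integrable_sum integrable_shift flux_integrable)
  show "(\<lambda>\<omega>. \<Sum>j\<in>UNIV. \<bar>\<kappa> \<omega> $ j\<bar>) \<in> borel_measurable P"
    by (intro borel_measurable_sum borel_measurable_abs measurable_\<kappa>)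
  show "AE \<omega> in P. norm (\<Sum>j\<in>UNIV. \<bar>\<kappa> \<omega> $ j\<bar>) \<le> norm (?b \<omega>)"
    using AE_good
  proof eventually_elim
    case (elim \<omega>)
    have \<omega>: "\<omega> \<in> space P" "shift (- 1) \<omega> \<in> space P" using good_space[OF elim] shift_in_space by auto
    have g1: "good (shift (- 1) \<omega>)" by (rule good_shift[OF elim])
    let ?y = "dn \<omega> v* Z (shift (- 1) \<omega>)"
    have y0: "0 \<le> ?y $ j" for j
      by (rule vector_matrix_nonneg[OF good_Z(2)[OF g1] flux_nonneg(3)[OF \<omega>(1)]])
    have "\<bar>\<kappa> \<omega> $ j\<bar> \<le> up (shift (- 1) \<omega>) $ j + ?y $ j" for j
      using y0[of j] flux_nonneg(1)[OF \<omega>(2), of j] by (simp add: \<kappa>_def)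
    then have "(\<Sum>j\<in>UNIV. \<bar>\<kappa> \<omega> $ j\<bar>) \<le> (\<Sum>j\<in>UNIV. up (shift (- 1) \<omega>) $ j + ?y $ j)" by (intro sum_mono)
    also have "\<dots> = ?b \<omega>"
      unfolding sum.distrib sum_vector_matrix_mult[of "dn \<omega>"] by (simp add: good_Z(3)[OF g1])
    finally show ?case by (simp add: sum_nonneg)
  qed
qed

text \<open>The row vectors \<open>\<kappa>\<close> form a stationary sequence with \<open>\<kappa> (shift 1 \<omega>) = \<kappa> \<omega> v* \<eta>\<close>. Since the products
  \<open>\<eta>\<^sub>-\<^sub>l \<dots> \<eta>\<^sub>-\<^sub>1\<close> approach the matrix all of whose rows are \<open>\<pi>\<close>, \<open>\<kappa>\<close> is the multiple of \<open>\<pi>\<close> with the same mass.\<close>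

lemma \<kappa>_eq: "AE \<omega> in P. \<kappa> \<omega> = v *\<^sub>R Pv \<omega>"
proof -
  let ?X = "\<lambda>\<omega>. \<Sum>j\<in>UNIV. \<bar>\<kappa> \<omega> $ j - v * Pv \<omega> $ j\<bar>"
  let ?f = "\<lambda>\<omega>. \<Sum>j\<in>UNIV. \<bar>\<kappa> \<omega> $ j\<bar>"
  let ?d = "\<lambda>l \<omega>. \<Sum>i\<in>UNIV. \<Sum>j\<in>UNIV. \<bar>eta_prod p q r l \<omega> $ i $ j - Pv \<omega> $ j\<bar>"
  have all: "AE \<omega> in P. \<forall>k. good (shift k \<omega>) \<and> image_density \<rho> (shift k \<omega>) = \<rho> (shift k \<omega>) \<and>
      (\<Sum>j\<in>UNIV. up (shift (- 1) (shift k \<omega>)) $ j) - (\<Sum>j\<in>UNIV. dn (shift k \<omega>) $ j) = v"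
    by (rule AE_shift_all) (use AE_good \<rho>_bal flux_constant in eventually_elim, blast)
  have "AE \<omega> in P. ?X \<omega> = 0"
  \<comment> \<open>The vector \<kappa> at the site \<open>- l\<close> is carried to the origin by
    the product of \<open>l\<close> hitting matrices, whose distance to its limit is
    \<open>?d l\<close>. The bound \<open>B\<close> counts the entries, each off by at most
    one.\<close>
  proof (rule vanishing_by_stationarity[where f = ?f and d = ?d and k = "\<lambda>l. - int l" and B = "real (CARD('d) * CARD('d))"])
    show "?X \<in> borel_measurable P"
      by (intro borel_measurable_sum borel_measurable_abs borel_measurable_diff borel_measurable_times
          measurable_\<kappa> measurable_Pv borel_measurable_const)
    show "?d l \<in> borel_measurable P" for l
      by (intro borel_measurable_sum borel_measurable_abs borel_measurable_diff measurable_eta_prod measurable_Pv)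
    show "integrable P ?f" by (rule \<kappa>_integrable)
    show "AE \<omega> in P. ?d l \<omega> \<le> real (CARD('d) * CARD('d))" for l
    proof (rule AE_I2)
      fix \<omega>
      have "\<bar>eta_prod p q r l \<omega> $ i $ j - Pv \<omega> $ j\<bar> \<le> 1" for i j
      proof -
        have nn: "0 \<le> eta_prod p q r l \<omega> $ i $ j" for j
          using eta_prod_nonneg[of l \<omega>] by (simp add: nonneg_matrix_def)
        have "eta_prod p q r l \<omega> $ i $ j \<le> (\<Sum>j\<in>UNIV. eta_prod p q r l \<omega> $ i $ j)"
          by (rule member_le_sum) (auto simp: nn)
        then have "eta_prod p q r l \<omega> $ i $ j \<le> 1" using eta_prod_row_sum[of l \<omega> i] by linarith
        moreover have "Pv \<omega> $ j \<le> 1" by (simp add: Pv_def pmf_le_1)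
        ultimately show ?thesis using nn[of j] Pv_nonneg[of \<omega> j] by (simp add: abs_le_iff)
      qed
      then have "?d l \<omega> \<le> (\<Sum>i\<in>(UNIV :: 'd set). \<Sum>j\<in>(UNIV :: 'd set). 1)" by (intro sum_mono)
      then show "?d l \<omega> \<le> real (CARD('d) * CARD('d))" by simp
    qed
    show "AE \<omega> in P. (\<lambda>l. ?d l \<omega>) \<longlonglongrightarrow> 0"
      using pi_limit
    proof eventually_elim
      case (elim \<omega>)
      have "(\<lambda>l. ?d l \<omega>) \<longlonglongrightarrow> (\<Sum>i\<in>(UNIV :: 'd set). \<Sum>j\<in>UNIV. \<bar>Pv \<omega> $ j - Pv \<omega> $ j\<bar>)"
        using elim by (intro tendsto_sum tendsto_rabs tendsto_diff tendsto_const) blast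
      then show ?case by simp
    qed
    show "AE \<omega> in P. ?X \<omega> \<le> ?f (shift (- int l) \<omega>) * ?d l \<omega>" for l
      using all
    proof eventually_elim
      case (elim \<omega>)
      have iter: "\<kappa> \<omega> = \<kappa> (shift (- int l) \<omega>) v* eta_prod p q r l \<omega>" for l
      proof (induction l)
        case 0
        then show ?case by simp
      next
        case (Suc l)
        let ?w = "shift (- int (Suc l)) \<omega>"
        have gw: "good ?w" and bw: "image_density \<rho> ?w = \<rho> ?w" using elim by blast+
        have "\<kappa> (shift 1 ?w) = \<kappa> ?w v* et ?w" using \<kappa>_step(2)[OF gw bw] good_et[OF gw] by simp
        moreover have "shift 1 ?w = shift (- int l) \<omega>" by simp
        ultimately show ?case
          using Suc unfolding eta_prod.simps eta_eq[of "- int (Suc l)"] by (simp only: vector_matrix_mul_assoc)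
      qed
      let ?w = "shift (- int l) \<omega>"
      have gp: "good (shift (- 1) ?w)" using elim[rule_format, of "- int l"] good_shift by blast
      have tot1: "(\<Sum>i\<in>UNIV. \<kappa> ?w $ i) = (\<Sum>j\<in>UNIV. up (shift (- 1) ?w) $ j) - (\<Sum>j\<in>UNIV. dn ?w $ j)"
        unfolding \<kappa>_def vector_minus_component sum_subtractf sum_vector_matrix_mult[of "dn ?w"]
        by (simp only: good_Z(3)[OF gp] mult_1_right)
      have tot: "(\<Sum>i\<in>UNIV. \<kappa> ?w $ i) = v" unfolding tot1 using elim by blast
      have "\<bar>\<kappa> \<omega> $ j - v * Pv \<omega> $ j\<bar> \<le> ?f ?w * (\<Sum>i\<in>UNIV. \<bar>eta_prod p q r l \<omega> $ i $ j - Pv \<omega> $ j\<bar>)" for j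
      proof -
        \<comment> \<open>As the mass of \<kappa> at the shifted site is \<open>v\<close>, the
          vector v \<pi> is its image under the matrix all of whose rows are \<pi>.\<close>
        have 1: "\<kappa> \<omega> $ j - v * Pv \<omega> $ j = (\<Sum>i\<in>UNIV. \<kappa> ?w $ i * (eta_prod p q r l \<omega> $ i $ j - Pv \<omega> $ j))"
          unfolding tot[symmetric] by (subst iter[of l])
            (simp add: vector_matrix_mult_def right_diff_distrib sum_subtractf sum_distrib_left sum_distrib_right mult.commute)
        have 2: "\<bar>\<kappa> \<omega> $ j - v * Pv \<omega> $ j\<bar> \<le> (\<Sum>i\<in>UNIV. \<bar>\<kappa> ?w $ i\<bar> * \<bar>eta_prod p q r l \<omega> $ i $ j - Pv \<omega> $ j\<bar>)"
          unfolding 1 abs_mult[symmetric] by (rule sum_abs)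
        have 3: "\<bar>\<kappa> ?w $ i\<bar> \<le> ?f ?w" for i by (rule member_le_sum) auto
        have "(\<Sum>i\<in>UNIV. \<bar>\<kappa> ?w $ i\<bar> * \<bar>eta_prod p q r l \<omega> $ i $ j - Pv \<omega> $ j\<bar>) \<le>
            (\<Sum>i\<in>UNIV. ?f ?w * \<bar>eta_prod p q r l \<omega> $ i $ j - Pv \<omega> $ j\<bar>)"
          by (rule sum_mono) (rule mult_right_mono[OF 3 abs_ge_zero])
        from order_trans[OF 2 this] show ?thesis by (simp only: sum_distrib_left)
      qed
      then have "?X \<omega> \<le> (\<Sum>j\<in>UNIV. ?f ?w * (\<Sum>i\<in>UNIV. \<bar>eta_prod p q r l \<omega> $ i $ j - Pv \<omega> $ j\<bar>))"
        by (intro sum_mono)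
      also have "\<dots> = ?f ?w * ?d l \<omega>"
        unfolding sum_distrib_left[symmetric] by (subst sum.swap) (rule refl)
      finally show ?case .
    qed
  qed (auto intro: sum_nonneg)
  then show ?thesis
  proof eventually_elim
    case (elim \<omega>)
    then have "\<bar>\<kappa> \<omega> $ j - v * Pv \<omega> $ j\<bar> = 0" for j by (simp add: sum_nonneg_eq_0_iff)
    then show ?case by (simp add: vec_eq_iff)
  qed
qed

lemma \<rho>_recursion: "AE \<omega> in P. \<rho> \<omega> = (v *\<^sub>R Pv \<omega> + dn (shift 1 \<omega>)) v* Ga \<omega>"
  using AE_good \<rho>_bal \<kappa>_eq
proof eventually_elim
  case (elim \<omega>)
  then show ?case using \<kappa>_step(1)[OF elim(1,2)] by simp
qed

text \<open>For v \<le> 0 the term with \<pi> in the recursion may be dropped, and the downward flux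
  becomes a nonnegative subsolution, hence zero. A positive density and a positive entry in a column
  of \<open>q\<close> exclude this.\<close>

lemma speed_positive: "0 < v"
proof (rule ccontr)
  assume "\<not> 0 < v"
  then have v: "v \<le> 0" by simp
  have "AE \<omega> in P. dn \<omega> = 0"
  proof (rule subsolution_vanishes)
    show "(\<lambda>\<omega>. dn \<omega> $ j) \<in> borel_measurable P" for j by (rule flux_measurable)
    show "AE \<omega> in P. \<forall>j. 0 \<le> dn \<omega> $ j" using AE_space by eventually_elim (simp add: flux_nonneg)
    show "AE \<omega> in P. \<forall>j. dn \<omega> $ j \<le> (dn (shift 1 \<omega>) v* A \<omega>) $ j"
      using AE_good \<rho>_recursion
    proof eventually_elim
      case (elim \<omega>)
      have "dn \<omega> = (v *\<^sub>R Pv \<omega> + dn (shift 1 \<omega>)) v* A \<omega>"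
        unfolding dn_def[of \<omega>] A_def vector_matrix_mul_assoc[symmetric] elim(2)[symmetric] ..
      then show ?case
        using v Pv_nonneg by (auto intro!: vector_matrix_mono[OF A_nonneg[OF elim(1)]] mult_nonpos_nonneg)
    qed
  qed
  with AE_good \<rho>_pos have "AE \<omega> in P. False"
  proof eventually_elim
    case (elim \<omega>)
    have q: "0 \<le> q0 \<omega> $ i $ j" for i j by (rule nonneg_pqr(2)[OF good_space[OF elim(1)]])
    fix j
    have "\<exists>i. 0 < q0 \<omega> $ i $ undefined"
    proof (rule ccontr)
      assume "\<not> ?thesis"
      then have "(\<Sum>i\<in>UNIV. q0 \<omega> $ i $ undefined) \<le> 0" by (intro sum_nonpos) (simp add: not_less)
      then show False using good_q_pos[OF elim(1), of undefined] by simp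
    qed
    then obtain i where i: "0 < q0 \<omega> $ i $ undefined" ..
    have "0 < (\<Sum>i\<in>UNIV. q0 \<omega> $ i $ undefined * \<rho> \<omega> $ i)"
      using elim(2) i q \<rho>0 by (intro sum_pos2[of UNIV i]) auto
    then have "0 < dn \<omega> $ undefined" by (simp add: dn_def vector_matrix_mult_def mult.commute)
    then show ?case using elim by simp
  qed
  then show False by simp
qed

text \<open>Iterating the recursion \<open>M\<close> times produces the first \<open>M\<close> terms
  of the series plus a remainder, which is nonnegative and discarded.\<close>

lemma \<rho>_lower: "AE \<omega> in P. \<forall>M i. v * (\<Sum>m<M. occ_term m \<omega> $ i) \<le> \<rho> \<omega> $ i"
proof -
  have all: "AE \<omega> in P. \<forall>k. good (shift k \<omega>) \<and>
      \<rho> (shift k \<omega>) = (v *\<^sub>R Pv (shift k \<omega>) + dn (shift 1 (shift k \<omega>))) v* Ga (shift k \<omega>)"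
    by (rule AE_shift_all) (use AE_good \<rho>_recursion in eventually_elim, blast)
  then show ?thesis
  proof eventually_elim
    case (elim \<omega>)
    \<comment> \<open>The bound is proved at all shifts together, because each induction step refers
      to the next site.\<close>
    have claim: "\<forall>k i. (v *\<^sub>R (\<Sum>m<M. occ_term m (shift k \<omega>))) $ i \<le> \<rho> (shift k \<omega>) $ i" for M
    proof (induction M)
      case 0
      then show ?case by (simp add: \<rho>0)
    next
      case (Suc M)
      show ?case
      proof (intro allI)
        fix k i
        let ?w = "shift k \<omega>"
        have g: "good ?w" "good (shift 1 ?w)" and rec: "\<rho> ?w = (v *\<^sub>R Pv ?w + dn (shift 1 ?w)) v* Ga ?w"
          using elim good_shift by blast+
        have "(\<Sum>m<Suc M. occ_term m ?w) = occ_term 0 ?w + (\<Sum>m<M. occ_term (Suc m) ?w)" by (rule sum.lessThan_Suc_shift)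
        also have "\<dots> = (Pv ?w + (\<Sum>m<M. occ_term m (shift 1 ?w)) v* q0 (shift 1 ?w)) v* Ga ?w"
          by (simp only: occ_term.simps vector_matrix_mul_sum vector_matrix_mul_add)
        finally have eq: "v *\<^sub>R (\<Sum>m<Suc M. occ_term m ?w) =
            (v *\<^sub>R Pv ?w + (v *\<^sub>R (\<Sum>m<M. occ_term m (shift 1 ?w))) v* q0 (shift 1 ?w)) v* Ga ?w"
          by (simp only: vector_matrix_mul_scaleR[symmetric] scaleR_add_right)
        have "((v *\<^sub>R Pv ?w + (v *\<^sub>R (\<Sum>m<M. occ_term m (shift 1 ?w))) v* q0 (shift 1 ?w)) v* Ga ?w) $ i \<le>
            ((v *\<^sub>R Pv ?w + dn (shift 1 ?w)) v* Ga ?w) $ i"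
        proof (rule vector_matrix_mono[OF Ga_nonneg[OF good_good0[OF g(1)] good_Z_prev[OF g(1)]]])
          fix j
          have "((v *\<^sub>R (\<Sum>m<M. occ_term m (shift 1 ?w))) v* q0 (shift 1 ?w)) $ j \<le> dn (shift 1 ?w) $ j"
            unfolding dn_def
          proof (rule vector_matrix_mono[OF nonneg_pqr(5)[OF good_space[OF g(2)]]])
            fix i
            show "(v *\<^sub>R (\<Sum>m<M. occ_term m (shift 1 ?w))) $ i \<le> \<rho> (shift 1 ?w) $ i"
              using Suc[rule_format, of "1 + k" i] by (simp only: shift_shift)
          qed
          then show "(v *\<^sub>R Pv ?w + (v *\<^sub>R (\<Sum>m<M. occ_term m (shift 1 ?w))) v* q0 (shift 1 ?w)) $ j \<le>
              (v *\<^sub>R Pv ?w + dn (shift 1 ?w)) $ j" by simp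
        qed
        then show "(v *\<^sub>R (\<Sum>m<Suc M. occ_term m ?w)) $ i \<le> \<rho> ?w $ i"
          by (simp only: eq rec[symmetric])
      qed
    qed
    show ?case
    proof (intro allI)
      fix M i
      show "v * (\<Sum>m<M. occ_term m \<omega> $ i) \<le> \<rho> \<omega> $ i"
        using claim[of M, rule_format, of 0 i] by simp
    qed
  qed
qed

text \<open>The lower bound makes the series finite and \<open>Df\<close> nonnegative. Both \<rho>
  and \<open>v\<close> times \<open>R\<close> satisfy the same affine recursion, so the difference
  satisfies the homogeneous one; its downward flux \<open>Ed\<close> vanishes as a subsolution, and
  with it \<open>Df\<close>.\<close>

lemma \<rho>_eq: "AE \<omega> in P. \<forall>i. ennreal (\<rho> \<omega> $ i) = ennreal v * occ_density \<omega> i"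
proof -
  note v = speed_positive
  have bound: "AE \<omega> in P. \<forall>i. occ_density \<omega> i < \<infinity> \<and> v * R \<omega> $ i \<le> \<rho> \<omega> $ i"
    using \<rho>_lower AE_good
  proof eventually_elim
    case (elim \<omega>)
    show ?case
    proof
      fix i
      have le: "(\<Sum>m<M. occ_term m \<omega> $ i) \<le> \<rho> \<omega> $ i / v" for M
      proof -
        have "v * (\<Sum>m<M. occ_term m \<omega> $ i) \<le> \<rho> \<omega> $ i" using elim(1) by blast
        then show ?thesis using v by (simp add: field_simps)
      qed
      have s: "summable (\<lambda>m. occ_term m \<omega> $ i)"
        by (rule summableI_nonneg_bounded[OF occ_term_nonneg[OF elim(2)] le])
      have "occ_density \<omega> i = ennreal (\<Sum>m. occ_term m \<omega> $ i)"
        unfolding occ_density_def by (rule suminf_ennreal2[OF occ_term_nonneg[OF elim(2)] s])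
      then have fin: "occ_density \<omega> i < \<infinity>" by simp
      have "R \<omega> $ i = (\<Sum>m. occ_term m \<omega> $ i)" by (rule sums_unique[OF R_sums[OF elim(2) fin]])
      also have "\<dots> \<le> \<rho> \<omega> $ i / v" by (rule suminf_le_const[OF s le])
      finally have "v * R \<omega> $ i \<le> \<rho> \<omega> $ i" using v by (simp add: field_simps)
      with fin show "occ_density \<omega> i < \<infinity> \<and> v * R \<omega> $ i \<le> \<rho> \<omega> $ i" by simp
    qed
  qed
  define Df where "Df \<omega> = \<rho> \<omega> - v *\<^sub>R R \<omega>" for \<omega>
  define Ed where "Ed \<omega> = Df \<omega> v* q0 \<omega>" for \<omega>
  have Df_rec: "AE \<omega> in P. Df \<omega> = Ed (shift 1 \<omega>) v* Ga \<omega>"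
    using AE_good \<rho>_recursion bound AE_shift[OF bound, of 1]
  proof eventually_elim
    case (elim \<omega>)
    have "R \<omega> = (Pv \<omega> + R (shift 1 \<omega>) v* q0 (shift 1 \<omega>)) v* Ga \<omega>"
      using elim by (intro R_recursion) auto
    then have "v *\<^sub>R R \<omega> = (v *\<^sub>R Pv \<omega> + (v *\<^sub>R R (shift 1 \<omega>)) v* q0 (shift 1 \<omega>)) v* Ga \<omega>"
      by (simp only: vector_matrix_mul_scaleR[symmetric] scaleR_add_right)
    then show ?case
      unfolding Df_def Ed_def elim(2) by (simp add: dn_def vector_matrix_mul_add vector_matrix_mul_diff)
  qed
  have "AE \<omega> in P. Ed \<omega> = 0"
  proof (rule subsolution_vanishes)
    show "(\<lambda>\<omega>. Ed \<omega> $ j) \<in> borel_measurable P" for j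
      unfolding Ed_def
    proof (intro borel_measurable_vec_mat_mult measurable_coef)
      show "(\<lambda>\<omega>. Df \<omega> $ i) \<in> borel_measurable P" for i
        unfolding Df_def vector_minus_component vector_scaleR_component
        by (intro borel_measurable_diff \<rho>m borel_measurable_scaleR borel_measurable_const measurable_R)
    qed
    show "AE \<omega> in P. \<forall>j. 0 \<le> Ed \<omega> $ j"
      using bound AE_space
    proof eventually_elim
      case (elim \<omega>)
      show ?case unfolding Ed_def
        using elim by (auto intro!: vector_matrix_nonneg nonneg_pqr simp: Df_def)
    qed
    show "AE \<omega> in P. \<forall>j. Ed \<omega> $ j \<le> (Ed (shift 1 \<omega>) v* A \<omega>) $ j"
      using Df_rec
    proof eventually_elim
      case (elim \<omega>)
      have "Ed \<omega> = Ed (shift 1 \<omega>) v* A \<omega>"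
        unfolding Ed_def[of \<omega>] A_def vector_matrix_mul_assoc[symmetric] elim[symmetric] ..
      then show ?case by simp
    qed
  qed
  from AE_shift[OF this, of 1] Df_rec bound show ?thesis
  proof eventually_elim
    case (elim \<omega>)
    then have "Df \<omega> = 0" by simp
    then have "\<rho> \<omega> = v *\<^sub>R R \<omega>" by (simp add: Df_def)
    then show ?case
      using elim(3) v by (auto simp: R_def ennreal_mult' less_top)
  qed
qed

end

text \<open>One direction of absolute continuity provides the Radon-Nikodym density, which is almost
  everywhere finite because its integral is one, so a real version exists. The other direction makes
  it almost surely positive in every phase.\<close>

lemma stationary_density:
  assumes Q: "equivalent_stationary P p q r Q"
  obtains \<rho> where "\<And>i. (\<lambda>\<omega>. \<rho> \<omega> $ i) \<in> borel_measurable P" "\<And>\<omega> i. 0 \<le> \<rho> \<omega> $ i"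
    "AE \<omega> in P. \<forall>i. 0 < \<rho> \<omega> $ i" "AE \<omega> in P. image_density \<rho> \<omega> = \<rho> \<omega>"
    "(\<integral>\<^sup>+\<omega>. (\<Sum>i\<in>UNIV. ennreal (\<rho> \<omega> $ i)) \<partial>P) = 1" "Q = Qm \<rho>"
proof -
  let ?N = "P \<Otimes>\<^sub>M (count_space UNIV :: 'd measure)"
  have st: "stationary_distribution P p q r Q" and eq: "equivalent_measures Q ?N"
    using Q by (auto simp: equivalent_stationary_def)
  interpret Q: prob_space Q using st by (simp add: stationary_distribution_def)
  have sQ: "sets Q = sets ?N" and QN: "absolutely_continuous Q ?N" and NQ: "absolutely_continuous ?N Q"
    using eq by (auto simp: equivalent_measures_def)
  interpret cnt: sigma_finite_measure "count_space UNIV :: 'd measure"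
    by (rule sigma_finite_measure_count_space_finite) simp
  interpret N: sigma_finite_measure ?N
    by (rule sigma_finite_pair_measure) unfold_locales
  obtain g where g: "g \<in> borel_measurable ?N" "density ?N g = Q"
    using N.Radon_Nikodym[OF NQ sQ] by auto
  have "(\<integral>\<^sup>+z. g z \<partial>?N) = emeasure (density ?N g) (space ?N)"
    by (subst emeasure_density[OF g(1)]) (auto intro!: nn_integral_cong)
  also have "\<dots> = 1" unfolding g(2) using Q.emeasure_space_1 sets_eq_imp_space_eq[OF sQ] by simp
  finally have "AE z in ?N. g z \<noteq> \<infinity>" by (intro nn_integral_PInf_AE[OF g(1)]) simp
  define \<rho> where "\<rho> \<omega> = (\<chi> i. enn2real (g (\<omega>, i)))" for \<omega>
  have \<rho>m: "(\<lambda>\<omega>. \<rho> \<omega> $ i) \<in> borel_measurable P" for i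
  proof -
    have "(\<lambda>\<omega>. g (\<omega>, i)) \<in> borel_measurable P"
      by (rule measurable_compose[OF _ g(1)]) simp
    then show ?thesis by (simp add: \<rho>_def)
  qed
  have \<rho>0: "0 \<le> \<rho> \<omega> $ i" for \<omega> i by (simp add: \<rho>_def)
  have Q_eq: "Q = Qm \<rho>"
  proof -
    have m: "(\<lambda>z. ennreal (\<rho> (fst z) $ snd z)) \<in> borel_measurable ?N"
      by (rule measurable_pair_count[OF measurable_compose[OF \<rho>m measurable_ennreal]])
    have "density ?N g = density ?N (\<lambda>z. ennreal (\<rho> (fst z) $ snd z))"
    proof (rule density_cong[OF g(1) m])
      show "AE z in ?N. g z = ennreal (\<rho> (fst z) $ snd z)"
        using \<open>AE z in ?N. g z \<noteq> \<infinity>\<close> by eventually_elim (simp add: \<rho>_def less_top)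
    qed
    then show ?thesis by (simp add: g(2) Qm_def)
  qed
  have "AE \<omega> in P. 0 < \<rho> \<omega> $ i" for i
  proof -
    let ?B = "{\<omega> \<in> space P. \<rho> \<omega> $ i \<le> 0}"
    have B: "?B \<in> sets P" using \<rho>m[of i] by measurable
    have "emeasure Q (?B \<times> {i}) = (\<integral>\<^sup>+\<omega>. 0 \<partial>P)"
      unfolding Q_eq emeasure_Qm[OF \<rho>m B]
    proof (rule nn_integral_cong)
      fix \<omega>
      show "ennreal (\<rho> \<omega> $ i) * indicator ?B \<omega> = 0"
        using ennreal_neg[of "\<rho> \<omega> $ i"] by (auto simp: indicator_def)
    qed
    then have "?B \<times> {i} \<in> null_sets Q" using B sQ by (intro null_setsI) auto
    then have "?B \<times> {i} \<in> null_sets ?N" using QN by (auto simp: absolutely_continuous_def)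
    then have "emeasure P ?B * emeasure (count_space UNIV) {i} = 0"
      using cnt.emeasure_pair_measure_Times[OF B, of "{i}"] by (simp add: null_sets_def)
    then have "?B \<in> null_sets P" using B by (intro null_setsI) simp_all
    from AE_not_in[OF this] AE_space show ?thesis by eventually_elim auto
  qed
  then have \<rho>_pos: "AE \<omega> in P. \<forall>i. 0 < \<rho> \<omega> $ i" by (simp add: AE_all_countable)
  have "stationary_distribution P p q r (Qm \<rho>)" using st by (simp only: Q_eq)
  then have \<rho>_bal: "AE \<omega> in P. image_density \<rho> \<omega> = \<rho> \<omega>" by (rule stationary_Qm_imp_image_density[OF \<rho>m \<rho>0])
  have "(\<integral>\<^sup>+\<omega>. (\<Sum>i\<in>UNIV. ennreal (\<rho> \<omega> $ i)) \<partial>P) = 1"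
    unfolding emeasure_Qm_space[OF \<rho>m, symmetric] Q_eq[symmetric] by (rule Q.emeasure_space_1)
  then show thesis using \<rho>m \<rho>0 \<rho>_pos \<rho>_bal Q_eq by (intro that[of \<rho>]) auto
qed

section \<open>Uniqueness and the explicit formula\<close>

lemma stationary_imp_speed_positive:
  assumes "equivalent_stationary P p q r Q"
  shows "0 < v"
  by (rule stationary_density[OF assms]) (rule speed_positive)

text \<open>The right-hand side does not involve \<open>Q\<close>, and \<open>X\<close> is an
  arbitrary measurable set; uniqueness is therefore immediate, and the formula of the theorem is the
  case of a rectangle.\<close>

lemma stationary_emeasure:
  assumes Q: "equivalent_stationary P p q r Q" and X: "X \<in> sets (P \<Otimes>\<^sub>M count_space UNIV)"
  shows "emeasure Q X = (\<Sum>i\<in>UNIV. \<integral>\<^sup>+\<omega>. ennreal v * occ_density \<omega> i * indicator X (\<omega>, i) \<partial>P)"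
proof -
  obtain \<rho> where \<rho>: "\<And>i. (\<lambda>\<omega>. \<rho> \<omega> $ i) \<in> borel_measurable P" "\<And>\<omega> i. 0 \<le> \<rho> \<omega> $ i"
    "AE \<omega> in P. \<forall>i. 0 < \<rho> \<omega> $ i" "AE \<omega> in P. image_density \<rho> \<omega> = \<rho> \<omega>"
    "(\<integral>\<^sup>+\<omega>. (\<Sum>i\<in>UNIV. ennreal (\<rho> \<omega> $ i)) \<partial>P) = 1" and Q_eq: "Q = Qm \<rho>"
    by (rule stationary_density[OF Q]) blast
  have ind: "(\<lambda>\<omega>. indicator X (\<omega>, i) :: ennreal) \<in> borel_measurable P" for i
    by (rule measurable_compose[OF _ borel_measurable_indicator[OF X]]) simp
  have "emeasure Q X = (\<integral>\<^sup>+z. indicator X (fst z, snd z) \<partial>Qm \<rho>)"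
    unfolding Q_eq using X by (simp add: sets_Qm[OF \<rho>(1)])
  also have "\<dots> = (\<Sum>i\<in>UNIV. \<integral>\<^sup>+\<omega>. ennreal (\<rho> \<omega> $ i) * indicator X (\<omega>, i) \<partial>P)"
    by (rule nn_integral_Qm[OF \<rho>(1), of "\<lambda>\<omega> i. indicator X (\<omega>, i)", OF ind])
  also have "\<dots> = (\<Sum>i\<in>UNIV. \<integral>\<^sup>+\<omega>. ennreal v * occ_density \<omega> i * indicator X (\<omega>, i) \<partial>P)"
    by (intro sum.cong refl nn_integral_cong_AE) (use \<rho>_eq[OF \<rho>] in eventually_elim, simp)
  finally show ?thesis .
qed

lemma stationary_formula:
  assumes Q: "equivalent_stationary P p q r Q" and B: "B \<in> sets P"
  shows "emeasure Q (B \<times> {i}) =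
    ennreal v * (\<integral>\<^sup>+(\<omega>, x). occupation B i \<omega> x \<partial>annealed P p q r \<pi>)"
proof -
  have "B \<times> {i} \<in> sets (P \<Otimes>\<^sub>M count_space UNIV)" using B by simp
  note stationary_emeasure[OF Q this]
  also have "(\<Sum>k\<in>UNIV. \<integral>\<^sup>+\<omega>. ennreal v * occ_density \<omega> k * indicator (B \<times> {i}) (\<omega>, k) \<partial>P) =
      (\<Sum>k\<in>UNIV. if k = i then \<integral>\<^sup>+\<omega>. ennreal v * occ_density \<omega> i * indicator B \<omega> \<partial>P else 0)"
    by (intro sum.cong refl) (auto simp: indicator_def intro!: nn_integral_cong)
  also have "\<dots> = (\<integral>\<^sup>+\<omega>. ennreal v * (occ_density \<omega> i * indicator B \<omega>) \<partial>P)"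
    by (subst sum.delta) (simp_all add: mult.assoc)
  also have "\<dots> = ennreal v * (\<integral>\<^sup>+\<omega>. occ_density \<omega> i * indicator B \<omega> \<partial>P)"
    by (rule nn_integral_cmult) (intro borel_measurable_times_ennreal measurable_occ_density borel_measurable_indicator B)
  finally show ?thesis by (simp only: occupation_annealed[OF B])
qed

lemma stationary_unique:
  assumes Q: "equivalent_stationary P p q r Q" "equivalent_stationary P p q r Q'"
  shows "Q' = Q"
proof (rule measure_eqI)
  have s: "sets Q = sets (P \<Otimes>\<^sub>M count_space UNIV)" "sets Q' = sets (P \<Otimes>\<^sub>M count_space UNIV)"
    using Q by (auto simp: equivalent_stationary_def stationary_distribution_def)
  then show "sets Q' = sets Q" by simp
  fix X assume "X \<in> sets Q'"
  then have "X \<in> sets (P \<Otimes>\<^sub>M count_space UNIV)" using s by simp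
  then show "emeasure Q' X = emeasure Q X"
    using stationary_emeasure[OF Q(1)] stationary_emeasure[OF Q(2)] by simp
qed

end

theorem theorem2p3:
  fixes S :: "'s measure" and P :: "'s env measure"
    and p q r :: "'s \<Rightarrow> ('d::finite) mat"
    and \<zeta> :: "int \<Rightarrow> 's env \<Rightarrow> 'd mat"
    and \<pi> :: "'s env \<Rightarrow> 'd pmf" and v :: real
  assumes "rwre S P p q r"
    and "condition_C P p q r"
    and "zeta_sequence P p q r \<zeta>"
    and "condition_D P q r \<zeta>"
    and "is_pi S P p q r \<pi>"
    and "is_speed S P p q r v"
  shows "(0 < v \<longleftrightarrow> (\<exists>Q. equivalent_stationary P p q r Q)) \<and>
    (\<forall>Q. equivalent_stationary P p q r Q \<longrightarrow>
      (\<forall>Q'. equivalent_stationary P p q r Q' \<longrightarrow> Q' = Q) \<and>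
      (\<forall>B\<in>sets P. \<forall>i. emeasure Q (B \<times> {i}) =
        ennreal v * (\<integral>\<^sup>+(\<omega>, x). occupation B i \<omega> x \<partial>annealed P p q r \<pi>)))"
proof -
  interpret strip_model S P p q r \<zeta> \<pi> v
    by unfold_locales (use assms in \<open>auto simp: condition_C_def\<close>)
  show ?thesis
    using positive_speed_imp_stationary stationary_imp_speed_positive stationary_unique stationary_formula
    by blast
qed

end
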